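(* Let $N\ge 3$ and let $\mathbf{u}\in\mathcal{D}(\mathbb{R}^N)$ be solenoidal, i.e. $\operatorname{div}\mathbf{u}=0$ (in the sense of distributions). Then \[ \int_{\mathbb{R}^N}|\nabla \mathbf{u}|^2dx\int_{\mathbb{R}^N}|\mathbf{u}|^2|\mathbf{x}|^2dx\ge C_N\left(\int_{\mathbb{R}^N}|\mathbf{u}|^2dx\right)^2 \] holds with \[ C_N=\frac{1}{4}\left(\sqrt{(N-2)^2+8}+2\right)^2, \] and this constant is the best possible. Moreover, $C_N$ is attained, i.e. there exists a solenoidal $\mathbf{u}\in\mathcal{D}(\mathbb{R}^N)\setminus\{\mathbf{0}\}$ for which equality holds.
   Context: Vector fields are real: $\mathbf{u}=(u_1,\dots,u_N):\mathbb{R}^N\to\mathbb{R}^N$. $\nabla\mathbf{u}=(\partial u_j/\partial x_k)_{j,k}$ is the Jacobian matrix, and $|\nabla\mathbf{u}|^2=\sum_{j,k}(\partial u_j/\partial x_k)^2$. The space $\mathcal{D}(\mathbb{R}^N)$ is the Hilbert space completion of $C_c^\infty(\mathbb{R}^N)^N$ with respect to the norm \[ \|\mathbf{u}\|_{\mathcal{D}}=\left(\int_{\mathbb{R}^N}|\mathbf{u}|^2dx+\int_{\mathbb{R}^N}|\mathbf{u}|^2|\mathbf{x}|^2dx+\int_{\mathbb{R}^N}|\nabla\mathbf{u}|^2dx\right)^{1/2}. \] "Best possible" means that $C_N$ equals the infimum of the ratio $\int|\nabla\mathbf{u}|^2\int|\mathbf{u}|^2|\mathbf{x}|^2/(\int|\mathbf{u}|^2)^2$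 over nonzero solenoidal $\mathbf{u}\in\mathcal{D}(\mathbb{R}^N)$. *)

theory Defs
  imports "HOL-Analysis.Analysis"
begin

coinductive smooth_fun :: "('a::euclidean_space \<Rightarrow> real) \<Rightarrow> bool" where
  "(\<forall>x. f differentiable (at x)) \<Longrightarrow>
   (\<forall>i\<in>Basis. smooth_fun (\<lambda>x. frechet_derivative f (at x) i)) \<Longrightarrow> smooth_fun f"

definition test_fun :: "(real^'n \<Rightarrow> real) \<Rightarrow> bool" where
  "test_fun \<psi> \<longleftrightarrow> smooth_fun \<psi> \<and> compact (closure {x. \<psi> x \<noteq> 0})"

definition test_field :: "(real^'n \<Rightarrow> real^'n) \<Rightarrow> bool" where
  "test_field \<phi> \<longleftrightarrow> (\<forall>j. smooth_fun (\<lambda>x. \<phi> x $ j)) \<and> compact (closure {x. \<phi> x \<noteq> 0})"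

text \<open>Gradient of a scalar function and Jacobian matrix (du_j/dx_k)_{j,k} of a vector field.
  The norm on real^'n^'n is the Frobenius norm, so norm (jac u x)^2 = |grad u|^2.\<close>
definition grad :: "(real^'n \<Rightarrow> real) \<Rightarrow> real^'n \<Rightarrow> real^'n" where
  "grad \<psi> x = (\<chi> k. frechet_derivative \<psi> (at x) (axis k 1))"

definition jac :: "(real^'n \<Rightarrow> real^'n) \<Rightarrow> real^'n \<Rightarrow> real^'n^'n" where
  "jac \<phi> x = (\<chi> j k. frechet_derivative (\<lambda>y. \<phi> y $ j) (at x) (axis k 1))"

text \<open>Concrete realisation of the completion D(R^N): u (with gradient G) belongs to D iff
  it is the limit of test fields phi_k in the norm
  int |v|^2 + int |v|^2 |x|^2 + int |grad v|^2, where G is the L^2-limit of the Jacobians.\<close>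
definition in_D :: "(real^'n \<Rightarrow> real^'n) \<Rightarrow> (real^'n \<Rightarrow> real^'n^'n) \<Rightarrow> bool" where
  "in_D u G \<longleftrightarrow> u \<in> borel_measurable lborel \<and> G \<in> borel_measurable lborel \<and>
     (\<exists>\<phi>. (\<forall>k. test_field (\<phi> k)) \<and>
        ((\<lambda>k. \<integral>\<^sup>+ x. ennreal ((norm (\<phi> k x - u x))\<^sup>2 * (1 + (norm x)\<^sup>2)) \<partial>lborel) \<longlonglongrightarrow> 0) \<and>
        ((\<lambda>k. \<integral>\<^sup>+ x. ennreal ((norm (jac (\<phi> k) x - G x))\<^sup>2) \<partial>lborel) \<longlonglongrightarrow> 0))"

definition solenoidal :: "(real^'n \<Rightarrow> real^'n) \<Rightarrow> bool" where
  "solenoidal u \<longleftrightarrow> (\<forall>\<psi>. test_fun \<psi> \<longrightarrow> (\<integral>x. u x \<bullet> grad \<psi> x \<partial>lborel) = 0)"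

definition CN :: "nat \<Rightarrow> real" where
  "CN N = (sqrt ((real N - 2)\<^sup>2 + 8) + 2)\<^sup>2 / 4"

definition ratio :: "(real^'n \<Rightarrow> real^'n) \<Rightarrow> (real^'n \<Rightarrow> real^'n^'n) \<Rightarrow> real" where
  "ratio u G = (\<integral>x. (norm (G x))\<^sup>2 \<partial>lborel) * (\<integral>x. (norm (u x))\<^sup>2 * (norm x)\<^sup>2 \<partial>lborel)
               / (\<integral>x. (norm (u x))\<^sup>2 \<partial>lborel)\<^sup>2"

end

theory Submission
  imports Defs "HOL-Probability.Distributions"
begin

text \<open>
  On the Fourier side the constraint \<open>div u = 0\<close> becomes the pointwise condition that the transform \<open>v\<close>
  is tangent to the spheres around the origin, and the two integrals on the left exchange their roles.
  For a tangential field the angular part of the gradient contributes at least twice the integral of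
  \<open>|v|\<^sup>2/|\<xi>|\<^sup>2\<close>: besides the second fundamental form of the sphere one uses that the integral of
  \<open>(div v)\<^sup>2 - tr (\<nabla>v)\<^sup>2\<close> vanishes, together with Cauchy--Schwarz for the tangential block of the Jacobian.
  What remains is a radial oscillator with inverse square potential,
  settled by the square \<open>|\<partial>\<^sub>r v + \<lambda> r v - \<alpha> v/r|\<^sup>2 \<ge> 0\<close> with \<open>\<alpha>\<^sup>2 + (N - 2)\<alpha> = 2\<close>.
  Everything amounts to a pointwise inequality modulo divergences. The approximating test fields are not
  solenoidal; the coupling of their normal and tangential parts vanishes in the limit because the normal
  parts converge weakly to 0. Equality holds for the ground state, a constant vector projected to the
  tangent spaces times \<open>r\<^sup>\<alpha> exp(- r\<^sup>2/2)\<close>, whose inverse transform is the extremal field; for it an upper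
  bound of the two integrals suffices, since the inequality itself supplies the lower bound.
\<close>

subsection \<open>Closure properties of smooth functions\<close>

text \<open>Origin of the constant: \<open>\<alpha>\<close> is the exponent for which
  \<open>r^\<alpha> exp (- r^2/2)\<close> is the ground state of the radial oscillator with
  potential \<open>2/r^2\<close>. Its energy is
  \<open>K = N + 2 * \<alpha> = sqrt ((N - 2)^2 + 8) + 2\<close>, and optimising
  \<open>l * K * Z \<le> Y + l^2 * X\<close> over all dilations \<open>l\<close> gives
  \<open>K^2/4\<close>. Why the convergence is only weak: the normal part of the transform is
  \<open>a x\<close>, and a nonzero \<open>a\<close> leaves two defects in the inequality, the
  square integral of \<open>|x| a\<close> and the pairing of \<open>a\<close> with the divergence of
  the tangential part. The divergence of the test field controls \<open>|x|^2 a\<close>, hence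
  little at low frequencies, while Hardy's inequality keeps \<open>a\<close> bounded. Interpolation
  settles the first defect; in the second the other factor converges strongly, being controlled by
  the weighted norm of the field. The tangential projection is singular at the origin, so
  integration by parts takes place off the origin, with fluxes controlled by \<open>v/|x|\<close>,
  which is square integrable from dimension 3 on. Cosine and sine transforms are treated as two real
  fields, which Plancherel's identity joins in sums.\<close>

inductive_set alg :: "('a::euclidean_space \<Rightarrow> real) set \<Rightarrow> ('a \<Rightarrow> real) set" for B where
  base: "f \<in> B \<Longrightarrow> f \<in> alg B"
| const: "(\<lambda>_. c) \<in> alg B"
| add: "f \<in> alg B \<Longrightarrow> g \<in> alg B \<Longrightarrow> (\<lambda>x. f x + g x) \<in> alg B"
| mult: "f \<in> alg B \<Longrightarrow> g \<in> alg B \<Longrightarrow> (\<lambda>x. f x * g x) \<in> alg B"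

lemma alg_differentiable:
  assumes "f \<in> alg B"
    and "\<And>f. f \<in> B \<Longrightarrow> \<exists>f'. (\<forall>x. (f has_derivative f' x) (at x)) \<and> (\<forall>i\<in>Basis. (\<lambda>x. f' x i) \<in> alg B)"
  shows "\<exists>f'. (\<forall>x. (f has_derivative f' x) (at x)) \<and> (\<forall>i\<in>Basis. (\<lambda>x. f' x i) \<in> alg B)"
  using assms(1)
proof induction
  case (base f)
  then show ?case using assms(2) by blast
next
  case (const c)
  show ?case by (rule exI[of _ "\<lambda>x h. 0"]) (auto intro: alg.const)
next
  case (add f g)
  then obtain f' g' where "\<forall>x. (f has_derivative f' x) (at x)" "\<forall>x. (g has_derivative g' x) (at x)"
    "\<forall>i\<in>Basis. (\<lambda>x. f' x i) \<in> alg B" "\<forall>i\<in>Basis. (\<lambda>x. g' x i) \<in> alg B" by blast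
  then show ?case
    by (intro exI[of _ "\<lambda>x h. f' x h + g' x h"]) (auto intro!: derivative_intros alg.add)
next
  case (mult f g)
  then obtain f' g' where "\<forall>x. (f has_derivative f' x) (at x)" "\<forall>x. (g has_derivative g' x) (at x)"
    "\<forall>i\<in>Basis. (\<lambda>x. f' x i) \<in> alg B" "\<forall>i\<in>Basis. (\<lambda>x. g' x i) \<in> alg B" by blast
  with mult.hyps show ?case
    by (intro exI[of _ "\<lambda>x h. f x * g' x h + f' x h * g x"]) (auto intro!: derivative_intros alg.add alg.mult)
qed

text \<open>Coinduction up to sums and products. The derivative of a generator is rarely a generator
  again, so the invariant is membership in the generated algebra, which is closed under partial
  derivatives as soon as those of the generators stay in it. The principle serves for products of
  smooth functions, for the cutoff and for the transforms.\<close>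

lemma smooth_fun_alg:
  assumes "f \<in> alg B"
    and B: "\<And>f. f \<in> B \<Longrightarrow> \<exists>f'. (\<forall>x. (f has_derivative f' x) (at x)) \<and> (\<forall>i\<in>Basis. (\<lambda>x. f' x i) \<in> alg B)"
  shows "smooth_fun f"
  using assms(1)
proof (coinduction arbitrary: f)
  case smooth_fun
  obtain f' where f': "\<forall>x. (f has_derivative f' x) (at x)" "\<forall>i\<in>Basis. (\<lambda>x. f' x i) \<in> alg B"
    using alg_differentiable[OF smooth_fun B] by blast
  have "frechet_derivative f (at x) = f' x" for x
    using f'(1) frechet_derivative_at by metis
  with f' show ?case by (auto simp: differentiable_def)
qed

lemma smooth_fun_has_derivative:
  "smooth_fun f \<Longrightarrow> (f has_derivative frechet_derivative f (at x)) (at x)"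
  by (erule smooth_fun.cases) (simp add: frechet_derivative_works)

lemma smooth_fun_frechet: "smooth_fun f \<Longrightarrow> i \<in> Basis \<Longrightarrow> smooth_fun (\<lambda>x. frechet_derivative f (at x) i)"
  by (erule smooth_fun.cases) simp

lemma smooth_fun_continuous: "smooth_fun f \<Longrightarrow> continuous_on UNIV f"
  using has_derivative_continuous smooth_fun_has_derivative
  by (metis continuous_at_imp_continuous_on)

lemma smooth_alg_smooth:
  assumes "f \<in> alg (Collect smooth_fun)" shows "smooth_fun f"
proof (rule smooth_fun_alg[OF assms])
  fix f :: "'a \<Rightarrow> real" assume "f \<in> Collect smooth_fun"
  then show "\<exists>f'. (\<forall>x. (f has_derivative f' x) (at x)) \<and> (\<forall>i\<in>Basis. (\<lambda>x. f' x i) \<in> alg (Collect smooth_fun))"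
    by (intro exI[of _ "\<lambda>x. frechet_derivative f (at x)"])
      (auto intro: alg.base smooth_fun_has_derivative smooth_fun_frechet)
qed

lemma smooth_fun_const: "smooth_fun (\<lambda>_. c)"
  by (rule smooth_alg_smooth) (rule alg.const)

lemma smooth_fun_add: "smooth_fun f \<Longrightarrow> smooth_fun g \<Longrightarrow> smooth_fun (\<lambda>x. f x + g x)"
  by (rule smooth_alg_smooth) (auto intro: alg.intros)

lemma smooth_fun_mult: "smooth_fun f \<Longrightarrow> smooth_fun g \<Longrightarrow> smooth_fun (\<lambda>x. f x * g x)"
  by (rule smooth_alg_smooth) (auto intro: alg.intros)

lemma smooth_fun_sum: "(\<And>i. i \<in> I \<Longrightarrow> smooth_fun (f i)) \<Longrightarrow> smooth_fun (\<lambda>x. \<Sum>i\<in>I. f i x)"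
  by (induction I rule: infinite_finite_induct) (auto intro: smooth_fun_const smooth_fun_add)

subsection \<open>A smooth cutoff function\<close>

text \<open>Differentiating the flat function \<open>exp (- 1 / t)\<close> produces negative powers
  of \<open>t\<close>; carrying them as the index \<open>m\<close> makes the family closed under
  derivation up to linear combinations.\<close>

definition eta :: "nat \<Rightarrow> real \<Rightarrow> real" where
  "eta m t = (if t > 0 then exp (- 1 / t) / t ^ m else 0)"

text \<open>A single term of the exponential series at \<open>1 / t\<close> absorbs the
  pole.\<close>

lemma eta_bound: "eta m t \<le> fact m" "eta m t \<ge> 0"
proof -
  show "eta m t \<ge> 0" by (simp add: eta_def)
  show "eta m t \<le> fact m"
  proof (cases "t > 0")
    case True
    have "(1 / t) ^ m / fact m \<le> exp (1 / t)"
      using exp_lower_Taylor_quadratic True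
    proof -
      have "(1 / t) ^ m /\<^sub>R fact m \<le> (\<Sum>n. (1 / t) ^ n /\<^sub>R fact n)"
        using True sum_le_suminf[OF summable_exp_generic[of "1/t"], of "{m}"] by simp
      then show ?thesis by (simp add: exp_def divide_inverse mult.commute)
    qed
    then have "(1 / t) ^ m \<le> fact m * exp (1 / t)"
      by (simp only: pos_divide_le_eq fact_gt_zero mult.commute)
    then have "exp (- (1 / t)) * (1 / t) ^ m \<le> exp (- (1 / t)) * (fact m * exp (1 / t))"
      by (intro mult_left_mono) auto
    also have "\<dots> = fact m" by (simp add: exp_minus)
    finally show ?thesis using True by (simp add: eta_def power_divide)
  qed (simp add: eta_def)
qed

lemma eta_has_real_derivative:
  "(eta m has_real_derivative (eta (m + 2) t - of_nat m * eta (m + 1) t)) (at t)"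
proof (cases t "0::real" rule: linorder_cases)
  case greater
  have "((\<lambda>t. exp (- 1 / t) / t ^ m) has_real_derivative (eta (m + 2) t - of_nat m * eta (m + 1) t)) (at t)"
  proof -
    have "((\<lambda>t. t ^ m) has_real_derivative of_nat m * (t ^ m / t)) (at t)"
      using DERIV_pow[of m t] greater by (cases m) auto
    moreover have "((\<lambda>t. exp (- 1 / t)) has_real_derivative exp (- 1 / t) / t\<^sup>2) (at t)"
      using greater by (auto intro!: derivative_eq_intros simp: power2_eq_square)
    ultimately have "((\<lambda>t. exp (- 1 / t) / t ^ m) has_real_derivative
      (exp (- 1 / t) / t\<^sup>2 * t ^ m - exp (- 1 / t) * (of_nat m * (t ^ m / t))) / (t ^ m * t ^ m)) (at t)"
      using greater by (intro DERIV_divide) auto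
    then show ?thesis
      using greater by (simp add: eta_def diff_divide_distrib power_add power2_eq_square mult_ac)
  qed
  then show ?thesis
    by (rule has_field_derivative_transform_within_open[where S = "{0<..}"])
       (use greater in \<open>auto simp: eta_def\<close>)
next
  case less
  have "((\<lambda>t. 0) has_real_derivative (eta (m + 2) t - of_nat m * eta (m + 1) t)) (at t)"
    using less by (simp add: eta_def)
  then show ?thesis
    by (rule has_field_derivative_transform_within_open[where S = "{..<0}"])
       (use less in \<open>auto simp: eta_def\<close>)
next
  case equal
  \<comment> \<open>At 0 the quotient is \<open>eta (m + 2) h * h\<close> for \<open>h > 0\<close>
    and 0 otherwise, and \<open>eta (m + 2)\<close> is bounded.\<close>
  have "((\<lambda>h. eta m h / h) \<longlongrightarrow> 0) (at 0)"
  proof (rule Lim_null_comparison)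
    show "((\<lambda>h. fact (m + 2) * \<bar>h\<bar>) \<longlongrightarrow> 0) (at (0::real))"
      by (auto intro!: tendsto_eq_intros)
    show "\<forall>\<^sub>F h in at (0::real). norm (eta m h / h) \<le> fact (m + 2) * \<bar>h\<bar>"
    proof (rule always_eventually, rule allI)
      fix h :: real
      show "norm (eta m h / h) \<le> fact (m + 2) * \<bar>h\<bar>"
      proof (cases "h > 0")
        case True
        then have "eta m h / h = eta (m + 2) h * h"
          by (simp add: eta_def field_simps power2_eq_square)
        then show ?thesis using eta_bound[of "m+2" h] True by (simp add: abs_mult mult_right_mono)
      next
        case False
        have "0 \<le> fact (m + 2) * \<bar>h\<bar>" by (intro mult_nonneg_nonneg) auto
        moreover have "eta m h = 0" using False by (simp add: eta_def)
        ultimately show ?thesis by simp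
      qed
    qed
  qed
  then show ?thesis using equal by (simp add: has_field_derivative_iff eta_def)
qed

text \<open>The factor \<open>exp 1\<close> normalises the value at the origin to 1, so that the
  cutoffs tend to 1 as \<open>\<rho>\<close> grows.\<close>

definition cutoff :: "real \<Rightarrow> 'a::euclidean_space \<Rightarrow> real" where
  "cutoff \<rho> x = exp 1 * eta 0 (1 - (x \<bullet> x) / \<rho>\<^sup>2)"

lemma eta_cutoff_has_derivative:
  "((\<lambda>x. eta m (1 - (x \<bullet> x) / c)) has_derivative
    (\<lambda>h. (eta (m + 2) (1 - (x \<bullet> x) / c) - of_nat m * eta (m + 1) (1 - (x \<bullet> x) / c)) * (- 2 * (x \<bullet> h) / c))) (at x)"
proof -
  have 1: "((\<lambda>x. 1 - (x \<bullet> x) / c) has_derivative (\<lambda>h. - 2 * (x \<bullet> h) / c)) (at x)"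
    by (auto intro!: derivative_eq_intros simp: inner_commute divide_inverse)
  show ?thesis
    using has_derivative_compose[OF 1 eta_has_real_derivative[of m, unfolded has_field_derivative_def]]
    by simp
qed

lemma smooth_cutoff: "smooth_fun (cutoff \<rho> :: 'a::euclidean_space \<Rightarrow> real)"
proof -
  define B where "B = {\<lambda>x::'a. eta m (1 - (x \<bullet> x) / \<rho>\<^sup>2) |m. True} \<union> {\<lambda>x. x \<bullet> a |a. True}"
  have "(\<lambda>x::'a. exp 1 * eta 0 (1 - (x \<bullet> x) / \<rho>\<^sup>2)) \<in> alg B"
    by (intro alg.mult alg.const alg.base) (auto simp: B_def)
  then have "smooth_fun (\<lambda>x::'a. exp 1 * eta 0 (1 - (x \<bullet> x) / \<rho>\<^sup>2))"
  proof (rule smooth_fun_alg)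
    fix f assume "f \<in> B"
    then consider (eta) m where "f = (\<lambda>x::'a. eta m (1 - (x \<bullet> x) / \<rho>\<^sup>2))" | (inner) a where "f = (\<lambda>x. x \<bullet> a)"
      by (auto simp: B_def)
    then show "\<exists>f'. (\<forall>x. (f has_derivative f' x) (at x)) \<and> (\<forall>i\<in>Basis. (\<lambda>x. f' x i) \<in> alg B)"
    proof cases
      case inner
      then show ?thesis
        by (intro exI[of _ "\<lambda>_ h. h \<bullet> a"]) (auto intro!: derivative_eq_intros alg.const)
    next
      case eta
      have e: "(\<lambda>x::'a. eta m (1 - (x \<bullet> x) / \<rho>\<^sup>2)) \<in> alg B" for m
        by (intro alg.base) (auto simp: B_def)
      have i: "(\<lambda>x::'a. x \<bullet> a) \<in> alg B" for a
        by (intro alg.base) (auto simp: B_def)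
      have "(\<lambda>x::'a. (eta (m + 2) (1 - (x \<bullet> x) / \<rho>\<^sup>2) + (- of_nat m) * eta (m + 1) (1 - (x \<bullet> x) / \<rho>\<^sup>2))
          * ((- 2 / \<rho>\<^sup>2) * (x \<bullet> a))) \<in> alg B" for a
        by (intro alg.mult alg.add alg.const e i)
      then have "(\<lambda>x::'a. (eta (m + 2) (1 - (x \<bullet> x) / \<rho>\<^sup>2) - of_nat m * eta (m + 1) (1 - (x \<bullet> x) / \<rho>\<^sup>2))
          * (- 2 * (x \<bullet> a) / \<rho>\<^sup>2)) \<in> alg B" for a by simp
      with eta_cutoff_has_derivative[of m "\<rho>\<^sup>2"] show ?thesis unfolding eta
        by (intro exI[of _ "\<lambda>x h. (eta (m + 2) (1 - (x \<bullet> x) / \<rho>\<^sup>2) - of_nat m * eta (m + 1) (1 - (x \<bullet> x) / \<rho>\<^sup>2))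
          * (- 2 * (x \<bullet> h) / \<rho>\<^sup>2)"]) blast
    qed
  qed
  then show ?thesis by (simp add: cutoff_def[abs_def])
qed

lemma cutoff_bounds: "0 \<le> cutoff \<rho> x" "cutoff \<rho> x \<le> 1"
proof -
  show "0 \<le> cutoff \<rho> x" by (simp add: cutoff_def eta_def)
  have "exp (1::real) * exp (- (1 / (1 - x \<bullet> x / \<rho>\<^sup>2))) \<le> 1" if "x \<bullet> x / \<rho>\<^sup>2 < 1"
    using that by (auto simp flip: exp_add simp: field_simps zero_le_divide_iff)
  then show "cutoff \<rho> x \<le> 1" by (auto simp: cutoff_def eta_def)
qed

lemma cutoff_tendsto: "(\<lambda>n. cutoff (real n) x) \<longlonglongrightarrow> 1"
proof -
  have 1: "(\<lambda>n. 1 - (x \<bullet> x) / (real n)\<^sup>2) \<longlonglongrightarrow> 1 - 0"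
    by (intro tendsto_intros real_tendsto_divide_at_top filterlim_pow_at_top filterlim_real_sequentially) auto
  have "isCont (eta 0) 1" using DERIV_isCont eta_has_real_derivative by blast
  then have "(\<lambda>n. eta 0 (1 - (x \<bullet> x) / (real n)\<^sup>2)) \<longlonglongrightarrow> eta 0 1"
    using 1 isCont_tendsto_compose by fastforce
  then have "(\<lambda>n. exp 1 * eta 0 (1 - (x \<bullet> x) / (real n)\<^sup>2)) \<longlonglongrightarrow> exp 1 * eta 0 1"
    by (intro tendsto_intros)
  then show ?thesis by (simp add: cutoff_def eta_def flip: exp_add)
qed

lemma cutoff_support: "norm x > \<bar>\<rho>\<bar> \<Longrightarrow> cutoff \<rho> x = 0" if "\<rho> \<noteq> 0"
proof -
  assume "norm x > \<bar>\<rho>\<bar>"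
  then have "x \<bullet> x > \<rho>\<^sup>2" by (metis power2_norm_eq_inner abs_le_square_iff abs_norm_cancel not_le)
  then show ?thesis using that by (simp add: cutoff_def eta_def)
qed

text \<open>Outside the ball of radius \<open>\<rho>\<close> the derivative vanishes, and inside it
  \<open>|x| / \<rho>^2\<close> is at most \<open>1 / \<rho>\<close>. This decay removes the
  commutator term when a smooth field is truncated.\<close>

lemma cutoff_derivative:
  fixes x h :: "'a::euclidean_space"
  assumes "\<rho> > 0"
  shows "\<bar>frechet_derivative (cutoff \<rho>) (at x) h\<bar> \<le> 4 * exp 1 / \<rho> * norm h"
proof -
  have "(cutoff \<rho> has_derivative
      (\<lambda>h. exp 1 * (eta 2 (1 - (x \<bullet> x) / \<rho>\<^sup>2) * (- 2 * (x \<bullet> h) / \<rho>\<^sup>2)))) (at x)"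
    unfolding cutoff_def[abs_def]
    using has_derivative_mult_right[OF eta_cutoff_has_derivative[of 0 "\<rho>\<^sup>2" x], of "exp 1"] by (simp add: mult.assoc numeral_2_eq_2)
  then have eq: "frechet_derivative (cutoff \<rho>) (at x) h
      = exp 1 * (eta 2 (1 - (x \<bullet> x) / \<rho>\<^sup>2) * (- 2 * (x \<bullet> h) / \<rho>\<^sup>2))"
    using frechet_derivative_at by metis
  show ?thesis
  proof (cases "norm x \<le> \<rho>")
    case True
    have "\<bar>x \<bullet> h\<bar> \<le> \<rho> * norm h"
      using Cauchy_Schwarz_ineq2[of x h] True by (meson mult_right_mono norm_ge_zero order_trans)
    then have "\<bar>- 2 * (x \<bullet> h) / \<rho>\<^sup>2\<bar> \<le> 2 * (norm h / \<rho>)"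
      using assms by (simp add: abs_mult field_simps power2_eq_square)
    moreover have "\<bar>eta 2 (1 - (x \<bullet> x) / \<rho>\<^sup>2)\<bar> \<le> 2"
      using eta_bound[of 2 "1 - (x \<bullet> x) / \<rho>\<^sup>2"] by (simp add: eval_nat_numeral)
    ultimately have "\<bar>eta 2 (1 - (x \<bullet> x) / \<rho>\<^sup>2)\<bar> * \<bar>- 2 * (x \<bullet> h) / \<rho>\<^sup>2\<bar> \<le> 2 * (2 * (norm h / \<rho>))"
      by (intro mult_mono) auto
    then have "exp 1 * (\<bar>eta 2 (1 - (x \<bullet> x) / \<rho>\<^sup>2)\<bar> * \<bar>- 2 * (x \<bullet> h) / \<rho>\<^sup>2\<bar>) \<le> exp 1 * (2 * (2 * (norm h / \<rho>)))"
      by (intro mult_left_mono) auto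
    also have "\<dots> = 4 * exp 1 / \<rho> * norm h" by simp
    finally show ?thesis unfolding eq abs_mult by simp
  next
    case False
    then have "x \<bullet> x > \<rho>\<^sup>2"
      using assms by (metis power2_norm_eq_inner not_le power_strict_mono less_imp_le zero_less_numeral)
    then have "eta 2 (1 - (x \<bullet> x) / \<rho>\<^sup>2) = 0" using assms by (simp add: eta_def)
    then show ?thesis unfolding eq using assms by simp
  qed
qed

subsection \<open>Lebesgue integration on Euclidean spaces\<close>

lemma integral_lborel_affine:
  fixes f :: "'a::euclidean_space \<Rightarrow> real"
  assumes "c \<noteq> 0" and [measurable]: "f \<in> borel_measurable borel"
  shows "(\<integral>x. f x \<partial>lborel) = \<bar>c\<bar> ^ DIM('a) * (\<integral>x. f (t + c *\<^sub>R x) \<partial>lborel)"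
  by (subst lborel_affine[OF assms(1), of t], subst integral_density)
    (auto simp: integral_distr)

lemma nn_integral_lborel_translate:
  fixes f :: "'a::euclidean_space \<Rightarrow> ennreal"
  assumes [measurable]: "f \<in> borel_measurable borel"
  shows "(\<integral>\<^sup>+x. f (x + t) \<partial>lborel) = (\<integral>\<^sup>+x. f x \<partial>lborel)"
  by (subst lborel_distr_plus[of t, symmetric], subst nn_integral_distr) (auto simp: add.commute)

lemma integral_lborel_translate:
  fixes f :: "'a::euclidean_space \<Rightarrow> real"
  assumes [measurable]: "f \<in> borel_measurable borel"
  shows "(\<integral>x. f (x + t) \<partial>lborel) = (\<integral>x. f x \<partial>lborel)"
  using integral_lborel_affine[of 1 f t] by (simp add: add.commute)

lemma integrable_lborel_translate:
  fixes f :: "'a::euclidean_space \<Rightarrow> real"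
  assumes "integrable lborel f"
  shows "integrable lborel (\<lambda>x. f (x + t))"
proof -
  have [measurable]: "f \<in> borel_measurable borel" using assms by auto
  have "(\<integral>\<^sup>+x. norm (f (x + t)) \<partial>lborel) = (\<integral>\<^sup>+x. norm (f x) \<partial>lborel)"
    using nn_integral_lborel_translate[of "\<lambda>x. ennreal (norm (f x))" t] by simp
  then show ?thesis using assms unfolding integrable_iff_bounded by simp
qed

lemma Fubini_integrable_lborel:
  fixes f :: "'a::euclidean_space \<Rightarrow> 'b::euclidean_space \<Rightarrow> real"
  assumes [measurable]: "(\<lambda>(x, y). f x y) \<in> borel_measurable borel"
    and "integrable lborel (\<lambda>x. \<integral>y. \<bar>f x y\<bar> \<partial>lborel)" and "\<And>x. integrable lborel (f x)"
  shows "integrable (lborel \<Otimes>\<^sub>M lborel) (\<lambda>(x, y). f x y)"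
proof -
  have [measurable]: "(\<lambda>(x, y). f x y) \<in> borel_measurable (borel \<Otimes>\<^sub>M borel)"
    using assms(1) by (simp add: borel_prod)
  have "(\<lambda>(x, y). f x y) \<in> borel_measurable (lborel \<Otimes>\<^sub>M lborel)" by measurable
  then show ?thesis
    by (rule lborel_pair.Fubini_integrable) (use assms in auto)
qed

text \<open>Fubini along a line: the integral of a derivative over a line segment is an increment,
  and increments have vanishing total integral by translation invariance.\<close>

lemma integral_directional_derivative:
  fixes f :: "'a::euclidean_space \<Rightarrow> real"
  assumes f: "integrable lborel f" and f': "integrable lborel f'" and cont: "continuous_on UNIV f'"
    and deriv: "\<And>x. ((\<lambda>s. f (x + s *\<^sub>R h)) has_real_derivative f' x) (at 0)"
  shows "(\<integral>x. f' x \<partial>lborel) = 0"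
proof -
  have [measurable]: "f' \<in> borel_measurable borel" "f \<in> borel_measurable borel"
    using f f' by auto
  define g where "g = (\<lambda>(s::real) x. indicator {0..1} s * f' (x + s *\<^sub>R h))"
  have d: "((\<lambda>s. f (x + s *\<^sub>R h)) has_real_derivative f' (x + s *\<^sub>R h)) (at s)" for x s
    using deriv[of "x + s *\<^sub>R h"] DERIV_shift[of "\<lambda>s. f (x + s *\<^sub>R h)" _ 0 s]
    by (simp add: scaleR_add_left add_ac)
  have inner: "(\<integral>s. g s x \<partial>lborel) = f (x + h) - f x" for x
  proof -
    have c: "continuous_on A (\<lambda>s. f' (x + s *\<^sub>R h))" for A
      by (rule continuous_on_compose2[OF cont]) (auto intro!: continuous_intros)
    have "(\<integral>s. indicator {0..1} s *\<^sub>R f' (x + s *\<^sub>R h) \<partial>lborel) = f (x + 1 *\<^sub>R h) - f (x + 0 *\<^sub>R h)"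
      by (rule integral_FTC_atLeastAtMost[OF _ _ c])
        (auto intro: has_vector_derivative_at_within d[unfolded has_real_derivative_iff_has_vector_derivative])
    then show ?thesis by (simp add: g_def)
  qed
  have "(\<lambda>(s, x). g s x) \<in> borel_measurable borel"
    unfolding g_def by (simp flip: borel_prod)
  moreover have "(\<integral>x. \<bar>g s x\<bar> \<partial>lborel) = indicator {0..1} s * (\<integral>x. \<bar>f' x\<bar> \<partial>lborel)" for s
    using integral_lborel_translate[of "\<lambda>x. \<bar>f' x\<bar>"] by (simp add: g_def abs_mult)
  moreover have "integrable lborel (g s)" for s
    unfolding g_def by (intro integrable_mult_right integrable_lborel_translate f')
  ultimately have int: "integrable (lborel \<Otimes>\<^sub>M lborel) (\<lambda>(s, x). g s x)"
    by (intro Fubini_integrable_lborel) (auto intro!: integrable_mult_left)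
  have "0 = (\<integral>x. f (x + h) - f x \<partial>lborel)"
    using f integrable_lborel_translate[OF f, of h] integral_lborel_translate[of f h] by simp
  also have "\<dots> = (\<integral>x. (\<integral>s. g s x \<partial>lborel) \<partial>lborel)" by (simp add: inner)
  also have "\<dots> = (\<integral>s. (\<integral>x. g s x \<partial>lborel) \<partial>lborel)"
    by (rule lborel_pair.Fubini_integral) (rule int)
  also have "\<dots> = (\<integral>s. indicator {0..1} s * (\<integral>x. f' x \<partial>lborel) \<partial>(lborel::real measure))"
    using integral_lborel_translate[of f'] by (simp add: g_def)
  finally show ?thesis by simp
qed

lemma integrable_continuous_bounded_support:
  fixes f :: "'a::euclidean_space \<Rightarrow> real"
  assumes "continuous_on UNIV f" and "\<And>x. norm x > B \<Longrightarrow> f x = 0"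
  shows "integrable lborel f"
proof -
  have "integrable lborel (\<lambda>x. indicator (cball 0 B) x *\<^sub>R f x)"
    by (rule borel_integrable_compact) (use assms(1) continuous_on_subset in auto)
  moreover have "(\<lambda>x. indicator (cball 0 B) x *\<^sub>R f x) = f"
    using assms(2) by (auto simp: indicator_def fun_eq_iff)
  ultimately show ?thesis by simp
qed

subsection \<open>The divergence theorem on the punctured space\<close>

text \<open>Nothing is required at the origin, where the fields of interest are singular.\<close>

definition pd :: "'n \<Rightarrow> (real^'n \<Rightarrow> real) \<Rightarrow> (real^'n \<Rightarrow> real) \<Rightarrow> bool" where
  "pd k f f' \<longleftrightarrow> continuous_on (-{0}) f \<and> continuous_on (-{0}) f' \<and>
     (\<forall>x. x \<noteq> 0 \<longrightarrow> ((\<lambda>s. f (x + s *\<^sub>R axis k 1)) has_real_derivative f' x) (at 0))"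

lemma pd_const: "pd k (\<lambda>_. c) (\<lambda>_. 0)"
  by (auto simp: pd_def)

lemma pd_add: "pd k f f' \<Longrightarrow> pd k g g' \<Longrightarrow> pd k (\<lambda>x. f x + g x) (\<lambda>x. f' x + g' x)"
  by (auto simp: pd_def intro!: continuous_intros derivative_intros)

lemma pd_diff: "pd k f f' \<Longrightarrow> pd k g g' \<Longrightarrow> pd k (\<lambda>x. f x - g x) (\<lambda>x. f' x - g' x)"
  by (auto simp: pd_def intro!: continuous_intros derivative_intros)

lemma pd_mult: "pd k f f' \<Longrightarrow> pd k g g' \<Longrightarrow> pd k (\<lambda>x. f x * g x) (\<lambda>x. f' x * g x + f x * g' x)"
  by (auto simp: pd_def intro!: continuous_intros derivative_eq_intros)

lemma pd_sum: "(\<And>i. i \<in> I \<Longrightarrow> pd k (f i) (f' i)) \<Longrightarrow> pd k (\<lambda>x. \<Sum>i\<in>I. f i x) (\<lambda>x. \<Sum>i\<in>I. f' i x)"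
  by (induction I rule: infinite_finite_induct) (auto intro: pd_const pd_add)

lemma pd_cmult: "pd k f f' \<Longrightarrow> pd k (\<lambda>x. c * f x) (\<lambda>x. c * f' x)"
  using pd_mult[OF pd_const[of k c]] by simp

lemma pd_nth: "pd k (\<lambda>x. x $ j) (\<lambda>x. if j = k then 1 else 0)"
  by (auto simp: pd_def axis_def intro!: continuous_intros derivative_eq_intros)

lemma pd_compose:
  assumes f: "pd k f f'" and g: "\<And>x. x \<noteq> 0 \<Longrightarrow> (g has_real_derivative g' (f x)) (at (f x))"
    and g': "continuous_on (f ` (-{0})) g'"
  shows "pd k (\<lambda>x. g (f x)) (\<lambda>x. g' (f x) * f' x)"
proof -
  have "continuous_on (f ` (-{0})) g"
    by (rule continuous_at_imp_continuous_on) (use g DERIV_isCont in fastforce)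
  then have "continuous_on (-{0}) (\<lambda>x. g (f x))"
    by (rule continuous_on_compose2) (use f in \<open>auto simp: pd_def\<close>)
  moreover have "continuous_on (-{0}) (\<lambda>x. g' (f x))"
    by (rule continuous_on_compose2[OF g']) (use f in \<open>auto simp: pd_def\<close>)
  then have "continuous_on (-{0}) (\<lambda>x. g' (f x) * f' x)"
    using f by (intro continuous_on_mult) (auto simp: pd_def)
  moreover have "((\<lambda>s. g (f (x + s *\<^sub>R axis k 1))) has_real_derivative g' (f x) * f' x) (at 0)" if "x \<noteq> 0" for x
    using DERIV_chain2[of g "g' (f x)" "\<lambda>s. f (x + s *\<^sub>R axis k 1)" 0] f g[OF that] that
    by (simp add: pd_def)
  ultimately show ?thesis by (simp add: pd_def)
qed

lemma inner_nth_sum: "(x::real^'n) \<bullet> y = (\<Sum>i\<in>UNIV. x $ i * y $ i)"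
  by (simp add: inner_vec_def)

lemma pd_inner_self: "pd k (\<lambda>x. x \<bullet> x) (\<lambda>x. 2 * x $ k)"
proof -
  have "pd k (\<lambda>x. \<Sum>i\<in>UNIV. x $ i * x $ i)
     (\<lambda>x. \<Sum>i\<in>UNIV. (if i = k then 1 else 0) * x $ i + x $ i * (if i = k then 1 else 0))"
    by (intro pd_sum pd_mult pd_nth)
  then show ?thesis
    by (simp add: inner_nth_sum sum.distrib if_distrib if_distribR cong: if_cong)
qed

lemma pd_inverse_inner_self: "pd k (\<lambda>x. 1 / (x \<bullet> x)) (\<lambda>x. - 2 * x $ k / (x \<bullet> x)\<^sup>2)"
proof -
  have "pd k (\<lambda>x. 1 / (x \<bullet> x)) (\<lambda>x. - 1 / (x \<bullet> x)\<^sup>2 * (2 * x $ k))"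
    by (rule pd_compose[OF pd_inner_self])
      (auto intro!: derivative_eq_intros continuous_intros simp: power2_eq_square)
  then show ?thesis by simp
qed

lemma pd_continuous: "pd k f f' \<Longrightarrow> continuous_on (-{0}) f" "pd k f f' \<Longrightarrow> continuous_on (-{0}) f'"
  by (auto simp: pd_def)

lemma borel_measurable_continuous_off_0:
  fixes f :: "real^'n \<Rightarrow> real"
  assumes "continuous_on (-{0}) f"
  shows "f \<in> borel_measurable borel"
proof -
  have "(\<lambda>x. if x \<in> -{0} then f x else f 0) \<in> borel_measurable borel"
    by (rule borel_measurable_continuous_on_if) (use assms in auto)
  also have "(\<lambda>x. if x \<in> -{0} then f x else f 0) = f" by auto
  finally show ?thesis .
qed

text \<open>Squaring makes the positive part continuously differentiable, which is the regularity
  that \<open>pd\<close> demands of a cutoff.\<close>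

lemma has_real_derivative_max_0_square: "((\<lambda>y. (max 0 y)\<^sup>2) has_real_derivative 2 * max 0 y) (at y)"
proof (cases y "0::real" rule: linorder_cases)
  case less
  have "((\<lambda>y. 0) has_real_derivative 2 * max 0 y) (at y)" using less by simp
  then show ?thesis
    by (rule has_field_derivative_transform_within_open[where S="{..<0}"]) (use less in auto)
next
  case greater
  have "((\<lambda>y. y\<^sup>2) has_real_derivative 2 * max 0 y) (at y)" using greater
    by (auto intro!: derivative_eq_intros)
  then show ?thesis
    by (rule has_field_derivative_transform_within_open[where S="{0<..}"]) (use greater in auto)
next
  case equal
  have "((\<lambda>h::real. (max 0 h)\<^sup>2 / h) \<longlongrightarrow> 0) (at 0)"
    by (rule Lim_null_comparison[of _ "\<lambda>h. \<bar>h\<bar>"])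
      (auto intro!: always_eventually tendsto_eq_intros simp: max_def power2_eq_square)
  then show ?thesis using equal by (simp add: has_field_derivative_iff)
qed

text \<open>Since \<open>R + 1/R\<close> is large at both ends, one radial cutoff removes the origin and infinity;
  its gradient is of order \<open>1/r\<close>, whence the integrability condition on the flux below.\<close>

definition ann :: "nat \<Rightarrow> real^'n \<Rightarrow> real" where
  "ann n x = (max 0 (1 - (x \<bullet> x + 1 / (x \<bullet> x)) / real n))\<^sup>2"

definition ann' :: "nat \<Rightarrow> 'n \<Rightarrow> real^'n \<Rightarrow> real" where
  "ann' n k x = - 2 * max 0 (1 - (x \<bullet> x + 1 / (x \<bullet> x)) / real n) *
     ((2 * x $ k - 2 * x $ k / (x \<bullet> x)\<^sup>2) / real n)"

lemma pd_ann: "pd (k::'n::finite) (ann n) (ann' n k)"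
proof -
  have "pd k (\<lambda>x. x \<bullet> x + 1 / (x \<bullet> x)) (\<lambda>x. 2 * x $ k + - 2 * x $ k / (x \<bullet> x)\<^sup>2)"
    by (intro pd_add pd_inner_self pd_inverse_inner_self)
  from pd_cmult[OF this, of "1 / real n"]
  have "pd k (\<lambda>x. 1 - 1 / real n * (x \<bullet> x + 1 / (x \<bullet> x)))
    (\<lambda>x. 0 - 1 / real n * (2 * x $ k + - 2 * x $ k / (x \<bullet> x)\<^sup>2))"
    by (rule pd_diff[OF pd_const])
  from pd_compose[OF this has_real_derivative_max_0_square continuous_on_mult[OF continuous_on_const continuous_on_max[OF continuous_on_const continuous_on_id]]]
  have "pd k (\<lambda>x. (max 0 (1 - 1 / real n * (x \<bullet> x + 1 / (x \<bullet> x))))\<^sup>2)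
    (\<lambda>x. 2 * max 0 (1 - 1 / real n * (x \<bullet> x + 1 / (x \<bullet> x))) * (0 - 1 / real n * (2 * x $ k + - 2 * x $ k / (x \<bullet> x)\<^sup>2)))"
    by simp
  moreover have "(\<lambda>x::real^'n. (max 0 (1 - 1 / real n * (x \<bullet> x + 1 / (x \<bullet> x))))\<^sup>2) = ann n"
    by (simp add: ann_def fun_eq_iff)
  moreover have "(\<lambda>x. 2 * max 0 (1 - 1 / real n * (x \<bullet> x + 1 / (x \<bullet> x))) * (0 - 1 / real n * (2 * x $ k + - 2 * x $ k / (x \<bullet> x)\<^sup>2))) = ann' n k"
  proof (rule ext)
    fix x
    have "2 * m * (0 - 1 / real n * (2 * x $ k + - 2 * x $ k / (x \<bullet> x)\<^sup>2))
      = - 2 * m * ((2 * x $ k - 2 * x $ k / (x \<bullet> x)\<^sup>2) / real n)" for m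
      by simp
    then show "2 * max 0 (1 - 1 / real n * (x \<bullet> x + 1 / (x \<bullet> x))) *
        (0 - 1 / real n * (2 * x $ k + - 2 * x $ k / (x \<bullet> x)\<^sup>2)) = ann' n k x"
      by (simp add: ann'_def)
  qed
  ultimately show ?thesis by (simp only:)
qed

lemma ann_bounds: "0 \<le> ann n x" "ann n x \<le> 1"
  by (auto simp: ann_def max_def power_le_one)

lemma ann_support:
  assumes "n > 0" "x \<bullet> x > real n \<or> (x \<noteq> 0 \<and> x \<bullet> x < 1 / real n)"
  shows "ann n x = 0" "ann' n k x = 0"
proof -
  have "x \<noteq> 0" using assms by auto
  then have pos: "x \<bullet> x > 0" by simp
  have "x \<bullet> x + 1 / (x \<bullet> x) > real n"
    using assms(2)
  proof
    assume "x \<bullet> x > real n"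
    moreover have "1 / (x \<bullet> x) > 0" using pos by simp
    ultimately show ?thesis by linarith
  next
    assume "x \<noteq> 0 \<and> x \<bullet> x < 1 / real n"
    then have "real n < 1 / (x \<bullet> x)" using pos assms(1) by (simp add: field_simps)
    then show ?thesis using pos by linarith
  qed
  then have "1 - (x \<bullet> x + 1 / (x \<bullet> x)) / real n < 0" using assms(1) by (simp add: field_simps)
  then show "ann n x = 0" "ann' n k x = 0" by (simp_all add: ann_def ann'_def)
qed

lemma ann_tendsto: "(\<lambda>n. ann n x) \<longlonglongrightarrow> 1"
proof -
  have "(\<lambda>n. (x \<bullet> x + 1 / (x \<bullet> x)) / real n) \<longlonglongrightarrow> 0"
    by (intro real_tendsto_divide_at_top[OF tendsto_const] filterlim_real_sequentially)
  then have "(\<lambda>n. (max 0 (1 - (x \<bullet> x + 1 / (x \<bullet> x)) / real n))\<^sup>2) \<longlonglongrightarrow> (max 0 (1 - 0))\<^sup>2"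
    by (intro tendsto_intros)
  then show ?thesis by (simp add: ann_def)
qed

lemma ann'_tendsto: "(\<lambda>n. ann' n k x) \<longlonglongrightarrow> 0"
proof -
  have "(\<lambda>n. c / real n) \<longlonglongrightarrow> 0" for c
    by (intro real_tendsto_divide_at_top[OF tendsto_const] filterlim_real_sequentially)
  then have "(\<lambda>n. - 2 * max 0 (1 - (x \<bullet> x + 1 / (x \<bullet> x)) / real n) *
     ((2 * x $ k - 2 * x $ k / (x \<bullet> x)\<^sup>2) / real n)) \<longlonglongrightarrow> - 2 * max 0 (1 - 0) * 0"
    by (intro tendsto_intros)
  then show ?thesis by (simp add: ann'_def)
qed

text \<open>On the support \<open>R + 1/R \<le> n\<close> with \<open>R = r^2\<close>, and the
  gradient has size \<open>(r + 1/r^3) / n = (R + 1/R) / (r n)\<close>. The bound is therefore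
  uniform in \<open>n\<close>, as dominated convergence requires.\<close>

lemma ann'_bound:
  assumes "x \<noteq> 0" shows "\<bar>ann' n k x\<bar> \<le> 4 / norm x"
\<comment> \<open>For \<open>n = 0\<close> the quotients by \<open>real n\<close> are 0 by
  convention, and so is \<open>ann'\<close>.\<close>
proof (cases "n = 0 \<or> x \<bullet> x + 1 / (x \<bullet> x) > real n")
  case True
  then have "ann' n k x = 0"
    by (cases "n = 0") (auto simp: ann'_def max_def field_simps)
  then show ?thesis by simp
next
  case False
  then have n: "n > 0" and le: "x \<bullet> x + 1 / (x \<bullet> x) \<le> real n" by auto
  define r where "r = norm x"
  have r: "r > 0" "x \<bullet> x = r\<^sup>2" using assms by (auto simp: r_def power2_norm_eq_inner)
  have xk: "\<bar>x $ k\<bar> \<le> r" by (simp add: r_def component_le_norm_cart)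
  have "0 \<le> x \<bullet> x + 1 / (x \<bullet> x)" by simp
  then have "0 \<le> (x \<bullet> x + 1 / (x \<bullet> x)) / real n" by (intro divide_nonneg_nonneg) auto
  then have m: "\<bar>max 0 (1 - (x \<bullet> x + 1 / (x \<bullet> x)) / real n)\<bar> \<le> 1" by (simp add: max_def)
  have "\<bar>2 * x $ k - 2 * x $ k / (x \<bullet> x)\<^sup>2\<bar> \<le> \<bar>2 * x $ k\<bar> + \<bar>2 * x $ k / (x \<bullet> x)\<^sup>2\<bar>" by linarith
  also have "\<dots> \<le> 2 * r + 2 * r / (r\<^sup>2)\<^sup>2"
    using xk r by (auto simp: abs_mult intro!: add_mono divide_right_mono)
  also have "\<dots> = 2 / r * (x \<bullet> x + 1 / (x \<bullet> x))"
    using r by (simp add: field_simps power2_eq_square)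
  also have "\<dots> \<le> 2 / r * real n" using r le by (intro mult_left_mono) auto
  finally have "\<bar>(2 * x $ k - 2 * x $ k / (x \<bullet> x)\<^sup>2) / real n\<bar> \<le> 2 / r"
    using n by (simp add: field_simps)
  then have "\<bar>max 0 (1 - (x \<bullet> x + 1 / (x \<bullet> x)) / real n)\<bar> * \<bar>(2 * x $ k - 2 * x $ k / (x \<bullet> x)\<^sup>2) / real n\<bar> \<le> 1 * (2 / r)"
    using m by (intro mult_mono) auto
  then show ?thesis unfolding ann'_def abs_mult r_def[symmetric] by (simp add: abs_mult)
qed

text \<open>Multiplied by the annular cutoff, \<open>f\<close> extends by 0 to a continuously
  differentiable function with compact support, to which the integral of a directional derivative
  applies.\<close>

lemma integral_pd_annulus:
  fixes f :: "real^'n \<Rightarrow> real"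
  assumes f: "pd k f f'" and n: "n > 0"
  shows "integrable lborel (\<lambda>x. ann n x * f' x + ann' n k x * f x)"
    and "(\<integral>x. ann n x * f' x + ann' n k x * f x \<partial>lborel) = 0"
proof -
  \<comment> \<open>Since \<open>1 / 0 = 0\<close>, the cutoff has the value 1 at the origin itself,
    so the product has to be reset there.\<close>
  define g where "g = (\<lambda>x. if x = 0 then 0 else ann n x * f x)"
  define g' where "g' = (\<lambda>x. if x = 0 then 0 else ann n x * f' x + ann' n k x * f x)"
  have p: "pd k (\<lambda>x. ann n x * f x) (\<lambda>x. ann' n k x * f x + ann n x * f' x)"
    by (intro pd_mult pd_ann f)
  define e where "e = sqrt (1 / real n)"
  have e: "e > 0" using n by (simp add: e_def)
  have near: "g x = 0" "g' x = 0" if "x \<in> ball 0 e" for x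
  proof -
    have "x \<bullet> x < 1 / real n"
      using that n unfolding e_def by (auto simp: norm_eq_sqrt_inner)
    then show "g x = 0" "g' x = 0" using ann_support[of n x] n by (auto simp: g_def g'_def)
  qed
  have far: "g x = 0" "g' x = 0" if "norm x > sqrt (real n)" for x
  proof -
    have "x \<bullet> x > real n"
      using that by (auto simp: norm_eq_sqrt_inner)
    then show "g x = 0" "g' x = 0" using ann_support[of n x] n by (auto simp: g_def g'_def)
  qed
  have cont: "continuous_on UNIV h" if "continuous_on (-{0}) h" "\<And>x. x \<in> ball 0 e \<Longrightarrow> h x = 0"
    for h :: "real^'n \<Rightarrow> real"
  proof -
    have "continuous_on (ball 0 e) h"
      using that(2) by (simp cong: continuous_on_cong_simp)
    with that(1) have "continuous_on (-{0} \<union> ball 0 e) h"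
      by (intro continuous_on_open_Un) auto
    moreover have "-{0} \<union> ball 0 e = (UNIV :: (real^'n) set)" using e by auto
    ultimately show ?thesis by simp
  qed
  have cg: "continuous_on UNIV g"
    by (rule cont) (use pd_continuous(1)[OF p] near in \<open>auto simp: g_def cong: continuous_on_cong_simp\<close>)
  have cg': "continuous_on UNIV g'"
    by (rule cont) (use pd_continuous(2)[OF p] near in \<open>auto simp: g'_def add.commute cong: continuous_on_cong_simp\<close>)
  have ig: "integrable lborel g" "integrable lborel g'"
    by (rule integrable_continuous_bounded_support[OF _ far(1)] integrable_continuous_bounded_support[OF _ far(2)];
        use cg cg' in blast)+
  have "((\<lambda>s. g (x + s *\<^sub>R axis k 1)) has_real_derivative g' x) (at 0)" for x
  proof (cases "x = 0")
    case True
    have "((\<lambda>s. 0) has_real_derivative g' x) (at 0)" using True by (simp add: g'_def)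
    then show ?thesis
      by (rule has_field_derivative_transform_within_open[where S = "ball 0 e"])
         (use True e near in \<open>auto\<close>)
  next
    case False
    have "((\<lambda>s. ann n (x + s *\<^sub>R axis k 1) * f (x + s *\<^sub>R axis k 1)) has_real_derivative g' x) (at 0)"
      using p False by (simp add: pd_def g'_def add.commute)
    then show ?thesis
    proof (rule has_field_derivative_transform_within[where d = "norm x"])
      fix s :: real assume "dist s 0 < norm x"
      then have "x + s *\<^sub>R axis k 1 \<noteq> 0"
        by (metis add_eq_0_iff dist_norm diff_zero norm_minus_cancel norm_scaleR norm_axis_1 mult.right_neutral
            less_irrefl real_norm_def)
      then show "ann n (x + s *\<^sub>R axis k 1) * f (x + s *\<^sub>R axis k 1) = g (x + s *\<^sub>R axis k 1)"
        by (simp add: g_def)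
    qed (use False in auto)
  qed
  then have 0: "(\<integral>x. g' x \<partial>lborel) = 0"
    by (rule integral_directional_derivative[OF ig cg'])
  have ae: "AE x in lborel. ann n x * f' x + ann' n k x * f x = g' x"
    using AE_lborel_singleton[where c=0] by eventually_elim (simp add: g'_def)
  have m: "(\<lambda>x. ann n x * f' x + ann' n k x * f x) \<in> borel_measurable borel"
    using pd_continuous(2)[OF p] by (intro borel_measurable_continuous_off_0) (simp add: add.commute)
  show "integrable lborel (\<lambda>x. ann n x * f' x + ann' n k x * f x)"
    using integrable_cong_AE[OF _ _ ae] m ig(2) by auto
  show "(\<integral>x. ann n x * f' x + ann' n k x * f x \<partial>lborel) = 0"
    using integral_cong_AE[OF _ _ ae] m ig(2) 0 by auto
qed

text \<open>The term with the gradient of the cutoff tends to 0 pointwise and is dominated through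
  the flux hypothesis. Integrability is asked of the divergence as a sum and not of its summands: in
  the applications the summands may contain second derivatives about whose size nothing is known,
  and these cancel only in the sum.\<close>

theorem integral_divergence_off_0:
  fixes F :: "'n \<Rightarrow> real^'n \<Rightarrow> real"
  assumes F: "\<And>k. pd k (F k) (F' k)"
    and flux: "\<And>k. integrable lborel (\<lambda>x. F k x / norm x)"
    and div: "integrable lborel (\<lambda>x. \<Sum>k\<in>UNIV. F' k x)"
  shows "(\<integral>x. (\<Sum>k\<in>UNIV. F' k x) \<partial>lborel) = 0"
proof -
  let ?D = "\<lambda>x. \<Sum>k\<in>UNIV. F' k x"
  let ?G = "\<lambda>n x. ann n x * ?D x + (\<Sum>k\<in>UNIV. ann' n k x * F k x)"
  have G: "(\<integral>x. ?G (Suc n) x \<partial>lborel) = 0" for n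
  proof -
    have "?G (Suc n) = (\<lambda>x. \<Sum>k\<in>UNIV. ann (Suc n) x * F' k x + ann' (Suc n) k x * F k x)"
      by (simp add: sum.distrib sum_distrib_left)
    then show ?thesis
      by (simp only: integral_pd_annulus[OF F] Bochner_Integration.integral_sum integral_pd_annulus(1)[OF F] zero_less_Suc sum.neutral_const)
  qed
  have [measurable]: "F k \<in> borel_measurable borel" "F' k \<in> borel_measurable borel"
    "(ann n :: real^'n \<Rightarrow> real) \<in> borel_measurable borel" "ann' n k \<in> borel_measurable borel" for k n
    using pd_continuous[OF F[of k]] pd_continuous[OF pd_ann[of k n]] by (auto intro!: borel_measurable_continuous_off_0)
  have "(\<lambda>n. \<integral>x. ?G (Suc n) x \<partial>lborel) \<longlonglongrightarrow> (\<integral>x. ?D x \<partial>lborel)"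
  proof (rule integral_dominated_convergence[where w = "\<lambda>x. \<bar>?D x\<bar> + (\<Sum>k\<in>UNIV. 4 * \<bar>F k x / norm x\<bar>)"])
    show "integrable lborel (\<lambda>x. \<bar>?D x\<bar> + (\<Sum>k\<in>UNIV. 4 * \<bar>F k x / norm x\<bar>))"
      by (intro Bochner_Integration.integrable_add Bochner_Integration.integrable_sum
          integrable_mult_right integrable_abs flux div)
    show "AE x in lborel. (\<lambda>n. ?G (Suc n) x) \<longlonglongrightarrow> ?D x"
    proof (rule AE_I2)
      fix x
      have "(\<lambda>n. ?G n x) \<longlonglongrightarrow> 1 * ?D x + (\<Sum>k\<in>UNIV. 0 * F k x)"
        by (intro tendsto_intros ann_tendsto ann'_tendsto)
      then have "(\<lambda>n. ?G n x) \<longlonglongrightarrow> ?D x" by simp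
      then show "(\<lambda>n. ?G (Suc n) x) \<longlonglongrightarrow> ?D x" by (rule LIMSEQ_Suc)
    qed
    show "AE x in lborel. norm (?G (Suc n) x) \<le> \<bar>?D x\<bar> + (\<Sum>k\<in>UNIV. 4 * \<bar>F k x / norm x\<bar>)" for n
      using AE_lborel_singleton[where c=0]
    proof eventually_elim
      fix x :: "real^'n" assume "x \<noteq> 0"
      have "\<bar>ann (Suc n) x * ?D x\<bar> \<le> 1 * \<bar>?D x\<bar>"
        unfolding abs_mult using ann_bounds[of "Suc n" x] by (intro mult_right_mono) auto
      moreover have "\<bar>\<Sum>k\<in>UNIV. ann' (Suc n) k x * F k x\<bar> \<le> (\<Sum>k\<in>UNIV. 4 * \<bar>F k x / norm x\<bar>)"
      proof (rule order_trans[OF sum_abs sum_mono])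
        fix k
        have "\<bar>ann' (Suc n) k x * F k x\<bar> \<le> (4 / norm x) * \<bar>F k x\<bar>"
          unfolding abs_mult using ann'_bound[OF \<open>x \<noteq> 0\<close>] by (intro mult_right_mono) auto
        then show "\<bar>ann' (Suc n) k x * F k x\<bar> \<le> 4 * \<bar>F k x / norm x\<bar>" by simp
      qed
      ultimately show "norm (?G (Suc n) x) \<le> \<bar>?D x\<bar> + (\<Sum>k\<in>UNIV. 4 * \<bar>F k x / norm x\<bar>)"
        by simp
    qed
  qed (auto simp: )
  then show ?thesis using G by (simp add: LIMSEQ_const_iff)
qed

subsection \<open>Gaussians and functions with finite moments\<close>

definition gauss :: "real \<Rightarrow> 'a::euclidean_space \<Rightarrow> real" where
  "gauss c x = exp (- c * (x \<bullet> x))"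

lemma gauss_measurable[measurable]: "gauss c \<in> borel_measurable borel"
  unfolding gauss_def by measurable

lemma gauss_pos: "gauss c x > 0" and gauss_le_1: "c \<ge> 0 \<Longrightarrow> gauss c x \<le> 1"
  by (auto simp: gauss_def)

lemma nn_integral_gauss_real:
  assumes "c > 0"
  shows "(\<integral>\<^sup>+t. ennreal (exp (- c * t\<^sup>2)) \<partial>lborel) = ennreal (sqrt (pi / c))"
proof -
  define \<sigma> where "\<sigma> = sqrt (1 / (2 * c))"
  have s: "\<sigma>\<^sup>2 = 1 / (2 * c)" using assms by (simp add: \<sigma>_def)
  then have e: "exp (- c * t\<^sup>2) = sqrt (pi / c) * normal_density 0 \<sigma> t" for t
    using assms by (simp add: normal_density_def real_sqrt_divide)
  have "\<sigma> > 0" using assms by (simp add: \<sigma>_def)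
  then have "(\<integral>\<^sup>+t. ennreal (normal_density 0 \<sigma> t) \<partial>lborel) = 1"
    by (subst nn_integral_eq_integral) auto
  then show ?thesis unfolding e
    using assms by (simp add: ennreal_mult nn_integral_cmult)
qed

lemma nn_integral_gauss:
  assumes "c > 0"
  shows "(\<integral>\<^sup>+x. ennreal (gauss c (x::'a::euclidean_space)) \<partial>lborel) = ennreal (sqrt (pi / c) ^ DIM('a))"
proof -
  have "ennreal (gauss c x) = (\<Prod>b\<in>Basis. ennreal (exp (- c * (x \<bullet> b)\<^sup>2)))" for x :: 'a
    by (subst prod_ennreal)
      (auto simp: gauss_def euclidean_inner[of x x] sum_distrib_left exp_sum power2_eq_square)
  then have "(\<integral>\<^sup>+x. ennreal (gauss c (x::'a)) \<partial>lborel) = (\<Prod>b\<in>(Basis::'a set). ennreal (sqrt (pi / c)))"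
    using nn_integral_lborel_prod[of "\<lambda>b t. ennreal (exp (- c * t\<^sup>2))"] nn_integral_gauss_real[OF assms] by simp
  then show ?thesis using assms by (simp add: ennreal_power)
qed

lemma gauss_integrable: "c > 0 \<Longrightarrow> integrable lborel (gauss c)"
  by (rule integrableI_nonneg) (auto simp: nn_integral_gauss less_imp_le[OF gauss_pos])

lemma integral_gauss:
  "c > 0 \<Longrightarrow> (\<integral>x. gauss c (x::'a::euclidean_space) \<partial>lborel) = sqrt (pi / c) ^ DIM('a)"
  by (subst integral_eq_nn_integral) (auto simp: nn_integral_gauss less_imp_le[OF gauss_pos])

text \<open>Tonelli, after writing \<open>exp(-R)/R\<close> as the integral of \<open>exp(-(1+t)R)\<close> over \<open>t > 0\<close>.\<close>

lemma gauss_inverse_square_integrable: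
  assumes "DIM('a::euclidean_space) \<ge> 3"
  shows "integrable lborel (\<lambda>x::'a. gauss 1 x / (x \<bullet> x))"
proof (rule integrableI_bounded)
  have 1: "ennreal (norm (gauss 1 x / (x \<bullet> x))) \<le> (\<integral>\<^sup>+t. ennreal (gauss (1 + t) x) * indicator {0..} t \<partial>lborel)" for x :: 'a
  proof (cases "x = 0")
    case False
    then have R: "x \<bullet> x > 0" by simp
    have "(\<integral>\<^sup>+t. ennreal (exp (- (1 + t) * (x \<bullet> x))) * indicator {0..} t \<partial>lborel)
        = 0 - (- exp (- (1 + 0) * (x \<bullet> x)) / (x \<bullet> x))"
    proof (rule nn_integral_FTC_atLeast)
      show "((\<lambda>t. - exp (- (1 + t) * (x \<bullet> x)) / (x \<bullet> x)) has_real_derivative exp (- (1 + t) * (x \<bullet> x))) (at t)" for t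
        using R by (auto intro!: derivative_eq_intros)
      have "((\<lambda>t. (- 1 / (x \<bullet> x)) / exp ((x \<bullet> x) * (1 + t))) \<longlongrightarrow> 0) at_top"
        by (intro real_tendsto_divide_at_top[OF tendsto_const] filterlim_compose[OF exp_at_top]
            filterlim_tendsto_pos_mult_at_top[OF tendsto_const R] filterlim_tendsto_add_at_top[OF tendsto_const] filterlim_ident)
      moreover have "(- 1 / (x \<bullet> x)) / exp ((x \<bullet> x) * (1 + t)) = - exp (- (1 + t) * (x \<bullet> x)) / (x \<bullet> x)" for t
      proof -
        have "exp (- (1 + t) * (x \<bullet> x)) = inverse (exp ((x \<bullet> x) * (1 + t)))"
          by (simp flip: exp_minus add: algebra_simps)
        then show ?thesis by (simp add: divide_inverse)
      qed
      ultimately show "((\<lambda>t. - exp (- (1 + t) * (x \<bullet> x)) / (x \<bullet> x)) \<longlongrightarrow> 0) at_top" by (simp only:)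
    qed auto
    then show ?thesis by (simp add: gauss_def)
  qed simp
  have "(\<integral>\<^sup>+x. ennreal (norm (gauss 1 x / ((x::'a) \<bullet> x))) \<partial>lborel)
      \<le> (\<integral>\<^sup>+x. (\<integral>\<^sup>+t. ennreal (gauss (1 + t) (x::'a)) * indicator {0..} t \<partial>lborel) \<partial>lborel)"
    by (intro nn_integral_mono 1)
  also have "\<dots> = (\<integral>\<^sup>+t. (\<integral>\<^sup>+x. ennreal (gauss (1 + t) (x::'a)) * indicator {0..} t \<partial>lborel) \<partial>lborel)"
    by (rule lborel_pair.Fubini') (auto simp: gauss_def)
  \<comment> \<open>The Gaussian integral decays like \<open>(1 + t)^(- N/2)\<close>, which is
    integrable over \<open>t > 0\<close> from dimension 3 on; the exponent 3/2 serves for all these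
    dimensions.\<close>
  also have "\<dots> \<le> (\<integral>\<^sup>+t. ennreal (sqrt pi ^ DIM('a)) * (ennreal (1 / sqrt (1 + t) ^ 3) * indicator {0..} t) \<partial>lborel)"
  proof (rule nn_integral_mono)
    fix t :: real
    show "(\<integral>\<^sup>+x. ennreal (gauss (1 + t) (x::'a)) * indicator {0..} t \<partial>lborel)
      \<le> ennreal (sqrt pi ^ DIM('a)) * (ennreal (1 / sqrt (1 + t) ^ 3) * indicator {0..} t)"
    proof (cases "t \<ge> 0")
      case True
      have "sqrt (pi / (1 + t)) ^ DIM('a) = sqrt pi ^ DIM('a) * (1 / sqrt (1 + t)) ^ DIM('a)"
        by (simp add: real_sqrt_divide power_divide)
      also have "\<dots> \<le> sqrt pi ^ DIM('a) * (1 / sqrt (1 + t)) ^ 3"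
        using True assms by (intro mult_left_mono power_decreasing) auto
      finally show ?thesis
        using True nn_integral_gauss[of "1 + t", where 'a='a]
        by (simp add: power_divide flip: ennreal_mult)
    qed simp
  qed
  also have "\<dots> = ennreal (sqrt pi ^ DIM('a)) * (\<integral>\<^sup>+t. ennreal (1 / sqrt (1 + t) ^ 3) * indicator {0..} t \<partial>lborel)"
    by (rule nn_integral_cmult) auto
  also have "(\<integral>\<^sup>+t. ennreal (1 / sqrt (1 + t) ^ 3) * indicator {0..} t \<partial>lborel) = 0 - (- 2 / sqrt (1 + 0))"
  proof (rule nn_integral_FTC_atLeast)
    show "((\<lambda>t. - 2 / sqrt (1 + t)) has_real_derivative 1 / sqrt (1 + t) ^ 3) (at t)" if "0 \<le> t" for t :: real
      using that by (auto intro!: derivative_eq_intros simp: divide_simps power3_eq_cube)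
    show "((\<lambda>t. - 2 / sqrt (1 + t)) \<longlongrightarrow> 0) at_top"
      by (intro real_tendsto_divide_at_top[OF tendsto_const] filterlim_compose[OF sqrt_at_top]
          filterlim_tendsto_add_at_top[OF tendsto_const] filterlim_ident)
  qed auto
  finally show "(\<integral>\<^sup>+x. ennreal (norm (gauss 1 x / ((x::'a) \<bullet> x))) \<partial>lborel) < \<infinity>"
    by (rule order.strict_trans1) (simp add: ennreal_mult_less_top)
qed auto

text \<open>These are the weights whose transforms can be differentiated any number of times under
  the integral sign. The class is stable under multiplication by \<open>\<xi> \<bullet> h\<close>,
  which is what differentiation of the kernel produces.\<close>

definition moments :: "('a::euclidean_space \<Rightarrow> real) \<Rightarrow> bool" where
  "moments w \<longleftrightarrow> w \<in> borel_measurable borel \<and> (\<forall>m. integrable lborel (\<lambda>x. norm x ^ m * w x))"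

lemma moments_measurable: "moments w \<Longrightarrow> w \<in> borel_measurable borel"
  and moments_integrable_power: "moments w \<Longrightarrow> integrable lborel (\<lambda>x. norm x ^ m * w x)"
  and moments_integrable: "moments w \<Longrightarrow> integrable lborel w"
  by (auto simp: moments_def dest: spec[of _ 0])

lemma moments_dominated:
  assumes w: "moments w" and v: "v \<in> borel_measurable borel" and "\<And>x. \<bar>v x\<bar> \<le> c * norm x ^ k * \<bar>w x\<bar>"
  shows "moments v"
  unfolding moments_def
proof (intro conjI allI v)
  fix m
  show "integrable lborel (\<lambda>x. norm x ^ m * v x)"
  proof (rule Bochner_Integration.integrable_bound)
    show "integrable lborel (\<lambda>x. c * (norm x ^ (m + k) * w x))"
      by (intro integrable_mult_right moments_integrable_power w)
    show "AE x in lborel. norm (norm x ^ m * v x) \<le> norm (c * (norm x ^ (m + k) * w x))"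
    proof (rule AE_I2)
      fix x
      have "norm x ^ m * \<bar>v x\<bar> \<le> norm x ^ m * (c * norm x ^ k * \<bar>w x\<bar>)"
        using assms(3) by (intro mult_left_mono) auto
      also have "\<dots> = c * (norm x ^ m * norm x ^ k * \<bar>w x\<bar>)" by (simp add: mult_ac)
      also have "\<dots> \<le> \<bar>c\<bar> * (norm x ^ m * norm x ^ k * \<bar>w x\<bar>)" by (rule mult_right_mono) auto
      finally show "norm (norm x ^ m * v x) \<le> norm (c * (norm x ^ (m + k) * w x))"
        by (simp add: abs_mult power_add)
    qed
  qed (use v in auto)
qed

lemma moments_add: "moments v \<Longrightarrow> moments w \<Longrightarrow> moments (\<lambda>x. v x + w x)"
  by (auto simp: moments_def distrib_left)

lemma moments_inner: "moments w \<Longrightarrow> moments (\<lambda>x. (x \<bullet> h) * w x)"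
  by (rule moments_dominated[where c = "norm h" and k = 1 and w = w])
    (auto dest: moments_measurable simp: abs_mult mult.commute[of "norm h"] intro!: mult_right_mono Cauchy_Schwarz_ineq2)

lemma power_le_exp:
  fixes c R :: real
  assumes "c > 0" "R \<ge> 0" shows "R ^ m \<le> fact m / c ^ m * exp (c * R)"
proof -
  have "(c * R) ^ m /\<^sub>R fact m \<le> (\<Sum>n. (c * R) ^ n /\<^sub>R fact n)"
    using assms sum_le_suminf[OF summable_exp_generic[of "c * R"], of "{m}"] by simp
  then have "(c * R) ^ m / fact m \<le> exp (c * R)" by (simp add: exp_def divide_inverse mult.commute)
  then show ?thesis using assms by (simp add: power_mult_distrib field_simps)
qed

lemma norm_power_gauss:
  assumes "c > d" "d \<ge> 0"
  obtains C where "C \<ge> 0" "\<And>x::'a::euclidean_space. norm x ^ m * gauss c x \<le> C * gauss d x"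
proof
  let ?C = "1 + fact m / (c - d) ^ m"
  show "0 \<le> ?C" using assms by (simp add: add_nonneg_nonneg)
  fix x :: 'a
  have "norm x ^ m \<le> 1 + (x \<bullet> x) ^ m"
  proof (cases "norm x \<le> 1")
    case True
    then show ?thesis using power_le_one[of "norm x" m] zero_le_power[OF inner_ge_zero, of x m] by (smt (verit) norm_ge_zero)
  next
    case False
    then have "norm x ^ m \<le> norm x ^ (2 * m)" by (intro power_increasing) auto
    then show ?thesis by (simp add: power_mult power2_norm_eq_inner)
  qed
  also have "\<dots> \<le> exp ((c - d) * (x \<bullet> x)) + fact m / (c - d) ^ m * exp ((c - d) * (x \<bullet> x))"
    using assms by (intro add_mono power_le_exp) auto
  finally have "norm x ^ m * gauss c x \<le> ?C * exp ((c - d) * (x \<bullet> x)) * gauss c x"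
    using gauss_pos[of c x] by (intro mult_right_mono) (auto simp: algebra_simps)
  also have "\<dots> = ?C * gauss d x"
    by (simp add: gauss_def algebra_simps flip: exp_add)
  finally show "norm x ^ m * gauss c x \<le> ?C * gauss d x" .
qed

text \<open>Of the Gaussian exponent \<open>c\<close>, the part \<open>c - d\<close> absorbs every
  power of the norm, and the part \<open>d\<close> remains to integrate \<open>h\<close>.\<close>

lemma moments_gauss_mult:
  assumes "c > d" "d > 0" and [measurable]: "h \<in> borel_measurable borel"
    and int: "integrable lborel (\<lambda>x. gauss d x * h x)"
  shows "moments (\<lambda>x. gauss c x * h x)"
  unfolding moments_def
proof (intro conjI allI)
  fix m
  obtain C where C: "C \<ge> 0" "\<And>x::'a. norm x ^ m * gauss c x \<le> C * gauss d x"
    using norm_power_gauss assms less_imp_le by metis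
  show "integrable lborel (\<lambda>x. norm x ^ m * (gauss c x * h x))"
  proof (rule Bochner_Integration.integrable_bound[OF integrable_mult_right[OF int, of C]])
    show "AE x in lborel. norm (norm x ^ m * (gauss c x * h x)) \<le> norm (C * (gauss d x * h x))"
    proof (rule AE_I2)
      fix x :: 'a
      have "norm x ^ m * gauss c x * \<bar>h x\<bar> \<le> C * gauss d x * \<bar>h x\<bar>"
        using C(2) by (rule mult_right_mono) simp
      then show "norm (norm x ^ m * (gauss c x * h x)) \<le> norm (C * (gauss d x * h x))"
        using C(1) gauss_pos[of c x] gauss_pos[of d x] by (simp add: abs_mult mult.assoc)
    qed
  qed auto
qed auto

lemma moments_gauss: "c > 0 \<Longrightarrow> moments (gauss c)"
  using moments_gauss_mult[of "c / 2" c "\<lambda>_. 1"] gauss_integrable[of "c / 2"] by simp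

lemma moments_continuous_bounded_support:
  fixes f :: "'a::euclidean_space \<Rightarrow> real"
  assumes "continuous_on UNIV f" "\<And>x. norm x > B \<Longrightarrow> f x = 0"
  shows "moments f"
  unfolding moments_def using assms
  by (auto intro!: borel_measurable_continuous_onI integrable_continuous_bounded_support[where B=B] continuous_intros)

subsection \<open>Cosine and sine transforms\<close>

text \<open>Real and imaginary part of the Fourier integral with kernel
  \<open>exp (i x \<bullet> \<xi>)\<close>, without normalisation; hence the factors
  \<open>(2 * pi) ^ DIM('a)\<close> further on.\<close>

definition CT :: "('a::euclidean_space \<Rightarrow> real) \<Rightarrow> 'a \<Rightarrow> real" where
  "CT w x = (\<integral>\<xi>. cos (x \<bullet> \<xi>) * w \<xi> \<partial>lborel)"

definition ST :: "('a::euclidean_space \<Rightarrow> real) \<Rightarrow> 'a \<Rightarrow> real" where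
  "ST w x = (\<integral>\<xi>. sin (x \<bullet> \<xi>) * w \<xi> \<partial>lborel)"

lemma kernel_integrable:
  fixes w :: "'a::euclidean_space \<Rightarrow> real"
  assumes "integrable lborel w" and [measurable]: "g \<in> borel_measurable borel" and "\<And>x. \<bar>g x\<bar> \<le> (1::real)"
  shows "integrable lborel (\<lambda>\<xi>. g \<xi> * w \<xi>)"
proof -
  have [measurable]: "w \<in> borel_measurable borel" using assms(1) by auto
  show ?thesis
    by (rule Bochner_Integration.integrable_bound[OF assms(1)])
      (auto simp: abs_mult intro!: mult_left_le_one_le assms(3))
qed

lemma CT_integrable: "integrable lborel w \<Longrightarrow> integrable lborel (\<lambda>\<xi>. cos (x \<bullet> \<xi>) * w \<xi>)"
  and ST_integrable: "integrable lborel w \<Longrightarrow> integrable lborel (\<lambda>\<xi>. sin (x \<bullet> \<xi>) * w \<xi>)"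
  by (auto intro!: kernel_integrable)

lemma CT_add: "integrable lborel v \<Longrightarrow> integrable lborel w \<Longrightarrow> CT (\<lambda>x. v x + w x) x = CT v x + CT w x"
  and ST_add: "integrable lborel v \<Longrightarrow> integrable lborel w \<Longrightarrow> ST (\<lambda>x. v x + w x) x = ST v x + ST w x"
  and CT_diff: "integrable lborel v \<Longrightarrow> integrable lborel w \<Longrightarrow> CT (\<lambda>x. v x - w x) x = CT v x - CT w x"
  and ST_diff: "integrable lborel v \<Longrightarrow> integrable lborel w \<Longrightarrow> ST (\<lambda>x. v x - w x) x = ST v x - ST w x"
  by (simp_all add: CT_def ST_def distrib_left right_diff_distrib CT_integrable ST_integrable)

lemma CT_cmult: "CT (\<lambda>x. c * w x) x = c * CT w x"
  and ST_cmult: "ST (\<lambda>x. c * w x) x = c * ST w x"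
  by (simp_all add: CT_def ST_def mult.left_commute[of _ c])

lemma CT_bound: "integrable lborel w \<Longrightarrow> \<bar>CT w x\<bar> \<le> (\<integral>\<xi>. \<bar>w \<xi>\<bar> \<partial>lborel)"
  and ST_bound: "integrable lborel w \<Longrightarrow> \<bar>ST w x\<bar> \<le> (\<integral>\<xi>. \<bar>w \<xi>\<bar> \<partial>lborel)"
  unfolding CT_def ST_def
  by (intro order_trans[OF integral_abs_bound] integral_mono integrable_abs CT_integrable ST_integrable;
      simp add: abs_mult mult_left_le_one_le)+

lemma CT_measurable[measurable]: "w \<in> borel_measurable borel \<Longrightarrow> CT w \<in> borel_measurable borel"
  and ST_measurable[measurable]: "w \<in> borel_measurable borel \<Longrightarrow> ST w \<in> borel_measurable borel"
  unfolding CT_def[abs_def] ST_def[abs_def]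
  by (rule lborel.borel_measurable_lebesgue_integral; simp add: split_beta')+

lemma
  fixes a b :: real
  shows cos_taylor: "\<bar>cos (a + b) - cos a + b * sin a\<bar> \<le> b\<^sup>2"
    and sin_taylor: "\<bar>sin (a + b) - sin a - b * cos a\<bar> \<le> b\<^sup>2"
proof -
  have s: "\<bar>sin b - b\<bar> \<le> b\<^sup>2 / 2"
    using Maclaurin_sin_bound[of b 2] by (simp add: numeral_2_eq_2 sin_coeff_def)
  have "\<bar>sin (b/2)\<bar>\<^sup>2 \<le> \<bar>b/2\<bar>\<^sup>2" by (intro power_mono abs_sin_x_le_abs_x) auto
  then have c: "\<bar>cos b - 1\<bar> \<le> b\<^sup>2 / 2"
    using cos_double_sin[of "b/2"] by (simp add: power2_eq_square abs_if split: if_splits)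
  have *: "\<bar>x * u\<bar> \<le> b\<^sup>2 / 2" if "\<bar>x\<bar> \<le> 1" "\<bar>u\<bar> \<le> b\<^sup>2 / 2" for x u :: real
    using mult_mono[OF that] by (simp add: abs_mult)
  have "cos (a + b) - cos a + b * sin a = cos a * (cos b - 1) - sin a * (sin b - b)"
    by (simp add: cos_add algebra_simps)
  then show "\<bar>cos (a + b) - cos a + b * sin a\<bar> \<le> b\<^sup>2"
    using *[OF abs_cos_le_one c, of a] *[OF abs_sin_le_one s, of a] by linarith
  have "sin (a + b) - sin a - b * cos a = sin a * (cos b - 1) + cos a * (sin b - b)"
    by (simp add: sin_add algebra_simps)
  then show "\<bar>sin (a + b) - sin a - b * cos a\<bar> \<le> b\<^sup>2"
    using *[OF abs_sin_le_one c, of a] *[OF abs_cos_le_one s, of a] by linarith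
qed

lemma bounded_linear_transform:
  fixes w :: "'a::euclidean_space \<Rightarrow> real"
  assumes "moments w"
  shows "bounded_linear (\<lambda>h. CT (\<lambda>\<xi>. (\<xi> \<bullet> h) * w \<xi>) x)" "bounded_linear (\<lambda>h. ST (\<lambda>\<xi>. (\<xi> \<bullet> h) * w \<xi>) x)"
  unfolding linear_conv_bounded_linear[symmetric]
  by (rule linearI; simp add: inner_add_right distrib_right CT_add ST_add moments_integrable moments_inner assms CT_cmult ST_cmult mult.assoc)+

lemma has_derivative_quadratic:
  fixes f :: "'a::real_normed_vector \<Rightarrow> real"
  assumes "bounded_linear f'" and "\<And>h. \<bar>f (x + h) - f x - f' h\<bar> \<le> K * (norm h)\<^sup>2"
  shows "(f has_derivative f') (at x)"
proof (rule has_derivativeI_sandwich[where e = 1 and H = "\<lambda>y. K * norm (y - x)"])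
  show "((\<lambda>y. K * norm (y - x)) \<longlongrightarrow> 0) (at x)"
    by (auto intro!: tendsto_eq_intros)
  show "norm (f y - f x - f' (y - x)) / norm (y - x) \<le> K * norm (y - x)" if "y \<noteq> x" for y
    using assms(2)[of "y - x"] that by (simp add: field_simps power2_eq_square)
qed (use assms in auto)

text \<open>The second order Taylor bounds for the kernel, integrated against
  \<open>|\<xi>|^2 |w|\<close>, yield a quadratic remainder directly.\<close>

lemma CT_has_derivative: "moments w \<Longrightarrow> (CT w has_derivative (\<lambda>h. - ST (\<lambda>\<xi>. (\<xi> \<bullet> h) * w \<xi>) x)) (at x)"
  and ST_has_derivative: "moments w \<Longrightarrow> (ST w has_derivative (\<lambda>h. CT (\<lambda>\<xi>. (\<xi> \<bullet> h) * w \<xi>) x)) (at x)"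
proof -
  assume w: "moments w"
  note i = moments_integrable[OF w] moments_integrable[OF moments_inner[OF w]]
  define K where "K = (\<integral>\<xi>. (norm \<xi>)\<^sup>2 * \<bar>w \<xi>\<bar> \<partial>lborel)"
  have iK: "integrable lborel (\<lambda>\<xi>. (norm \<xi>)\<^sup>2 * \<bar>w \<xi>\<bar>)"
    using integrable_abs[OF moments_integrable_power[OF w, of 2]] by (simp add: abs_mult)
  have bd: "\<bar>\<integral>\<xi>. g \<xi> * w \<xi> \<partial>lborel\<bar> \<le> K * (norm h)\<^sup>2"
    if int: "integrable lborel (\<lambda>\<xi>. g \<xi> * w \<xi>)" and g: "\<And>\<xi>. \<bar>g \<xi>\<bar> \<le> (h \<bullet> \<xi>)\<^sup>2" for g :: "'a \<Rightarrow> real" and h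
  proof -
    have "\<bar>\<integral>\<xi>. g \<xi> * w \<xi> \<partial>lborel\<bar> \<le> (\<integral>\<xi>. \<bar>g \<xi> * w \<xi>\<bar> \<partial>lborel)"
      by (rule integral_abs_bound)
    also have "\<dots> \<le> (\<integral>\<xi>. (norm h)\<^sup>2 * ((norm \<xi>)\<^sup>2 * \<bar>w \<xi>\<bar>) \<partial>lborel)"
    proof (intro integral_mono integrable_abs int integrable_mult_right iK)
      fix \<xi>
      have "(h \<bullet> \<xi>)\<^sup>2 \<le> (norm h * norm \<xi>)\<^sup>2"
        using Cauchy_Schwarz_ineq[of h \<xi>] by (simp add: power_mult_distrib power2_norm_eq_inner)
      then have "\<bar>g \<xi>\<bar> * \<bar>w \<xi>\<bar> \<le> (norm h * norm \<xi>)\<^sup>2 * \<bar>w \<xi>\<bar>"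
        using g[of \<xi>] by (intro mult_right_mono) auto
      then show "\<bar>g \<xi> * w \<xi>\<bar> \<le> (norm h)\<^sup>2 * ((norm \<xi>)\<^sup>2 * \<bar>w \<xi>\<bar>)"
        by (simp add: abs_mult power_mult_distrib mult.assoc)
    qed
    finally show ?thesis by (simp add: K_def mult.commute)
  qed
  show "(CT w has_derivative (\<lambda>h. - ST (\<lambda>\<xi>. (\<xi> \<bullet> h) * w \<xi>) x)) (at x)"
  proof (rule has_derivative_quadratic)
    show "bounded_linear (\<lambda>h. - ST (\<lambda>\<xi>. (\<xi> \<bullet> h) * w \<xi>) x)"
      by (intro bounded_linear_minus bounded_linear_transform w)
    fix h
    have 1: "integrable lborel (\<lambda>\<xi>. cos ((x + h) \<bullet> \<xi>) * w \<xi> - cos (x \<bullet> \<xi>) * w \<xi> - - (sin (x \<bullet> \<xi>) * ((\<xi> \<bullet> h) * w \<xi>)))"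
      by (intro Bochner_Integration.integrable_diff integrable_minus CT_integrable ST_integrable i)
    have 2: "CT w (x + h) - CT w x - - ST (\<lambda>\<xi>. (\<xi> \<bullet> h) * w \<xi>) x =
      (\<integral>\<xi>. cos ((x + h) \<bullet> \<xi>) * w \<xi> - cos (x \<bullet> \<xi>) * w \<xi> - - (sin (x \<bullet> \<xi>) * ((\<xi> \<bullet> h) * w \<xi>)) \<partial>lborel)"
      unfolding CT_def ST_def
      by (simp only: Bochner_Integration.integral_diff Bochner_Integration.integral_minus Bochner_Integration.integrable_diff integrable_minus CT_integrable ST_integrable i)
    have 3: "cos ((x + h) \<bullet> \<xi>) * w \<xi> - cos (x \<bullet> \<xi>) * w \<xi> - - (sin (x \<bullet> \<xi>) * ((\<xi> \<bullet> h) * w \<xi>))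
      = (cos (x \<bullet> \<xi> + h \<bullet> \<xi>) - cos (x \<bullet> \<xi>) + h \<bullet> \<xi> * sin (x \<bullet> \<xi>)) * w \<xi>" for \<xi>
      by (simp add: inner_add_left inner_commute[of \<xi> h] algebra_simps)
    show "\<bar>CT w (x + h) - CT w x - - ST (\<lambda>\<xi>. (\<xi> \<bullet> h) * w \<xi>) x\<bar> \<le> K * (norm h)\<^sup>2"
      unfolding 2 unfolding 3 by (rule bd[OF 1[unfolded 3] cos_taylor])
  qed
  show "(ST w has_derivative (\<lambda>h. CT (\<lambda>\<xi>. (\<xi> \<bullet> h) * w \<xi>) x)) (at x)"
  proof (rule has_derivative_quadratic)
    show "bounded_linear (\<lambda>h. CT (\<lambda>\<xi>. (\<xi> \<bullet> h) * w \<xi>) x)"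
      by (intro bounded_linear_transform w)
    fix h
    have 1: "integrable lborel (\<lambda>\<xi>. sin ((x + h) \<bullet> \<xi>) * w \<xi> - sin (x \<bullet> \<xi>) * w \<xi> - cos (x \<bullet> \<xi>) * ((\<xi> \<bullet> h) * w \<xi>))"
      by (intro Bochner_Integration.integrable_diff CT_integrable ST_integrable i)
    have 2: "ST w (x + h) - ST w x - CT (\<lambda>\<xi>. (\<xi> \<bullet> h) * w \<xi>) x =
      (\<integral>\<xi>. sin ((x + h) \<bullet> \<xi>) * w \<xi> - sin (x \<bullet> \<xi>) * w \<xi> - cos (x \<bullet> \<xi>) * ((\<xi> \<bullet> h) * w \<xi>) \<partial>lborel)"
      unfolding CT_def ST_def
      by (simp only: Bochner_Integration.integral_diff Bochner_Integration.integrable_diff CT_integrable ST_integrable i)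
    have 3: "sin ((x + h) \<bullet> \<xi>) * w \<xi> - sin (x \<bullet> \<xi>) * w \<xi> - cos (x \<bullet> \<xi>) * ((\<xi> \<bullet> h) * w \<xi>)
      = (sin (x \<bullet> \<xi> + h \<bullet> \<xi>) - sin (x \<bullet> \<xi>) - h \<bullet> \<xi> * cos (x \<bullet> \<xi>)) * w \<xi>" for \<xi>
      by (simp add: inner_add_left inner_commute[of \<xi> h] algebra_simps)
    show "\<bar>ST w (x + h) - ST w x - CT (\<lambda>\<xi>. (\<xi> \<bullet> h) * w \<xi>) x\<bar> \<le> K * (norm h)\<^sup>2"
      unfolding 2 unfolding 3 by (rule bd[OF 1[unfolded 3] sin_taylor])
  qed
qed

lemma CT_continuous: "moments w \<Longrightarrow> continuous_on A (CT w)"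
  and ST_continuous: "moments w \<Longrightarrow> continuous_on A (ST w)"
  using has_derivative_continuous[OF CT_has_derivative] has_derivative_continuous[OF ST_has_derivative]
  by (auto intro!: continuous_at_imp_continuous_on)

lemma transform_swap:
  fixes f g :: "'a::euclidean_space \<Rightarrow> real"
  assumes f: "integrable lborel f" and g: "integrable lborel g"
    and k: "continuous_on UNIV k" "\<And>t. \<bar>k t\<bar> \<le> (1::real)"
  shows "(\<integral>x. (\<integral>\<xi>. k (x \<bullet> \<xi>) * f \<xi> \<partial>lborel) * g x \<partial>lborel) = (\<integral>\<xi>. f \<xi> * (\<integral>x. k (\<xi> \<bullet> x) * g x \<partial>lborel) \<partial>lborel)"
proof -
  have [measurable]: "f \<in> borel_measurable borel" "g \<in> borel_measurable borel" "k \<in> borel_measurable borel"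
    using f g k by (auto intro: borel_measurable_continuous_onI)
  have "integrable (lborel \<Otimes>\<^sub>M lborel) (\<lambda>(x, \<xi>). g x * (k (x \<bullet> \<xi>) * f \<xi>))"
  proof (rule Fubini_integrable_lborel)
    show "(\<lambda>(x, y). g x * (k (x \<bullet> y) * f y)) \<in> borel_measurable borel"
      by (simp flip: borel_prod)
    have kf: "integrable lborel (\<lambda>\<xi>. k (x \<bullet> \<xi>) * f \<xi>)" for x
      by (rule kernel_integrable[OF f]) (use k in auto)
    show "integrable lborel (\<lambda>y. g x * (k (x \<bullet> y) * f y))" for x
      by (rule integrable_mult_right) (rule kf)
    show "integrable lborel (\<lambda>x. \<integral>y. \<bar>g x * (k (x \<bullet> y) * f y)\<bar> \<partial>lborel)"
    proof (rule Bochner_Integration.integrable_bound)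
      show "integrable lborel (\<lambda>x. \<bar>g x\<bar> * (\<integral>y. \<bar>f y\<bar> \<partial>lborel))"
        by (intro integrable_mult_left integrable_abs g)
      show "(\<lambda>x. \<integral>y. \<bar>g x * (k (x \<bullet> y) * f y)\<bar> \<partial>lborel) \<in> borel_measurable lborel"
        by (rule lborel.borel_measurable_lebesgue_integral) (simp add: split_beta')
      show "AE x in lborel. norm (\<integral>y. \<bar>g x * (k (x \<bullet> y) * f y)\<bar> \<partial>lborel) \<le> norm (\<bar>g x\<bar> * (\<integral>y. \<bar>f y\<bar> \<partial>lborel))"
      proof (rule AE_I2)
        fix x
        have "(\<integral>y. \<bar>k (x \<bullet> y) * f y\<bar> \<partial>lborel) \<le> (\<integral>y. \<bar>f y\<bar> \<partial>lborel)"
          by (intro integral_mono integrable_abs kf f) (simp add: abs_mult mult_left_le_one_le k)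
        then show "norm (\<integral>y. \<bar>g x * (k (x \<bullet> y) * f y)\<bar> \<partial>lborel) \<le> norm (\<bar>g x\<bar> * (\<integral>y. \<bar>f y\<bar> \<partial>lborel))"
          by (simp add: abs_mult[of "g x"] mult_left_mono)
      qed
    qed
  qed
  then have "(\<integral>\<xi>. (\<integral>x. g x * (k (x \<bullet> \<xi>) * f \<xi>) \<partial>lborel) \<partial>lborel) = (\<integral>x. (\<integral>\<xi>. g x * (k (x \<bullet> \<xi>) * f \<xi>) \<partial>lborel) \<partial>lborel)"
    by (rule lborel_pair.Fubini_integral)
  moreover have "(\<integral>x. g x * (k (x \<bullet> \<xi>) * f \<xi>) \<partial>lborel) = f \<xi> * (\<integral>x. k (\<xi> \<bullet> x) * g x \<partial>lborel)" for \<xi>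
    by (simp add: mult_ac inner_commute flip: integral_mult_right_zero)
  ultimately show ?thesis by (simp add: mult.commute)
qed

lemma CT_swap: "integrable lborel f \<Longrightarrow> integrable lborel g \<Longrightarrow> (\<integral>x. CT f x * g x \<partial>lborel) = (\<integral>x. f x * CT g x \<partial>lborel)"
  and ST_swap: "integrable lborel f \<Longrightarrow> integrable lborel g \<Longrightarrow> (\<integral>x. ST f x * g x \<partial>lborel) = (\<integral>x. f x * ST g x \<partial>lborel)"
  unfolding CT_def ST_def by (rule transform_swap; auto intro: continuous_intros)+

subsection \<open>Plancherel's identity\<close>

lemma has_derivative_line:
  fixes f :: "'a::real_normed_vector \<Rightarrow> real"
  assumes "(f has_derivative f') (at (x + s *\<^sub>R h))"
  shows "((\<lambda>s. f (x + s *\<^sub>R h)) has_real_derivative f' h) (at s)"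
proof -
  have "((\<lambda>s. x + s *\<^sub>R h) has_derivative (\<lambda>t. t *\<^sub>R h)) (at s)"
    by (auto intro!: derivative_eq_intros)
  from has_derivative_compose[OF this assms]
  have "((\<lambda>s. f (x + s *\<^sub>R h)) has_derivative (\<lambda>t. f' (t *\<^sub>R h))) (at s)" .
  moreover have "(\<lambda>t. f' (t *\<^sub>R h)) = (*) (f' h)"
    using linear_scale[OF has_derivative_linear[OF assms]] by (simp add: fun_eq_iff mult.commute)
  ultimately show ?thesis by (simp add: has_field_derivative_def)
qed

lemma gauss_has_derivative: "(gauss c has_derivative (\<lambda>h. - 2 * c * (x \<bullet> h) * gauss c x)) (at x)"
  unfolding gauss_def[abs_def] by (auto intro!: derivative_eq_intros simp: inner_commute algebra_simps)

text \<open>Along the ray \<open>s z\<close> the transform \<open>F\<close> solves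
  \<open>F' = - s |z|^2 / (2 c) * F\<close>: the derivative brings down
  \<open>\<xi> \<bullet> z\<close>, and this factor times the Gaussian is itself a derivative of the
  Gaussian, so that an integration by parts returns to \<open>F\<close>.\<close>

lemma CT_gauss:
  fixes z :: "'a::euclidean_space"
  assumes c: "c > 0"
  shows "CT (gauss c) z = sqrt (pi / c) ^ DIM('a) * exp (- (z \<bullet> z) / (4 * c))"
proof -
  note m = moments_gauss[OF c]
  have int: "integrable lborel (gauss c :: 'a \<Rightarrow> real)" "integrable lborel (\<lambda>\<xi>. (\<xi> \<bullet> z) * gauss c \<xi>)"
    by (rule moments_integrable m moments_inner)+
  define F where "F s = CT (gauss c) (s *\<^sub>R z)" for s
  have dF: "(F has_real_derivative - ST (\<lambda>\<xi>. (\<xi> \<bullet> z) * gauss c \<xi>) (s *\<^sub>R z)) (at s)" for s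
    unfolding F_def using has_derivative_line[of "CT (gauss c)" _ 0 s z, OF CT_has_derivative[OF m]] by simp
  have ibp: "2 * c * ST (\<lambda>\<xi>. (\<xi> \<bullet> z) * gauss c \<xi>) (s *\<^sub>R z) = s * (z \<bullet> z) * F s" for s
  proof -
    define y where "y = s *\<^sub>R z"
    have i: "integrable lborel (\<lambda>\<xi>. sin (y \<bullet> \<xi>) * gauss c \<xi>)" "integrable lborel (\<lambda>\<xi>. cos (y \<bullet> \<xi>) * gauss c \<xi>)"
        "integrable lborel (\<lambda>\<xi>. sin (y \<bullet> \<xi>) * ((\<xi> \<bullet> z) * gauss c \<xi>))"
      by (intro ST_integrable CT_integrable int)+
    have "(\<integral>\<xi>. (y \<bullet> z) * (cos (y \<bullet> \<xi>) * gauss c \<xi>) - 2 * c * (sin (y \<bullet> \<xi>) * ((\<xi> \<bullet> z) * gauss c \<xi>)) \<partial>lborel) = 0"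
    proof (rule integral_directional_derivative[OF i(1)])
      show "integrable lborel (\<lambda>\<xi>. (y \<bullet> z) * (cos (y \<bullet> \<xi>) * gauss c \<xi>) - 2 * c * (sin (y \<bullet> \<xi>) * ((\<xi> \<bullet> z) * gauss c \<xi>)))"
        by (intro Bochner_Integration.integrable_diff integrable_mult_right i)
      show "continuous_on UNIV (\<lambda>\<xi>. (y \<bullet> z) * (cos (y \<bullet> \<xi>) * gauss c \<xi>) - 2 * c * (sin (y \<bullet> \<xi>) * ((\<xi> \<bullet> z) * gauss c \<xi>)))"
        unfolding gauss_def by (intro continuous_intros)
      fix \<xi>
      have "((\<lambda>\<xi>. sin (y \<bullet> \<xi>) * gauss c \<xi>) has_derivative
          (\<lambda>h. sin (y \<bullet> \<xi>) * (- 2 * c * (\<xi> \<bullet> h) * gauss c \<xi>) + (y \<bullet> h) * cos (y \<bullet> \<xi>) * gauss c \<xi>)) (at \<xi>)"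
        by (auto intro!: derivative_eq_intros gauss_has_derivative)
      from has_derivative_line[of _ _ \<xi> 0 z, simplified, OF this]
      show "((\<lambda>s. sin (y \<bullet> (\<xi> + s *\<^sub>R z)) * gauss c (\<xi> + s *\<^sub>R z)) has_real_derivative
         (y \<bullet> z) * (cos (y \<bullet> \<xi>) * gauss c \<xi>) - 2 * c * (sin (y \<bullet> \<xi>) * ((\<xi> \<bullet> z) * gauss c \<xi>))) (at 0)"
        by (simp add: algebra_simps)
    qed
    then have "(y \<bullet> z) * CT (gauss c) y - 2 * c * ST (\<lambda>\<xi>. (\<xi> \<bullet> z) * gauss c \<xi>) y = 0"
      by (simp add: CT_def ST_def i Bochner_Integration.integral_diff)
    then show ?thesis by (simp add: y_def F_def)
  qed
  have "((\<lambda>s. F s * exp (s\<^sup>2 * (z \<bullet> z) / (4 * c))) has_real_derivative 0) (at s)" for s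
  proof -
    have "- ST (\<lambda>\<xi>. (\<xi> \<bullet> z) * gauss c \<xi>) (s *\<^sub>R z) = - (s * (z \<bullet> z) / (2 * c)) * F s"
      using ibp[of s] c by (simp add: field_simps)
    then show ?thesis using dF[of s] c
      by (auto intro!: derivative_eq_intros simp: field_simps)
  qed
  then have "F 1 * exp (1\<^sup>2 * (z \<bullet> z) / (4 * c)) = F 0 * exp (0\<^sup>2 * (z \<bullet> z) / (4 * c))"
    by (intro DERIV_isconst_all[where f = "\<lambda>s. F s * exp (s\<^sup>2 * (z \<bullet> z) / (4 * c))"]) blast
  moreover have "F 0 = sqrt (pi / c) ^ DIM('a)"
    using integral_gauss[OF c, where 'a='a] by (simp add: F_def CT_def)
  ultimately have "CT (gauss c) z * exp ((z \<bullet> z) / (4 * c)) = sqrt (pi / c) ^ DIM('a)"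
    by (simp add: F_def)
  then show ?thesis by (simp add: exp_minus field_simps)
qed

text \<open>The power spectrum is formally the Fourier transform of this function, and its value at
  0 is the squared L2 norm. Plancherel's identity is thus Fourier inversion at the single point
  0.\<close>

definition autocorr :: "('a::euclidean_space \<Rightarrow> real) \<Rightarrow> 'a \<Rightarrow> real" where
  "autocorr w y = (\<integral>\<xi>. w \<xi> * w (\<xi> + y) \<partial>lborel)"

lemma autocorr_integrable:
  fixes w :: "'a::euclidean_space \<Rightarrow> real"
  assumes [measurable]: "w \<in> borel_measurable borel" and w2: "integrable lborel (\<lambda>x. (w x)\<^sup>2)"
  shows "integrable lborel (\<lambda>\<xi>. w \<xi> * w (\<xi> + y))" "\<bar>autocorr w y\<bar> \<le> (\<integral>x. (w x)\<^sup>2 \<partial>lborel)"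
proof -
  have w2': "integrable lborel (\<lambda>x. (w (x + y))\<^sup>2)"
    using integrable_lborel_translate[OF w2] .
  have le: "\<bar>w \<xi> * w (\<xi> + y)\<bar> \<le> ((w \<xi>)\<^sup>2 + (w (\<xi> + y))\<^sup>2) / 2" for \<xi>
    using sum_squares_bound[of "\<bar>w \<xi>\<bar>" "\<bar>w (\<xi> + y)\<bar>"] by (simp add: abs_mult)
  have int: "integrable lborel (\<lambda>\<xi>. ((w \<xi>)\<^sup>2 + (w (\<xi> + y))\<^sup>2) / 2)" using w2 w2' by simp
  show i: "integrable lborel (\<lambda>\<xi>. w \<xi> * w (\<xi> + y))"
    by (rule Bochner_Integration.integrable_bound[OF int]) (use le in \<open>auto intro: order_trans\<close>)
  have "\<bar>autocorr w y\<bar> \<le> (\<integral>\<xi>. \<bar>w \<xi> * w (\<xi> + y)\<bar> \<partial>lborel)"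
    unfolding autocorr_def by (rule integral_abs_bound)
  also have "\<dots> \<le> (\<integral>\<xi>. ((w \<xi>)\<^sup>2 + (w (\<xi> + y))\<^sup>2) / 2 \<partial>lborel)"
    by (intro integral_mono integrable_abs i int le)
  also have "\<dots> = (\<integral>x. (w x)\<^sup>2 \<partial>lborel)"
    using w2 w2' integral_lborel_translate[of "\<lambda>x. (w x)\<^sup>2" y] by simp
  finally show "\<bar>autocorr w y\<bar> \<le> (\<integral>x. (w x)\<^sup>2 \<partial>lborel)" .
qed

lemma autocorr_measurable[measurable]:
  "w \<in> borel_measurable borel \<Longrightarrow> autocorr w \<in> borel_measurable borel"
  unfolding autocorr_def[abs_def] by (rule lborel.borel_measurable_lebesgue_integral) (simp add: split_beta')

definition power_spectrum :: "('a::euclidean_space \<Rightarrow> real) \<Rightarrow> 'a \<Rightarrow> real" where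
  "power_spectrum w x = (CT w x)\<^sup>2 + (ST w x)\<^sup>2"

lemma integrable_mult_bounded:
  fixes g :: "'a::euclidean_space \<Rightarrow> real"
  assumes "integrable lborel g" "h \<in> borel_measurable borel" "\<And>x. \<bar>h x\<bar> \<le> C"
  shows "integrable lborel (\<lambda>x. h x * g x)"
proof (rule Bochner_Integration.integrable_bound[OF integrable_mult_right[OF assms(1), of C]])
  have [measurable]: "g \<in> borel_measurable borel" using assms(1) by auto
  show "(\<lambda>x. h x * g x) \<in> borel_measurable lborel" using assms(2) by auto
  show "AE x in lborel. norm (h x * g x) \<le> norm (C * g x)"
  proof (rule AE_I2)
    fix x
    have "\<bar>h x\<bar> * \<bar>g x\<bar> \<le> \<bar>C\<bar> * \<bar>g x\<bar>"
      using assms(3)[of x] by (intro mult_right_mono) auto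
    then show "norm (h x * g x) \<le> norm (C * g x)" by (simp add: abs_mult)
  qed
qed

text \<open>The Gaussian weight makes all double integrals absolutely convergent. The transform of
  the weight then appears as an averaging kernel for the autocorrelation.\<close>

lemma integral_power_spectrum_gauss:
  fixes w :: "'a::euclidean_space \<Rightarrow> real"
  assumes w: "integrable lborel w" and w2: "integrable lborel (\<lambda>x. (w x)\<^sup>2)" and c: "c > 0"
  shows "integrable lborel (\<lambda>x. power_spectrum w x * gauss c x)"
    and "(\<integral>x. power_spectrum w x * gauss c x \<partial>lborel) = (\<integral>y. CT (gauss c) y * autocorr w y \<partial>lborel)"
proof -
  have [measurable]: "w \<in> borel_measurable borel" using w by auto
  note g = gauss_integrable[OF c, where 'a='a]
  define B where "B = (\<integral>\<xi>. \<bar>w \<xi>\<bar> \<partial>lborel)"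
  note bd = CT_bound[OF w, folded B_def] ST_bound[OF w, folded B_def]
  have gC: "integrable lborel (\<lambda>x. CT w x * gauss c x)" and gS: "integrable lborel (\<lambda>x. ST w x * gauss c x)"
    by (auto intro!: integrable_mult_bounded[OF g] bd)
  have gCC: "integrable lborel (\<lambda>x. CT w x * (CT w x * gauss c x))" and gSS: "integrable lborel (\<lambda>x. ST w x * (ST w x * gauss c x))"
    by (auto intro!: integrable_mult_bounded[OF gC] integrable_mult_bounded[OF gS] bd)
  have eq: "power_spectrum w x * gauss c x = CT w x * (CT w x * gauss c x) + ST w x * (ST w x * gauss c x)" for x
    by (simp add: power_spectrum_def power2_eq_square algebra_simps)
  show "integrable lborel (\<lambda>x. power_spectrum w x * gauss c x)"
    unfolding eq using gCC gSS by simp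
  let ?K = "CT (gauss c) :: 'a \<Rightarrow> real"
  have Km[measurable]: "?K \<in> borel_measurable borel" by measurable
  have Kb: "\<bar>?K y\<bar> \<le> (\<integral>\<xi>. \<bar>gauss c (\<xi>::'a)\<bar> \<partial>lborel)" for y by (rule CT_bound[OF g])
  have inner: "CT (\<lambda>x. CT w x * gauss c x) \<xi> + ST (\<lambda>x. ST w x * gauss c x) \<xi> = (\<integral>y. w (\<xi> + y) * ?K y \<partial>lborel)" for \<xi>
  proof -
    have ic: "integrable lborel (\<lambda>x. cos (\<xi> \<bullet> x) * gauss c x)" and i_s: "integrable lborel (\<lambda>x. sin (\<xi> \<bullet> x) * gauss c x)"
      by (intro CT_integrable ST_integrable g)+
    have "CT (\<lambda>x. CT w x * gauss c x) \<xi> = (\<integral>\<eta>. w \<eta> * CT (\<lambda>x. cos (\<xi> \<bullet> x) * gauss c x) \<eta> \<partial>lborel)"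
      unfolding CT_swap[OF w ic, symmetric] by (simp add: CT_def[of "\<lambda>x. CT w x * gauss c x"] mult_ac)
    moreover have "ST (\<lambda>x. ST w x * gauss c x) \<xi> = (\<integral>\<eta>. w \<eta> * ST (\<lambda>x. sin (\<xi> \<bullet> x) * gauss c x) \<eta> \<partial>lborel)"
      unfolding ST_swap[OF w i_s, symmetric] by (simp add: ST_def[of "\<lambda>x. ST w x * gauss c x"] mult_ac)
    moreover have "integrable lborel (\<lambda>\<eta>. w \<eta> * CT (\<lambda>x. cos (\<xi> \<bullet> x) * gauss c x) \<eta>)"
        "integrable lborel (\<lambda>\<eta>. w \<eta> * ST (\<lambda>x. sin (\<xi> \<bullet> x) * gauss c x) \<eta>)"
      using integrable_mult_bounded[OF w _ CT_bound[OF ic]] integrable_mult_bounded[OF w _ ST_bound[OF i_s]]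
      by (simp_all add: mult.commute)
    \<comment> \<open>By the addition theorem for the cosine the kernel depends on the difference of
      the two frequencies alone; this is what turns the double integral into an
      autocorrelation.\<close>
    moreover have "CT (\<lambda>x. cos (\<xi> \<bullet> x) * gauss c x) \<eta> + ST (\<lambda>x. sin (\<xi> \<bullet> x) * gauss c x) \<eta> = ?K (\<eta> - \<xi>)" for \<eta>
    proof -
      have "CT (\<lambda>x. cos (\<xi> \<bullet> x) * gauss c x) \<eta> + ST (\<lambda>x. sin (\<xi> \<bullet> x) * gauss c x) \<eta>
        = (\<integral>x. cos (\<eta> \<bullet> x) * (cos (\<xi> \<bullet> x) * gauss c x) + sin (\<eta> \<bullet> x) * (sin (\<xi> \<bullet> x) * gauss c x) \<partial>lborel)"
        unfolding CT_def ST_def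
        by (rule Bochner_Integration.integral_add[symmetric]) (intro CT_integrable ST_integrable ic i_s)+
      also have "\<dots> = ?K (\<eta> - \<xi>)"
        unfolding CT_def by (simp add: inner_diff_left cos_diff algebra_simps)
      finally show ?thesis .
    qed
    ultimately have "CT (\<lambda>x. CT w x * gauss c x) \<xi> + ST (\<lambda>x. ST w x * gauss c x) \<xi> = (\<integral>\<eta>. w \<eta> * ?K (\<eta> - \<xi>) \<partial>lborel)"
      by (simp flip: Bochner_Integration.integral_add distrib_left)
    also have "\<dots> = (\<integral>y. w (y + \<xi>) * ?K (y + \<xi> - \<xi>) \<partial>lborel)"
      by (rule integral_lborel_translate[symmetric]) measurable
    finally show ?thesis by (simp add: add.commute)
  qed
  have "(\<integral>x. power_spectrum w x * gauss c x \<partial>lborel) =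
      (\<integral>x. CT w x * (CT w x * gauss c x) \<partial>lborel) + (\<integral>x. ST w x * (ST w x * gauss c x) \<partial>lborel)"
    unfolding eq using gCC gSS by simp
  also have "\<dots> = (\<integral>\<xi>. w \<xi> * CT (\<lambda>x. CT w x * gauss c x) \<xi> \<partial>lborel) + (\<integral>\<xi>. w \<xi> * ST (\<lambda>x. ST w x * gauss c x) \<xi> \<partial>lborel)"
    by (simp add: CT_swap[OF w gC] ST_swap[OF w gS])
  also have "\<dots> = (\<integral>\<xi>. w \<xi> * CT (\<lambda>x. CT w x * gauss c x) \<xi> + w \<xi> * ST (\<lambda>x. ST w x * gauss c x) \<xi> \<partial>lborel)"
  proof (rule Bochner_Integration.integral_add[symmetric])
    have m: "(\<lambda>x. CT w x * gauss c x) \<in> borel_measurable borel" "(\<lambda>x. ST w x * gauss c x) \<in> borel_measurable borel"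
      by measurable
    show "integrable lborel (\<lambda>\<xi>. w \<xi> * CT (\<lambda>x. CT w x * gauss c x) \<xi>)"
      using integrable_mult_bounded[OF w CT_measurable[OF m(1)] CT_bound[OF gC]] by (simp add: mult.commute)
    show "integrable lborel (\<lambda>\<xi>. w \<xi> * ST (\<lambda>x. ST w x * gauss c x) \<xi>)"
      using integrable_mult_bounded[OF w ST_measurable[OF m(2)] ST_bound[OF gS]] by (simp add: mult.commute)
  qed
  also have "\<dots> = (\<integral>\<xi>. (\<integral>y. w \<xi> * (w (\<xi> + y) * ?K y) \<partial>lborel) \<partial>lborel)"
    by (simp flip: distrib_left add: inner)
  also have "\<dots> = (\<integral>y. (\<integral>\<xi>. w \<xi> * (w (\<xi> + y) * ?K y) \<partial>lborel) \<partial>lborel)"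
  proof (rule lborel_pair.Fubini_integral[symmetric], rule Fubini_integrable_lborel)
    show "(\<lambda>(\<xi>, y). w \<xi> * (w (\<xi> + y) * ?K y)) \<in> borel_measurable borel"
      by (simp flip: borel_prod)
    define L where "L = (\<integral>\<xi>. \<bar>gauss c (\<xi>::'a)\<bar> \<partial>lborel)"
    have L0: "L \<ge> 0" by (simp add: L_def)
    have wt: "integrable lborel (\<lambda>y. w (\<xi> + y))" for \<xi>
      using integrable_lborel_translate[OF w, of \<xi>] by (simp add: add.commute)
    have iK: "integrable lborel (\<lambda>y. w (\<xi> + y) * ?K y)" for \<xi>
      using integrable_mult_bounded[OF wt Km Kb] by (simp add: mult.commute)
    show "integrable lborel (\<lambda>y. w \<xi> * (w (\<xi> + y) * ?K y))" for \<xi>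
      by (rule integrable_mult_right) (rule iK)
    show "integrable lborel (\<lambda>\<xi>. \<integral>y. \<bar>w \<xi> * (w (\<xi> + y) * ?K y)\<bar> \<partial>lborel)"
    proof (rule Bochner_Integration.integrable_bound)
      show "integrable lborel (\<lambda>\<xi>. \<bar>w \<xi>\<bar> * (B * L))"
        by (intro integrable_mult_left integrable_abs w)
      show "(\<lambda>\<xi>. \<integral>y. \<bar>w \<xi> * (w (\<xi> + y) * ?K y)\<bar> \<partial>lborel) \<in> borel_measurable lborel"
        by (rule lborel.borel_measurable_lebesgue_integral) (simp add: split_beta')
      show "AE \<xi> in lborel. norm (\<integral>y. \<bar>w \<xi> * (w (\<xi> + y) * ?K y)\<bar> \<partial>lborel) \<le> norm (\<bar>w \<xi>\<bar> * (B * L))"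
      proof (rule AE_I2)
        fix \<xi>
        have "(\<integral>y. \<bar>w (\<xi> + y) * ?K y\<bar> \<partial>lborel) \<le> (\<integral>y. \<bar>w (\<xi> + y)\<bar> * L \<partial>lborel)"
          using Kb by (intro integral_mono integrable_abs integrable_mult_left iK wt)
            (auto simp: abs_mult L_def intro: mult_left_mono)
        also have "\<dots> = B * L"
          using integral_lborel_translate[of "\<lambda>y. \<bar>w y\<bar>" \<xi>] by (simp add: B_def add.commute)
        finally have "\<bar>w \<xi>\<bar> * (\<integral>y. \<bar>w (\<xi> + y) * ?K y\<bar> \<partial>lborel) \<le> \<bar>w \<xi>\<bar> * (B * L)"
          by (intro mult_left_mono) auto
        then show "norm (\<integral>y. \<bar>w \<xi> * (w (\<xi> + y) * ?K y)\<bar> \<partial>lborel) \<le> norm (\<bar>w \<xi>\<bar> * (B * L))"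
          by (simp add: abs_mult[of "w \<xi>"])
      qed
    qed
  qed
  also have "\<dots> = (\<integral>y. ?K y * autocorr w y \<partial>lborel)"
    by (simp add: autocorr_def mult_ac flip: integral_mult_right_zero)
  finally show "(\<integral>x. power_spectrum w x * gauss c x \<partial>lborel) = (\<integral>y. ?K y * autocorr w y \<partial>lborel)" .
qed

text \<open>The total mass does not depend on \<open>c\<close>: up to the factor
  \<open>(2 * pi) ^ DIM('a)\<close> these kernels form an approximate identity as \<open>c\<close>
  tends to 0.\<close>

lemma integrable_CT_gauss:
  assumes "c > 0"
  shows "integrable lborel (CT (gauss c) :: 'a::euclidean_space \<Rightarrow> real)"
    and "(\<integral>y. CT (gauss c) (y::'a) \<partial>lborel) = (2 * pi) ^ DIM('a)"
proof -
  have eq: "CT (gauss c) = (\<lambda>z::'a. sqrt (pi / c) ^ DIM('a) * gauss (1 / (4 * c)) z)"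
    by (simp add: CT_gauss[OF assms] gauss_def fun_eq_iff)
  have c4: "1 / (4 * c) > 0" using assms by simp
  show "integrable lborel (CT (gauss c) :: 'a \<Rightarrow> real)"
    unfolding eq by (intro integrable_mult_right gauss_integrable c4)
  have "(\<integral>y. CT (gauss c) (y::'a) \<partial>lborel) = (sqrt (pi / c) * sqrt (pi / (1 / (4 * c)))) ^ DIM('a)"
    unfolding eq using integral_gauss[OF c4, where 'a='a] by (simp add: power_mult_distrib)
  moreover have "sqrt (pi / c) * sqrt (pi / (1 / (4 * c))) = sqrt ((2 * pi)\<^sup>2)"
    using assms by (simp flip: real_sqrt_mult add: power2_eq_square)
  moreover have "sqrt ((2 * pi)\<^sup>2) = 2 * pi" by (rule real_sqrt_unique) auto
  ultimately show "(\<integral>y. CT (gauss c) (y::'a) \<partial>lborel) = (2 * pi) ^ DIM('a)" by (simp only:)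
qed

lemma CT_gauss_nonneg: "c > 0 \<Longrightarrow> 0 \<le> CT (gauss c) y"
  by (simp add: CT_gauss)

text \<open>The Gaussian weights increase to 1, so monotone convergence applies and integrability of
  the power spectrum is part of the conclusion.\<close>

lemma power_spectrum_limit:
  fixes w :: "'a::euclidean_space \<Rightarrow> real"
  assumes [measurable]: "w \<in> borel_measurable borel"
    and i: "\<And>n. integrable lborel (\<lambda>x. power_spectrum w x * gauss ((1 / real (Suc n))\<^sup>2) x)"
    and lim: "(\<lambda>n. \<integral>x. power_spectrum w x * gauss ((1 / real (Suc n))\<^sup>2) x \<partial>lborel) \<longlonglongrightarrow> l"
  shows "integrable lborel (power_spectrum w)" "(\<integral>x. power_spectrum w x \<partial>lborel) = l"
proof -
  have 1: "AE x in lborel. mono (\<lambda>n. power_spectrum w x * gauss ((1 / real (Suc n))\<^sup>2) x)"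
  proof (intro AE_I2 monoI)
    fix x :: 'a and m n :: nat assume "m \<le> n"
    then have "(1 / real (Suc n))\<^sup>2 * (x \<bullet> x) \<le> (1 / real (Suc m))\<^sup>2 * (x \<bullet> x)"
      by (intro mult_right_mono power_mono) (auto simp: frac_le)
    then show "power_spectrum w x * gauss ((1 / real (Suc m))\<^sup>2) x \<le> power_spectrum w x * gauss ((1 / real (Suc n))\<^sup>2) x"
      by (intro mult_left_mono) (auto simp: power_spectrum_def gauss_def)
  qed
  have 2: "AE x in lborel. (\<lambda>n. power_spectrum w x * gauss ((1 / real (Suc n))\<^sup>2) x) \<longlonglongrightarrow> power_spectrum w x"
  proof (rule AE_I2)
    fix x :: 'a
    have "(\<lambda>n. power_spectrum w x * exp (- (1 / real (Suc n))\<^sup>2 * (x \<bullet> x))) \<longlonglongrightarrow> power_spectrum w x * exp (- 0\<^sup>2 * (x \<bullet> x))"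
      by (intro tendsto_intros LIMSEQ_Suc[OF lim_1_over_n])
    then show "(\<lambda>n. power_spectrum w x * gauss ((1 / real (Suc n))\<^sup>2) x) \<longlonglongrightarrow> power_spectrum w x"
      by (simp add: gauss_def)
  qed
  have 3: "power_spectrum w \<in> borel_measurable lborel"
    unfolding power_spectrum_def[abs_def] by measurable
  show "integrable lborel (power_spectrum w)" "(\<integral>x. power_spectrum w x \<partial>lborel) = l"
    using integrable_monotone_convergence[OF i 1 2 lim 3] integral_monotone_convergence[OF i 1 2 lim 3] by auto
qed

text \<open>The autocorrelation is estimated by its maximum, the squared L2 norm. This gives up
  equality but asks for no continuity of \<open>w\<close>, and so it covers the Jacobian of the
  extremal field, which is singular at the origin.\<close>

lemma Plancherel_le:
  fixes w :: "'a::euclidean_space \<Rightarrow> real"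
  assumes w: "integrable lborel w" and w2: "integrable lborel (\<lambda>x. (w x)\<^sup>2)"
  shows "integrable lborel (power_spectrum w)"
    and "(\<integral>x. power_spectrum w x \<partial>lborel) \<le> (2 * pi) ^ DIM('a) * (\<integral>x. (w x)\<^sup>2 \<partial>lborel)"
proof -
  have [measurable]: "w \<in> borel_measurable borel" using w by auto
  define I where "I n = (\<integral>x. power_spectrum w x * gauss ((1 / real (Suc n))\<^sup>2) x \<partial>lborel)" for n
  have pos: "(1 / real (Suc n))\<^sup>2 > 0" for n by simp
  note i = integral_power_spectrum_gauss[OF w w2 pos]
  have le: "I n \<le> (2 * pi) ^ DIM('a) * (\<integral>x. (w x)\<^sup>2 \<partial>lborel)" for n
  proof -
    note K = integrable_CT_gauss[OF pos[of n], where 'a='a]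
    have "I n = (\<integral>y. CT (gauss ((1 / real (Suc n))\<^sup>2)) y * autocorr w y \<partial>lborel)"
      unfolding I_def by (rule i)
    also have "\<dots> \<le> (\<integral>y. CT (gauss ((1 / real (Suc n))\<^sup>2)) (y::'a) * (\<integral>x. (w x)\<^sup>2 \<partial>lborel) \<partial>lborel)"
    proof (rule integral_mono)
      show "integrable lborel (\<lambda>y. CT (gauss ((1 / real (Suc n))\<^sup>2)) y * autocorr w y)"
        using integrable_mult_bounded[OF K(1) _ autocorr_integrable(2)[OF _ w2]] by (simp add: mult.commute)
      show "CT (gauss ((1 / real (Suc n))\<^sup>2)) y * autocorr w y \<le> CT (gauss ((1 / real (Suc n))\<^sup>2)) y * (\<integral>x. (w x)\<^sup>2 \<partial>lborel)" for y
        using autocorr_integrable(2)[OF _ w2, of y] by (intro mult_left_mono CT_gauss_nonneg pos) auto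
    qed (intro integrable_mult_left K)
    also have "\<dots> = (2 * pi) ^ DIM('a) * (\<integral>x. (w x)\<^sup>2 \<partial>lborel)" using K by simp
    finally show ?thesis .
  qed
  have "incseq I"
    unfolding I_def
  proof (intro monoI integral_mono i)
    fix x :: 'a and m n :: nat assume "m \<le> n"
    then have "(1 / real (Suc n))\<^sup>2 * (x \<bullet> x) \<le> (1 / real (Suc m))\<^sup>2 * (x \<bullet> x)"
      by (intro mult_right_mono power_mono) (auto simp: frac_le)
    then show "power_spectrum w x * gauss ((1 / real (Suc m))\<^sup>2) x \<le> power_spectrum w x * gauss ((1 / real (Suc n))\<^sup>2) x"
      by (intro mult_left_mono) (auto simp: power_spectrum_def gauss_def)
  qed
  then obtain l where l: "I \<longlonglongrightarrow> l"
    using incseq_convergent[of I] le by blast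
  then have "l \<le> (2 * pi) ^ DIM('a) * (\<integral>x. (w x)\<^sup>2 \<partial>lborel)"
    using le by (intro LIMSEQ_le_const2) auto
  with power_spectrum_limit[OF _ i(1) l[unfolded I_def]]
  show "integrable lborel (power_spectrum w)" "(\<integral>x. power_spectrum w x \<partial>lborel) \<le> (2 * pi) ^ DIM('a) * (\<integral>x. (w x)\<^sup>2 \<partial>lborel)"
    by auto
qed

text \<open>Continuity and boundedness of \<open>w\<close> make the autocorrelation converge along
  every ray to its value at 0, so the approximate identity picks out exactly the squared L2
  norm.\<close>

theorem Plancherel:
  fixes w :: "'a::euclidean_space \<Rightarrow> real"
  assumes w: "integrable lborel w" and cont: "continuous_on UNIV w" and bd: "\<And>x. \<bar>w x\<bar> \<le> B"
  shows "integrable lborel (power_spectrum w)"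
    and "(\<integral>x. power_spectrum w x \<partial>lborel) = (2 * pi) ^ DIM('a) * (\<integral>x. (w x)\<^sup>2 \<partial>lborel)"
proof -
  have [measurable]: "w \<in> borel_measurable borel" using w by auto
  have w2: "integrable lborel (\<lambda>x. (w x)\<^sup>2)"
    using integrable_mult_bounded[OF w _ bd] by (simp add: power2_eq_square)
  define e where "e n = 1 / real (Suc n)" for n
  have e: "e n > 0" "(e n)\<^sup>2 > 0" for n by (auto simp: e_def)
  note i = integral_power_spectrum_gauss[OF w w2 e(2)]
  have A0: "(\<lambda>n. autocorr w (e n *\<^sub>R z)) \<longlonglongrightarrow> (\<integral>x. (w x)\<^sup>2 \<partial>lborel)" for z
    unfolding autocorr_def
  proof (rule integral_dominated_convergence[where w = "\<lambda>x. B * \<bar>w x\<bar>"])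
    show "AE x in lborel. (\<lambda>n. w x * w (x + e n *\<^sub>R z)) \<longlonglongrightarrow> (w x)\<^sup>2"
    proof (rule AE_I2)
      fix x
      have "(\<lambda>n. x + e n *\<^sub>R z) \<longlonglongrightarrow> x + 0 *\<^sub>R z"
        unfolding e_def by (intro tendsto_intros LIMSEQ_Suc[OF lim_1_over_n])
      moreover have "isCont w x" using cont by (simp add: continuous_on_eq_continuous_at)
      ultimately have "(\<lambda>n. w (x + e n *\<^sub>R z)) \<longlonglongrightarrow> w x"
        using isCont_tendsto_compose by fastforce
      then show "(\<lambda>n. w x * w (x + e n *\<^sub>R z)) \<longlonglongrightarrow> (w x)\<^sup>2"
        unfolding power2_eq_square by (intro tendsto_intros)
    qed
    show "AE x in lborel. norm (w x * w (x + e n *\<^sub>R z)) \<le> B * \<bar>w x\<bar>" for n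
      using mult_left_mono[OF bd abs_ge_zero] by (intro AE_I2) (simp add: abs_mult mult.commute[of B])
  qed (use w in auto)
  \<comment> \<open>The substitution \<open>y = e n * z\<close> freezes the kernel and moves the
    small parameter into the argument of the autocorrelation, where dominated convergence can
    act.\<close>
  have sc: "(\<integral>x. power_spectrum w x * gauss ((e n)\<^sup>2) x \<partial>lborel)
      = (\<integral>z. CT (gauss 1) z * autocorr w (e n *\<^sub>R z) \<partial>lborel)" for n
  proof -
    have "(\<integral>x. power_spectrum w x * gauss ((e n)\<^sup>2) x \<partial>lborel) = (\<integral>y. CT (gauss ((e n)\<^sup>2)) y * autocorr w y \<partial>lborel)"
      by (rule i)
    also have "\<dots> = \<bar>e n\<bar> ^ DIM('a) * (\<integral>z. CT (gauss ((e n)\<^sup>2)) (0 + e n *\<^sub>R z) * autocorr w (0 + e n *\<^sub>R z) \<partial>lborel)"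
      by (rule integral_lborel_affine) (use e(1)[of n] in auto)
    also have "\<dots> = (\<integral>z. (e n ^ DIM('a) * CT (gauss ((e n)\<^sup>2)) (e n *\<^sub>R z)) * autocorr w (e n *\<^sub>R z) \<partial>lborel)"
      using e(1)[of n] by (simp add: mult.assoc)
    also have "(\<lambda>z::'a. e n ^ DIM('a) * CT (gauss ((e n)\<^sup>2)) (e n *\<^sub>R z)) = CT (gauss 1)"
    proof
      fix z :: 'a
      have "e n * sqrt (pi / (e n)\<^sup>2) = sqrt pi" using e(1)[of n] by (simp add: real_sqrt_divide)
      then have "e n ^ DIM('a) * sqrt (pi / (e n)\<^sup>2) ^ DIM('a) = sqrt pi ^ DIM('a)"
        by (metis power_mult_distrib)
      moreover have "- (e n *\<^sub>R z \<bullet> e n *\<^sub>R z) / (4 * (e n)\<^sup>2) = - (z \<bullet> z) / 4"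
        using e(1)[of n] by (simp add: power2_eq_square)
      ultimately show "e n ^ DIM('a) * CT (gauss ((e n)\<^sup>2)) (e n *\<^sub>R z) = CT (gauss 1) z"
        unfolding CT_gauss[OF e(2)] CT_gauss[OF zero_less_one]
        by (metis div_by_1 mult.assoc mult.right_neutral)
    qed
    finally show ?thesis .
  qed
  note K = integrable_CT_gauss[of 1, where 'a='a]
  have "(\<lambda>n. \<integral>z. CT (gauss 1) z * autocorr w (e n *\<^sub>R z) \<partial>lborel) \<longlonglongrightarrow> (\<integral>z. CT (gauss 1) (z::'a) * (\<integral>x. (w x)\<^sup>2 \<partial>lborel) \<partial>lborel)"
  proof (rule integral_dominated_convergence[where w = "\<lambda>z. CT (gauss 1) (z::'a) * (\<integral>x. (w x)\<^sup>2 \<partial>lborel)"])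
    show "integrable lborel (\<lambda>z. CT (gauss 1) (z::'a) * (\<integral>x. (w x)\<^sup>2 \<partial>lborel))"
      using K by (intro integrable_mult_left) auto
    show "AE z in lborel. (\<lambda>n. CT (gauss 1) z * autocorr w (e n *\<^sub>R z)) \<longlonglongrightarrow> CT (gauss 1) z * (\<integral>x. (w x)\<^sup>2 \<partial>lborel)"
      by (intro AE_I2 tendsto_intros A0)
    show "AE z in lborel. norm (CT (gauss 1) z * autocorr w (e n *\<^sub>R z)) \<le> CT (gauss 1) z * (\<integral>x. (w x)\<^sup>2 \<partial>lborel)" for n
      using autocorr_integrable(2)[OF _ w2] by (auto simp: abs_mult CT_gauss intro!: AE_I2 mult_left_mono)
  qed auto
  then have "(\<lambda>n. \<integral>x. power_spectrum w x * gauss ((e n)\<^sup>2) x \<partial>lborel) \<longlonglongrightarrow> (2 * pi) ^ DIM('a) * (\<integral>x. (w x)\<^sup>2 \<partial>lborel)"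
    using K(2) by (simp only: sc integral_mult_left_zero zero_less_one)
  with power_spectrum_limit[of w] i(1)
  show "integrable lborel (power_spectrum w)" "(\<integral>x. power_spectrum w x \<partial>lborel) = (2 * pi) ^ DIM('a) * (\<integral>x. (w x)\<^sup>2 \<partial>lborel)"
    unfolding e_def by auto
qed

subsection \<open>Matrix algebra\<close>

declare transpose_matrix_vector [simp del]

definition outer :: "real^'n \<Rightarrow> real^'m \<Rightarrow> real^'m^'n" where
  "outer p q = (\<chi> j k. p $ j * q $ k)"

lemma inner_outer: "A \<bullet> outer p q = p \<bullet> (A *v q)"
  by (simp add: outer_def inner_vec_def matrix_vector_mult_def sum_distrib_left mult_ac)

lemma outer_mult_vec: "outer p q *v y = (q \<bullet> y) *\<^sub>R p"
  by (simp add: outer_def vec_eq_iff matrix_vector_mult_def inner_vec_def sum_distrib_left sum_distrib_right mult_ac)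

lemma transpose_outer: "transpose (outer p q) = outer q p"
  by (simp add: outer_def transpose_def vec_eq_iff mult.commute)

lemma transpose_add: "transpose (A + B :: real^'n^'m) = transpose A + transpose B"
  and transpose_diff: "transpose (A - B :: real^'n^'m) = transpose A - transpose B"
  and transpose_scaleR: "transpose (c *\<^sub>R (A :: real^'n^'m)) = c *\<^sub>R transpose A"
  by (simp_all add: transpose_def vec_eq_iff)

lemma inner_transpose: "transpose A \<bullet> transpose B = (A::real^'n^'m) \<bullet> B"
  unfolding inner_vec_def transpose_def by (simp, rule sum.swap)

lemma inner_transpose_swap: "transpose A \<bullet> B = (A::real^'n^'m) \<bullet> transpose B"
  using inner_transpose[of A "transpose B"] by simp

lemma inner_mat_1: "A \<bullet> mat 1 = trace (A :: real^'n^'n)"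
  by (simp add: inner_vec_def mat_def trace_def if_distrib if_distribR cong: if_cong)

lemma inner_transpose_mult_vec: "(transpose A *v y) \<bullet> z = y \<bullet> ((A::real^'n^'m) *v z)"
  by (metis dot_lmul_matrix transpose_matrix_vector)

lemma trace_outer: "trace (outer p q) = p \<bullet> q"
  by (simp add: trace_def outer_def inner_vec_def)

text \<open>Cauchy--Schwarz for the Frobenius inner product of \<open>A\<close> with the rank one
  matrix \<open>outer (A *v x) x\<close>.\<close>

lemma norm_mult_vec_le: "norm (A *v x) \<le> norm (A :: real^'n^'m) * norm x"
proof -
  have "norm (outer p q) = norm p * norm q" for p :: "real^'m" and q :: "real^'n"
    by (simp add: norm_eq_sqrt_inner inner_outer outer_mult_vec real_sqrt_mult)
  moreover have "(A *v x) \<bullet> (A *v x) \<le> norm A * norm (outer (A *v x) x)"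
    unfolding inner_outer[symmetric] by (rule norm_cauchy_schwarz)
  ultimately have "norm (A *v x) * norm (A *v x) \<le> norm (A *v x) * (norm A * norm x)"
    by (simp add: mult_ac flip: power2_norm_eq_inner power2_eq_square)
  then show ?thesis
    by (cases "A *v x = 0") auto
qed

lemma norm_outer: "norm (outer p q) = norm p * norm q"
  by (simp add: norm_eq_sqrt_inner inner_outer outer_mult_vec real_sqrt_mult)

lemma abs_trace_le: "\<bar>trace A\<bar> \<le> CARD('n) * norm (A :: real^'n^'n)"
proof -
  have "\<bar>trace A\<bar> \<le> (\<Sum>i\<in>UNIV. \<bar>A $ i $ i\<bar>)"
    unfolding trace_def by (rule sum_abs)
  also have "\<dots> \<le> (\<Sum>i\<in>(UNIV::'n set). norm A)"
    by (intro sum_mono order_trans[OF component_le_norm_cart Finite_Cartesian_Product.norm_nth_le])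
  finally show ?thesis by simp
qed

lemma norm_transpose: "norm (transpose A) = norm (A :: real^'n^'m)"
  by (simp add: norm_eq_sqrt_inner inner_transpose)

lemma abs_inner_transpose_le: "\<bar>A \<bullet> transpose A\<bar> \<le> (norm (A :: real^'n^'n))\<^sup>2"
  using Cauchy_Schwarz_ineq2[of A "transpose A"] by (simp add: norm_transpose power2_eq_square)

text \<open>A matrix acting on a hyperplane: Cauchy--Schwarz for its symmetric part against the projection.\<close>

lemma trace_square_le:
  fixes M :: "real^'n^'n"
  assumes N: "CARD('n) \<ge> 3" and s: "s \<bullet> s = 1" and Ms: "M *v s = 0"
  shows "(trace M)\<^sup>2 - M \<bullet> transpose M \<le> (real CARD('n) - 2) * (M \<bullet> M)"
proof -
  define N where "N = real CARD('n)"
  define Pi where "Pi = (mat 1 :: real^'n^'n) - outer s s"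
  have N3: "N \<ge> 3" using N by (simp add: N_def)
  have "M \<bullet> outer s s = 0"
    by (simp add: inner_outer Ms)
  moreover from this have "transpose M \<bullet> outer s s = 0"
    by (simp only: inner_transpose_swap transpose_outer)
  moreover have "transpose M \<bullet> mat 1 = trace M"
    by (simp add: inner_mat_1) (simp add: trace_def transpose_def)
  ultimately have SP: "(M + transpose M) \<bullet> Pi = 2 * trace M"
    by (simp add: Pi_def inner_diff_right inner_add_left inner_mat_1 trace_add)
  have mm: "(mat 1 :: real^'n^'n) \<bullet> mat 1 = N"
    by (simp add: inner_mat_1 trace_I N_def)
  have PP: "Pi \<bullet> Pi = N - 1"
  proof -
    have "mat 1 \<bullet> outer s s = 1" "outer s s \<bullet> mat 1 = 1" "outer s s \<bullet> outer s s = 1"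
      by (simp_all add: inner_mat_1 trace_outer inner_outer outer_mult_vec s)
    then show ?thesis unfolding Pi_def inner_diff_left inner_diff_right mm by simp
  qed
  have SS: "(M + transpose M) \<bullet> (M + transpose M) = 2 * (M \<bullet> M) + 2 * (M \<bullet> transpose M)"
    by (simp add: inner_add_left inner_add_right inner_transpose inner_transpose_swap)
  have "(2 * trace M)\<^sup>2 \<le> (2 * (M \<bullet> M) + 2 * (M \<bullet> transpose M)) * (N - 1)"
    using Cauchy_Schwarz_ineq[of "M + transpose M" Pi] unfolding SP SS PP .
  then have 1: "2 * (trace M)\<^sup>2 \<le> (M \<bullet> M + M \<bullet> transpose M) * (N - 1)"
    by (simp add: power_mult_distrib algebra_simps)
  \<comment> \<open>After halving, Cauchy--Schwarz leaves the coefficient \<open>(N - 3) / 2\<close>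
    in front of \<open>M \<bullet> transpose M\<close>. It is nonnegative, so that product may be
    replaced by \<open>M \<bullet> M\<close>, which raises \<open>(N - 1) / 2\<close> to
    \<open>N - 2\<close>.\<close>
  have "M \<bullet> transpose M \<le> M \<bullet> M"
    using norm_cauchy_schwarz[of M "transpose M"]
    by (simp add: norm_transpose flip: power2_norm_eq_inner power2_eq_square)
  then have "(N - 3) * (M \<bullet> transpose M) \<le> (N - 3) * (M \<bullet> M)"
    using N3 by (intro mult_left_mono) auto
  with 1 show ?thesis unfolding N_def[symmetric] by (simp add: algebra_simps)
qed

text \<open>Here \<open>t\<close> is the value at \<open>x\<close> of a field tangent to the spheres around 0 and \<open>T\<close> its Jacobian;
  differentiating \<open>x \<bullet> t = 0\<close> gives \<open>transpose T *v x = - t\<close>.\<close>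

lemma tangential_jacobian_bound:
  fixes T :: "real^'n^'n" and t x :: "real^'n"
  assumes N: "CARD('n) \<ge> 3" and x: "x \<noteq> 0" and xt: "x \<bullet> t = 0" and Tx: "transpose T *v x = - t"
  shows "T \<bullet> T \<ge> ((T *v x) \<bullet> (T *v x)) / (x \<bullet> x) + (t \<bullet> t) / (x \<bullet> x)
    + ((trace T)\<^sup>2 - T \<bullet> transpose T - 2 * (t \<bullet> (T *v x)) / (x \<bullet> x)) / (real CARD('n) - 2)"
proof -
  define R where "R = x \<bullet> x"
  define p where "p = T *v x"
  have R: "R > 0" using x by (simp add: R_def)
  have xp: "x \<bullet> p = 0"
    using inner_transpose_mult_vec[of T x x] xt by (simp add: p_def Tx inner_commute)
  have xT: "x \<bullet> (T *v y) = - (t \<bullet> y)" for y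
    using inner_transpose_mult_vec[of T x y] by (simp add: Tx)
  \<comment> \<open>Two pieces are removed from \<open>T\<close>: the radial derivative, and the
    normal component of the derivatives, which
    \<open>x \<bullet> (T *v y) = - (t \<bullet> y)\<close> identifies with the second fundamental
    form of the sphere. What remains is the intrinsic derivative along the sphere. The three pieces
    are mutually orthogonal.\<close>
  define M where "M = T - (1 / R) *\<^sub>R outer p x + (1 / R) *\<^sub>R outer x t"
  define s where "s = (1 / sqrt R) *\<^sub>R x"
  have ss: "s \<bullet> s = 1" using R by (simp add: s_def R_def flip: real_sqrt_mult)
  have "M *v x = 0"
    using R xt by (simp add: M_def matrix_vector_mult_add_rdistrib matrix_vector_mult_diff_rdistrib
        scaleR_matrix_vector_assoc[symmetric] outer_mult_vec inner_commute[of t x] p_def[symmetric])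
      (simp add: R_def)
  then have Ms: "M *v s = 0"
    by (simp add: s_def matrix_vector_mult_scaleR)
  note sp = xt xp inner_commute[of t x] inner_commute[of p x] inner_commute[of p t] R_def[symmetric] p_def[symmetric]
  have trM: "trace M = trace T"
    by (simp add: M_def inner_mat_1[symmetric] inner_add_left inner_diff_left)
      (simp add: inner_mat_1 trace_outer sp)
  have MM: "M \<bullet> M = T \<bullet> T - (p \<bullet> p) / R - (t \<bullet> t) / R"
  proof -
    define u where "u = 1 / R"
    have uR: "u * R = 1" using R by (simp add: u_def)
    have f: "T \<bullet> outer p x = p \<bullet> p" "T \<bullet> outer x t = - (t \<bullet> t)"
      "outer p x \<bullet> T = p \<bullet> p" "outer x t \<bullet> T = - (t \<bullet> t)"
      "outer p x \<bullet> outer p x = R * (p \<bullet> p)" "outer p x \<bullet> outer x t = 0"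
      "outer x t \<bullet> outer p x = 0" "outer x t \<bullet> outer x t = R * (t \<bullet> t)"
      by (simp_all only: inner_commute[of "outer _ _" T])
        (simp_all add: inner_outer outer_mult_vec xT sp)
    have "M \<bullet> M = T \<bullet> T - u * (2 * (p \<bullet> p)) - u * (2 * (t \<bullet> t)) + u * u * (R * (p \<bullet> p) + R * (t \<bullet> t))"
      unfolding M_def u_def[symmetric]
        inner_add_left inner_add_right inner_diff_left inner_diff_right inner_scaleR_left inner_scaleR_right f
      by (simp add: algebra_simps)
    also have "\<dots> = T \<bullet> T - u * (p \<bullet> p) - u * (t \<bullet> t)"
      using uR by algebra
    finally show ?thesis by (simp add: u_def)
  qed
  \<comment> \<open>Here, unlike in the norm, the removed pieces interact, because each is paired
    with the transpose of the other; this is the source of the term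
    \<open>t \<bullet> p\<close>.\<close>
  have MMt: "M \<bullet> transpose M = T \<bullet> transpose T + 2 * (t \<bullet> p) / R"
  proof -
    define u where "u = 1 / R"
    have uR: "u * R = 1" using R by (simp add: u_def)
    have Tt: "p \<bullet> (transpose T *v x) = - (t \<bullet> p)" "x \<bullet> (transpose T *v t) = t \<bullet> p"
      using inner_transpose_mult_vec[of T t x]
      by (simp_all add: Tx inner_commute[of p t] inner_commute[of x "transpose T *v t"] inner_commute[of "T *v x" t] p_def)
    have f: "T \<bullet> outer x p = - (t \<bullet> p)" "T \<bullet> outer t x = t \<bullet> p"
      "outer p x \<bullet> transpose T = - (t \<bullet> p)" "outer x t \<bullet> transpose T = t \<bullet> p"
      "outer p x \<bullet> outer x p = 0" "outer p x \<bullet> outer t x = R * (t \<bullet> p)"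
      "outer x t \<bullet> outer x p = R * (t \<bullet> p)" "outer x t \<bullet> outer t x = 0"
      by (simp_all only: inner_commute[of "outer _ _" "transpose T"])
        (simp_all add: inner_outer outer_mult_vec xT Tt sp)
    have "M \<bullet> transpose M = T \<bullet> transpose T + u * (4 * (t \<bullet> p)) - u * u * (2 * (R * (t \<bullet> p)))"
      unfolding M_def u_def[symmetric] transpose_add transpose_diff transpose_scaleR transpose_outer
        inner_add_left inner_add_right inner_diff_left inner_diff_right inner_scaleR_left inner_scaleR_right f
      by (simp add: algebra_simps)
    also have "\<dots> = T \<bullet> transpose T + 2 * u * (t \<bullet> p)"
      using uR by algebra
    finally show ?thesis by (simp add: u_def)
  qed
  have "T \<bullet> T - (p \<bullet> p) / R - (t \<bullet> t) / R \<ge> ((trace T)\<^sup>2 - (T \<bullet> transpose T + 2 * (t \<bullet> p) / R)) / (real CARD('n) - 2)"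
    using trace_square_le[OF N ss Ms] N unfolding trM MM MMt by (simp add: divide_le_eq mult.commute)
  then show ?thesis unfolding R_def p_def by (simp add: algebra_simps)
qed

text \<open>The right-hand side consists of three divergences. The second fundamental form supplies
  one multiple of \<open>|t|^2/|x|^2\<close>; the term
  \<open>- 2 (t \<bullet> (T *v x)) / |x|^2\<close>, divided by \<open>N - 2\<close>, equals another
  one up to the divergence of \<open>|t|^2 x / |x|^2\<close>. The equation for
  \<open>\<alpha>\<close> says that the resulting coefficient 2 is exactly used up by completing the
  radial square.\<close>

lemma tangential_pointwise:
  fixes T :: "real^'n^'n" and t x :: "real^'n"
  assumes N: "CARD('n) \<ge> 3" and x: "x \<noteq> 0" and xt: "x \<bullet> t = 0" and Tx: "transpose T *v x = - t"
    and \<alpha>: "\<alpha>\<^sup>2 + \<alpha> * (real CARD('n) - 2) = 2"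
  shows "T \<bullet> T + l\<^sup>2 * (x \<bullet> x) * (t \<bullet> t) - l * (real CARD('n) + 2 * \<alpha>) * (t \<bullet> t)
    \<ge> - l * (real CARD('n) * (t \<bullet> t) + 2 * (t \<bullet> (T *v x)))
      + (\<alpha> - 1 / (real CARD('n) - 2)) * (((real CARD('n) - 2) * (t \<bullet> t) + 2 * (t \<bullet> (T *v x))) / (x \<bullet> x))
      + ((trace T)\<^sup>2 - T \<bullet> transpose T) / (real CARD('n) - 2)"
proof -
  define R N P q D c where "R = x \<bullet> x" and "N = real CARD('n)" and "P = t \<bullet> t" and "q = t \<bullet> (T *v x)"
    and "D = (trace T)\<^sup>2 - T \<bullet> transpose T" and "c = l * R - \<alpha>"
  have R: "R > 0" using x by (simp add: R_def)
  have N2: "N - 2 > 0" using N by (simp add: N_def)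
  \<comment> \<open>This square vanishes when \<open>T *v x = (\<alpha> - l * R) t\<close>, as it
    does for the radial profile \<open>r^\<alpha> exp (- l r^2/2)\<close>.\<close>
  have "0 \<le> ((T *v x + c *\<^sub>R t) \<bullet> (T *v x + c *\<^sub>R t)) / R" using R by simp
  also have "\<dots> = ((T *v x) \<bullet> (T *v x)) / R + (2 * c * q + c\<^sup>2 * P) / R"
    by (simp add: inner_add_left inner_add_right q_def P_def inner_commute[of "T *v x" t] power2_eq_square add_divide_distrib distrib_left)
  finally have 1: "((T *v x) \<bullet> (T *v x)) / R \<ge> - ((2 * c * q + c\<^sup>2 * P) / R)" by linarith
  have 2: "T \<bullet> T \<ge> ((T *v x) \<bullet> (T *v x)) / R + P / R + (D - 2 * q / R) / (N - 2)"
    using tangential_jacobian_bound[OF N x xt Tx] by (simp add: R_def N_def P_def q_def D_def)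
  have 3: "- ((2 * c * q + c\<^sup>2 * P) / R) + P / R + (D - 2 * q / R) / (N - 2) + l\<^sup>2 * R * P - l * (N + 2 * \<alpha>) * P
    = - l * (N * P + 2 * q) + (\<alpha> - 1 / (N - 2)) * (((N - 2) * P + 2 * q) / R) + D / (N - 2)
      + (2 - \<alpha>\<^sup>2 - \<alpha> * (N - 2)) * P / R"
  proof -
    define n A B E where "n = 1 / (N - 2)" and "A = P / R" and "B = q / R" and "E = D / (N - 2)"
    have n: "n * (N - 2) = 1" using N2 by (simp add: n_def)
    have 1: "(2 * c * q + c\<^sup>2 * P) / R = 2 * l * q - 2 * \<alpha> * B + l\<^sup>2 * R * P - 2 * l * \<alpha> * P + \<alpha>\<^sup>2 * A"
      using R by (simp add: c_def A_def B_def field_simps power2_eq_square)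
    have 2: "((N - 2) * P + 2 * q) / R = (N - 2) * A + 2 * B" "(D - 2 * q / R) / (N - 2) = E - 2 * n * B"
      by (simp_all add: A_def B_def E_def n_def add_divide_distrib diff_divide_distrib)
    have 4: "(2 - \<alpha>\<^sup>2 - \<alpha> * (N - 2)) * P / R = (2 - \<alpha>\<^sup>2 - \<alpha> * (N - 2)) * A" by (simp add: A_def)
    show ?thesis unfolding 1 2 4 A_def[symmetric] E_def[symmetric] n_def[symmetric]
      using n by algebra
  qed
  have "2 - \<alpha>\<^sup>2 - \<alpha> * (N - 2) = 0" using \<alpha> by (simp add: N_def)
  with 1 2 3 show ?thesis unfolding R_def[symmetric] N_def[symmetric] P_def[symmetric] q_def[symmetric] D_def[symmetric]
    by simp
qed

subsection \<open>Three divergence identities\<close>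

lemma pd_inner:
  assumes "\<And>j. pd k (\<lambda>x. w x $ j) (\<lambda>x. W x $ j $ k)"
  shows "pd k (\<lambda>x. w x \<bullet> w x) (\<lambda>x. 2 * (\<Sum>j\<in>UNIV. w x $ j * W x $ j $ k))"
proof -
  have "pd k (\<lambda>x. \<Sum>j\<in>UNIV. w x $ j * w x $ j) (\<lambda>x. \<Sum>j\<in>UNIV. W x $ j $ k * w x $ j + w x $ j * W x $ j $ k)"
    by (intro pd_sum pd_mult assms)
  then show ?thesis
    by (simp add: inner_nth_sum sum.distrib sum_distrib_left mult_ac flip: mult_2)
qed

lemma sum_inner_mult_vec: "(\<Sum>k\<in>UNIV. y $ k * (\<Sum>j\<in>UNIV. w $ j * W $ j $ k)) = w \<bullet> (W *v y)"
  by (simp add: inner_vec_def matrix_vector_mult_def sum_distrib_left mult_ac) (rule sum.swap)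

lemma integrable_product_AM_GM:
  fixes f g :: "'a::euclidean_space \<Rightarrow> real"
  assumes f: "integrable lborel (\<lambda>x. (f x)\<^sup>2)" and g: "integrable lborel (\<lambda>x. (g x)\<^sup>2)"
    and h: "h \<in> borel_measurable borel" and le: "AE x in lborel. \<bar>h x\<bar> \<le> C * (f x * g x)"
  shows "integrable lborel h"
proof (rule Bochner_Integration.integrable_bound)
  show "integrable lborel (\<lambda>x. \<bar>C\<bar> * ((f x)\<^sup>2 + (g x)\<^sup>2))"
    using f g by (intro integrable_mult_right Bochner_Integration.integrable_add)
  show "AE x in lborel. norm (h x) \<le> norm (\<bar>C\<bar> * ((f x)\<^sup>2 + (g x)\<^sup>2))"
    using le
  proof eventually_elim
    fix x assume "\<bar>h x\<bar> \<le> C * (f x * g x)"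
    also have "\<dots> \<le> \<bar>C\<bar> * (\<bar>f x\<bar> * \<bar>g x\<bar>)"
      by (metis abs_ge_self abs_mult)
    also have "\<dots> \<le> \<bar>C\<bar> * ((f x)\<^sup>2 + (g x)\<^sup>2)"
    proof (rule mult_left_mono)
      have "0 \<le> \<bar>f x\<bar> * \<bar>g x\<bar>" by simp
      moreover have "2 * \<bar>f x\<bar> * \<bar>g x\<bar> \<le> (f x)\<^sup>2 + (g x)\<^sup>2"
        using sum_squares_bound[of "\<bar>f x\<bar>" "\<bar>g x\<bar>"] by simp
      ultimately show "\<bar>f x\<bar> * \<bar>g x\<bar> \<le> (f x)\<^sup>2 + (g x)\<^sup>2" by linarith
    qed simp
    finally show "norm (h x) \<le> norm (\<bar>C\<bar> * ((f x)\<^sup>2 + (g x)\<^sup>2))" by simp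
  qed
qed (use h in auto)

lemma pd_measurable:
  assumes "pd k f f'" shows "f \<in> borel_measurable borel" "f' \<in> borel_measurable borel"
  using pd_continuous[OF assms] borel_measurable_continuous_off_0 by auto

lemma borel_measurable_vec:
  fixes f :: "'a \<Rightarrow> 'b::euclidean_space^'n"
  assumes "\<And>j. (\<lambda>x. f x $ j) \<in> borel_measurable M"
  shows "f \<in> borel_measurable M"
proof -
  have "(\<lambda>x. f x \<bullet> b) \<in> borel_measurable M" if b: "b \<in> Basis" for b :: "'b^'n"
  proof -
    from b obtain i u where "b = axis i u" by (auto simp: Basis_vec_def)
    then have "(\<lambda>x. f x \<bullet> b) = (\<lambda>x. f x $ i \<bullet> u)" by (simp add: inner_axis)
    then show ?thesis using assms[of i] by simp
  qed
  then show ?thesis by (subst borel_measurable_euclidean_space) auto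
qed

text \<open>The interpretations are the transforms of test fields and their tangential parts. Square
  integrability of \<open>w/|x|\<close> is a hypothesis because the proof of Hardy's inequality
  itself integrates a flux that is controlled by it; Hardy then adds the quantitative bound.\<close>

locale L2_field =
  fixes w :: "real^'n \<Rightarrow> real^'n" and W :: "real^'n \<Rightarrow> real^'n^'n"
  assumes pd_w: "\<And>j k. pd k (\<lambda>x. w x $ j) (\<lambda>x. W x $ j $ k)"
    and W_L2: "integrable lborel (\<lambda>x. (norm (W x))\<^sup>2)"
    and w_L2: "integrable lborel (\<lambda>x. (norm (w x))\<^sup>2)"
    and xw_L2: "integrable lborel (\<lambda>x. (norm x * norm (w x))\<^sup>2)"
    and w_over_x_L2: "integrable lborel (\<lambda>x. (norm (w x) / norm x)\<^sup>2)"
begin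

lemma w_measurable[measurable]: "w \<in> borel_measurable borel"
  using pd_measurable(1)[OF pd_w] by (intro borel_measurable_vec)

lemma W_measurable[measurable]: "W \<in> borel_measurable borel"
  using pd_measurable(2)[OF pd_w] by (intro borel_measurable_vec)

lemma mult_vec_measurable[measurable]: "(\<lambda>x. W x *v x) \<in> borel_measurable borel" "(\<lambda>x. W x *v w x) \<in> borel_measurable borel"
  unfolding matrix_vector_mult_def
  by (intro borel_measurable_vec; simp; intro borel_measurable_sum borel_measurable_times pd_measurable(1)[OF pd_w] pd_measurable(2)[OF pd_w]
      borel_measurable_continuous_onI continuous_intros)+

lemma trace_measurable[measurable]: "(\<lambda>x. trace (W x)) \<in> borel_measurable borel"
  unfolding trace_def by (intro borel_measurable_sum pd_measurable(2)[OF pd_w])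

lemma inner_transpose_measurable[measurable]: "(\<lambda>x. W x \<bullet> transpose (W x)) \<in> borel_measurable borel"
  unfolding inner_vec_def transpose_def
  by (simp, intro borel_measurable_sum borel_measurable_times pd_measurable(2)[OF pd_w])

lemma w_sq: "integrable lborel (\<lambda>x. w x \<bullet> w x)"
  using w_L2 by (simp add: power2_norm_eq_inner)

lemma w_sq_over: "integrable lborel (\<lambda>x. (w x \<bullet> w x) / (x \<bullet> x))"
  using w_over_x_L2 by (simp add: power_divide power2_norm_eq_inner)

lemma radial_integrable: "integrable lborel (\<lambda>x. w x \<bullet> (W x *v x))"
proof (rule integrable_product_AM_GM[OF xw_L2 W_L2, where C = 1])
  show "AE x in lborel. \<bar>w x \<bullet> (W x *v x)\<bar> \<le> 1 * (norm x * norm (w x) * norm (W x))"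
  proof (rule AE_I2)
    fix x
    have "\<bar>w x \<bullet> (W x *v x)\<bar> \<le> norm (w x) * (norm (W x) * norm x)"
      by (meson Cauchy_Schwarz_ineq2 mult_left_mono norm_ge_zero norm_mult_vec_le order_trans)
    then show "\<bar>w x \<bullet> (W x *v x)\<bar> \<le> 1 * (norm x * norm (w x) * norm (W x))" by (simp add: mult_ac)
  qed
qed measurable

lemma radial_over_integrable: "integrable lborel (\<lambda>x. (w x \<bullet> (W x *v x)) / (x \<bullet> x))"
proof (rule integrable_product_AM_GM[OF w_over_x_L2 W_L2, where C = 1])
  show "AE x in lborel. \<bar>(w x \<bullet> (W x *v x)) / (x \<bullet> x)\<bar> \<le> 1 * (norm (w x) / norm x * norm (W x))"
  proof (rule AE_I2)
    fix x
    have "\<bar>w x \<bullet> (W x *v x)\<bar> \<le> norm (w x) * (norm (W x) * norm x)"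
      by (meson Cauchy_Schwarz_ineq2 mult_left_mono norm_ge_zero norm_mult_vec_le order_trans)
    then have "\<bar>w x \<bullet> (W x *v x)\<bar> / (norm x)\<^sup>2 \<le> norm (w x) * (norm (W x) * norm x) / (norm x)\<^sup>2"
      by (intro divide_right_mono) auto
    then show "\<bar>(w x \<bullet> (W x *v x)) / (x \<bullet> x)\<bar> \<le> 1 * (norm (w x) / norm x * norm (W x))"
      by (cases "x = 0") (simp_all add: power2_eq_square mult_ac flip: power2_norm_eq_inner)
  qed
qed measurable

text \<open>The integrand is the divergence of \<open>|w|^2 x\<close>.\<close>

lemma divergence_radial:
  "(\<integral>x. real CARD('n) * (w x \<bullet> w x) + 2 * (w x \<bullet> (W x *v x)) \<partial>lborel) = 0"
proof -
  have pd: "pd k (\<lambda>x. x $ k * (w x \<bullet> w x)) (\<lambda>x. (if k = k then 1 else 0) * (w x \<bullet> w x) + x $ k * (2 * (\<Sum>j\<in>UNIV. w x $ j * W x $ j $ k)))" for k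
    by (intro pd_mult pd_nth pd_inner pd_w)
  have eq: "(\<Sum>k\<in>UNIV. (if k = k then 1 else 0) * (w x \<bullet> w x) + x $ k * (2 * (\<Sum>j\<in>UNIV. w x $ j * W x $ j $ k)))
    = real CARD('n) * (w x \<bullet> w x) + 2 * (w x \<bullet> (W x *v x))" for x
    by (simp add: sum.distrib sum_inner_mult_vec[symmetric] sum_distrib_left mult.left_commute)
  show ?thesis
    unfolding eq[symmetric]
  proof (rule integral_divergence_off_0[OF pd])
    show "integrable lborel (\<lambda>x. x $ k * (w x \<bullet> w x) / norm x)" for k
    proof (rule integrable_product_AM_GM[OF w_L2 w_L2, where C = 1])
      show "AE x in lborel. \<bar>x $ k * (w x \<bullet> w x) / norm x\<bar> \<le> 1 * (norm (w x) * norm (w x))"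
      proof (rule AE_I2)
        fix x :: "real^'n"
        have "\<bar>x $ k\<bar> * (w x \<bullet> w x) \<le> norm x * (w x \<bullet> w x)"
          by (intro mult_right_mono component_le_norm_cart) auto
        then show "\<bar>x $ k * (w x \<bullet> w x) / norm x\<bar> \<le> 1 * (norm (w x) * norm (w x))"
          by (cases "x = 0") (simp_all add: abs_mult field_simps flip: power2_norm_eq_inner power2_eq_square)
      qed
    qed measurable
    show "integrable lborel (\<lambda>x. \<Sum>k\<in>UNIV. (if k = k then 1 else 0) * (w x \<bullet> w x) + x $ k * (2 * (\<Sum>j\<in>UNIV. w x $ j * W x $ j $ k)))"
      unfolding eq by (intro Bochner_Integration.integrable_add integrable_mult_right w_sq radial_integrable)
  qed
qed

lemma radial_over_divergence_integrable:
  "integrable lborel (\<lambda>x. ((real CARD('n) - 2) * (w x \<bullet> w x) + 2 * (w x \<bullet> (W x *v x))) / (x \<bullet> x))"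
  unfolding add_divide_distrib times_divide_eq_right[symmetric]
  by (intro Bochner_Integration.integrable_add integrable_mult_right w_sq_over radial_over_integrable)

text \<open>The integrand is the divergence of \<open>|w|^2 x / |x|^2\<close>; the factor
  \<open>N - 2\<close> comes from the divergence of \<open>x / |x|^2\<close>.\<close>

lemma divergence_radial_over:
  "(\<integral>x. ((real CARD('n) - 2) * (w x \<bullet> w x) + 2 * (w x \<bullet> (W x *v x))) / (x \<bullet> x) \<partial>lborel) = 0"
proof -
  let ?F' = "\<lambda>k x. ((if k = k then 1 else 0) * (w x \<bullet> w x) + x $ k * (2 * (\<Sum>j\<in>UNIV. w x $ j * W x $ j $ k))) * (1 / (x \<bullet> x))
     + (x $ k * (w x \<bullet> w x)) * (- 2 * x $ k / (x \<bullet> x)\<^sup>2)"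
  have pd: "pd k (\<lambda>x. x $ k * (w x \<bullet> w x) * (1 / (x \<bullet> x))) (?F' k)" for k
    by (intro pd_mult pd_nth pd_inner pd_w pd_inverse_inner_self)
  have eq: "(\<Sum>k\<in>UNIV. ?F' k x) = ((real CARD('n) - 2) * (w x \<bullet> w x) + 2 * (w x \<bullet> (W x *v x))) / (x \<bullet> x)" for x
  proof (cases "x = 0")
    case False
    then have R: "x \<bullet> x \<noteq> 0" by simp
    have "(\<Sum>k\<in>UNIV. ?F' k x) = (real CARD('n) * (w x \<bullet> w x) + 2 * (w x \<bullet> (W x *v x))) * (1 / (x \<bullet> x))
        - 2 * (w x \<bullet> w x) / (x \<bullet> x)\<^sup>2 * (\<Sum>k\<in>UNIV. x $ k * x $ k)"
      unfolding sum_inner_mult_vec[symmetric] sum.distrib sum_distrib_left sum_distrib_right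
      by (simp add: sum_distrib_left sum_distrib_right sum_subtractf sum.distrib sum_negf algebra_simps)
    also have "(\<Sum>k\<in>UNIV. x $ k * x $ k) = x \<bullet> x" by (simp add: inner_nth_sum)
    finally show ?thesis using R by (simp add: power2_eq_square field_simps)
  qed simp
  show ?thesis
    unfolding eq[symmetric]
  proof (rule integral_divergence_off_0[OF pd])
    show "integrable lborel (\<lambda>x. x $ k * (w x \<bullet> w x) * (1 / (x \<bullet> x)) / norm x)" for k
    proof (rule integrable_product_AM_GM[OF w_over_x_L2 w_over_x_L2, where C = 1])
      show "AE x in lborel. \<bar>x $ k * (w x \<bullet> w x) * (1 / (x \<bullet> x)) / norm x\<bar> \<le> 1 * (norm (w x) / norm x * (norm (w x) / norm x))"
      proof (rule AE_I2)
        fix x :: "real^'n"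
        have "\<bar>x $ k\<bar> * ((w x \<bullet> w x) / (x \<bullet> x) / norm x) \<le> norm x * ((w x \<bullet> w x) / (x \<bullet> x) / norm x)"
          by (intro mult_right_mono component_le_norm_cart) auto
        then show "\<bar>x $ k * (w x \<bullet> w x) * (1 / (x \<bullet> x)) / norm x\<bar> \<le> 1 * (norm (w x) / norm x * (norm (w x) / norm x))"
          by (cases "x = 0") (simp_all add: abs_mult power2_eq_square flip: power2_norm_eq_inner)
      qed
    qed measurable
    show "integrable lborel (\<lambda>x. \<Sum>k\<in>UNIV. ?F' k x)"
      unfolding eq by (rule radial_over_divergence_integrable)
  qed
qed

text \<open>The square of \<open>W x *v x + w x / 2\<close>, divided by \<open>|x|^2\<close>, is
  nonnegative, and the divergence of \<open>|w|^2 x / |x|^2\<close> trades its mixed term for the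
  potential. The bound keeps the radial coefficients of the approximating transforms bounded in
  L2.\<close>

theorem Hardy:
  assumes N: "CARD('n) \<ge> 3"
  shows "(\<integral>x. (norm (w x) / norm x)\<^sup>2 \<partial>lborel) \<le> 4 * (\<integral>x. (norm (W x))\<^sup>2 \<partial>lborel)"
proof -
  let ?D = "\<lambda>x. ((real CARD('n) - 2) * (w x \<bullet> w x) + 2 * (w x \<bullet> (W x *v x))) / (x \<bullet> x)"
  note iD = radial_over_divergence_integrable
  have "(norm (w x) / norm x)\<^sup>2 \<le> 4 * (norm (W x))\<^sup>2 + 2 * ?D x" if "x \<noteq> 0" for x
  proof -
    have R: "x \<bullet> x > 0" using that by simp
    have "0 \<le> ((W x *v x + (1/2) *\<^sub>R w x) \<bullet> (W x *v x + (1/2) *\<^sub>R w x)) / (x \<bullet> x)" by simp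
    also have "\<dots> = ((W x *v x) \<bullet> (W x *v x)) / (x \<bullet> x) + (w x \<bullet> (W x *v x)) / (x \<bullet> x) + (w x \<bullet> w x) / (x \<bullet> x) / 4"
      by (simp add: inner_add_left inner_add_right inner_commute[of "W x *v x" "w x"] add_divide_distrib)
    also have "((W x *v x) \<bullet> (W x *v x)) / (x \<bullet> x) \<le> (norm (W x))\<^sup>2"
      using power_mono[OF norm_mult_vec_le[of "W x" x], of 2] R
      by (simp add: power_mult_distrib divide_le_eq power2_norm_eq_inner)
    finally have "0 \<le> 4 * (norm (W x))\<^sup>2 + 4 * (w x \<bullet> (W x *v x)) / (x \<bullet> x) + (w x \<bullet> w x) / (x \<bullet> x)" by simp
    moreover have "1 * ((w x \<bullet> w x) / (x \<bullet> x)) \<le> (real CARD('n) - 2) * ((w x \<bullet> w x) / (x \<bullet> x))"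
      using N by (intro mult_right_mono) auto
    moreover have "?D x = (real CARD('n) - 2) * ((w x \<bullet> w x) / (x \<bullet> x)) + 2 * (w x \<bullet> (W x *v x)) / (x \<bullet> x)"
      by (simp add: add_divide_distrib)
    ultimately have "(w x \<bullet> w x) / (x \<bullet> x) \<le> 4 * (norm (W x))\<^sup>2 + 2 * ?D x" by simp
    then show ?thesis by (simp add: power_divide power2_norm_eq_inner)
  qed
  then have "(\<integral>x. (norm (w x) / norm x)\<^sup>2 \<partial>lborel) \<le> (\<integral>x. 4 * (norm (W x))\<^sup>2 + 2 * ?D x \<partial>lborel)"
    using AE_lborel_singleton[where c = 0]
    by (intro integral_mono_AE w_over_x_L2 Bochner_Integration.integrable_add integrable_mult_right W_L2 iD)
      (auto elim: eventually_mono)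
  also have "\<dots> = 4 * (\<integral>x. (norm (W x))\<^sup>2 \<partial>lborel) + 2 * (\<integral>x. ?D x \<partial>lborel)"
    unfolding Bochner_Integration.integral_add[OF integrable_mult_right[OF W_L2] integrable_mult_right[OF iD]]
    by (simp only: integral_mult_right_zero)
  finally show ?thesis by (simp add: divergence_radial_over)
qed

lemma trace_square_integrable: "integrable lborel (\<lambda>x. (trace (W x))\<^sup>2)"
proof (rule integrable_product_AM_GM[OF W_L2 W_L2, where C = "(real CARD('n))\<^sup>2"])
  show "AE x in lborel. \<bar>(trace (W x))\<^sup>2\<bar> \<le> (real CARD('n))\<^sup>2 * (norm (W x) * norm (W x))"
  proof (rule AE_I2)
    fix x
    have "\<bar>trace (W x)\<bar>\<^sup>2 \<le> (real CARD('n) * norm (W x))\<^sup>2"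
      by (intro power_mono abs_trace_le) auto
    then show "\<bar>(trace (W x))\<^sup>2\<bar> \<le> (real CARD('n))\<^sup>2 * (norm (W x) * norm (W x))"
      by (simp add: power_mult_distrib power2_eq_square mult_ac)
  qed
qed measurable

lemma inner_transpose_integrable: "integrable lborel (\<lambda>x. W x \<bullet> transpose (W x))"
  by (rule integrable_product_AM_GM[OF W_L2 W_L2, where C = 1])
    (use abs_inner_transpose_le in \<open>auto simp: power2_eq_square\<close>)

text \<open>The flux \<open>w div w - (w \<cdot> \<nabla>) w\<close>; its divergence contains no second derivatives.\<close>

lemma divergence_trace:
  assumes pd_W: "\<And>j k l. pd l (\<lambda>x. W x $ j $ k) (W' j k l)" and sym: "\<And>j k l x. W' j k l x = W' j l k x"
  shows "(\<integral>x. (trace (W x))\<^sup>2 - W x \<bullet> transpose (W x) \<partial>lborel) = 0"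
proof -
  let ?F = "\<lambda>k x. w x $ k * (\<Sum>j\<in>UNIV. W x $ j $ j) - (\<Sum>j\<in>UNIV. W x $ k $ j * w x $ j)"
  let ?F' = "\<lambda>k x. (W x $ k $ k * (\<Sum>j\<in>UNIV. W x $ j $ j) + w x $ k * (\<Sum>j\<in>UNIV. W' j j k x))
      - (\<Sum>j\<in>UNIV. W' k j k x * w x $ j + W x $ k $ j * W x $ j $ k)"
  have pd: "pd k (?F k) (?F' k)" for k
    by (intro pd_diff pd_mult pd_sum pd_w pd_W)
  have eq: "(\<Sum>k\<in>UNIV. ?F' k x) = (trace (W x))\<^sup>2 - W x \<bullet> transpose (W x)" for x
  proof -
    have "(\<Sum>k\<in>UNIV. \<Sum>j\<in>UNIV. W' k j k x * w x $ j) = (\<Sum>k\<in>UNIV. w x $ k * (\<Sum>j\<in>UNIV. W' j j k x))"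
      unfolding sum_distrib_left by (subst sum.swap) (simp add: mult.commute sym[of _ _ "_" x])
    moreover have "W x \<bullet> transpose (W x) = (\<Sum>k\<in>UNIV. \<Sum>j\<in>UNIV. W x $ k $ j * W x $ j $ k)"
      by (simp add: inner_vec_def transpose_def)
    moreover have "(trace (W x))\<^sup>2 = (\<Sum>k\<in>UNIV. W x $ k $ k * (\<Sum>j\<in>UNIV. W x $ j $ j))"
      by (simp add: trace_def power2_eq_square sum_distrib_right)
    ultimately show ?thesis by (simp add: sum.distrib sum_subtractf)
  qed
  show ?thesis
    unfolding eq[symmetric]
  proof (rule integral_divergence_off_0[OF pd])
    show "integrable lborel (\<lambda>x. \<Sum>k\<in>UNIV. ?F' k x)"
      unfolding eq by (intro Bochner_Integration.integrable_diff trace_square_integrable inner_transpose_integrable)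
    fix k
    have F: "?F k x = w x $ k * trace (W x) - (W x *v w x) $ k" for x
      by (simp add: trace_def matrix_vector_mult_def)
    show "integrable lborel (\<lambda>x. ?F k x / norm x)"
      unfolding F
    proof (rule integrable_product_AM_GM[OF w_over_x_L2 W_L2, where C = "real CARD('n) + 1"])
      have [measurable]: "(\<lambda>x. w x $ k) \<in> borel_measurable borel" "(\<lambda>x. (W x *v w x) $ k) \<in> borel_measurable borel"
        using pd_measurable(1)[OF pd_w] pd_measurable(2)[OF pd_w]
        by (auto simp: matrix_vector_mult_def intro!: borel_measurable_sum borel_measurable_times)
      show "(\<lambda>x. (w x $ k * trace (W x) - (W x *v w x) $ k) / norm x) \<in> borel_measurable borel"
        by measurable
      show "AE x in lborel. \<bar>(w x $ k * trace (W x) - (W x *v w x) $ k) / norm x\<bar>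
          \<le> (real CARD('n) + 1) * (norm (w x) / norm x * norm (W x))"
      proof (rule AE_I2)
        fix x
        have "\<bar>w x $ k * trace (W x)\<bar> \<le> norm (w x) * (CARD('n) * norm (W x))"
          unfolding abs_mult by (intro mult_mono component_le_norm_cart abs_trace_le) auto
        moreover have "\<bar>(W x *v w x) $ k\<bar> \<le> norm (W x) * norm (w x)"
          by (meson component_le_norm_cart norm_mult_vec_le order_trans)
        ultimately have "\<bar>w x $ k * trace (W x) - (W x *v w x) $ k\<bar> \<le> (real CARD('n) + 1) * (norm (w x) * norm (W x))"
          by (simp add: algebra_simps)
        then have "\<bar>w x $ k * trace (W x) - (W x *v w x) $ k\<bar> / norm x \<le> (real CARD('n) + 1) * (norm (w x) * norm (W x)) / norm x"
          by (rule divide_right_mono) simp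
        then show "\<bar>(w x $ k * trace (W x) - (W x *v w x) $ k) / norm x\<bar> \<le> (real CARD('n) + 1) * (norm (w x) / norm x * norm (W x))"
          by simp
      qed
    qed
  qed
qed

end

subsection \<open>The inequality for the tangential part of a field\<close>

text \<open>The coefficient of \<open>x\<close> itself, not of the unit normal, in the orthogonal
  decomposition of \<open>y\<close>. It is polynomial in \<open>x\<close> up to the factor
  \<open>1/|x|^2\<close>, at the price of being only of size \<open>|y|/|x|\<close>. At the origin
  it is 0 by the convention for division.\<close>

definition radial_coeff :: "real^'n \<Rightarrow> real^'n \<Rightarrow> real" where
  "radial_coeff x y = (x \<bullet> y) / (x \<bullet> x)"

text \<open>The divergence of the tangential part of a field with value y and Jacobian A at x.\<close>

definition tangential_div :: "real^'n \<Rightarrow> real^'n \<Rightarrow> real^'n^'n \<Rightarrow> real" where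
  "tangential_div x y A = trace A - (x \<bullet> (A *v x)) / (x \<bullet> x) - (real CARD('n) - 1) * radial_coeff x y"

lemma radial_coeff_bound: "\<bar>radial_coeff x y\<bar> \<le> norm y / norm x"
proof (cases "x = 0")
  case False
  have "\<bar>x \<bullet> y\<bar> / (norm x)\<^sup>2 \<le> norm x * norm y / (norm x)\<^sup>2"
    by (intro divide_right_mono Cauchy_Schwarz_ineq2) auto
  then show ?thesis using False
    by (simp add: radial_coeff_def power2_eq_square flip: power2_norm_eq_inner)
qed (simp add: radial_coeff_def)

lemma tangential_div_bound:
  fixes A :: "real^'n^'n"
  shows "\<bar>tangential_div x y A\<bar> \<le> (real CARD('n) + 1) * (norm A + norm y / norm x)"
proof -
  have 1: "\<bar>trace A\<bar> \<le> real CARD('n) * norm A" by (rule abs_trace_le)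
  have 2: "\<bar>x \<bullet> (A *v x) / (x \<bullet> x)\<bar> \<le> norm A"
  proof (cases "x = 0")
    case False
    have "\<bar>x \<bullet> (A *v x)\<bar> \<le> norm x * (norm A * norm x)"
      by (meson Cauchy_Schwarz_ineq2 mult_left_mono norm_ge_zero norm_mult_vec_le order_trans)
    then have "\<bar>x \<bullet> (A *v x)\<bar> \<le> norm A * (x \<bullet> x)"
      by (simp add: power2_eq_square mult_ac flip: power2_norm_eq_inner)
    then show ?thesis using False by (simp add: divide_le_eq)
  qed simp
  have "1 \<le> real CARD('n)"
    using zero_less_card_finite[where 'a='n] by linarith
  then have 3: "\<bar>(real CARD('n) - 1) * radial_coeff x y\<bar> \<le> (real CARD('n) - 1) * (norm y / norm x)"
    unfolding abs_mult by (intro mult_mono radial_coeff_bound) auto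
  have 4: "0 \<le> norm y / norm x" by simp
  have "\<bar>tangential_div x y A\<bar> \<le> real CARD('n) * norm A + norm A + (real CARD('n) - 1) * (norm y / norm x)"
    unfolding tangential_div_def using 1 2 3 by linarith
  also have "\<dots> \<le> (real CARD('n) + 1) * norm A + (real CARD('n) + 1) * (norm y / norm x)"
    using mult_right_mono[OF _ 4, of "real CARD('n) - 1" "real CARD('n) + 1"] by (simp add: distrib_right)
  finally show ?thesis by (simp add: distrib_left)
qed

lemma sum_delta_mult: "(\<Sum>j\<in>UNIV. (if j = k then 1 else 0) * f j) = (f (k::'n::finite) :: real)"
  by (simp add: if_distrib if_distribR cong: if_cong)

text \<open>The second derivatives \<open>H\<close> have to exist, be continuous off the origin and
  be symmetric, because the flux for \<open>divergence_trace\<close> contains first derivatives. No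
  bound on them is assumed, as they cancel in that divergence.\<close>

locale C2_field = L2_field v J
  for v :: "real^'n \<Rightarrow> real^'n" and J :: "real^'n \<Rightarrow> real^'n^'n" +
  fixes H :: "'n \<Rightarrow> 'n \<Rightarrow> 'n \<Rightarrow> real^'n \<Rightarrow> real"
  assumes pd_J: "\<And>j k l. pd l (\<lambda>x. J x $ j $ k) (H j k l)"
    and H_sym: "\<And>j k l x. H j k l x = H j l k x"
    and dim: "CARD('n) \<ge> 3"
begin

text \<open>The splitting of \<open>v\<close>: \<open>a\<close> is the radial coefficient with
  gradient \<open>ga\<close> and Hessian \<open>ga2\<close>, and \<open>t\<close> is the tangential
  part with Jacobian \<open>T\<close>. The auxiliary \<open>nu\<close> and \<open>nu2\<close> are
  first and second derivatives of the numerator \<open>x \<bullet> v x\<close>. All are explicit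
  because \<open>pd\<close> relates a function to a named derivative.\<close>

definition "a x = radial_coeff x (v x)"
definition "ga x = (1 / (x \<bullet> x)) *\<^sub>R (v x + transpose (J x) *v x) - (2 * (x \<bullet> v x) / (x \<bullet> x)\<^sup>2) *\<^sub>R x"
definition "t x = v x - a x *\<^sub>R x"
definition "T x = J x - outer x (ga x) - a x *\<^sub>R mat 1"

definition "nu k x = v x $ k + (\<Sum>j\<in>UNIV. x $ j * J x $ j $ k)"
definition "nu2 k l x = J x $ k $ l + J x $ l $ k + (\<Sum>j\<in>UNIV. x $ j * H j k l x)"
definition "ga2 k l x = nu2 k l x * (1 / (x \<bullet> x)) + nu k x * (- 2 * x $ l / (x \<bullet> x)\<^sup>2)
  + nu l x * (- 2 * x $ k / (x \<bullet> x)\<^sup>2)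
  + (x \<bullet> v x) * (- 2 * (if k = l then 1 else 0) / (x \<bullet> x)\<^sup>2 + 8 * x $ k * x $ l / (x \<bullet> x) ^ 3)"

section \<open>Derivatives of the radial coefficient and of the tangential part\<close>

lemma pd_xv: "pd k (\<lambda>x. x \<bullet> v x) (nu k)"
proof -
  have "pd k (\<lambda>x. \<Sum>j\<in>UNIV. x $ j * v x $ j) (\<lambda>x. \<Sum>j\<in>UNIV. (if j = k then 1 else 0) * v x $ j + x $ j * J x $ j $ k)"
    by (intro pd_sum pd_mult pd_nth pd_w)
  then show ?thesis
    by (simp only: inner_nth_sum sum.distrib nu_def[abs_def] sum_delta_mult)
qed

lemma pd_nu: "pd l (nu k) (nu2 k l)"
proof -
  have "pd l (\<lambda>x. v x $ k + (\<Sum>j\<in>UNIV. x $ j * J x $ j $ k))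
    (\<lambda>x. J x $ k $ l + (\<Sum>j\<in>UNIV. (if j = l then 1 else 0) * J x $ j $ k + x $ j * H j k l x))"
    by (intro pd_add pd_sum pd_mult pd_nth pd_w pd_J)
  moreover have "(\<Sum>j\<in>UNIV. (if j = l then 1 else 0) * J x $ j $ k + x $ j * H j k l x)
    = J x $ l $ k + (\<Sum>j\<in>UNIV. x $ j * H j k l x)" for x
    by (simp only: sum.distrib sum_delta_mult)
  ultimately show ?thesis by (simp add: nu_def[abs_def] nu2_def[abs_def] add.assoc)
qed

lemma ga_nth: "ga x $ k = nu k x * (1 / (x \<bullet> x)) + (x \<bullet> v x) * (- 2 * x $ k / (x \<bullet> x)\<^sup>2)"
  by (simp add: ga_def nu_def transpose_matrix_vector vector_matrix_mult_def mult_ac)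

lemma pd_a: "pd k a (\<lambda>x. ga x $ k)"
proof -
  have "pd k (\<lambda>x. (x \<bullet> v x) * (1 / (x \<bullet> x))) (\<lambda>x. nu k x * (1 / (x \<bullet> x)) + (x \<bullet> v x) * (- 2 * x $ k / (x \<bullet> x)\<^sup>2))"
    by (intro pd_mult pd_xv pd_inverse_inner_self)
  then show ?thesis by (simp add: a_def[abs_def] radial_coeff_def ga_nth)
qed

lemma pd_ga: "pd l (\<lambda>x. ga x $ k) (ga2 k l)"
proof -
  let ?r = "\<lambda>x::real^'n. 1 / (x \<bullet> x)"
  let ?s = "\<lambda>x::real^'n. - 2 * x $ l / (x \<bullet> x)\<^sup>2"
  have "pd l (\<lambda>x. nu k x * ?r x + (x \<bullet> v x) * ((- 2 * x $ k) * (?r x * ?r x)))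
    (\<lambda>x. (nu2 k l x * ?r x + nu k x * ?s x)
       + (nu l x * ((- 2 * x $ k) * (?r x * ?r x))
          + (x \<bullet> v x) * ((- 2 * (if k = l then 1 else 0)) * (?r x * ?r x) + (- 2 * x $ k) * (?s x * ?r x + ?r x * ?s x))))"
    by (intro pd_add pd_mult pd_nu pd_xv pd_inverse_inner_self pd_cmult pd_nth)
  moreover have "nu k x * ?r x + (x \<bullet> v x) * ((- 2 * x $ k) * (?r x * ?r x)) = ga x $ k" for x
    by (simp add: ga_nth power2_eq_square)
  moreover have "(nu2 k l x * ?r x + nu k x * ?s x)
       + (nu l x * ((- 2 * x $ k) * (?r x * ?r x))
          + (x \<bullet> v x) * ((- 2 * (if k = l then 1 else 0)) * (?r x * ?r x) + (- 2 * x $ k) * (?s x * ?r x + ?r x * ?s x))) = ga2 k l x" for x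
    by (simp add: ga2_def power2_eq_square power3_eq_cube algebra_simps)
  ultimately show ?thesis by (simp only:)
qed

lemma ga2_sym: "ga2 k l x = ga2 l k x"
  by (simp add: ga2_def nu2_def H_sym[of _ k l] algebra_simps)

lemma pd_t: "pd k (\<lambda>x. t x $ j) (\<lambda>x. T x $ j $ k)"
proof -
  have "pd k (\<lambda>x. v x $ j - a x * x $ j) (\<lambda>x. J x $ j $ k - (ga x $ k * x $ j + a x * (if j = k then 1 else 0)))"
    by (intro pd_diff pd_mult pd_a pd_nth pd_w)
  then show ?thesis
    by (simp add: t_def T_def outer_def mat_def algebra_simps)
qed

definition "T2 j k l x = H j k l x - ((if j = l then 1 else 0) * ga x $ k + x $ j * ga2 k l x) - ga x $ l * (if j = k then 1 else 0)"

lemma pd_T: "pd l (\<lambda>x. T x $ j $ k) (T2 j k l)"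
proof -
  have "pd l (\<lambda>x. J x $ j $ k - x $ j * ga x $ k - a x * (if j = k then 1 else 0))
     (\<lambda>x. H j k l x - ((if j = l then 1 else 0) * ga x $ k + x $ j * ga2 k l x) - (ga x $ l * (if j = k then 1 else 0) + a x * 0))"
    by (intro pd_diff pd_mult pd_a pd_nth pd_ga pd_J pd_const)
  then show ?thesis
    by (simp add: T_def T2_def[abs_def] outer_def mat_def)
qed

lemma T2_sym: "T2 j k l x = T2 j l k x"
  by (simp add: T2_def H_sym[of j k l] ga2_sym[of k l])

section \<open>Pointwise relations and bounds for the splitting\<close>

lemma x_t: "x \<bullet> t x = 0"
  by (cases "x = 0") (simp_all add: t_def a_def radial_coeff_def inner_diff_right)

lemma norm_v_split: "(norm (v x))\<^sup>2 = (norm (t x))\<^sup>2 + (norm x * a x)\<^sup>2"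
proof -
  have "v x = t x + a x *\<^sub>R x" by (simp add: t_def)
  then have "v x \<bullet> v x = t x \<bullet> t x + (a x)\<^sup>2 * (x \<bullet> x)"
    using x_t[of x] by (simp add: inner_add_left inner_add_right inner_commute[of "t x" x] power2_eq_square)
  then show ?thesis by (simp add: power2_norm_eq_inner power_mult_distrib)
qed

lemma norm_t_le: "norm (t x) \<le> norm (v x)"
  using norm_v_split[of x] by (metis add_increasing2 order_refl power2_le_imp_le norm_ge_zero zero_le_power2 le_add_same_cancel1)

lemma x_ga: "x \<bullet> ga x = (x \<bullet> (J x *v x)) / (x \<bullet> x) - a x"
proof (cases "x = 0")
  case False
  then have "x \<bullet> x \<noteq> 0" by simp
  moreover have "x \<bullet> (transpose (J x) *v x) = x \<bullet> (J x *v x)"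
    using inner_transpose_mult_vec[of "J x" x x] by (simp add: inner_commute)
  ultimately show ?thesis
    by (simp add: ga_def a_def radial_coeff_def inner_diff_right inner_add_right power2_eq_square field_simps)
qed (simp add: a_def radial_coeff_def)

lemma trace_T: "trace (T x) = tangential_div x (v x) (J x)"
  by (simp add: T_def tangential_div_def trace_sub trace_outer x_ga a_def[symmetric])
    (simp add: trace_def mat_def algebra_simps)

lemma transpose_T_x:
  assumes "x \<noteq> 0" shows "transpose (T x) *v x = - t x"
proof -
  have R: "x \<bullet> x \<noteq> 0" using assms by simp
  have "transpose (T x) *v x = transpose (J x) *v x - (x \<bullet> x) *\<^sub>R ga x - a x *\<^sub>R x"
    by (simp add: T_def transpose_diff transpose_outer transpose_scaleR transpose_mat matrix_vector_mult_diff_rdistrib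
        outer_mult_vec scaleR_matrix_vector_assoc[symmetric])
  also have "(x \<bullet> x) *\<^sub>R ga x = v x + transpose (J x) *v x - (2 * a x) *\<^sub>R x"
    using R by (simp add: ga_def scaleR_diff_right a_def radial_coeff_def power2_eq_square)
  finally show ?thesis by (simp add: t_def vec_eq_iff algebra_simps)
qed

text \<open>The coefficient \<open>a\<close> is one degree less homogeneous than \<open>v\<close>,
  so its gradient has to be multiplied by \<open>|x|\<close> before it compares with
  \<open>J\<close> and \<open>v/|x|\<close>.\<close>

lemma norm_ga_le: "norm x * norm (ga x) \<le> norm (J x) + 3 * (norm (v x) / norm x)"
proof (cases "x = 0")
  case False
  define r where "r = norm x"
  have r: "r > 0" "x \<bullet> x = r * r" using False by (simp_all add: r_def flip: power2_norm_eq_inner power2_eq_square)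
  have "norm (v x + transpose (J x) *v x) \<le> norm (v x) + norm (J x) * r"
    using norm_triangle_ineq[of "v x" "transpose (J x) *v x"] norm_mult_vec_le[of "transpose (J x)" x]
    by (simp add: norm_transpose r_def)
  then have 1: "norm ((1 / (x \<bullet> x)) *\<^sub>R (v x + transpose (J x) *v x)) \<le> (norm (v x) + norm (J x) * r) / (r * r)"
    using r by (simp add: divide_right_mono)
  have "\<bar>x \<bullet> v x\<bar> \<le> r * norm (v x)" unfolding r_def by (rule Cauchy_Schwarz_ineq2)
  then have "2 * \<bar>x \<bullet> v x\<bar> / (r * r)\<^sup>2 * r \<le> 2 * (r * norm (v x)) / (r * r)\<^sup>2 * r"
    using r by (intro mult_right_mono divide_right_mono mult_left_mono) auto
  then have 2: "norm ((2 * (x \<bullet> v x) / (x \<bullet> x)\<^sup>2) *\<^sub>R x) \<le> 2 * (r * norm (v x)) / (r * r)\<^sup>2 * r"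
    using r by (simp add: abs_mult r_def[symmetric])
  have "r * norm (ga x) \<le> r * ((norm (v x) + norm (J x) * r) / (r * r) + 2 * (r * norm (v x)) / (r * r)\<^sup>2 * r)"
    unfolding ga_def using r order_trans[OF norm_triangle_ineq4 add_mono[OF 1 2]] by (intro mult_left_mono) auto
  also have "\<dots> = norm (J x) + 3 * (norm (v x) / r)"
    using r by (simp add: field_simps power2_eq_square)
  finally show ?thesis by (simp add: r_def)
qed simp

lemma norm_mat_1: "norm (mat 1 :: real^'n^'n) \<le> real CARD('n)"
proof -
  have "norm (mat 1 :: real^'n^'n) = sqrt (real CARD('n))"
    by (simp add: norm_eq_sqrt_inner inner_mat_1 trace_I)
  also have "\<dots> \<le> real CARD('n)"
    using dim by (intro real_le_lsqrt) (auto simp: power2_eq_square)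
  finally show ?thesis .
qed

lemma norm_T_le: "norm (T x) \<le> (real CARD('n) + 3) * (norm (J x) + norm (v x) / norm x)"
proof -
  have "norm (T x) \<le> norm (J x) + norm (outer x (ga x)) + norm (a x *\<^sub>R (mat 1 :: real^'n^'n))"
    unfolding T_def by (meson add_mono norm_triangle_ineq4 order_refl order_trans)
  moreover have "norm (outer x (ga x)) \<le> norm (J x) + 3 * (norm (v x) / norm x)"
    using norm_ga_le by (simp add: norm_outer)
  moreover have "norm (a x *\<^sub>R (mat 1 :: real^'n^'n)) \<le> (norm (v x) / norm x) * real CARD('n)"
    unfolding norm_scaleR a_def real_norm_def by (intro mult_mono radial_coeff_bound norm_mat_1) auto
  ultimately have "norm (T x) \<le> 2 * norm (J x) + (real CARD('n) + 3) * (norm (v x) / norm x)"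
    by (simp add: algebra_simps)
  also have "\<dots> \<le> (real CARD('n) + 3) * norm (J x) + (real CARD('n) + 3) * (norm (v x) / norm x)"
    by (intro add_right_mono mult_right_mono) auto
  finally show ?thesis by (simp add: distrib_left)
qed

section \<open>Integrability for the splitting\<close>

lemma a_measurable[measurable]: "a \<in> borel_measurable borel"
  by (rule pd_measurable[OF pd_a])

lemma ga_measurable[measurable]: "ga \<in> borel_measurable borel"
  by (rule borel_measurable_vec) (rule pd_measurable(2)[OF pd_a])

lemma t_measurable[measurable]: "t \<in> borel_measurable borel"
  by (rule borel_measurable_vec) (rule pd_measurable(1)[OF pd_t])

lemma T_measurable[measurable]: "T \<in> borel_measurable borel"
  by (rule borel_measurable_vec, rule borel_measurable_vec) (rule pd_measurable(2)[OF pd_t])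

lemma integrable_square_dominated:
  assumes f: "integrable lborel (\<lambda>x. (f x)\<^sup>2)" and h: "h \<in> borel_measurable borel" and le: "\<And>x. \<bar>h x\<bar> \<le> C * f x"
  shows "integrable lborel (\<lambda>x::'a::euclidean_space. (h x)\<^sup>2 :: real)"
proof (rule Bochner_Integration.integrable_bound)
  show "integrable lborel (\<lambda>x. C\<^sup>2 * (f x)\<^sup>2)" by (intro integrable_mult_right f)
  show "AE x in lborel. norm ((h x)\<^sup>2) \<le> norm (C\<^sup>2 * (f x)\<^sup>2)"
    using power_mono[OF le abs_ge_zero, of _ 2] by (intro AE_I2) (simp add: power_mult_distrib)
qed (use h in auto)

lemma e_L2: "integrable lborel (\<lambda>x. (norm (J x) + norm (v x) / norm x)\<^sup>2)"
proof (rule Bochner_Integration.integrable_bound)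
  show "integrable lborel (\<lambda>x. 2 * (norm (J x))\<^sup>2 + 2 * (norm (v x) / norm x)\<^sup>2)"
    by (intro Bochner_Integration.integrable_add integrable_mult_right W_L2 w_over_x_L2)
  have "(p + q)\<^sup>2 \<le> 2 * p\<^sup>2 + 2 * q\<^sup>2" for p q :: real
    using sum_squares_bound[of p q] by (simp add: power2_sum)
  then show "AE x in lborel. norm ((norm (J x) + norm (v x) / norm x)\<^sup>2) \<le> norm (2 * (norm (J x))\<^sup>2 + 2 * (norm (v x) / norm x)\<^sup>2)"
    by (intro AE_I2) (simp del: power_divide)
qed measurable

lemma a_L2: "integrable lborel (\<lambda>x. (a x)\<^sup>2)"
  by (rule integrable_square_dominated[OF w_over_x_L2, where C = 1])
    (use radial_coeff_bound a_measurable in \<open>auto simp: a_def[abs_def]\<close>)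

text \<open>The tangential projection is homogeneous of degree 0: it does not increase norms, and
  its derivative costs a factor \<open>1/|x|\<close>. All hypotheses thus pass from \<open>v\<close>
  to \<open>t\<close>, with \<open>|J| + |v|/|x|\<close> in the place of \<open>|J|\<close>.\<close>

sublocale t: L2_field t T
proof
  show "pd k (\<lambda>x. t x $ j) (\<lambda>x. T x $ j $ k)" for j k by (rule pd_t)
  show "integrable lborel (\<lambda>x. (norm (T x))\<^sup>2)"
    by (rule integrable_square_dominated[OF e_L2]) (use norm_T_le in auto)
  show "integrable lborel (\<lambda>x. (norm (t x))\<^sup>2)"
    by (rule integrable_square_dominated[OF w_L2, where C = 1]) (use norm_t_le in auto)
  show "integrable lborel (\<lambda>x. (norm x * norm (t x))\<^sup>2)"
    by (rule integrable_square_dominated[OF xw_L2, where C = 1]) (use norm_t_le in \<open>auto simp: mult_left_mono\<close>)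
  show "integrable lborel (\<lambda>x. (norm (t x) / norm x)\<^sup>2)"
    by (rule integrable_square_dominated[OF w_over_x_L2, where C = 1]) (use norm_t_le in \<open>auto simp: divide_right_mono\<close>)
qed

lemma a_trace_integrable: "integrable lborel (\<lambda>x. a x * trace (T x))"
proof (rule integrable_product_AM_GM[OF w_over_x_L2 e_L2, where C = "real CARD('n) + 1"])
  show "AE x in lborel. \<bar>a x * trace (T x)\<bar> \<le> (real CARD('n) + 1) * (norm (v x) / norm x * (norm (J x) + norm (v x) / norm x))"
  proof (rule AE_I2)
    fix x
    have "\<bar>a x * trace (T x)\<bar> \<le> norm (v x) / norm x * ((real CARD('n) + 1) * (norm (J x) + norm (v x) / norm x))"
      unfolding abs_mult trace_T a_def by (intro mult_mono radial_coeff_bound tangential_div_bound) auto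
    then show "\<bar>a x * trace (T x)\<bar> \<le> (real CARD('n) + 1) * (norm (v x) / norm x * (norm (J x) + norm (v x) / norm x))"
      by (simp add: mult_ac)
  qed
qed measurable

lemma t_ga_integrable: "integrable lborel (\<lambda>x. t x \<bullet> ga x)"
proof (rule integrable_product_AM_GM[OF w_over_x_L2 e_L2, where C = 3])
  show "AE x in lborel. \<bar>t x \<bullet> ga x\<bar> \<le> 3 * (norm (v x) / norm x * (norm (J x) + norm (v x) / norm x))"
  proof (rule AE_I2)
    fix x
    show "\<bar>t x \<bullet> ga x\<bar> \<le> 3 * (norm (v x) / norm x * (norm (J x) + norm (v x) / norm x))"
    proof (cases "x = 0")
      case False
      have "\<bar>t x \<bullet> ga x\<bar> \<le> norm (v x) * norm (ga x)"
        by (meson Cauchy_Schwarz_ineq2 mult_right_mono norm_ge_zero norm_t_le order_trans)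
      also have "\<dots> = norm (v x) / norm x * (norm x * norm (ga x))" using False by simp
      also have "\<dots> \<le> norm (v x) / norm x * (norm (J x) + 3 * (norm (v x) / norm x))"
        by (intro mult_left_mono norm_ga_le) auto
      also have "\<dots> \<le> norm (v x) / norm x * (3 * (norm (J x) + norm (v x) / norm x))"
        by (intro mult_left_mono) auto
      finally show ?thesis by (simp only: mult.left_commute)
    qed (simp add: ga_def)
  qed
qed measurable

text \<open>The integrand is the divergence of \<open>a t\<close>. It allows the gradient of the
  radial coefficient to be exchanged for the coefficient itself.\<close>

lemma divergence_a_t: "(\<integral>x. t x \<bullet> ga x + a x * trace (T x) \<partial>lborel) = 0"
proof -
  have pd: "pd k (\<lambda>x. a x * t x $ k) (\<lambda>x. ga x $ k * t x $ k + a x * T x $ k $ k)" for k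
    by (intro pd_mult pd_a pd_t)
  have eq: "(\<Sum>k\<in>UNIV. ga x $ k * t x $ k + a x * T x $ k $ k) = t x \<bullet> ga x + a x * trace (T x)" for x
    by (simp add: sum.distrib inner_nth_sum trace_def sum_distrib_left mult.commute)
  show ?thesis
    unfolding eq[symmetric]
  proof (rule integral_divergence_off_0[OF pd])
    show "integrable lborel (\<lambda>x. \<Sum>k\<in>UNIV. ga x $ k * t x $ k + a x * T x $ k $ k)"
      unfolding eq by (intro Bochner_Integration.integrable_add t_ga_integrable a_trace_integrable)
    show "integrable lborel (\<lambda>x. a x * t x $ k / norm x)" for k
    proof (rule integrable_product_AM_GM[OF w_over_x_L2 w_over_x_L2, where C = 1])
      have [measurable]: "(\<lambda>x. t x $ k) \<in> borel_measurable borel" by (rule pd_measurable(1)[OF pd_t])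
      show "(\<lambda>x. a x * t x $ k / norm x) \<in> borel_measurable borel" by measurable
      show "AE x in lborel. \<bar>a x * t x $ k / norm x\<bar> \<le> 1 * (norm (v x) / norm x * (norm (v x) / norm x))"
      proof (rule AE_I2)
        fix x
        have "\<bar>t x $ k / norm x\<bar> \<le> norm (v x) / norm x"
          using order_trans[OF component_le_norm_cart norm_t_le] by (simp add: divide_right_mono)
        then have "\<bar>a x\<bar> * \<bar>t x $ k / norm x\<bar> \<le> norm (v x) / norm x * (norm (v x) / norm x)"
          unfolding a_def by (intro mult_mono radial_coeff_bound) auto
        then show "\<bar>a x * t x $ k / norm x\<bar> \<le> 1 * (norm (v x) / norm x * (norm (v x) / norm x))"
          by (simp add: abs_mult)
      qed
    qed
  qed
qed

text \<open>In \<open>J = T + X\<close> the matrix \<open>X\<close> is the Jacobian of the normal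
  part; its square is discarded, and the mixed term is \<open>2 (a tr T - t \<bullet> ga)\<close>.
  Adding the divergence of \<open>a t\<close> turns this into \<open>4 a tr T\<close>. No derivative
  of \<open>a\<close> is left, which matters because only \<open>a\<close> itself will be under
  control in the limit.\<close>

lemma tangential_inequality_pointwise:
  assumes \<alpha>: "\<alpha>\<^sup>2 + \<alpha> * (real CARD('n) - 2) = 2" and l: "l > 0" and x: "x \<noteq> 0"
  shows "- 2 * (t x \<bullet> ga x + a x * trace (T x))
    - l * (real CARD('n) * (t x \<bullet> t x) + 2 * (t x \<bullet> (T x *v x)))
    + (\<alpha> - 1 / (real CARD('n) - 2)) * (((real CARD('n) - 2) * (t x \<bullet> t x) + 2 * (t x \<bullet> (T x *v x))) / (x \<bullet> x))
    + 1 / (real CARD('n) - 2) * ((trace (T x))\<^sup>2 - T x \<bullet> transpose (T x))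
    \<le> (norm (J x))\<^sup>2 + l\<^sup>2 * (norm x * norm (v x))\<^sup>2
      - l * (real CARD('n) + 2 * \<alpha>) * ((norm (v x))\<^sup>2 - (norm x * a x)\<^sup>2) - 4 * (a x * trace (T x))"
proof -
  define X where "X = outer x (ga x) + a x *\<^sub>R (mat 1 :: real^'n^'n)"
  have "J x = T x + X" by (simp add: T_def X_def)
  then have "J x \<bullet> J x = T x \<bullet> T x + 2 * (T x \<bullet> X) + X \<bullet> X"
    by (simp add: inner_add_left inner_add_right inner_commute[of X "T x"])
  moreover have "T x \<bullet> X = - (t x \<bullet> ga x) + a x * trace (T x)"
    using inner_transpose_mult_vec[of "T x" x "ga x"]
    by (simp add: X_def inner_add_right inner_outer inner_mat_1 transpose_T_x[OF x])
  ultimately have 1: "J x \<bullet> J x \<ge> T x \<bullet> T x - 2 * (t x \<bullet> ga x) + 2 * (a x * trace (T x))" by simp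
  have 2: "(norm (v x))\<^sup>2 - (norm x * a x)\<^sup>2 = t x \<bullet> t x"
    using norm_v_split[of x] by (simp add: power2_norm_eq_inner)
  have "l\<^sup>2 * (x \<bullet> x) * (t x \<bullet> t x) \<le> l\<^sup>2 * (norm x * norm (v x))\<^sup>2"
    using norm_t_le[of x] l
    by (auto simp: power_mult_distrib mult.assoc power2_norm_eq_inner[symmetric] intro!: mult_left_mono power_mono)
  with 1 tangential_pointwise[OF dim x x_t transpose_T_x[OF x] \<alpha>, of l]
  show ?thesis unfolding 2 by (simp add: power2_norm_eq_inner[of "J x"])
qed

text \<open>All expressions in \<open>?L\<close> integrate to 0. A field with a normal part leaves
  two defects: its normal mass, and the pairing of \<open>a\<close> with the divergence of the
  tangential part. Both are absent for a tangential field.\<close>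

theorem tangential_inequality:
  assumes \<alpha>: "\<alpha>\<^sup>2 + \<alpha> * (real CARD('n) - 2) = 2" and l: "l > 0"
  shows "l * (real CARD('n) + 2 * \<alpha>) * ((\<integral>x. (norm (v x))\<^sup>2 \<partial>lborel) - (\<integral>x. (norm x * a x)\<^sup>2 \<partial>lborel))
    \<le> (\<integral>x. (norm (J x))\<^sup>2 \<partial>lborel) + l\<^sup>2 * (\<integral>x. (norm x * norm (v x))\<^sup>2 \<partial>lborel)
      - 4 * (\<integral>x. a x * trace (T x) \<partial>lborel)"
proof -
  have ra: "integrable lborel (\<lambda>x. (norm x * a x)\<^sup>2)"
  proof (rule integrable_square_dominated[OF w_L2, where C = 1])
    have "(norm x * a x)\<^sup>2 \<le> (norm (v x))\<^sup>2" for x using norm_v_split[of x] by simp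
    then show "\<bar>norm x * a x\<bar> \<le> 1 * norm (v x)" for x
      by (metis abs_le_square_iff abs_norm_cancel mult_1)
  qed measurable
  let ?L = "\<lambda>x. - 2 * (t x \<bullet> ga x + a x * trace (T x))
    - l * (real CARD('n) * (t x \<bullet> t x) + 2 * (t x \<bullet> (T x *v x)))
    + (\<alpha> - 1 / (real CARD('n) - 2)) * (((real CARD('n) - 2) * (t x \<bullet> t x) + 2 * (t x \<bullet> (T x *v x))) / (x \<bullet> x))
    + 1 / (real CARD('n) - 2) * ((trace (T x))\<^sup>2 - T x \<bullet> transpose (T x))"
  let ?R = "\<lambda>x. (norm (J x))\<^sup>2 + l\<^sup>2 * (norm x * norm (v x))\<^sup>2
      - l * (real CARD('n) + 2 * \<alpha>) * ((norm (v x))\<^sup>2 - (norm x * a x)\<^sup>2) - 4 * (a x * trace (T x))"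
  note 1 = Bochner_Integration.integrable_add[OF t_ga_integrable a_trace_integrable]
  note 2 = Bochner_Integration.integrable_add[OF integrable_mult_right[OF t.w_sq] integrable_mult_right[OF t.radial_integrable], of "real CARD('n)" 2]
  note 3 = t.radial_over_divergence_integrable
  note 4 = Bochner_Integration.integrable_diff[OF t.trace_square_integrable t.inner_transpose_integrable]
  note 5 = Bochner_Integration.integrable_diff[OF w_L2 ra]
  have iL: "integrable lborel ?L"
    by (intro Bochner_Integration.integrable_add Bochner_Integration.integrable_diff integrable_mult_right 1 2 3 4)
  have iR: "integrable lborel ?R"
    by (intro Bochner_Integration.integrable_add Bochner_Integration.integrable_diff integrable_mult_right
        W_L2 xw_L2 w_L2 ra a_trace_integrable)
  have L: "(\<integral>x. ?L x \<partial>lborel) = - 2 * (\<integral>x. t x \<bullet> ga x + a x * trace (T x) \<partial>lborel)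
    - l * (\<integral>x. real CARD('n) * (t x \<bullet> t x) + 2 * (t x \<bullet> (T x *v x)) \<partial>lborel)
    + (\<alpha> - 1 / (real CARD('n) - 2)) * (\<integral>x. ((real CARD('n) - 2) * (t x \<bullet> t x) + 2 * (t x \<bullet> (T x *v x))) / (x \<bullet> x) \<partial>lborel)
    + 1 / (real CARD('n) - 2) * (\<integral>x. (trace (T x))\<^sup>2 - T x \<bullet> transpose (T x) \<partial>lborel)"
    by (simp only: Bochner_Integration.integral_add Bochner_Integration.integral_diff integral_mult_right_zero
        Bochner_Integration.integrable_add Bochner_Integration.integrable_diff integrable_mult_right
        t_ga_integrable a_trace_integrable t.w_sq t.radial_integrable 3 t.trace_square_integrable t.inner_transpose_integrable)
  have R: "(\<integral>x. ?R x \<partial>lborel) = (\<integral>x. (norm (J x))\<^sup>2 \<partial>lborel) + l\<^sup>2 * (\<integral>x. (norm x * norm (v x))\<^sup>2 \<partial>lborel)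
      - l * (real CARD('n) + 2 * \<alpha>) * ((\<integral>x. (norm (v x))\<^sup>2 \<partial>lborel) - (\<integral>x. (norm x * a x)\<^sup>2 \<partial>lborel))
      - 4 * (\<integral>x. a x * trace (T x) \<partial>lborel)"
    by (simp only: Bochner_Integration.integral_add Bochner_Integration.integral_diff integral_mult_right_zero
        Bochner_Integration.integrable_add Bochner_Integration.integrable_diff integrable_mult_right
        W_L2 xw_L2 w_L2 ra a_trace_integrable)
  have "(\<integral>x. ?L x \<partial>lborel) \<le> (\<integral>x. ?R x \<partial>lborel)"
  proof (rule integral_mono_AE[OF iL iR])
    show "AE x in lborel. ?L x \<le> ?R x"
      using AE_lborel_singleton[where c = 0] by eventually_elim (rule tangential_inequality_pointwise[OF \<alpha> l])
  qed
  then show ?thesis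
    unfolding L R by (simp add: divergence_a_t t.divergence_radial t.divergence_radial_over t.divergence_trace[OF pd_T T2_sym])
qed

end

subsection \<open>Transforms of test fields\<close>

definition cosT :: "(real^'n \<Rightarrow> real^'n) \<Rightarrow> real^'n \<Rightarrow> real^'n" where
  "cosT \<phi> x = (\<chi> j. CT (\<lambda>\<xi>. \<phi> \<xi> $ j) x)"

definition sinT :: "(real^'n \<Rightarrow> real^'n) \<Rightarrow> real^'n \<Rightarrow> real^'n" where
  "sinT \<phi> x = (\<chi> j. ST (\<lambda>\<xi>. \<phi> \<xi> $ j) x)"

definition cosTJ :: "(real^'n \<Rightarrow> real^'n) \<Rightarrow> real^'n \<Rightarrow> real^'n^'n" where
  "cosTJ \<phi> x = (\<chi> j k. - ST (\<lambda>\<xi>. (\<xi> \<bullet> axis k 1) * \<phi> \<xi> $ j) x)"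

definition sinTJ :: "(real^'n \<Rightarrow> real^'n) \<Rightarrow> real^'n \<Rightarrow> real^'n^'n" where
  "sinTJ \<phi> x = (\<chi> j k. CT (\<lambda>\<xi>. (\<xi> \<bullet> axis k 1) * \<phi> \<xi> $ j) x)"

lemma pd_CT: "moments w \<Longrightarrow> pd k (CT w) (\<lambda>x. - ST (\<lambda>\<xi>. (\<xi> \<bullet> axis k 1) * w \<xi>) x)"
  using has_derivative_line[where s = 0, simplified, OF CT_has_derivative]
  by (auto simp: pd_def intro!: CT_continuous ST_continuous continuous_intros moments_inner)

lemma pd_ST: "moments w \<Longrightarrow> pd k (ST w) (\<lambda>x. CT (\<lambda>\<xi>. (\<xi> \<bullet> axis k 1) * w \<xi>) x)"
  using has_derivative_line[where s = 0, simplified, OF ST_has_derivative]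
  by (auto simp: pd_def intro!: CT_continuous ST_continuous continuous_intros moments_inner)

lemma pd_minus: "pd k f f' \<Longrightarrow> pd k (\<lambda>x. - f x) (\<lambda>x. - f' x)"
  using pd_cmult[of k f f' "-1"] by simp

text \<open>Boundedness is used in the unit ball, where \<open>1/|x|^2\<close> is integrable from
  dimension 3 on, and square integrability outside. The Gaussian serves as a majorant, up to the
  factor \<open>exp 1\<close>, of the indicator of the ball.\<close>

lemma integrable_square_over:
  fixes v :: "real^'n \<Rightarrow> real^'n"
  assumes N: "CARD('n) \<ge> 3" and [measurable]: "v \<in> borel_measurable borel"
    and v2: "integrable lborel (\<lambda>x. (norm (v x))\<^sup>2)" and bd: "\<And>x. norm (v x) \<le> B"
  shows "integrable lborel (\<lambda>x. (norm (v x) / norm x)\<^sup>2)"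
proof (rule Bochner_Integration.integrable_bound)
  show "integrable lborel (\<lambda>x::real^'n. (B\<^sup>2 * exp 1) * (gauss 1 x / (x \<bullet> x)) + (norm (v x))\<^sup>2)"
    using N by (intro Bochner_Integration.integrable_add integrable_mult_right gauss_inverse_square_integrable v2) simp
  show "AE x in lborel. norm ((norm (v x) / norm x)\<^sup>2) \<le> norm ((B\<^sup>2 * exp 1) * (gauss 1 x / (x \<bullet> x)) + (norm (v x))\<^sup>2)"
  proof (rule AE_I2)
    fix x :: "real^'n"
    define R where "R = x \<bullet> x"
    have R0: "R \<ge> 0" by (simp add: R_def)
    have eq: "(norm (v x) / norm x)\<^sup>2 = (norm (v x))\<^sup>2 / R"
      by (simp add: power_divide power2_norm_eq_inner R_def)
    have nn: "0 \<le> (B\<^sup>2 * exp 1) * (gauss 1 x / R)" using R0 gauss_pos[of 1 x] by simp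
    have "(norm (v x))\<^sup>2 / R \<le> (B\<^sup>2 * exp 1) * (gauss 1 x / R) + (norm (v x))\<^sup>2"
    proof (cases "R \<ge> 1")
      case True
      then have "(norm (v x))\<^sup>2 / R \<le> (norm (v x))\<^sup>2" by (simp add: divide_le_eq mult_left_mono[of 1 R "(norm (v x))\<^sup>2", simplified])
      with nn show ?thesis by linarith
    next
      case False
      have "1 \<le> exp 1 * gauss 1 x" using False by (simp add: gauss_def R_def flip: exp_add)
      moreover have "(norm (v x))\<^sup>2 \<le> B\<^sup>2" using bd by (intro power_mono) auto
      ultimately have "(norm (v x))\<^sup>2 * 1 \<le> B\<^sup>2 * (exp 1 * gauss 1 x)"
        by (intro mult_mono) auto
      then have "(norm (v x))\<^sup>2 / R \<le> B\<^sup>2 * (exp 1 * gauss 1 x) / R"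
        using R0 by (intro divide_right_mono) auto
      then have "(norm (v x))\<^sup>2 / R \<le> (B\<^sup>2 * exp 1) * (gauss 1 x / R)" by (simp add: mult_ac)
      then show ?thesis by (simp add: add_increasing2)
    qed
    with nn show "norm ((norm (v x) / norm x)\<^sup>2) \<le> norm ((B\<^sup>2 * exp 1) * (gauss 1 x / (x \<bullet> x)) + (norm (v x))\<^sup>2)"
      unfolding eq R_def[symmetric] using R0 by simp
  qed
qed measurable

lemma norm_vec_square: "(norm (y::real^'n))\<^sup>2 = (\<Sum>j\<in>UNIV. (y $ j)\<^sup>2)"
  unfolding power2_norm_eq_inner by (simp add: inner_vec_def power2_eq_square)

lemma norm_mat_square: "(norm (A::real^'m^'n))\<^sup>2 = (\<Sum>j\<in>UNIV. \<Sum>k\<in>UNIV. (A $ j $ k)\<^sup>2)"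
  unfolding power2_norm_eq_inner by (simp add: inner_vec_def power2_eq_square)

definition compactly_supported :: "(real^'n \<Rightarrow> real) \<Rightarrow> bool" where
  "compactly_supported w \<longleftrightarrow> continuous_on UNIV w \<and> (\<exists>B. \<forall>x. norm x > B \<longrightarrow> w x = 0)"

lemma Plancherel_compactly_supported:
  fixes w :: "real^'n \<Rightarrow> real"
  assumes "compactly_supported w"
  shows "integrable lborel (power_spectrum w)"
    and "(\<integral>x. power_spectrum w x \<partial>lborel) = (2 * pi) ^ CARD('n) * (\<integral>x. (w x)\<^sup>2 \<partial>lborel)"
    and "integrable lborel (\<lambda>x. (w x)\<^sup>2)"
proof -
  obtain B where c: "continuous_on UNIV w" and B: "\<And>x. norm x > B \<Longrightarrow> w x = 0"
    using assms by (auto simp: compactly_supported_def)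
  have "compact (w ` cball 0 B)"
    using c by (intro compact_continuous_image) (auto intro: continuous_on_subset)
  then obtain C where C: "\<And>y. y \<in> w ` cball 0 B \<Longrightarrow> \<bar>y\<bar> \<le> C"
    using compact_imp_bounded bounded_real by metis
  have bd: "\<bar>w x\<bar> \<le> max C 0" for x
    using C[of "w x"] B[of x] by (cases "norm x \<le> B") (auto simp: le_max_iff_disj)
  have i: "integrable lborel w" by (rule integrable_continuous_bounded_support[OF c B])
  show "integrable lborel (power_spectrum w)"
    and "(\<integral>x. power_spectrum w x \<partial>lborel) = (2 * pi) ^ CARD('n) * (\<integral>x. (w x)\<^sup>2 \<partial>lborel)"
    using Plancherel[OF i c bd] by auto
  show "integrable lborel (\<lambda>x. (w x)\<^sup>2)"
    by (rule integrable_continuous_bounded_support[where B = B]) (use c B in \<open>auto intro!: continuous_intros\<close>)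
qed

locale test_field_loc =
  fixes \<phi> :: "real^'n \<Rightarrow> real^'n"
  assumes test: "test_field \<phi>"
begin

lemma smooth: "smooth_fun (\<lambda>x. \<phi> x $ j)"
  using test by (simp add: test_field_def)

lemma support: obtains B where "\<And>x. norm x > B \<Longrightarrow> \<phi> x = 0"
proof -
  have "bounded (closure {x. \<phi> x \<noteq> 0})" using test by (auto simp: test_field_def compact_imp_bounded)
  then obtain B where B: "\<And>x. x \<in> closure {x. \<phi> x \<noteq> 0} \<Longrightarrow> norm x \<le> B" by (auto simp: bounded_iff)
  then have "\<phi> x = 0" if "norm x > B" for x
    using that closure_subset[of "{x. \<phi> x \<noteq> 0}"] by force
  then show ?thesis using that by blast
qed

definition "dphi k j x = jac \<phi> x $ j $ k"

lemma partial_eq: "dphi k j x = frechet_derivative (\<lambda>y. \<phi> y $ j) (at x) (axis k 1)"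
  by (simp add: dphi_def jac_def)

lemma partial_smooth: "smooth_fun (dphi k j)"
  using smooth_fun_frechet[OF smooth, of "axis k 1" j] by (simp add: partial_eq[abs_def] axis_in_Basis_iff)

lemma partial_line: "((\<lambda>s. \<phi> (x + s *\<^sub>R axis k 1) $ j) has_real_derivative dphi k j x) (at 0)"
  using has_derivative_line[of "\<lambda>y. \<phi> y $ j" _ x 0 "axis k 1"] smooth_fun_has_derivative[OF smooth, of j x]
  by (simp add: partial_eq)

lemma partial_support:
  assumes B: "\<And>x. norm x > B \<Longrightarrow> \<phi> x = 0" and x: "norm x > B"
  shows "dphi k j x = 0"
proof -
  have "((\<lambda>y. \<phi> y $ j) has_derivative (\<lambda>_. 0)) (at x)"
  proof (rule has_derivative_transform_within_open[where s = "{y. norm y > B}"])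
    show "((\<lambda>y. 0) has_derivative (\<lambda>_. 0)) (at x)" by simp
    show "open {y::real^'n. norm y > B}" by (intro open_Collect_less continuous_intros)
  qed (use x B in auto)
  then show ?thesis unfolding partial_eq using frechet_derivative_at by metis
qed

lemma cont: "continuous_on UNIV (\<lambda>x. \<phi> x $ j)" "continuous_on UNIV (dphi k j)"
  by (rule smooth_fun_continuous smooth partial_smooth)+

lemma mom: "moments (\<lambda>x. \<phi> x $ j)" and mom_partial: "moments (dphi k j)"
proof -
  obtain B where B: "\<And>x. norm x > B \<Longrightarrow> \<phi> x = 0" using support by blast
  show "moments (\<lambda>x. \<phi> x $ j)"
    by (rule moments_continuous_bounded_support[OF cont(1), of B]) (simp add: B)
  show "moments (dphi k j)"
    by (rule moments_continuous_bounded_support[OF cont(2) partial_support[OF B]])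
qed

lemma mom_xk: "moments (\<lambda>\<xi>. (\<xi> \<bullet> axis k 1) * \<phi> \<xi> $ j)"
  by (rule moments_inner[OF mom])

lemma compactly_supported: "compactly_supported (\<lambda>x. \<phi> x $ j)" "compactly_supported (dphi k j)"
  "compactly_supported (\<lambda>x. (x \<bullet> axis k 1) * \<phi> x $ j)"
proof -
  obtain B where B: "\<And>x. norm x > B \<Longrightarrow> \<phi> x = 0" using support by blast
  show "compactly_supported (\<lambda>x. \<phi> x $ j)" "compactly_supported (dphi k j)"
    "compactly_supported (\<lambda>x. (x \<bullet> axis k 1) * \<phi> x $ j)"
    unfolding compactly_supported_def using B partial_support[OF B]
    by (auto intro!: cont continuous_intros exI[of _ B])
qed

lemmas Plancherel_phi = Plancherel_compactly_supported[OF compactly_supported(1)]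
lemmas Plancherel_partial = Plancherel_compactly_supported[OF compactly_supported(2)]
lemmas Plancherel_xk = Plancherel_compactly_supported[OF compactly_supported(3)]

definition "divergence x = (\<Sum>j\<in>UNIV. dphi j j x)"

lemma divergence_smooth: "smooth_fun divergence"
  unfolding divergence_def[abs_def] by (intro smooth_fun_sum partial_smooth)

lemma divergence_trace: "divergence x = trace (jac \<phi> x)"
  by (simp add: divergence_def dphi_def trace_def)

lemma divergence_compactly_supported: "compactly_supported divergence"
proof -
  obtain B where B: "\<And>x. norm x > B \<Longrightarrow> \<phi> x = 0" using support by blast
  then show ?thesis
    unfolding compactly_supported_def using smooth_fun_continuous[OF divergence_smooth]
    by (auto intro!: exI[of _ B] simp: divergence_def partial_support[OF B])
qed

lemmas Plancherel_divergence = Plancherel_compactly_supported[OF divergence_compactly_supported]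

lemma CT_ST_partial:
  "ST (dphi k j) x = - (x $ k) * CT (\<lambda>\<xi>. \<phi> \<xi> $ j) x"
  "CT (dphi k j) x = x $ k * ST (\<lambda>\<xi>. \<phi> \<xi> $ j) x"
proof -
  note i = moments_integrable[OF mom[of j]] moments_integrable[OF mom_partial[of k j]]
  have ax: "x \<bullet> axis k 1 = x $ k" by (simp add: inner_axis)
  have "(\<integral>\<xi>. x $ k * (cos (x \<bullet> \<xi>) * \<phi> \<xi> $ j) + sin (x \<bullet> \<xi>) * dphi k j \<xi> \<partial>lborel) = 0"
  proof (rule integral_directional_derivative[where f = "\<lambda>\<xi>. sin (x \<bullet> \<xi>) * \<phi> \<xi> $ j" and h = "axis k 1"])
    show "((\<lambda>s. sin (x \<bullet> (\<xi> + s *\<^sub>R axis k 1)) * \<phi> (\<xi> + s *\<^sub>R axis k 1) $ j) has_real_derivative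
         x $ k * (cos (x \<bullet> \<xi>) * \<phi> \<xi> $ j) + sin (x \<bullet> \<xi>) * dphi k j \<xi>) (at 0)" for \<xi>
      unfolding inner_add_right inner_scaleR_right ax
      by (rule derivative_eq_intros partial_line refl)+ simp
  qed (auto intro!: Bochner_Integration.integrable_add integrable_mult_right CT_integrable ST_integrable i continuous_intros cont)
  then show "ST (dphi k j) x = - (x $ k) * CT (\<lambda>\<xi>. \<phi> \<xi> $ j) x"
    by (simp add: ST_def CT_def Bochner_Integration.integral_add integrable_mult_right CT_integrable ST_integrable i)
  have "(\<integral>\<xi>. - (x $ k) * (sin (x \<bullet> \<xi>) * \<phi> \<xi> $ j) + cos (x \<bullet> \<xi>) * dphi k j \<xi> \<partial>lborel) = 0"
  proof (rule integral_directional_derivative[where f = "\<lambda>\<xi>. cos (x \<bullet> \<xi>) * \<phi> \<xi> $ j" and h = "axis k 1"])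
    show "((\<lambda>s. cos (x \<bullet> (\<xi> + s *\<^sub>R axis k 1)) * \<phi> (\<xi> + s *\<^sub>R axis k 1) $ j) has_real_derivative
         - (x $ k) * (sin (x \<bullet> \<xi>) * \<phi> \<xi> $ j) + cos (x \<bullet> \<xi>) * dphi k j \<xi>) (at 0)" for \<xi>
      unfolding inner_add_right inner_scaleR_right ax
      by (rule derivative_eq_intros partial_line refl)+ simp
  qed (auto intro!: Bochner_Integration.integrable_diff Bochner_Integration.integrable_add integrable_mult_right CT_integrable ST_integrable i continuous_intros cont)
  then show "CT (dphi k j) x = x $ k * ST (\<lambda>\<xi>. \<phi> \<xi> $ j) x"
    by (simp add: ST_def CT_def Bochner_Integration.integral_add integrable_mult_right CT_integrable ST_integrable i)
qed

section \<open>Norms of the transforms\<close>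

lemma spectrum_phi: "(norm (cosT \<phi> x))\<^sup>2 + (norm (sinT \<phi> x))\<^sup>2 = (\<Sum>j\<in>UNIV. power_spectrum (\<lambda>x. \<phi> x $ j) x)"
  by (simp add: norm_vec_square cosT_def sinT_def power_spectrum_def sum.distrib)

lemma spectrum_xk: "(norm (cosTJ \<phi> x))\<^sup>2 + (norm (sinTJ \<phi> x))\<^sup>2
    = (\<Sum>j\<in>UNIV. \<Sum>k\<in>UNIV. power_spectrum (\<lambda>x. (x \<bullet> axis k 1) * \<phi> x $ j) x)"
  by (simp add: norm_mat_square cosTJ_def sinTJ_def power_spectrum_def sum.distrib)

lemma spectrum_partial: "(norm x * norm (cosT \<phi> x))\<^sup>2 + (norm x * norm (sinT \<phi> x))\<^sup>2
    = (\<Sum>j\<in>UNIV. \<Sum>k\<in>UNIV. power_spectrum (dphi k j) x)"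
  unfolding power_spectrum_def CT_ST_partial
  by (simp add: norm_vec_square cosT_def sinT_def power_mult_distrib sum_product sum.distrib)
    (simp add: sum.swap[of "\<lambda>i j. (x $ i)\<^sup>2 * _ j"])

lemma spectrum_divergence: "(x \<bullet> cosT \<phi> x)\<^sup>2 + (x \<bullet> sinT \<phi> x)\<^sup>2 = power_spectrum divergence x"
proof -
  have i: "integrable lborel (dphi k j)" for k j by (rule moments_integrable[OF mom_partial])
  have "ST divergence x = (\<Sum>j\<in>UNIV. ST (dphi j j) x)"
    unfolding ST_def divergence_def sum_distrib_left
    by (intro Bochner_Integration.integral_sum ST_integrable i)
  moreover have "CT divergence x = (\<Sum>j\<in>UNIV. CT (dphi j j) x)"
    unfolding CT_def divergence_def sum_distrib_left
    by (intro Bochner_Integration.integral_sum CT_integrable i)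
  ultimately show ?thesis
    by (simp add: power_spectrum_def CT_ST_partial inner_vec_def cosT_def sinT_def sum_negf)
qed

lemma transform_measurable[measurable]: "cosT \<phi> \<in> borel_measurable borel" "sinT \<phi> \<in> borel_measurable borel"
  "cosTJ \<phi> \<in> borel_measurable borel" "sinTJ \<phi> \<in> borel_measurable borel"
  using moments_measurable[OF mom] moments_measurable[OF mom_xk]
  by (auto simp: cosT_def sinT_def cosTJ_def sinTJ_def intro!: borel_measurable_vec CT_measurable ST_measurable borel_measurable_uminus)

lemma pair_integrable:
  assumes "integrable lborel (\<lambda>x. (f x)\<^sup>2 + (g x)\<^sup>2)" and [measurable]: "f \<in> borel_measurable borel" "g \<in> borel_measurable borel"
  shows "integrable lborel (\<lambda>x::real^'n. (f x)\<^sup>2 :: real)" "integrable lborel (\<lambda>x. (g x)\<^sup>2 :: real)"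
  by (rule Bochner_Integration.integrable_bound[OF assms(1)]; simp)+

text \<open>Plancherel's identity determines the sum of the contributions of cosine and sine
  transform; the integrability of each follows by domination. The inequalities for the two
  transforms are therefore added before they are translated back.\<close>

lemma L2_phi: "integrable lborel (\<lambda>x. (norm (cosT \<phi> x))\<^sup>2)" "integrable lborel (\<lambda>x. (norm (sinT \<phi> x))\<^sup>2)"
  "(\<integral>x. (norm (cosT \<phi> x))\<^sup>2 \<partial>lborel) + (\<integral>x. (norm (sinT \<phi> x))\<^sup>2 \<partial>lborel) = (2 * pi) ^ CARD('n) * (\<integral>x. (norm (\<phi> x))\<^sup>2 \<partial>lborel)"
proof -
  have i: "integrable lborel (\<lambda>x. (norm (cosT \<phi> x))\<^sup>2 + (norm (sinT \<phi> x))\<^sup>2)"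
    unfolding spectrum_phi by (intro Bochner_Integration.integrable_sum Plancherel_phi)
  show p: "integrable lborel (\<lambda>x. (norm (cosT \<phi> x))\<^sup>2)" "integrable lborel (\<lambda>x. (norm (sinT \<phi> x))\<^sup>2)"
    by (rule pair_integrable[OF i]; measurable)+
  show "(\<integral>x. (norm (cosT \<phi> x))\<^sup>2 \<partial>lborel) + (\<integral>x. (norm (sinT \<phi> x))\<^sup>2 \<partial>lborel) = (2 * pi) ^ CARD('n) * (\<integral>x. (norm (\<phi> x))\<^sup>2 \<partial>lborel)"
    unfolding Bochner_Integration.integral_add[OF p, symmetric] spectrum_phi unfolding norm_vec_square
    by (simp add: Bochner_Integration.integral_sum Plancherel_phi sum_distrib_left)
qed

lemma L2_xk: "integrable lborel (\<lambda>x. (norm (cosTJ \<phi> x))\<^sup>2)" "integrable lborel (\<lambda>x. (norm (sinTJ \<phi> x))\<^sup>2)"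
  "(\<integral>x. (norm (cosTJ \<phi> x))\<^sup>2 \<partial>lborel) + (\<integral>x. (norm (sinTJ \<phi> x))\<^sup>2 \<partial>lborel) = (2 * pi) ^ CARD('n) * (\<integral>x. (norm (norm x *\<^sub>R \<phi> x))\<^sup>2 \<partial>lborel)"
proof -
  have i: "integrable lborel (\<lambda>x. (norm (cosTJ \<phi> x))\<^sup>2 + (norm (sinTJ \<phi> x))\<^sup>2)"
    unfolding spectrum_xk by (intro Bochner_Integration.integrable_sum Plancherel_xk)
  show p: "integrable lborel (\<lambda>x. (norm (cosTJ \<phi> x))\<^sup>2)" "integrable lborel (\<lambda>x. (norm (sinTJ \<phi> x))\<^sup>2)"
    by (rule pair_integrable[OF i]; measurable)+
  have "(norm (norm x *\<^sub>R \<phi> x))\<^sup>2 = (\<Sum>j\<in>UNIV. \<Sum>k\<in>UNIV. ((x \<bullet> axis k 1) * \<phi> x $ j)\<^sup>2)" for x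
    by (simp add: power_mult_distrib norm_vec_square inner_axis sum_product) (rule sum.swap)
  then show "(\<integral>x. (norm (cosTJ \<phi> x))\<^sup>2 \<partial>lborel) + (\<integral>x. (norm (sinTJ \<phi> x))\<^sup>2 \<partial>lborel) = (2 * pi) ^ CARD('n) * (\<integral>x. (norm (norm x *\<^sub>R \<phi> x))\<^sup>2 \<partial>lborel)"
    unfolding Bochner_Integration.integral_add[OF p, symmetric] spectrum_xk
    by (simp add: Bochner_Integration.integral_sum Plancherel_xk Bochner_Integration.integrable_sum sum_distrib_left)
qed

lemma L2_partial: "integrable lborel (\<lambda>x. (norm x * norm (cosT \<phi> x))\<^sup>2)" "integrable lborel (\<lambda>x. (norm x * norm (sinT \<phi> x))\<^sup>2)"
  "(\<integral>x. (norm x * norm (cosT \<phi> x))\<^sup>2 \<partial>lborel) + (\<integral>x. (norm x * norm (sinT \<phi> x))\<^sup>2 \<partial>lborel) = (2 * pi) ^ CARD('n) * (\<integral>x. (norm (jac \<phi> x))\<^sup>2 \<partial>lborel)"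
proof -
  have i: "integrable lborel (\<lambda>x. (norm x * norm (cosT \<phi> x))\<^sup>2 + (norm x * norm (sinT \<phi> x))\<^sup>2)"
    unfolding spectrum_partial by (intro Bochner_Integration.integrable_sum Plancherel_partial)
  show p: "integrable lborel (\<lambda>x. (norm x * norm (cosT \<phi> x))\<^sup>2)" "integrable lborel (\<lambda>x. (norm x * norm (sinT \<phi> x))\<^sup>2)"
    by (rule pair_integrable[OF i]; measurable)+
  show "(\<integral>x. (norm x * norm (cosT \<phi> x))\<^sup>2 \<partial>lborel) + (\<integral>x. (norm x * norm (sinT \<phi> x))\<^sup>2 \<partial>lborel) = (2 * pi) ^ CARD('n) * (\<integral>x. (norm (jac \<phi> x))\<^sup>2 \<partial>lborel)"
    unfolding Bochner_Integration.integral_add[OF p, symmetric] spectrum_partial unfolding norm_mat_square dphi_def[symmetric]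
    by (simp add: Bochner_Integration.integral_sum Plancherel_partial Bochner_Integration.integrable_sum sum_distrib_left)
qed

lemma L2_divergence: "integrable lborel (\<lambda>x. (x \<bullet> cosT \<phi> x)\<^sup>2)" "integrable lborel (\<lambda>x. (x \<bullet> sinT \<phi> x)\<^sup>2)"
  "(\<integral>x. (x \<bullet> cosT \<phi> x)\<^sup>2 \<partial>lborel) + (\<integral>x. (x \<bullet> sinT \<phi> x)\<^sup>2 \<partial>lborel) = (2 * pi) ^ CARD('n) * (\<integral>x. (trace (jac \<phi> x))\<^sup>2 \<partial>lborel)"
proof -
  have i: "integrable lborel (\<lambda>x. (x \<bullet> cosT \<phi> x)\<^sup>2 + (x \<bullet> sinT \<phi> x)\<^sup>2)"
    unfolding spectrum_divergence by (rule Plancherel_divergence)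
  show p: "integrable lborel (\<lambda>x. (x \<bullet> cosT \<phi> x)\<^sup>2)" "integrable lborel (\<lambda>x. (x \<bullet> sinT \<phi> x)\<^sup>2)"
    by (rule pair_integrable[OF i]; measurable)+
  show "(\<integral>x. (x \<bullet> cosT \<phi> x)\<^sup>2 \<partial>lborel) + (\<integral>x. (x \<bullet> sinT \<phi> x)\<^sup>2 \<partial>lborel) = (2 * pi) ^ CARD('n) * (\<integral>x. (trace (jac \<phi> x))\<^sup>2 \<partial>lborel)"
    unfolding Bochner_Integration.integral_add[OF p, symmetric] spectrum_divergence divergence_trace[symmetric]
    by (rule Plancherel_divergence)
qed

lemma transform_bounded: obtains B where "\<And>x. norm (cosT \<phi> x) \<le> B" "\<And>x. norm (sinT \<phi> x) \<le> B"
proof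
  fix x
  note i = moments_integrable[OF mom]
  show "norm (cosT \<phi> x) \<le> (\<Sum>j\<in>UNIV. \<integral>\<xi>. \<bar>\<phi> \<xi> $ j\<bar> \<partial>lborel)"
    by (rule order_trans[OF norm_le_l1_cart]) (auto simp: cosT_def intro!: sum_mono CT_bound i)
  show "norm (sinT \<phi> x) \<le> (\<Sum>j\<in>UNIV. \<integral>\<xi>. \<bar>\<phi> \<xi> $ j\<bar> \<partial>lborel)"
    by (rule order_trans[OF norm_le_l1_cart]) (auto simp: sinT_def intro!: sum_mono ST_bound i)
qed

lemma cos_field: 
  assumes "CARD('n) \<ge> 3"
  shows "C2_field (cosT \<phi>) (cosTJ \<phi>) (\<lambda>j k l x. - CT (\<lambda>\<xi>. (\<xi> \<bullet> axis l 1) * ((\<xi> \<bullet> axis k 1) * \<phi> \<xi> $ j)) x)"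
proof (unfold_locales)
  obtain B where B: "\<And>x. norm (cosT \<phi> x) \<le> B" "\<And>x. norm (sinT \<phi> x) \<le> B" using transform_bounded by metis
  show "integrable lborel (\<lambda>x. (norm (cosT \<phi> x) / norm x)\<^sup>2)"
    by (rule integrable_square_over[OF assms _ L2_phi(1) B(1)]) measurable
  show "pd k (\<lambda>x. cosT \<phi> x $ j) (\<lambda>x. cosTJ \<phi> x $ j $ k)" for j k
    using pd_CT[OF mom] by (simp add: cosT_def cosTJ_def)
  show "pd l (\<lambda>x. cosTJ \<phi> x $ j $ k) (\<lambda>x. - CT (\<lambda>\<xi>. (\<xi> \<bullet> axis l 1) * ((\<xi> \<bullet> axis k 1) * \<phi> \<xi> $ j)) x)" for j k l
    using pd_minus[OF pd_ST[OF mom_xk]] by (simp add: cosTJ_def)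
qed (use assms L2_phi(1) L2_partial(1) L2_xk(1) in \<open>simp_all add: mult.left_commute\<close>)

lemma sin_field: 
  assumes "CARD('n) \<ge> 3"
  shows "C2_field (sinT \<phi>) (sinTJ \<phi>) (\<lambda>j k l x. - ST (\<lambda>\<xi>. (\<xi> \<bullet> axis l 1) * ((\<xi> \<bullet> axis k 1) * \<phi> \<xi> $ j)) x)"
proof (unfold_locales)
  obtain B where B: "\<And>x. norm (cosT \<phi> x) \<le> B" "\<And>x. norm (sinT \<phi> x) \<le> B" using transform_bounded by metis
  show "integrable lborel (\<lambda>x. (norm (sinT \<phi> x) / norm x)\<^sup>2)"
    by (rule integrable_square_over[OF assms _ L2_phi(2) B(2)]) measurable
  show "pd k (\<lambda>x. sinT \<phi> x $ j) (\<lambda>x. sinTJ \<phi> x $ j $ k)" for j k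
    using pd_ST[OF mom] by (simp add: sinT_def sinTJ_def)
  show "pd l (\<lambda>x. sinTJ \<phi> x $ j $ k) (\<lambda>x. - ST (\<lambda>\<xi>. (\<xi> \<bullet> axis l 1) * ((\<xi> \<bullet> axis k 1) * \<phi> \<xi> $ j)) x)" for j k l
    using pd_CT[OF mom_xk] by (simp add: sinTJ_def)
qed (use assms L2_phi(2) L2_partial(2) L2_xk(2) in \<open>simp_all add: mult.left_commute\<close>)

end

subsection \<open>Convergence in the space of square integrable functions\<close>

lemma Cauchy_Schwarz_integral:
  fixes f g :: "'a::euclidean_space \<Rightarrow> real"
  assumes f2: "integrable lborel (\<lambda>x. (f x)\<^sup>2)" and g2: "integrable lborel (\<lambda>x. (g x)\<^sup>2)"
    and [measurable]: "f \<in> borel_measurable borel" "g \<in> borel_measurable borel"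
  shows "integrable lborel (\<lambda>x. f x * g x)"
    and "\<bar>\<integral>x. f x * g x \<partial>lborel\<bar> \<le> sqrt (\<integral>x. (f x)\<^sup>2 \<partial>lborel) * sqrt (\<integral>x. (g x)\<^sup>2 \<partial>lborel)"
proof -
  have af: "integrable lborel (\<lambda>x. \<bar>f x\<bar>\<^sup>2)" "integrable lborel (\<lambda>x. \<bar>g x\<bar>\<^sup>2)" using f2 g2 by auto
  show i: "integrable lborel (\<lambda>x. f x * g x)"
    by (rule integrable_product_AM_GM[OF af, where C = 1]) (auto simp: abs_mult)
  define F G P where "F = (\<integral>x. (f x)\<^sup>2 \<partial>lborel)" and "G = (\<integral>x. (g x)\<^sup>2 \<partial>lborel)" and "P = (\<integral>x. f x * g x \<partial>lborel)"
  have q: "0 \<le> F - 2 * s * P + s\<^sup>2 * G" for s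
  proof -
    have "0 \<le> (\<integral>x. (f x - s * g x)\<^sup>2 \<partial>lborel)" by simp
    also have "(\<lambda>x. (f x - s * g x)\<^sup>2) = (\<lambda>x. (f x)\<^sup>2 - (2 * s) * (f x * g x) + s\<^sup>2 * (g x)\<^sup>2)"
      by (simp add: fun_eq_iff power2_eq_square algebra_simps)
    also have "(\<integral>x. (f x)\<^sup>2 - (2 * s) * (f x * g x) + s\<^sup>2 * (g x)\<^sup>2 \<partial>lborel) = F - 2 * s * P + s\<^sup>2 * G"
      unfolding F_def G_def P_def
      by (simp only: Bochner_Integration.integral_add Bochner_Integration.integral_diff integral_mult_right_zero
          Bochner_Integration.integrable_diff integrable_mult_right f2 g2 i)
    finally show ?thesis .
  qed
  have G0: "G \<ge> 0" and F0: "F \<ge> 0" by (simp_all add: G_def F_def)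
  have "P\<^sup>2 \<le> F * G"
  proof (cases "G = 0")
    case True
    have "P = 0"
    proof (rule ccontr)
      assume "P \<noteq> 0"
      then show False using q[of "(F + 1) / (2 * P)"] True by simp
    qed
    then show ?thesis using F0 G0 by simp
  next
    case False
    then have "0 \<le> (F - 2 * (P / G) * P + (P / G)\<^sup>2 * G) * G" using q[of "P / G"] G0 by simp
    also have "\<dots> = F * G - P\<^sup>2" using False by (simp add: field_simps power2_eq_square)
    finally show ?thesis by simp
  qed
  then have "sqrt (P\<^sup>2) \<le> sqrt (F * G)" by (rule real_sqrt_le_mono)
  then show "\<bar>P\<bar> \<le> sqrt F * sqrt G" by (simp add: real_sqrt_mult)
qed

text \<open>Convergence in \<open>in_D\<close> is expressed by nonnegative extended integrals, which
  presuppose no integrability. One index at finite distance makes \<open>g\<close> square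
  integrable, and from then on real integrals can be used.\<close>

lemma L2_convergence:
  fixes f :: "nat \<Rightarrow> 'a::euclidean_space \<Rightarrow> 'b::euclidean_space"
  assumes fm[measurable]: "\<And>k. f k \<in> borel_measurable borel" and gm[measurable]: "g \<in> borel_measurable borel"
    and f2: "\<And>k. integrable lborel (\<lambda>x. (norm (f k x))\<^sup>2)"
    and conv: "(\<lambda>k. \<integral>\<^sup>+x. ennreal ((norm (f k x - g x))\<^sup>2) \<partial>lborel) \<longlonglongrightarrow> 0"
  shows "integrable lborel (\<lambda>x. (norm (g x))\<^sup>2)"
    and "\<And>k. integrable lborel (\<lambda>x. (norm (f k x - g x))\<^sup>2)"
    and "(\<lambda>k. \<integral>x. (norm (f k x - g x))\<^sup>2 \<partial>lborel) \<longlonglongrightarrow> 0"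
    and "(\<lambda>k. \<integral>x. (norm (f k x))\<^sup>2 \<partial>lborel) \<longlonglongrightarrow> (\<integral>x. (norm (g x))\<^sup>2 \<partial>lborel)"
proof -
  have tri: "(norm (p + q))\<^sup>2 \<le> 2 * (norm p)\<^sup>2 + 2 * (norm q)\<^sup>2" for p q :: 'b
  proof -
    have "(norm (p + q))\<^sup>2 \<le> (norm p + norm q)\<^sup>2" by (intro power_mono norm_triangle_ineq) auto
    also have "\<dots> \<le> 2 * (norm p)\<^sup>2 + 2 * (norm q)\<^sup>2"
      using sum_squares_bound[of "norm p" "norm q"] by (simp add: power2_sum)
    finally show ?thesis .
  qed
  have "eventually (\<lambda>k. (\<integral>\<^sup>+x. ennreal ((norm (f k x - g x))\<^sup>2) \<partial>lborel) < 1) sequentially"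
    using conv by (rule order_tendstoD) simp
  then obtain K where K: "(\<integral>\<^sup>+x. ennreal ((norm (f K x - g x))\<^sup>2) \<partial>lborel) < 1"
    by (meson eventually_happens sequentially_bot)
  have iK: "integrable lborel (\<lambda>x. (norm (f K x - g x))\<^sup>2)"
    by (rule integrableI_bounded) (use K in \<open>auto intro: less_trans[OF _ ennreal_one_less_top]\<close>)
  show g2: "integrable lborel (\<lambda>x. (norm (g x))\<^sup>2)"
  proof (rule Bochner_Integration.integrable_bound)
    show "integrable lborel (\<lambda>x. 2 * (norm (f K x))\<^sup>2 + 2 * (norm (f K x - g x))\<^sup>2)"
      by (intro Bochner_Integration.integrable_add integrable_mult_right f2 iK)
    show "AE x in lborel. norm ((norm (g x))\<^sup>2) \<le> norm (2 * (norm (f K x))\<^sup>2 + 2 * (norm (f K x - g x))\<^sup>2)"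
      using tri[of "f K x" "- (f K x - g x)" for x] by (intro AE_I2) (simp add: norm_minus_commute)
  qed measurable
  show d2: "integrable lborel (\<lambda>x. (norm (f k x - g x))\<^sup>2)" for k
  proof (rule Bochner_Integration.integrable_bound)
    show "integrable lborel (\<lambda>x. 2 * (norm (f k x))\<^sup>2 + 2 * (norm (g x))\<^sup>2)"
      by (intro Bochner_Integration.integrable_add integrable_mult_right f2 g2)
    show "AE x in lborel. norm ((norm (f k x - g x))\<^sup>2) \<le> norm (2 * (norm (f k x))\<^sup>2 + 2 * (norm (g x))\<^sup>2)"
      using tri[of "f k x" "- g x" for x] by (intro AE_I2) simp
  qed measurable
  have "(\<integral>\<^sup>+x. ennreal ((norm (f k x - g x))\<^sup>2) \<partial>lborel) = ennreal (\<integral>x. (norm (f k x - g x))\<^sup>2 \<partial>lborel)" for k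
    by (rule nn_integral_eq_integral[OF d2]) simp
  with conv show l: "(\<lambda>k. \<integral>x. (norm (f k x - g x))\<^sup>2 \<partial>lborel) \<longlonglongrightarrow> 0"
    by (simp add: tendsto_ennreal_iff[where x = 0, simplified])
  have i: "integrable lborel (\<lambda>x. g x \<bullet> (f k x - g x))" for k
  proof (rule integrable_product_AM_GM[OF g2 d2, where C = 1])
    show "AE x in lborel. \<bar>g x \<bullet> (f k x - g x)\<bar> \<le> 1 * (norm (g x) * norm (f k x - g x))"
      by (simp add: Cauchy_Schwarz_ineq2)
  qed measurable
  have cross: "(\<lambda>k. \<integral>x. g x \<bullet> (f k x - g x) \<partial>lborel) \<longlonglongrightarrow> 0"
  proof (rule Lim_null_comparison)
    show "eventually (\<lambda>k. norm (\<integral>x. g x \<bullet> (f k x - g x) \<partial>lborel) \<le>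
      sqrt (\<integral>x. (norm (g x))\<^sup>2 \<partial>lborel) * sqrt (\<integral>x. (norm (f k x - g x))\<^sup>2 \<partial>lborel)) sequentially"
    proof (rule always_eventually, rule allI)
      fix k
      have m: "(\<lambda>x. norm (g x)) \<in> borel_measurable borel" "(\<lambda>x. norm (f k x - g x)) \<in> borel_measurable borel" by measurable
      note cs = Cauchy_Schwarz_integral[OF g2 d2[of k] m]
      have "\<bar>\<integral>x. g x \<bullet> (f k x - g x) \<partial>lborel\<bar> \<le> (\<integral>x. \<bar>g x \<bullet> (f k x - g x)\<bar> \<partial>lborel)" by (rule integral_abs_bound)
      also have "\<dots> \<le> (\<integral>x. norm (g x) * norm (f k x - g x) \<partial>lborel)"
        by (intro integral_mono integrable_abs i cs Cauchy_Schwarz_ineq2)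
      finally show "norm (\<integral>x. g x \<bullet> (f k x - g x) \<partial>lborel) \<le>
        sqrt (\<integral>x. (norm (g x))\<^sup>2 \<partial>lborel) * sqrt (\<integral>x. (norm (f k x - g x))\<^sup>2 \<partial>lborel)"
        using cs(2) by simp
    qed
    have "(\<lambda>k. sqrt (\<integral>x. (norm (g x))\<^sup>2 \<partial>lborel) * sqrt (\<integral>x. (norm (f k x - g x))\<^sup>2 \<partial>lborel)) \<longlonglongrightarrow> sqrt (\<integral>x. (norm (g x))\<^sup>2 \<partial>lborel) * sqrt 0"
      by (intro tendsto_intros l)
    then show "(\<lambda>k. sqrt (\<integral>x. (norm (g x))\<^sup>2 \<partial>lborel) * sqrt (\<integral>x. (norm (f k x - g x))\<^sup>2 \<partial>lborel)) \<longlonglongrightarrow> 0" by simp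
  qed
  have "(\<integral>x. (norm (f k x))\<^sup>2 \<partial>lborel) = (\<integral>x. (norm (g x))\<^sup>2 \<partial>lborel) + 2 * (\<integral>x. g x \<bullet> (f k x - g x) \<partial>lborel) + (\<integral>x. (norm (f k x - g x))\<^sup>2 \<partial>lborel)" for k
  proof -
    have "(\<lambda>x. (norm (f k x))\<^sup>2) = (\<lambda>x. (norm (g x))\<^sup>2 + 2 * (g x \<bullet> (f k x - g x)) + (norm (f k x - g x))\<^sup>2)"
      unfolding power2_norm_eq_inner by (simp add: fun_eq_iff inner_diff_left inner_diff_right inner_commute)
    then show ?thesis
      by (simp only: Bochner_Integration.integral_add integral_mult_right_zero Bochner_Integration.integrable_add integrable_mult_right g2 i d2)
  qed
  moreover have "(\<lambda>k. (\<integral>x. (norm (g x))\<^sup>2 \<partial>lborel) + 2 * (\<integral>x. g x \<bullet> (f k x - g x) \<partial>lborel) + (\<integral>x. (norm (f k x - g x))\<^sup>2 \<partial>lborel))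
     \<longlonglongrightarrow> (\<integral>x. (norm (g x))\<^sup>2 \<partial>lborel) + 2 * 0 + 0"
    by (intro tendsto_intros cross l)
  ultimately show "(\<lambda>k. \<integral>x. (norm (f k x))\<^sup>2 \<partial>lborel) \<longlonglongrightarrow> (\<integral>x. (norm (g x))\<^sup>2 \<partial>lborel)" by simp
qed

text \<open>The transform of the limit field is never constructed, so strong convergence on the
  Fourier side is available in this form.\<close>

definition L2_Cauchy :: "(nat \<Rightarrow> 'a::euclidean_space \<Rightarrow> 'b::euclidean_space) \<Rightarrow> bool" where
  "L2_Cauchy f \<longleftrightarrow> (\<forall>e>0. \<exists>K. \<forall>k\<ge>K. \<forall>m\<ge>K. (\<integral>x. (norm (f k x - f m x))\<^sup>2 \<partial>lborel) < e)"

lemma L2_convergence_Cauchy: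
  fixes f :: "nat \<Rightarrow> 'a::euclidean_space \<Rightarrow> 'b::euclidean_space"
  assumes fm[measurable]: "\<And>k. f k \<in> borel_measurable borel" and gm[measurable]: "g \<in> borel_measurable borel"
    and f2: "\<And>k. integrable lborel (\<lambda>x. (norm (f k x))\<^sup>2)"
    and conv: "(\<lambda>k. \<integral>\<^sup>+x. ennreal ((norm (f k x - g x))\<^sup>2) \<partial>lborel) \<longlonglongrightarrow> 0"
  shows "L2_Cauchy f"
  unfolding L2_Cauchy_def
proof (intro allI impI)
  fix e :: real assume e: "e > 0"
  note L = L2_convergence[OF fm gm f2 conv]
  obtain K where K: "\<And>k. k \<ge> K \<Longrightarrow> (\<integral>x. (norm (f k x - g x))\<^sup>2 \<partial>lborel) < e / 4"
    using order_tendstoD(2)[OF L(3), of "e / 4"] e by (auto simp: eventually_sequentially)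
  have "(\<integral>x. (norm (f k x - f m x))\<^sup>2 \<partial>lborel) < e" if "k \<ge> K" "m \<ge> K" for k m
  proof -
    have tri: "(norm (f k x - f m x))\<^sup>2 \<le> 2 * (norm (f k x - g x))\<^sup>2 + 2 * (norm (f m x - g x))\<^sup>2" for x
    proof -
      have "norm (f k x - f m x) \<le> norm (f k x - g x) + norm (f m x - g x)"
        using norm_triangle_ineq4[of "f k x - g x" "f m x - g x"] by simp
      then have "(norm (f k x - f m x))\<^sup>2 \<le> (norm (f k x - g x) + norm (f m x - g x))\<^sup>2" by (intro power_mono) auto
      also have "\<dots> \<le> 2 * (norm (f k x - g x))\<^sup>2 + 2 * (norm (f m x - g x))\<^sup>2"
        using sum_squares_bound[of "norm (f k x - g x)" "norm (f m x - g x)"] by (simp add: power2_sum)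
      finally show ?thesis .
    qed
    have i: "integrable lborel (\<lambda>x. 2 * (norm (f k x - g x))\<^sup>2 + 2 * (norm (f m x - g x))\<^sup>2)"
      by (intro Bochner_Integration.integrable_add integrable_mult_right L)
    have "(\<integral>x. (norm (f k x - f m x))\<^sup>2 \<partial>lborel) \<le> (\<integral>x. 2 * (norm (f k x - g x))\<^sup>2 + 2 * (norm (f m x - g x))\<^sup>2 \<partial>lborel)"
    proof (rule integral_mono[OF _ i tri])
      show "integrable lborel (\<lambda>x. (norm (f k x - f m x))\<^sup>2)"
        by (rule Bochner_Integration.integrable_bound[OF i]) (use tri in auto)
    qed
    also have "\<dots> = 2 * (\<integral>x. (norm (f k x - g x))\<^sup>2 \<partial>lborel) + 2 * (\<integral>x. (norm (f m x - g x))\<^sup>2 \<partial>lborel)"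
      using L(2) by simp
    finally show ?thesis using K[OF that(1)] K[OF that(2)] by linarith
  qed
  then show "\<exists>K. \<forall>k\<ge>K. \<forall>m\<ge>K. (\<integral>x. (norm (f k x - f m x))\<^sup>2 \<partial>lborel) < e" by blast
qed

text \<open>A Cauchy sequence with weak limit 0 tends to 0 strongly, and it is enough to test
  against its own members: expanding \<open>|d k - d K|^2\<close> for one large \<open>K\<close>
  bounds the norm of \<open>d k\<close> by a small distance plus twice a small pairing.\<close>

lemma L2_Cauchy_norm_tendsto_0:
  fixes d :: "nat \<Rightarrow> 'a::euclidean_space \<Rightarrow> real"
  assumes m[measurable]: "\<And>k. d k \<in> borel_measurable borel" and d2: "\<And>k. integrable lborel (\<lambda>x. (d k x)\<^sup>2)"
    and C: "L2_Cauchy d" and weak: "\<And>m. (\<lambda>k. \<integral>x. d k x * d m x \<partial>lborel) \<longlonglongrightarrow> 0"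
  shows "(\<lambda>k. \<integral>x. (d k x)\<^sup>2 \<partial>lborel) \<longlonglongrightarrow> 0"
proof (rule LIMSEQ_I)
  fix e :: real assume e: "e > 0"
  obtain K where K: "\<And>k m. k \<ge> K \<Longrightarrow> m \<ge> K \<Longrightarrow> (\<integral>x. (norm (d k x - d m x))\<^sup>2 \<partial>lborel) < e / 2"
    using C e unfolding L2_Cauchy_def by (meson half_gt_zero)
  obtain K' where K': "\<And>k. k \<ge> K' \<Longrightarrow> \<bar>\<integral>x. d k x * d K x \<partial>lborel\<bar> < e / 4"
    using LIMSEQ_D[OF weak[of K], of "e / 4"] e by auto
  have "norm ((\<integral>x. (d k x)\<^sup>2 \<partial>lborel) - 0) < e" if "k \<ge> max K K'" for k
  proof -
    have i: "integrable lborel (\<lambda>x. d k x * d K x)" by (rule Cauchy_Schwarz_integral; (rule d2 m)?)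
    have "(\<integral>x. (norm (d k x - d K x))\<^sup>2 \<partial>lborel) = (\<integral>x. (d k x)\<^sup>2 \<partial>lborel) - 2 * (\<integral>x. d k x * d K x \<partial>lborel) + (\<integral>x. (d K x)\<^sup>2 \<partial>lborel)"
    proof -
      have "(\<lambda>x. (norm (d k x - d K x))\<^sup>2) = (\<lambda>x. (d k x)\<^sup>2 - 2 * (d k x * d K x) + (d K x)\<^sup>2)"
        by (simp add: fun_eq_iff power2_eq_square algebra_simps)
      then show ?thesis
        by (simp only: Bochner_Integration.integral_add Bochner_Integration.integral_diff integral_mult_right_zero
          Bochner_Integration.integrable_diff integrable_mult_right d2 i)
    qed
    moreover have "(\<integral>x. (d K x)\<^sup>2 \<partial>lborel) \<ge> 0" "(\<integral>x. (d k x)\<^sup>2 \<partial>lborel) \<ge> 0" by simp_all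
    moreover have "(\<integral>x. (norm (d k x - d K x))\<^sup>2 \<partial>lborel) < e / 2" "\<bar>\<integral>x. d k x * d K x \<partial>lborel\<bar> < e / 4"
      using K[of k K] K'[of k] that by auto
    ultimately have "(\<integral>x. (d k x)\<^sup>2 \<partial>lborel) < e" by linarith
    then show ?thesis by simp
  qed
  then show "\<exists>no. \<forall>n\<ge>no. norm ((\<integral>x. (d n x)\<^sup>2 \<partial>lborel) - 0) < e" by blast
qed

text \<open>A bounded sequence \<open>a\<close> with \<open>|x|\<^sup>2 a\<close> tending to 0 converges weakly to 0;
  hence its pairing with a strongly convergent sequence vanishes in the limit.\<close>

lemma weak_strong_pairing:
  fixes a d :: "nat \<Rightarrow> real^'n \<Rightarrow> real"
  assumes am[measurable]: "\<And>k. a k \<in> borel_measurable borel" and dm[measurable]: "\<And>k. d k \<in> borel_measurable borel"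
    and a2: "\<And>k. integrable lborel (\<lambda>x. (a k x)\<^sup>2)" and d2: "\<And>k. integrable lborel (\<lambda>x. (d k x)\<^sup>2)"
    and ra2: "\<And>k. integrable lborel (\<lambda>x. ((x \<bullet> x) * a k x)\<^sup>2)"
    and bd: "\<And>k. (\<integral>x. (a k x)\<^sup>2 \<partial>lborel) \<le> M\<^sup>2" and M: "M > 0"
    and ra0: "(\<lambda>k. \<integral>x. ((x \<bullet> x) * a k x)\<^sup>2 \<partial>lborel) \<longlonglongrightarrow> 0"
    and C: "L2_Cauchy d"
  shows "(\<lambda>k. \<integral>x. a k x * d k x \<partial>lborel) \<longlonglongrightarrow> 0"
proof (rule LIMSEQ_I)
  fix e :: real assume e: "e > 0"
  \<comment> \<open>Three errors are estimated: the first two by \<open>M * e' = e / 4\<close> each,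
    the third by \<open>e / 4\<close>.\<close>
  define e' where "e' = e / (4 * M)"
  have e': "e' > 0" using e M by (simp add: e'_def)
  have sM: "sqrt (\<integral>x. (a k x)\<^sup>2 \<partial>lborel) \<le> M" for k
    using real_sqrt_le_mono[OF bd[of k]] M by simp
  obtain K where K: "\<And>k m. k \<ge> K \<Longrightarrow> m \<ge> K \<Longrightarrow> (\<integral>x. (norm (d k x - d m x))\<^sup>2 \<partial>lborel) < e'\<^sup>2"
    using C e' unfolding L2_Cauchy_def by (meson zero_less_power)
  have dd: "integrable lborel (\<lambda>x. (d k x - d K x)\<^sup>2)" for k
  proof (rule Bochner_Integration.integrable_bound)
    show "integrable lborel (\<lambda>x. 2 * (d k x)\<^sup>2 + 2 * (d K x)\<^sup>2)"
      by (intro Bochner_Integration.integrable_add integrable_mult_right d2)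
    have "(p - q)\<^sup>2 \<le> 2 * p\<^sup>2 + 2 * q\<^sup>2" for p q :: real
      using sum_squares_bound[of p "- q"] by (simp add: power2_diff)
    then show "AE x in lborel. norm ((d k x - d K x)\<^sup>2) \<le> norm (2 * (d k x)\<^sup>2 + 2 * (d K x)\<^sup>2)"
      by (intro AE_I2) simp
  qed measurable
  \<comment> \<open>With \<open>\<delta> = 1 / Suc n\<close>, the function
    \<open>h = \<delta> / (|x|^2 + \<delta>)\<close> is a smoothed indicator of the origin, and
    \<open>d K = h d K + |x|^2 g\<close> for \<open>g = d K / (|x|^2 + \<delta>)\<close>. The first
    summand is small in L2 for small \<open>\<delta>\<close>; the second hands its factor
    \<open>|x|^2\<close> over to \<open>a\<close>.\<close>
  define h where "h n x = (1 / real (Suc n)) / (x \<bullet> x + 1 / real (Suc n))" for n and x :: "real^'n"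
  have h01: "0 \<le> h n x" "h n x \<le> 1" for n x
  proof -
    have p: "0 < x \<bullet> x + 1 / real (Suc n)" by (intro add_nonneg_pos) auto
    then show "0 \<le> h n x" unfolding h_def by (intro divide_nonneg_pos) auto
    show "h n x \<le> 1" unfolding h_def using p by (subst pos_divide_le_eq) auto
  qed
  have hm[measurable]: "h n \<in> borel_measurable borel" for n unfolding h_def by measurable
  have "(\<lambda>n. \<integral>x. (h n x * d K x)\<^sup>2 \<partial>lborel) \<longlonglongrightarrow> (\<integral>x. 0 \<partial>(lborel :: (real^'n) measure))"
  proof (rule integral_dominated_convergence[where w = "\<lambda>x. (d K x)\<^sup>2"])
    show "AE x in lborel. (\<lambda>n. (h n x * d K x)\<^sup>2) \<longlonglongrightarrow> 0"
      using AE_lborel_singleton[where c = 0]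
    proof eventually_elim
      fix x :: "real^'n" assume x: "x \<noteq> 0"
      have "(\<lambda>n. h n x) \<longlonglongrightarrow> 0 / (x \<bullet> x + 0)"
        unfolding h_def using x by (intro tendsto_intros LIMSEQ_Suc[OF lim_1_over_n]) auto
      then have "(\<lambda>n. (h n x * d K x)\<^sup>2) \<longlonglongrightarrow> (0 * d K x)\<^sup>2"
        by (intro tendsto_intros) simp
      then show "(\<lambda>n. (h n x * d K x)\<^sup>2) \<longlonglongrightarrow> 0" by simp
    qed
    show "AE x in lborel. norm ((h n x * d K x)\<^sup>2) \<le> (d K x)\<^sup>2" for n
      using h01 by (intro AE_I2) (auto simp: power_mult_distrib power_le_one mult_left_le_one_le)
  qed (use d2 in auto)
  then have "(\<lambda>n. \<integral>x. (h n x * d K x)\<^sup>2 \<partial>lborel) \<longlonglongrightarrow> 0" by simp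
  then obtain n where n: "(\<integral>x. (h n x * d K x)\<^sup>2 \<partial>lborel) < e'\<^sup>2"
    using order_tendstoD(2)[of _ 0 sequentially "e'\<^sup>2"] e' by (meson eventually_happens sequentially_bot zero_less_power)
  define g where "g x = d K x / (x \<bullet> x + 1 / real (Suc n))" for x
  have gm[measurable]: "g \<in> borel_measurable borel" unfolding g_def by measurable
  have g2: "integrable lborel (\<lambda>x. (g x)\<^sup>2)"
  proof (rule Bochner_Integration.integrable_bound)
    show "integrable lborel (\<lambda>x. (real (Suc n))\<^sup>2 * (d K x)\<^sup>2)" by (intro integrable_mult_right d2)
    show "AE x in lborel. norm ((g x)\<^sup>2) \<le> norm ((real (Suc n))\<^sup>2 * (d K x)\<^sup>2)"
    proof (rule AE_I2)
      fix x
      have "\<bar>g x\<bar> = h n x * real (Suc n) * \<bar>d K x\<bar>"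
        using add_nonneg_pos[of "x \<bullet> x" "1 / real (Suc n)"] by (simp add: g_def h_def abs_div)
      also have "\<dots> \<le> 1 * real (Suc n) * \<bar>d K x\<bar>"
        using h01 by (intro mult_right_mono) auto
      finally have "\<bar>g x\<bar>\<^sup>2 \<le> (real (Suc n) * \<bar>d K x\<bar>)\<^sup>2" by (intro power_mono) auto
      then show "norm ((g x)\<^sup>2) \<le> norm ((real (Suc n))\<^sup>2 * (d K x)\<^sup>2)" by (simp add: power_mult_distrib)
    qed
  qed measurable
  have hd2: "integrable lborel (\<lambda>x. (h n x * d K x)\<^sup>2)"
    by (rule Bochner_Integration.integrable_bound[OF d2[of K]])
      (use h01 in \<open>auto simp: power_mult_distrib power_le_one mult_left_le_one_le\<close>)
  have "(\<lambda>k. sqrt (\<integral>x. ((x \<bullet> x) * a k x)\<^sup>2 \<partial>lborel) * sqrt (\<integral>x. (g x)\<^sup>2 \<partial>lborel)) \<longlonglongrightarrow> sqrt 0 * sqrt (\<integral>x. (g x)\<^sup>2 \<partial>lborel)"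
    by (intro tendsto_intros ra0)
  then have "(\<lambda>k. sqrt (\<integral>x. ((x \<bullet> x) * a k x)\<^sup>2 \<partial>lborel) * sqrt (\<integral>x. (g x)\<^sup>2 \<partial>lborel)) \<longlonglongrightarrow> 0" by simp
  then obtain K' where K': "\<And>k. k \<ge> K' \<Longrightarrow> sqrt (\<integral>x. ((x \<bullet> x) * a k x)\<^sup>2 \<partial>lborel) * sqrt (\<integral>x. (g x)\<^sup>2 \<partial>lborel) < e / 4"
    using order_tendstoD(2)[of _ 0 sequentially "e / 4"] e by (auto simp: eventually_sequentially)
  have "norm ((\<integral>x. a k x * d k x \<partial>lborel) - 0) < e" if k: "k \<ge> max K K'" for k
  proof -
    have split: "a k x * d k x = a k x * (d k x - d K x) + a k x * (h n x * d K x) + ((x \<bullet> x) * a k x) * g x" for x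
    proof -
      have p: "x \<bullet> x + 1 / real (Suc n) \<noteq> 0" using add_nonneg_pos[of "x \<bullet> x" "1 / real (Suc n)"] by auto
      have "h n x * d K x + (x \<bullet> x) * g x = (x \<bullet> x + 1 / real (Suc n)) * d K x / (x \<bullet> x + 1 / real (Suc n))"
      proof -
        have "c / (R + c) * d + R * (d / (R + c)) = (R + c) * d / (R + c)" for c R d :: real
          by (simp add: add_divide_distrib distrib_right)
        then show ?thesis unfolding h_def g_def .
      qed
      also have "\<dots> = d K x" using p by simp
      finally have e: "h n x * d K x + (x \<bullet> x) * g x = d K x" .
      have "a k x * (d k x - d K x) + a k x * (h n x * d K x) + ((x \<bullet> x) * a k x) * g x
        = a k x * (d k x - d K x) + a k x * (h n x * d K x + (x \<bullet> x) * g x)"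
        by (simp add: distrib_left)
      then show ?thesis unfolding e by (simp add: right_diff_distrib)
    qed
    have m3: "(\<lambda>x. d k x - d K x) \<in> borel_measurable borel" "(\<lambda>x. h n x * d K x) \<in> borel_measurable borel"
      "(\<lambda>x. (x \<bullet> x) * a k x) \<in> borel_measurable borel" by measurable
    note c1 = Cauchy_Schwarz_integral[OF a2[of k] dd[of k] am m3(1)]
    note c2 = Cauchy_Schwarz_integral[OF a2[of k] hd2 am m3(2)]
    note c3 = Cauchy_Schwarz_integral[OF ra2[of k] g2 m3(3) gm]
    have "(\<integral>x. a k x * d k x \<partial>lborel) = (\<integral>x. a k x * (d k x - d K x) \<partial>lborel) + (\<integral>x. a k x * (h n x * d K x) \<partial>lborel) + (\<integral>x. ((x \<bullet> x) * a k x) * g x \<partial>lborel)"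
      unfolding split
      by (simp only: Bochner_Integration.integral_add Bochner_Integration.integrable_add c1(1) c2(1) c3(1))
    moreover have "\<bar>\<integral>x. a k x * (d k x - d K x) \<partial>lborel\<bar> \<le> M * e'"
    proof (rule order_trans[OF c1(2)], intro mult_mono sM)
      have "(\<integral>x. (d k x - d K x)\<^sup>2 \<partial>lborel) \<le> e'\<^sup>2" using K[of k K] k by simp
      from real_sqrt_le_mono[OF this] show "sqrt (\<integral>x. (d k x - d K x)\<^sup>2 \<partial>lborel) \<le> e'" using e' by simp
    qed (use M in auto)
    moreover have "\<bar>\<integral>x. a k x * (h n x * d K x) \<partial>lborel\<bar> \<le> M * e'"
    proof (rule order_trans[OF c2(2)], intro mult_mono sM)
      from real_sqrt_le_mono[OF less_imp_le[OF n]] show "sqrt (\<integral>x. (h n x * d K x)\<^sup>2 \<partial>lborel) \<le> e'" using e' by simp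
    qed (use M in auto)
    moreover have "M * e' = e / 4" using M by (simp add: e'_def)
    moreover have "\<bar>\<integral>x. ((x \<bullet> x) * a k x) * g x \<partial>lborel\<bar> < e / 4"
      using c3(2) K'[of k] k by linarith
    ultimately have "\<bar>\<integral>x. a k x * d k x \<partial>lborel\<bar> < e" using e by linarith
    then show ?thesis by simp
  qed
  then show "\<exists>no. \<forall>k\<ge>no. norm ((\<integral>x. a k x * d k x \<partial>lborel) - 0) < e" by blast
qed

subsection \<open>The uncertainty inequality for solenoidal fields\<close>

context C2_field
begin

lemma a_square_le: "(\<integral>x. (a x)\<^sup>2 \<partial>lborel) \<le> 4 * (\<integral>x. (norm (J x))\<^sup>2 \<partial>lborel)"
proof -
  have "(\<integral>x. (a x)\<^sup>2 \<partial>lborel) \<le> (\<integral>x. (norm (v x) / norm x)\<^sup>2 \<partial>lborel)"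
  proof (rule integral_mono[OF a_L2 w_over_x_L2])
    show "(a x)\<^sup>2 \<le> (norm (v x) / norm x)\<^sup>2" for x
      using power_mono[OF radial_coeff_bound abs_ge_zero, of x "v x" 2] by (simp add: a_def)
  qed
  with Hardy[OF dim] show ?thesis by simp
qed

lemma trace_T_square_le:
  "(\<integral>x. (trace (T x))\<^sup>2 \<partial>lborel) \<le> 10 * (real CARD('n) + 1)\<^sup>2 * (\<integral>x. (norm (J x))\<^sup>2 \<partial>lborel)"
proof -
  let ?N = "real CARD('n) + 1"
  have i: "integrable lborel (\<lambda>x. ?N\<^sup>2 * (2 * (norm (J x))\<^sup>2 + 2 * (norm (v x) / norm x)\<^sup>2))"
    by (intro integrable_mult_right Bochner_Integration.integrable_add W_L2 w_over_x_L2)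
  have "(\<integral>x. (trace (T x))\<^sup>2 \<partial>lborel) \<le> (\<integral>x. ?N\<^sup>2 * (2 * (norm (J x))\<^sup>2 + 2 * (norm (v x) / norm x)\<^sup>2) \<partial>lborel)"
  proof (rule integral_mono[OF t.trace_square_integrable i])
    fix x
    have "\<bar>trace (T x)\<bar>\<^sup>2 \<le> (?N * (norm (J x) + norm (v x) / norm x))\<^sup>2"
      unfolding trace_T by (intro power_mono tangential_div_bound) auto
    also have "\<dots> = ?N\<^sup>2 * (norm (J x) + norm (v x) / norm x)\<^sup>2" by (simp only: power_mult_distrib)
    also have "\<dots> \<le> ?N\<^sup>2 * (2 * (norm (J x))\<^sup>2 + 2 * (norm (v x) / norm x)\<^sup>2)"
      using sum_squares_bound[of "norm (J x)" "norm (v x) / norm x"]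
      by (intro mult_left_mono) (simp_all add: power2_sum del: power_divide)
    finally show "(trace (T x))\<^sup>2 \<le> ?N\<^sup>2 * (2 * (norm (J x))\<^sup>2 + 2 * (norm (v x) / norm x)\<^sup>2)" by simp
  qed
  also have "\<dots> = ?N\<^sup>2 * (2 * (\<integral>x. (norm (J x))\<^sup>2 \<partial>lborel) + 2 * (\<integral>x. (norm (v x) / norm x)\<^sup>2 \<partial>lborel))"
    by (simp only: integral_mult_right_zero Bochner_Integration.integral_add integrable_mult_right W_L2 w_over_x_L2)
  also have "\<dots> \<le> ?N\<^sup>2 * (10 * (\<integral>x. (norm (J x))\<^sup>2 \<partial>lborel))"
    using Hardy[OF dim] by (intro mult_left_mono) auto
  finally show ?thesis by simp
qed

lemma x_a: "(x \<bullet> x) * a x = x \<bullet> v x"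
  by (cases "x = 0") (simp_all add: a_def radial_coeff_def)

text \<open>Interpolation: \<open>|x|^2 a^2\<close> is the product of \<open>a\<close>, bounded by
  Hardy's inequality, and of \<open>x \<bullet> v\<close>, which on the Fourier side represents the
  divergence.\<close>

lemma radial_square_le:
  assumes "integrable lborel (\<lambda>x. (x \<bullet> v x)\<^sup>2)"
  shows "(\<integral>x. (norm x * a x)\<^sup>2 \<partial>lborel) \<le> sqrt (\<integral>x. (a x)\<^sup>2 \<partial>lborel) * sqrt (\<integral>x. (x \<bullet> v x)\<^sup>2 \<partial>lborel)"
proof -
  have eq: "(norm x * a x)\<^sup>2 = a x * (x \<bullet> v x)" for x
    unfolding x_a[symmetric] by (simp add: power_mult_distrib power2_norm_eq_inner) (simp add: power2_eq_square)
  have "\<bar>\<integral>x. a x * (x \<bullet> v x) \<partial>lborel\<bar> \<le> sqrt (\<integral>x. (a x)\<^sup>2 \<partial>lborel) * sqrt (\<integral>x. (x \<bullet> v x)\<^sup>2 \<partial>lborel)"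
    by (rule Cauchy_Schwarz_integral(2)[OF a_L2 assms]) measurable
  then show ?thesis unfolding eq by linarith
qed

end

context test_field_loc
begin

lemma phi_measurable[measurable]: "\<phi> \<in> borel_measurable borel"
  by (rule borel_measurable_vec) (rule moments_measurable[OF mom])

lemma jac_measurable[measurable]: "jac \<phi> \<in> borel_measurable borel"
  by (rule borel_measurable_vec, rule borel_measurable_vec)
    (use moments_measurable[OF mom_partial] in \<open>simp add: dphi_def[abs_def]\<close>)

lemma phi_L2: "integrable lborel (\<lambda>x. (norm (\<phi> x))\<^sup>2)"
  unfolding norm_vec_square by (intro Bochner_Integration.integrable_sum Plancherel_phi)

lemma xphi_L2: "integrable lborel (\<lambda>x. (norm (norm x *\<^sub>R \<phi> x))\<^sup>2)"
proof -
  have eq: "(norm (norm x *\<^sub>R \<phi> x))\<^sup>2 = (\<Sum>j\<in>UNIV. \<Sum>k\<in>UNIV. ((x \<bullet> axis k 1) * \<phi> x $ j)\<^sup>2)" for x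
    by (simp add: power_mult_distrib norm_vec_square inner_axis sum_product) (rule sum.swap)
  show ?thesis unfolding eq by (intro Bochner_Integration.integrable_sum Plancherel_xk)
qed

lemma jac_L2: "integrable lborel (\<lambda>x. (norm (jac \<phi> x))\<^sup>2)"
  unfolding norm_mat_square dphi_def[symmetric] by (intro Bochner_Integration.integrable_sum Plancherel_partial)

text \<open>The tangential divergence is taken from the explicit formula, which is linear in the
  value and the Jacobian together; this lets the same bounds be applied to differences of test
  fields.\<close>

definition "aC x = radial_coeff x (cosT \<phi> x)"
definition "aS x = radial_coeff x (sinT \<phi> x)"
definition "dC x = tangential_div x (cosT \<phi> x) (cosTJ \<phi> x)"
definition "dS x = tangential_div x (sinT \<phi> x) (sinTJ \<phi> x)"

text \<open>Every bound is in terms of \<open>Y\<close> and \<open>D\<close>: along the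
  approximating sequence the former stays bounded and the latter tends to 0.\<close>

lemma transform_bounds:
  assumes N: "CARD('n) \<ge> 3"
  defines "c \<equiv> (2 * pi) ^ CARD('n)"
  defines "Y \<equiv> \<integral>x. (norm (norm x *\<^sub>R \<phi> x))\<^sup>2 \<partial>lborel" and "D \<equiv> \<integral>x. (trace (jac \<phi> x))\<^sup>2 \<partial>lborel"
  shows "aC \<in> borel_measurable borel" "aS \<in> borel_measurable borel" "dC \<in> borel_measurable borel" "dS \<in> borel_measurable borel"
    and "integrable lborel (\<lambda>x. (aC x)\<^sup>2)" "integrable lborel (\<lambda>x. (aS x)\<^sup>2)"
    and "integrable lborel (\<lambda>x. (dC x)\<^sup>2)" "integrable lborel (\<lambda>x. (dS x)\<^sup>2)"
    and "integrable lborel (\<lambda>x. ((x \<bullet> x) * aC x)\<^sup>2)" "integrable lborel (\<lambda>x. ((x \<bullet> x) * aS x)\<^sup>2)"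
    and "(\<integral>x. (aC x)\<^sup>2 \<partial>lborel) \<le> 4 * c * Y" "(\<integral>x. (aS x)\<^sup>2 \<partial>lborel) \<le> 4 * c * Y"
    and "(\<integral>x. (dC x)\<^sup>2 \<partial>lborel) \<le> 10 * (real CARD('n) + 1)\<^sup>2 * c * Y" "(\<integral>x. (dS x)\<^sup>2 \<partial>lborel) \<le> 10 * (real CARD('n) + 1)\<^sup>2 * c * Y"
    and "(\<integral>x. ((x \<bullet> x) * aC x)\<^sup>2 \<partial>lborel) \<le> c * D" "(\<integral>x. ((x \<bullet> x) * aS x)\<^sup>2 \<partial>lborel) \<le> c * D"
    and "(\<integral>x. (norm x * aC x)\<^sup>2 \<partial>lborel) \<le> sqrt (4 * c * Y) * sqrt (c * D)"
    and "(\<integral>x. (norm x * aS x)\<^sup>2 \<partial>lborel) \<le> sqrt (4 * c * Y) * sqrt (c * D)"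
proof -
  interpret C: C2_field "cosT \<phi>" "cosTJ \<phi>" "\<lambda>j k l x. - CT (\<lambda>\<xi>. (\<xi> \<bullet> axis l 1) * ((\<xi> \<bullet> axis k 1) * \<phi> \<xi> $ j)) x"
    by (rule cos_field[OF N])
  interpret S: C2_field "sinT \<phi>" "sinTJ \<phi>" "\<lambda>j k l x. - ST (\<lambda>\<xi>. (\<xi> \<bullet> axis l 1) * ((\<xi> \<bullet> axis k 1) * \<phi> \<xi> $ j)) x"
    by (rule sin_field[OF N])
  have eq: "aC = C.a" "aS = S.a" "dC = (\<lambda>x. trace (C.T x))" "dS = (\<lambda>x. trace (S.T x))"
    by (simp_all add: aC_def C.a_def aS_def S.a_def dC_def C.trace_T dS_def S.trace_T fun_eq_iff)
  have xeq: "((x \<bullet> x) * aC x)\<^sup>2 = (x \<bullet> cosT \<phi> x)\<^sup>2" "((x \<bullet> x) * aS x)\<^sup>2 = (x \<bullet> sinT \<phi> x)\<^sup>2" for x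
    by (simp_all add: eq C.x_a S.x_a)
  have J: "(\<integral>x. (norm (cosTJ \<phi> x))\<^sup>2 \<partial>lborel) \<le> c * Y" "(\<integral>x. (norm (sinTJ \<phi> x))\<^sup>2 \<partial>lborel) \<le> c * Y"
  proof -
    have "0 \<le> (\<integral>x. (norm (cosTJ \<phi> x))\<^sup>2 \<partial>lborel)" "0 \<le> (\<integral>x. (norm (sinTJ \<phi> x))\<^sup>2 \<partial>lborel)" by simp_all
    then show "(\<integral>x. (norm (cosTJ \<phi> x))\<^sup>2 \<partial>lborel) \<le> c * Y" "(\<integral>x. (norm (sinTJ \<phi> x))\<^sup>2 \<partial>lborel) \<le> c * Y"
      using L2_xk(3) unfolding c_def Y_def by linarith+
  qed
  have X: "(\<integral>x. (x \<bullet> cosT \<phi> x)\<^sup>2 \<partial>lborel) \<le> c * D" "(\<integral>x. (x \<bullet> sinT \<phi> x)\<^sup>2 \<partial>lborel) \<le> c * D"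
  proof -
    have "0 \<le> (\<integral>x. (x \<bullet> cosT \<phi> x)\<^sup>2 \<partial>lborel)" "0 \<le> (\<integral>x. (x \<bullet> sinT \<phi> x)\<^sup>2 \<partial>lborel)" by simp_all
    then show "(\<integral>x. (x \<bullet> cosT \<phi> x)\<^sup>2 \<partial>lborel) \<le> c * D" "(\<integral>x. (x \<bullet> sinT \<phi> x)\<^sup>2 \<partial>lborel) \<le> c * D"
      using L2_divergence(3) unfolding c_def D_def by linarith+
  qed
  show "aC \<in> borel_measurable borel" "aS \<in> borel_measurable borel" "dC \<in> borel_measurable borel" "dS \<in> borel_measurable borel"
    unfolding eq by measurable
  show "integrable lborel (\<lambda>x. (aC x)\<^sup>2)" "integrable lborel (\<lambda>x. (aS x)\<^sup>2)"
    "integrable lborel (\<lambda>x. (dC x)\<^sup>2)" "integrable lborel (\<lambda>x. (dS x)\<^sup>2)"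
    unfolding eq by (rule C.a_L2 S.a_L2 C.t.trace_square_integrable S.t.trace_square_integrable)+
  show "integrable lborel (\<lambda>x. ((x \<bullet> x) * aC x)\<^sup>2)" "integrable lborel (\<lambda>x. ((x \<bullet> x) * aS x)\<^sup>2)"
    "(\<integral>x. ((x \<bullet> x) * aC x)\<^sup>2 \<partial>lborel) \<le> c * D" "(\<integral>x. ((x \<bullet> x) * aS x)\<^sup>2 \<partial>lborel) \<le> c * D"
    unfolding xeq by (rule L2_divergence X)+
  show a2: "(\<integral>x. (aC x)\<^sup>2 \<partial>lborel) \<le> 4 * c * Y" "(\<integral>x. (aS x)\<^sup>2 \<partial>lborel) \<le> 4 * c * Y"
    using C.a_square_le S.a_square_le J unfolding eq by auto
  let ?M = "10 * (real CARD('n) + 1)\<^sup>2"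
  have "?M * (\<integral>x. (norm (cosTJ \<phi> x))\<^sup>2 \<partial>lborel) \<le> ?M * (c * Y)" "?M * (\<integral>x. (norm (sinTJ \<phi> x))\<^sup>2 \<partial>lborel) \<le> ?M * (c * Y)"
    by (intro mult_left_mono J; simp)+
  with C.trace_T_square_le S.trace_T_square_le
  show "(\<integral>x. (dC x)\<^sup>2 \<partial>lborel) \<le> ?M * c * Y" "(\<integral>x. (dS x)\<^sup>2 \<partial>lborel) \<le> ?M * c * Y"
    unfolding eq mult.assoc[of ?M] by linarith+
  have "c * D \<ge> 0" by (simp add: c_def D_def)
  show "(\<integral>x. (norm x * aC x)\<^sup>2 \<partial>lborel) \<le> sqrt (4 * c * Y) * sqrt (c * D)"
    by (rule order_trans[OF C.radial_square_le[folded eq, OF L2_divergence(1)]])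
      (intro mult_mono real_sqrt_le_mono a2 X; simp add: \<open>c * D \<ge> 0\<close> c_def Y_def)
  show "(\<integral>x. (norm x * aS x)\<^sup>2 \<partial>lborel) \<le> sqrt (4 * c * Y) * sqrt (c * D)"
    by (rule order_trans[OF S.radial_square_le[folded eq, OF L2_divergence(2)]])
      (intro mult_mono real_sqrt_le_mono a2 X; simp add: \<open>c * D \<ge> 0\<close> c_def Y_def)
qed

text \<open>Going back from the transforms exchanges the two energies, so the weight
  \<open>l^2\<close> moves to the gradient of the field.\<close>

lemma test_field_inequality:
  assumes N: "CARD('n) \<ge> 3" and \<alpha>: "\<alpha>\<^sup>2 + \<alpha> * (real CARD('n) - 2) = 2" and l: "l > 0"
  shows "l * (real CARD('n) + 2 * \<alpha>) * ((2 * pi) ^ CARD('n) * (\<integral>x. (norm (\<phi> x))\<^sup>2 \<partial>lborel)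
      - ((\<integral>x. (norm x * aC x)\<^sup>2 \<partial>lborel) + (\<integral>x. (norm x * aS x)\<^sup>2 \<partial>lborel)))
    \<le> (2 * pi) ^ CARD('n) * (\<integral>x. (norm (norm x *\<^sub>R \<phi> x))\<^sup>2 \<partial>lborel)
      + l\<^sup>2 * ((2 * pi) ^ CARD('n) * (\<integral>x. (norm (jac \<phi> x))\<^sup>2 \<partial>lborel))
      - 4 * ((\<integral>x. aC x * dC x \<partial>lborel) + (\<integral>x. aS x * dS x \<partial>lborel))"
proof -
  interpret C: C2_field "cosT \<phi>" "cosTJ \<phi>" "\<lambda>j k l x. - CT (\<lambda>\<xi>. (\<xi> \<bullet> axis l 1) * ((\<xi> \<bullet> axis k 1) * \<phi> \<xi> $ j)) x"
    by (rule cos_field[OF N])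
  interpret S: C2_field "sinT \<phi>" "sinTJ \<phi>" "\<lambda>j k l x. - ST (\<lambda>\<xi>. (\<xi> \<bullet> axis l 1) * ((\<xi> \<bullet> axis k 1) * \<phi> \<xi> $ j)) x"
    by (rule sin_field[OF N])
  have eq: "C.a = aC" "S.a = aS" "trace (C.T x) = dC x" "trace (S.T x) = dS x" for x
    by (simp_all add: aC_def C.a_def aS_def S.a_def dC_def C.trace_T dS_def S.trace_T fun_eq_iff)
  note 1 = C.tangential_inequality[OF \<alpha> l, unfolded eq]
  note 2 = S.tangential_inequality[OF \<alpha> l, unfolded eq]
  show ?thesis
    unfolding L2_phi(3)[symmetric] L2_xk(3)[symmetric] L2_partial(3)[symmetric]
    using add_mono[OF 1 2] by (simp only: ring_distribs)
qed

end

section \<open>Solenoidal limits: the divergence of the approximating fields\<close>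

lemma test_field_diff:
  assumes "test_field \<phi>" "test_field \<psi>"
  shows "test_field (\<lambda>x. \<phi> x - \<psi> x)"
proof -
  have "smooth_fun (\<lambda>x. \<phi> x $ j + (- 1) * \<psi> x $ j)" for j
    using assms by (intro smooth_fun_add smooth_fun_mult smooth_fun_const) (auto simp: test_field_def)
  moreover have "compact (closure {x. \<phi> x - \<psi> x \<noteq> 0})"
  proof -
    have sub: "closure {x. \<phi> x - \<psi> x \<noteq> 0} \<subseteq> closure {x. \<phi> x \<noteq> 0} \<union> closure {x. \<psi> x \<noteq> 0}"
      unfolding closure_Un[symmetric] by (rule closure_mono) auto
    have "compact ((closure {x. \<phi> x \<noteq> 0} \<union> closure {x. \<psi> x \<noteq> 0}) \<inter> closure {x. \<phi> x - \<psi> x \<noteq> 0})"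
      using assms unfolding test_field_def by (intro compact_Int_closed compact_Un closed_closure) auto
    then show ?thesis using sub by (simp add: Int_absorb1)
  qed
  ultimately show ?thesis by (simp add: test_field_def)
qed

lemma L2_Cauchy_transfer:
  assumes "L2_Cauchy f" and le: "\<And>k m. (\<integral>x. (norm (g k x - g m x))\<^sup>2 \<partial>lborel) \<le> C * (\<integral>x. (norm (f k x - f m x))\<^sup>2 \<partial>lborel)"
  shows "L2_Cauchy g"
  unfolding L2_Cauchy_def
proof (intro allI impI)
  fix e :: real assume e: "e > 0"
  let ?C = "max C 1"
  obtain K where K: "\<And>k m. k \<ge> K \<Longrightarrow> m \<ge> K \<Longrightarrow> (\<integral>x. (norm (f k x - f m x))\<^sup>2 \<partial>lborel) < e / ?C"
    using assms(1) e unfolding L2_Cauchy_def by (meson divide_pos_pos less_max_iff_disj zero_less_one)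
  have "(\<integral>x. (norm (g k x - g m x))\<^sup>2 \<partial>lborel) < e" if "k \<ge> K" "m \<ge> K" for k m
  proof -
    have "C * (\<integral>x. (norm (f k x - f m x))\<^sup>2 \<partial>lborel) \<le> ?C * (\<integral>x. (norm (f k x - f m x))\<^sup>2 \<partial>lborel)"
      by (intro mult_right_mono) auto
    also have "\<dots> < ?C * (e / ?C)"
      using K[OF that] by (intro mult_strict_left_mono) auto
    finally show ?thesis using le[of k m] by simp
  qed
  then show "\<exists>K. \<forall>k\<ge>K. \<forall>m\<ge>K. (\<integral>x. (norm (g k x - g m x))\<^sup>2 \<partial>lborel) < e" by blast
qed

lemma integral_by_parts_divergence:
  fixes \<phi> :: "real^'n \<Rightarrow> real^'n"
  assumes "test_field \<phi>" and g: "smooth_fun g"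
  shows "integrable lborel (\<lambda>x. \<phi> x \<bullet> grad g x)"
    and "(\<integral>x. trace (jac \<phi> x) * g x \<partial>lborel) = - (\<integral>x. \<phi> x \<bullet> grad g x \<partial>lborel)"
proof -
  interpret test_field_loc \<phi> by unfold_locales fact
  obtain B where B: "\<And>x. norm x > B \<Longrightarrow> \<phi> x = 0" using support by blast
  have gc: "continuous_on UNIV g" "continuous_on UNIV (\<lambda>x. grad g x $ j)" for j
    using smooth_fun_continuous[OF g] smooth_fun_continuous[OF smooth_fun_frechet[OF g, of "axis j 1"]]
    by (auto simp: grad_def axis_in_Basis_iff)
  have i1: "integrable lborel (\<lambda>x. dphi j j x * g x)" for j
    by (rule integrable_continuous_bounded_support[where B = B])
      (auto intro!: continuous_intros gc cont simp: partial_support[OF B])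
  have i2: "integrable lborel (\<lambda>x. \<phi> x $ j * grad g x $ j)" for j
    by (rule integrable_continuous_bounded_support[where B = B])
      (auto intro!: continuous_intros gc cont simp: B)
  have i3: "integrable lborel (\<lambda>x. \<phi> x $ j * g x)" for j
    by (rule integrable_continuous_bounded_support[where B = B])
      (auto intro!: continuous_intros gc cont simp: B)
  have "(\<integral>x. dphi j j x * g x + \<phi> x $ j * grad g x $ j \<partial>lborel) = 0" for j
  proof (rule integral_directional_derivative[OF i3, where h = "axis j 1"])
    have "((\<lambda>s. g (x + s *\<^sub>R axis j 1)) has_real_derivative grad g x $ j) (at 0)" for x
      using has_derivative_line[of g _ x 0 "axis j 1"] smooth_fun_has_derivative[OF g, of x]
      by (simp add: grad_def)
    from DERIV_mult[OF partial_line this]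
    show "((\<lambda>s. \<phi> (x + s *\<^sub>R axis j 1) $ j * g (x + s *\<^sub>R axis j 1)) has_real_derivative dphi j j x * g x + \<phi> x $ j * grad g x $ j) (at 0)" for x
      by (simp add: mult.commute)
  qed (intro Bochner_Integration.integrable_add i1 i2 continuous_intros gc cont)+
  then have *: "(\<integral>x. dphi j j x * g x \<partial>lborel) = - (\<integral>x. \<phi> x $ j * grad g x $ j \<partial>lborel)" for j
    using Bochner_Integration.integral_add[OF i1[of j] i2[of j]] by (simp add: eq_neg_iff_add_eq_0)
  show "integrable lborel (\<lambda>x. \<phi> x \<bullet> grad g x)"
    unfolding inner_nth_sum by (intro Bochner_Integration.integrable_sum i2)
  show "(\<integral>x. trace (jac \<phi> x) * g x \<partial>lborel) = - (\<integral>x. \<phi> x \<bullet> grad g x \<partial>lborel)"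
    unfolding inner_nth_sum divergence_trace[symmetric] divergence_def sum_distrib_right
    by (simp add: Bochner_Integration.integral_sum i1 i2 * sum_negf)
qed

locale solenoidal_limit =
  fixes u :: "real^'n \<Rightarrow> real^'n" and G :: "real^'n \<Rightarrow> real^'n^'n" and \<phi> :: "nat \<Rightarrow> real^'n \<Rightarrow> real^'n"
  assumes dim: "CARD('n) \<ge> 3"
    and u_meas[measurable]: "u \<in> borel_measurable borel" and G_meas[measurable]: "G \<in> borel_measurable borel"
    and test: "\<And>k. test_field (\<phi> k)"
    and conv_u: "(\<lambda>k. \<integral>\<^sup>+ x. ennreal ((norm (\<phi> k x - u x))\<^sup>2 * (1 + (norm x)\<^sup>2)) \<partial>lborel) \<longlonglongrightarrow> 0"
    and conv_G: "(\<lambda>k. \<integral>\<^sup>+ x. ennreal ((norm (jac (\<phi> k) x - G x))\<^sup>2) \<partial>lborel) \<longlonglongrightarrow> 0"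
    and sol: "solenoidal u"
begin

lemma loc: "test_field_loc (\<phi> k)"
  by unfold_locales (rule test)

lemma conv0: "(\<lambda>k. \<integral>\<^sup>+ x. ennreal ((norm (\<phi> k x - u x))\<^sup>2) \<partial>lborel) \<longlonglongrightarrow> 0"
  by (rule tendsto_sandwich[OF _ _ tendsto_const conv_u])
    (auto intro!: always_eventually nn_integral_mono ennreal_leI simp: distrib_left)

lemma conv1: "(\<lambda>k. \<integral>\<^sup>+ x. ennreal ((norm (norm x *\<^sub>R \<phi> k x - norm x *\<^sub>R u x))\<^sup>2) \<partial>lborel) \<longlonglongrightarrow> 0"
proof (rule tendsto_sandwich[OF _ _ tendsto_const conv_u])
  have "(norm (norm x *\<^sub>R \<phi> k x - norm x *\<^sub>R u x))\<^sup>2 \<le> (norm (\<phi> k x - u x))\<^sup>2 * (1 + (norm x)\<^sup>2)" for k x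
    by (simp add: distrib_left power_mult_distrib mult.commute[of "(norm x)\<^sup>2"] flip: scaleR_diff_right)
  then show "eventually (\<lambda>k. (\<integral>\<^sup>+ x. ennreal ((norm (norm x *\<^sub>R \<phi> k x - norm x *\<^sub>R u x))\<^sup>2) \<partial>lborel)
    \<le> (\<integral>\<^sup>+ x. ennreal ((norm (\<phi> k x - u x))\<^sup>2 * (1 + (norm x)\<^sup>2)) \<partial>lborel)) sequentially"
    by (intro always_eventually allI nn_integral_mono ennreal_leI)
qed simp

lemma phi_meas[measurable]: "\<phi> k \<in> borel_measurable borel" and jac_meas[measurable]: "jac (\<phi> k) \<in> borel_measurable borel"
  by (rule test_field_loc.phi_measurable test_field_loc.jac_measurable, rule loc)+

lemma x_meas: "(\<lambda>x. norm x *\<^sub>R \<phi> k x) \<in> borel_measurable borel" "(\<lambda>x. norm x *\<^sub>R u x) \<in> borel_measurable borel"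
  by measurable

lemmas L0 = L2_convergence[OF phi_meas u_meas test_field_loc.phi_L2[OF loc] conv0]
lemmas L1 = L2_convergence[OF x_meas test_field_loc.xphi_L2[OF loc] conv1]
lemmas LG = L2_convergence[OF jac_meas G_meas test_field_loc.jac_L2[OF loc] conv_G]
lemmas C1 = L2_convergence_Cauchy[OF x_meas test_field_loc.xphi_L2[OF loc] conv1]
lemmas CG = L2_convergence_Cauchy[OF jac_meas G_meas test_field_loc.jac_L2[OF loc] conv_G]

text \<open>The divergences form a Cauchy sequence because the Jacobians converge in L2. For weak
  convergence to 0 it suffices to pair with the divergence \<open>g\<close> of a fixed member, which
  is a legitimate test function, so that an integration by parts moves the derivative onto
  it.\<close>

lemma divergence_tendsto_0: "(\<lambda>k. \<integral>x. (trace (jac (\<phi> k) x))\<^sup>2 \<partial>lborel) \<longlonglongrightarrow> 0"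
proof (rule L2_Cauchy_norm_tendsto_0)
  have tr: "(\<lambda>x. trace (jac (\<phi> k) x)) = test_field_loc.divergence (\<phi> k)" for k
    using test_field_loc.divergence_trace[OF loc] by auto
  show m: "(\<lambda>x. trace (jac (\<phi> k) x)) \<in> borel_measurable borel" for k
    unfolding tr by (intro borel_measurable_continuous_onI smooth_fun_continuous test_field_loc.divergence_smooth[OF loc])
  show d2: "integrable lborel (\<lambda>x. (trace (jac (\<phi> k) x))\<^sup>2)" for k
    using test_field_loc.Plancherel_divergence(3)[OF loc] by (simp add: test_field_loc.divergence_trace[OF loc])
  show "L2_Cauchy (\<lambda>k x. trace (jac (\<phi> k) x))"
  proof (rule L2_Cauchy_transfer[OF CG, where C = "(real CARD('n))\<^sup>2"])
    fix k m
    have i: "integrable lborel (\<lambda>x. (norm (jac (\<phi> k) x - jac (\<phi> m) x))\<^sup>2)"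
    proof (rule Bochner_Integration.integrable_bound)
      show "integrable lborel (\<lambda>x. 2 * (norm (jac (\<phi> k) x))\<^sup>2 + 2 * (norm (jac (\<phi> m) x))\<^sup>2)"
        by (intro Bochner_Integration.integrable_add integrable_mult_right test_field_loc.jac_L2[OF loc])
      have "(norm (jac (\<phi> k) x - jac (\<phi> m) x))\<^sup>2 \<le> 2 * (norm (jac (\<phi> k) x))\<^sup>2 + 2 * (norm (jac (\<phi> m) x))\<^sup>2" for x
      proof -
        have "(norm (jac (\<phi> k) x - jac (\<phi> m) x))\<^sup>2 \<le> (norm (jac (\<phi> k) x) + norm (jac (\<phi> m) x))\<^sup>2"
          by (intro power_mono norm_triangle_ineq4) auto
        then show ?thesis using sum_squares_bound[of "norm (jac (\<phi> k) x)" "norm (jac (\<phi> m) x)"] by (simp add: power2_sum)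
      qed
      then show "AE x in lborel. norm ((norm (jac (\<phi> k) x - jac (\<phi> m) x))\<^sup>2) \<le> norm (2 * (norm (jac (\<phi> k) x))\<^sup>2 + 2 * (norm (jac (\<phi> m) x))\<^sup>2)"
        by (intro AE_I2) simp
    qed measurable
    have le: "(norm (trace (jac (\<phi> k) x) - trace (jac (\<phi> m) x)))\<^sup>2 \<le> (real CARD('n))\<^sup>2 * (norm (jac (\<phi> k) x - jac (\<phi> m) x))\<^sup>2" for x
      using power_mono[OF abs_trace_le abs_ge_zero, of "jac (\<phi> k) x - jac (\<phi> m) x" 2]
      by (simp add: trace_sub power_mult_distrib)
    have "(\<integral>x. (norm (trace (jac (\<phi> k) x) - trace (jac (\<phi> m) x)))\<^sup>2 \<partial>lborel) \<le> (\<integral>x. (real CARD('n))\<^sup>2 * (norm (jac (\<phi> k) x - jac (\<phi> m) x))\<^sup>2 \<partial>lborel)"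
    proof (rule integral_mono[OF _ integrable_mult_right[OF i] le])
      show "integrable lborel (\<lambda>x. (norm (trace (jac (\<phi> k) x) - trace (jac (\<phi> m) x)))\<^sup>2)"
        by (rule Bochner_Integration.integrable_bound[OF integrable_mult_right[OF i, of "(real CARD('n))\<^sup>2"]])
          (use le m in \<open>auto\<close>)
    qed
    then show "(\<integral>x. (norm (trace (jac (\<phi> k) x) - trace (jac (\<phi> m) x)))\<^sup>2 \<partial>lborel) \<le> (real CARD('n))\<^sup>2 * (\<integral>x. (norm (jac (\<phi> k) x - jac (\<phi> m) x))\<^sup>2 \<partial>lborel)"
      by simp
  qed
  fix m
  define g where "g x = trace (jac (\<phi> m) x)" for x
  have gs: "smooth_fun g" using test_field_loc.divergence_smooth[OF loc] by (simp add: g_def[abs_def] tr)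
  obtain B where B: "\<And>x. norm x > B \<Longrightarrow> \<phi> m x = 0" using test_field_loc.support[OF loc] by blast
  have g0: "g x = 0" if "norm x > B" for x
    using test_field_loc.partial_support[OF loc B that]
    by (simp add: g_def test_field_loc.divergence_trace[OF loc, symmetric] test_field_loc.divergence_def[OF loc])
  have tf: "test_fun g"
    unfolding test_fun_def
  proof (intro conjI gs)
    have "{x. g x \<noteq> 0} \<subseteq> cball 0 B" using g0 by (force simp: not_less)
    then show "compact (closure {x. g x \<noteq> 0})"
      by (meson bounded_cball bounded_subset compact_closure)
  qed
  have grad0: "grad g x = 0" if "norm x > B" for x
  proof -
    have "(g has_derivative (\<lambda>_. 0)) (at x)"
    proof (rule has_derivative_transform_within_open[where s = "{y. norm y > B}"])
      show "((\<lambda>y. 0) has_derivative (\<lambda>_. 0)) (at x)" by simp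
      show "open {y::real^'n. norm y > B}" by (intro open_Collect_less continuous_intros)
    qed (use that g0 in auto)
    then have "frechet_derivative g (at x) = (\<lambda>_. 0)" using frechet_derivative_at by metis
    then show ?thesis by (simp add: grad_def vec_eq_iff)
  qed
  have gc: "continuous_on UNIV (\<lambda>x. grad g x $ j)" for j
    using smooth_fun_continuous[OF smooth_fun_frechet[OF gs, of "axis j 1"]] by (simp add: grad_def axis_in_Basis_iff)
  have gm[measurable]: "grad g \<in> borel_measurable borel"
    by (rule borel_measurable_vec) (rule borel_measurable_continuous_onI[OF gc])
  have g2: "integrable lborel (\<lambda>x. (norm (grad g x))\<^sup>2)"
    unfolding norm_vec_square
    by (rule integrable_continuous_bounded_support[where B = B]) (auto intro!: continuous_intros gc simp: grad0)
  have iu: "integrable lborel (\<lambda>x. u x \<bullet> grad g x)"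
    by (rule integrable_product_AM_GM[OF L0(1) g2, where C = 1]) (auto simp: Cauchy_Schwarz_ineq2)
  \<comment> \<open>This is the place where \<open>div u = 0\<close> enters: it allows
    \<open>u\<close> to be subtracted from the approximating field.\<close>
  have eq: "(\<integral>x. trace (jac (\<phi> k) x) * g x \<partial>lborel) = - (\<integral>x. (\<phi> k x - u x) \<bullet> grad g x \<partial>lborel)" for k
  proof -
    note ibp = integral_by_parts_divergence[OF test gs, of k]
    have "(\<integral>x. (\<phi> k x - u x) \<bullet> grad g x \<partial>lborel) = (\<integral>x. \<phi> k x \<bullet> grad g x \<partial>lborel) - (\<integral>x. u x \<bullet> grad g x \<partial>lborel)"
      using ibp(1) iu by (simp add: inner_diff_left)
    moreover have "(\<integral>x. u x \<bullet> grad g x \<partial>lborel) = 0" using sol tf by (simp add: solenoidal_def)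
    ultimately show ?thesis using ibp(2) by simp
  qed
  show "(\<lambda>k. \<integral>x. trace (jac (\<phi> k) x) * trace (jac (\<phi> m) x) \<partial>lborel) \<longlonglongrightarrow> 0"
    unfolding g_def[symmetric] eq
  proof (rule Lim_null_comparison)
    have "(\<lambda>k. sqrt (\<integral>x. (norm (\<phi> k x - u x))\<^sup>2 \<partial>lborel) * sqrt (\<integral>x. (norm (grad g x))\<^sup>2 \<partial>lborel)) \<longlonglongrightarrow> sqrt 0 * sqrt (\<integral>x. (norm (grad g x))\<^sup>2 \<partial>lborel)"
      by (intro tendsto_intros L0(3))
    then show "(\<lambda>k. sqrt (\<integral>x. (norm (\<phi> k x - u x))\<^sup>2 \<partial>lborel) * sqrt (\<integral>x. (norm (grad g x))\<^sup>2 \<partial>lborel)) \<longlonglongrightarrow> 0" by simp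
    show "\<forall>\<^sub>F k in sequentially. norm (- (\<integral>x. (\<phi> k x - u x) \<bullet> grad g x \<partial>lborel)) \<le> sqrt (\<integral>x. (norm (\<phi> k x - u x))\<^sup>2 \<partial>lborel) * sqrt (\<integral>x. (norm (grad g x))\<^sup>2 \<partial>lborel)"
    proof (rule always_eventually, rule allI)
      fix k
      have mm: "(\<lambda>x. norm (\<phi> k x - u x)) \<in> borel_measurable borel" "(\<lambda>x. norm (grad g x)) \<in> borel_measurable borel" by measurable
      note cs = Cauchy_Schwarz_integral[OF L0(2)[of k] g2 mm]
      have i: "integrable lborel (\<lambda>x. (\<phi> k x - u x) \<bullet> grad g x)"
        by (rule integrable_product_AM_GM[OF L0(2)[of k] g2, where C = 1]) (auto simp: Cauchy_Schwarz_ineq2)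
      have "\<bar>\<integral>x. (\<phi> k x - u x) \<bullet> grad g x \<partial>lborel\<bar> \<le> (\<integral>x. \<bar>(\<phi> k x - u x) \<bullet> grad g x\<bar> \<partial>lborel)" by (rule integral_abs_bound)
      also have "\<dots> \<le> (\<integral>x. norm (\<phi> k x - u x) * norm (grad g x) \<partial>lborel)"
        by (intro integral_mono integrable_abs i cs Cauchy_Schwarz_ineq2)
      finally show "norm (- (\<integral>x. (\<phi> k x - u x) \<bullet> grad g x \<partial>lborel)) \<le> sqrt (\<integral>x. (norm (\<phi> k x - u x))\<^sup>2 \<partial>lborel) * sqrt (\<integral>x. (norm (grad g x))\<^sup>2 \<partial>lborel)"
        using cs(2) by simp
    qed
  qed
qed

end

section \<open>Passage to the limit in the inequality\<close>

lemma transform_diff: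
  assumes "test_field \<phi>" "test_field \<psi>"
  shows "cosT (\<lambda>x. \<phi> x - \<psi> x) x = cosT \<phi> x - cosT \<psi> x" "sinT (\<lambda>x. \<phi> x - \<psi> x) x = sinT \<phi> x - sinT \<psi> x"
    "cosTJ (\<lambda>x. \<phi> x - \<psi> x) x = cosTJ \<phi> x - cosTJ \<psi> x" "sinTJ (\<lambda>x. \<phi> x - \<psi> x) x = sinTJ \<phi> x - sinTJ \<psi> x"
proof -
  interpret F: test_field_loc \<phi> by unfold_locales fact
  interpret P: test_field_loc \<psi> by unfold_locales fact
  note i = moments_integrable[OF F.mom] moments_integrable[OF P.mom] moments_integrable[OF F.mom_xk] moments_integrable[OF P.mom_xk]
  show "cosT (\<lambda>x. \<phi> x - \<psi> x) x = cosT \<phi> x - cosT \<psi> x" "sinT (\<lambda>x. \<phi> x - \<psi> x) x = sinT \<phi> x - sinT \<psi> x"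
    "cosTJ (\<lambda>x. \<phi> x - \<psi> x) x = cosTJ \<phi> x - cosTJ \<psi> x" "sinTJ (\<lambda>x. \<phi> x - \<psi> x) x = sinTJ \<phi> x - sinTJ \<psi> x"
    by (simp_all add: vec_eq_iff cosT_def sinT_def cosTJ_def sinTJ_def right_diff_distrib CT_diff ST_diff i)
qed

lemma tangential_div_diff: "tangential_div x (y - z) (A - B) = tangential_div x y A - tangential_div x z B"
  by (simp add: tangential_div_def radial_coeff_def trace_sub matrix_vector_mult_diff_rdistrib inner_diff_right
      diff_divide_distrib algebra_simps)

context solenoidal_limit
begin

abbreviation "Y k \<equiv> \<integral>x. (norm (norm x *\<^sub>R \<phi> k x))\<^sup>2 \<partial>lborel"
abbreviation "D k \<equiv> \<integral>x. (trace (jac (\<phi> k) x))\<^sup>2 \<partial>lborel"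

lemmas bounds = test_field_loc.transform_bounds[OF loc dim]

text \<open>Differences of test fields are test fields, so the estimate of the tangential divergence
  by the weighted norm applies to them, and the weighted fields converge in L2.\<close>

lemma d_Cauchy: "L2_Cauchy (\<lambda>k. test_field_loc.dC (\<phi> k))" "L2_Cauchy (\<lambda>k. test_field_loc.dS (\<phi> k))"
proof -
  have loc': "test_field_loc (\<lambda>x. \<phi> k x - \<phi> m x)" for k m
    by unfold_locales (intro test_field_diff test)
  have "test_field_loc.dC (\<phi> k) x - test_field_loc.dC (\<phi> m) x = test_field_loc.dC (\<lambda>x. \<phi> k x - \<phi> m x) x"
    "test_field_loc.dS (\<phi> k) x - test_field_loc.dS (\<phi> m) x = test_field_loc.dS (\<lambda>x. \<phi> k x - \<phi> m x) x" for k m x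
    by (simp_all add: test_field_loc.dC_def[OF loc] test_field_loc.dC_def[OF loc'] test_field_loc.dS_def[OF loc] test_field_loc.dS_def[OF loc']
        transform_diff test tangential_div_diff)
  then have le: "(\<integral>x. (norm (test_field_loc.dC (\<phi> k) x - test_field_loc.dC (\<phi> m) x))\<^sup>2 \<partial>lborel)
      \<le> 10 * (real CARD('n) + 1)\<^sup>2 * (2 * pi) ^ CARD('n) * (\<integral>x. (norm (norm x *\<^sub>R \<phi> k x - norm x *\<^sub>R \<phi> m x))\<^sup>2 \<partial>lborel)"
    "(\<integral>x. (norm (test_field_loc.dS (\<phi> k) x - test_field_loc.dS (\<phi> m) x))\<^sup>2 \<partial>lborel)
      \<le> 10 * (real CARD('n) + 1)\<^sup>2 * (2 * pi) ^ CARD('n) * (\<integral>x. (norm (norm x *\<^sub>R \<phi> k x - norm x *\<^sub>R \<phi> m x))\<^sup>2 \<partial>lborel)" for k m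
    using test_field_loc.transform_bounds(13,14)[OF loc' dim, of k m] by (simp_all add: scaleR_diff_right)
  show "L2_Cauchy (\<lambda>k. test_field_loc.dC (\<phi> k))" "L2_Cauchy (\<lambda>k. test_field_loc.dS (\<phi> k))"
    by (rule L2_Cauchy_transfer[OF C1 le(1)] L2_Cauchy_transfer[OF C1 le(2)])+
qed

lemma cD_tendsto_0: "(\<lambda>k. (2 * pi) ^ CARD('n) * D k) \<longlonglongrightarrow> 0"
  using tendsto_mult_right_zero[OF divergence_tendsto_0] .

lemma pairing_tendsto_0:
  "(\<lambda>k. \<integral>x. test_field_loc.aC (\<phi> k) x * test_field_loc.dC (\<phi> k) x \<partial>lborel) \<longlonglongrightarrow> 0"
  "(\<lambda>k. \<integral>x. test_field_loc.aS (\<phi> k) x * test_field_loc.dS (\<phi> k) x \<partial>lborel) \<longlonglongrightarrow> 0"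
proof -
  have "Bseq Y" using L1(4) by (meson convergentI convergent_imp_Bseq)
  then obtain B where B: "B > 0" "\<And>k. \<bar>Y k\<bar> \<le> B" by (auto elim: BseqE)
  define M where "M = sqrt (4 * (2 * pi) ^ CARD('n) * B)"
  have M: "M > 0" "M\<^sup>2 = 4 * (2 * pi) ^ CARD('n) * B" using B(1) by (simp_all add: M_def)
  have le: "4 * (2 * pi) ^ CARD('n) * Y k \<le> M\<^sup>2" for k
    unfolding M(2) using B(2)[of k] by (intro mult_left_mono) auto
  have z: "(\<lambda>k. \<integral>x. ((x \<bullet> x) * test_field_loc.aC (\<phi> k) x)\<^sup>2 \<partial>lborel) \<longlonglongrightarrow> 0"
    "(\<lambda>k. \<integral>x. ((x \<bullet> x) * test_field_loc.aS (\<phi> k) x)\<^sup>2 \<partial>lborel) \<longlonglongrightarrow> 0"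
    by (rule tendsto_sandwich[OF always_eventually always_eventually tendsto_const cD_tendsto_0, OF allI allI];
        simp only: bounds(15,16) Bochner_Integration.integral_nonneg zero_le_power2)+
  show "(\<lambda>k. \<integral>x. test_field_loc.aC (\<phi> k) x * test_field_loc.dC (\<phi> k) x \<partial>lborel) \<longlonglongrightarrow> 0"
    by (rule weak_strong_pairing[OF bounds(1) bounds(3) bounds(5) bounds(7) bounds(9) order_trans[OF bounds(11) le] M(1) z(1) d_Cauchy(1)])
  show "(\<lambda>k. \<integral>x. test_field_loc.aS (\<phi> k) x * test_field_loc.dS (\<phi> k) x \<partial>lborel) \<longlonglongrightarrow> 0"
    by (rule weak_strong_pairing[OF bounds(2) bounds(4) bounds(6) bounds(8) bounds(10) order_trans[OF bounds(12) le] M(1) z(2) d_Cauchy(2)])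
qed

lemma radial_tendsto_0:
  "(\<lambda>k. \<integral>x. (norm x * test_field_loc.aC (\<phi> k) x)\<^sup>2 \<partial>lborel) \<longlonglongrightarrow> 0"
  "(\<lambda>k. \<integral>x. (norm x * test_field_loc.aS (\<phi> k) x)\<^sup>2 \<partial>lborel) \<longlonglongrightarrow> 0"
proof -
  have "(\<lambda>k. sqrt (4 * (2 * pi) ^ CARD('n) * Y k) * sqrt ((2 * pi) ^ CARD('n) * D k)) \<longlonglongrightarrow> sqrt (4 * (2 * pi) ^ CARD('n) * (\<integral>x. (norm (norm x *\<^sub>R u x))\<^sup>2 \<partial>lborel)) * sqrt 0"
    by (intro tendsto_intros cD_tendsto_0 L1(4))
  then have z: "(\<lambda>k. sqrt (4 * (2 * pi) ^ CARD('n) * Y k) * sqrt ((2 * pi) ^ CARD('n) * D k)) \<longlonglongrightarrow> 0" by simp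
  show "(\<lambda>k. \<integral>x. (norm x * test_field_loc.aC (\<phi> k) x)\<^sup>2 \<partial>lborel) \<longlonglongrightarrow> 0"
    "(\<lambda>k. \<integral>x. (norm x * test_field_loc.aS (\<phi> k) x)\<^sup>2 \<partial>lborel) \<longlonglongrightarrow> 0"
    by (rule tendsto_sandwich[OF always_eventually always_eventually tendsto_const z, OF allI allI];
        simp only: bounds(17,18) Bochner_Integration.integral_nonneg zero_le_power2)+
qed

lemma additive_inequality:
  assumes \<alpha>: "\<alpha>\<^sup>2 + \<alpha> * (real CARD('n) - 2) = 2" and l: "l > 0"
  shows "l * (real CARD('n) + 2 * \<alpha>) * (\<integral>x. (norm (u x))\<^sup>2 \<partial>lborel)
    \<le> (\<integral>x. (norm (u x))\<^sup>2 * (norm x)\<^sup>2 \<partial>lborel) + l\<^sup>2 * (\<integral>x. (norm (G x))\<^sup>2 \<partial>lborel)"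
proof -
  \<comment> \<open>The zeros are the limits of the defect terms, kept so that the limit can be
    taken term by term.\<close>
  have "l * (real CARD('n) + 2 * \<alpha>) * ((2 * pi) ^ CARD('n) * (\<integral>x. (norm (u x))\<^sup>2 \<partial>lborel) - (0 + 0))
    \<le> (2 * pi) ^ CARD('n) * (\<integral>x. (norm (norm x *\<^sub>R u x))\<^sup>2 \<partial>lborel) + l\<^sup>2 * ((2 * pi) ^ CARD('n) * (\<integral>x. (norm (G x))\<^sup>2 \<partial>lborel)) - 4 * (0 + 0)"
  proof (rule LIMSEQ_le)
    show "\<exists>N. \<forall>k\<ge>N. l * (real CARD('n) + 2 * \<alpha>) * ((2 * pi) ^ CARD('n) * (\<integral>x. (norm (\<phi> k x))\<^sup>2 \<partial>lborel)
      - ((\<integral>x. (norm x * test_field_loc.aC (\<phi> k) x)\<^sup>2 \<partial>lborel) + (\<integral>x. (norm x * test_field_loc.aS (\<phi> k) x)\<^sup>2 \<partial>lborel)))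
     \<le> (2 * pi) ^ CARD('n) * Y k + l\<^sup>2 * ((2 * pi) ^ CARD('n) * (\<integral>x. (norm (jac (\<phi> k) x))\<^sup>2 \<partial>lborel))
      - 4 * ((\<integral>x. test_field_loc.aC (\<phi> k) x * test_field_loc.dC (\<phi> k) x \<partial>lborel) + (\<integral>x. test_field_loc.aS (\<phi> k) x * test_field_loc.dS (\<phi> k) x \<partial>lborel))"
      using test_field_loc.test_field_inequality[OF loc dim \<alpha> l] by blast
  qed (intro tendsto_intros L0(4) L1(4) LG(4) radial_tendsto_0 pairing_tendsto_0)+
  then have "(2 * pi) ^ CARD('n) * (l * (real CARD('n) + 2 * \<alpha>) * (\<integral>x. (norm (u x))\<^sup>2 \<partial>lborel))
    \<le> (2 * pi) ^ CARD('n) * ((\<integral>x. (norm (norm x *\<^sub>R u x))\<^sup>2 \<partial>lborel) + l\<^sup>2 * (\<integral>x. (norm (G x))\<^sup>2 \<partial>lborel))"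
    by (simp add: distrib_left mult_ac)
  then have "l * (real CARD('n) + 2 * \<alpha>) * (\<integral>x. (norm (u x))\<^sup>2 \<partial>lborel)
    \<le> (\<integral>x. (norm (norm x *\<^sub>R u x))\<^sup>2 \<partial>lborel) + l\<^sup>2 * (\<integral>x. (norm (G x))\<^sup>2 \<partial>lborel)"
    by (rule mult_left_le_imp_le) simp
  then show ?thesis by (simp add: power_mult_distrib mult.commute)
qed

end

text \<open>The positive root of \<open>\<alpha>^2 + (N - 2) \<alpha> = 2\<close>.\<close>

definition ground_exponent :: "nat \<Rightarrow> real" where
  "ground_exponent N = (sqrt ((real N - 2)\<^sup>2 + 8) - (real N - 2)) / 2"

lemma ground_exponent: "(ground_exponent N)\<^sup>2 + ground_exponent N * (real N - 2) = 2"
proof -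
  define s where "s = sqrt ((real N - 2)\<^sup>2 + 8)"
  have "s\<^sup>2 = (real N - 2)\<^sup>2 + 8" by (simp add: s_def)
  then show ?thesis unfolding ground_exponent_def s_def[symmetric]
    by (simp add: field_simps power2_eq_square)
qed

lemma CN_eq: "CN N = (real N + 2 * ground_exponent N)\<^sup>2 / 4"
proof -
  have "real N + 2 * ground_exponent N = sqrt ((real N - 2)\<^sup>2 + 8) + 2"
    by (simp add: ground_exponent_def field_simps)
  then show ?thesis by (simp add: CN_def)
qed

section \<open>The multiplicative form of the inequality\<close>

lemma in_D_facts:
  fixes u :: "real^'n \<Rightarrow> real^'n"
  assumes dim: "CARD('n) \<ge> 3" and u: "in_D u G" and sol: "solenoidal u"
  shows "integrable lborel (\<lambda>x. (norm (u x))\<^sup>2)"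
    and "l > 0 \<Longrightarrow> l * (real CARD('n) + 2 * ground_exponent CARD('n)) * (\<integral>x. (norm (u x))\<^sup>2 \<partial>lborel)
    \<le> (\<integral>x. (norm (u x))\<^sup>2 * (norm x)\<^sup>2 \<partial>lborel) + l\<^sup>2 * (\<integral>x. (norm (G x))\<^sup>2 \<partial>lborel)"
proof -
  obtain \<phi> where "\<And>k. test_field (\<phi> k)"
    "(\<lambda>k. \<integral>\<^sup>+ x. ennreal ((norm (\<phi> k x - u x))\<^sup>2 * (1 + (norm x)\<^sup>2)) \<partial>lborel) \<longlonglongrightarrow> 0"
    "(\<lambda>k. \<integral>\<^sup>+ x. ennreal ((norm (jac (\<phi> k) x - G x))\<^sup>2) \<partial>lborel) \<longlonglongrightarrow> 0"
    using u unfolding in_D_def by blast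
  then interpret solenoidal_limit u G \<phi>
    by unfold_locales (use dim sol u in \<open>auto simp: in_D_def\<close>)
  show "integrable lborel (\<lambda>x. (norm (u x))\<^sup>2)" by (rule L0(1))
  show "l > 0 \<Longrightarrow> l * (real CARD('n) + 2 * ground_exponent CARD('n)) * (\<integral>x. (norm (u x))\<^sup>2 \<partial>lborel)
    \<le> (\<integral>x. (norm (u x))\<^sup>2 * (norm x)\<^sup>2 \<partial>lborel) + l\<^sup>2 * (\<integral>x. (norm (G x))\<^sup>2 \<partial>lborel)"
    by (rule additive_inequality[OF ground_exponent])
qed

text \<open>For \<open>X > 0\<close> the best parameter is \<open>l = K * Z / (2 * X)\<close>, the
  minimiser of \<open>Y + l^2 * X - l * K * Z\<close>.\<close>

lemma scaling_optimization:
  fixes X Y Z K :: real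
  assumes le: "\<And>l. l > 0 \<Longrightarrow> l * K * Z \<le> Y + l\<^sup>2 * X" and "X \<ge> 0" "Y \<ge> 0" "Z \<ge> 0" "K > 0"
  shows "K\<^sup>2 / 4 * Z\<^sup>2 \<le> X * Y"
proof (cases "Z = 0")
  case False
  then have Z: "Z > 0" using assms by simp
  have "X > 0"
  proof (rule ccontr)
    assume "\<not> X > 0"
    then have "X = 0" using assms by simp
    \<comment> \<open>If \<open>X = 0\<close>, the left-hand side could be made arbitrarily large;
      this \<open>l\<close> makes it \<open>Y + 1\<close>, which exceeds \<open>Y\<close>.\<close>
    moreover have "(Y + 1) / (K * Z) * K * Z = Y + 1" "(Y + 1) / (K * Z) > 0"
      using Z assms(3,5) by simp_all
    ultimately show False using le[of "(Y + 1) / (K * Z)"] by simp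
  qed
  then have "K * Z / (2 * X) * K * Z \<le> Y + (K * Z / (2 * X))\<^sup>2 * X"
    using Z assms by (intro le) simp
  then show ?thesis using \<open>X > 0\<close> by (simp add: field_simps power2_eq_square)
qed (use assms in simp)

theorem solenoidal_uncertainty:
  fixes u :: "real^'n \<Rightarrow> real^'n"
  assumes dim: "CARD('n) \<ge> 3" and u: "in_D u G" and sol: "solenoidal u"
  shows "CN CARD('n) * (\<integral>x. (norm (u x))\<^sup>2 \<partial>lborel)\<^sup>2
    \<le> (\<integral>x. (norm (G x))\<^sup>2 \<partial>lborel) * (\<integral>x. (norm (u x))\<^sup>2 * (norm x)\<^sup>2 \<partial>lborel)"
  unfolding CN_eq
proof (rule scaling_optimization[OF in_D_facts(2)[OF dim u sol]])
  have "sqrt ((real CARD('n) - 2)\<^sup>2 + 8) \<ge> sqrt ((real CARD('n) - 2)\<^sup>2)" by (rule real_sqrt_le_mono) simp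
  then have "ground_exponent CARD('n) \<ge> 0" using dim by (simp add: ground_exponent_def)
  then show "real CARD('n) + 2 * ground_exponent CARD('n) > 0" using dim by simp
qed simp_all

subsection \<open>The extremal field on the Fourier side\<close>

text \<open>Up to polynomial factors this is a common majorant for the extremal field, its Jacobian
  and their squares, whose singularities at the origin are no worse than
  \<open>1/|x|^2\<close>.\<close>

definition singular_gauss :: "real \<Rightarrow> 'a::euclidean_space \<Rightarrow> real" where
  "singular_gauss c x = gauss c x * (1 + 1 / (x \<bullet> x))"

lemma singular_gauss_nonneg: "0 \<le> singular_gauss c x"
  using gauss_pos[of c x] by (simp add: singular_gauss_def)

lemma moments_singular_gauss:
  assumes dim: "DIM('a::euclidean_space) \<ge> 3" and c: "c > 0"
  shows "moments (singular_gauss c :: 'a \<Rightarrow> real)"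
  unfolding singular_gauss_def[abs_def]
proof (rule moments_gauss_mult)
  show "c / 2 < c" "0 < c / 2" using c by auto
  show "integrable lborel (\<lambda>x::'a. gauss (c / 2) x * (1 + 1 / (x \<bullet> x)))"
  proof (rule Bochner_Integration.integrable_bound)
    show "integrable lborel (\<lambda>x::'a. 2 * gauss (c / 2) x + exp 1 * (gauss 1 x / (x \<bullet> x)))"
      using c by (intro Bochner_Integration.integrable_add integrable_mult_right gauss_integrable gauss_inverse_square_integrable dim) auto
    show "AE x in lborel. norm (gauss (c / 2) x * (1 + 1 / ((x::'a) \<bullet> x))) \<le> norm (2 * gauss (c / 2) x + exp 1 * (gauss 1 x / (x \<bullet> x)))"
    proof (rule AE_I2)
      fix x :: 'a
      have g: "0 \<le> gauss (c / 2) x" "gauss (c / 2) x \<le> 1" "0 \<le> exp 1 * (gauss 1 x / (x \<bullet> x))"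
        using less_imp_le[OF gauss_pos[of "c/2" x]] less_imp_le[OF gauss_pos[of 1 x]] gauss_le_1[of "c/2" x] c by simp_all
      have "gauss (c / 2) x * (1 / (x \<bullet> x)) \<le> gauss (c / 2) x + exp 1 * (gauss 1 x / (x \<bullet> x))"
      proof (cases "x \<bullet> x \<ge> 1")
        case True
        then have "gauss (c / 2) x * (1 / (x \<bullet> x)) \<le> gauss (c / 2) x * 1"
          using g by (intro mult_left_mono) (simp_all only: divide_le_eq_1_pos zero_less_one order.strict_trans2[OF zero_less_one True])
        then show ?thesis using g(3) by linarith
      next
        case False
        have "1 \<le> exp 1 * gauss 1 x" using False by (simp add: gauss_def flip: exp_add)
        then have "gauss (c / 2) x * (1 / (x \<bullet> x)) \<le> (exp 1 * gauss 1 x) * (1 / (x \<bullet> x))"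
          using g by (intro mult_right_mono) auto
        then show ?thesis using g(1) by simp
      qed
      then have "gauss (c / 2) x * (1 + 1 / (x \<bullet> x)) \<le> 2 * gauss (c / 2) x + exp 1 * (gauss 1 x / (x \<bullet> x))"
        by (simp add: distrib_left)
      moreover have "0 \<le> gauss (c / 2) x * (1 + 1 / (x \<bullet> x))" using g by simp
      ultimately show "norm (gauss (c / 2) x * (1 + 1 / (x \<bullet> x))) \<le> norm (2 * gauss (c / 2) x + exp 1 * (gauss 1 x / (x \<bullet> x)))"
        using g by simp
    qed
  qed measurable
qed measurable

lemma moments_norm_power: "moments w \<Longrightarrow> moments (\<lambda>x. norm x ^ k * w x)"
  by (rule moments_dominated[where c = 1 and k = k and w = w]) (auto dest: moments_measurable simp: abs_mult)

lemma moments_cmult: "moments w \<Longrightarrow> moments (\<lambda>x. c * w x)"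
  by (rule moments_dominated[where c = "\<bar>c\<bar>" and k = 0 and w = w]) (auto dest: moments_measurable simp: abs_mult)

lemma moments_polynomial_singular_gauss:
  assumes "DIM('a::euclidean_space) \<ge> 3" "c > 0"
  shows "moments (\<lambda>x::'a. (p + q * norm x ^ k) * singular_gauss c x)"
  using moments_add[OF moments_cmult[OF moments_singular_gauss[OF assms], of p]
      moments_cmult[OF moments_norm_power[OF moments_singular_gauss[OF assms], of k], of q]]
  by (simp add: distrib_right mult.assoc)

locale extremal =
  fixes e :: "'n::finite"
  assumes dim: "CARD('n) \<ge> 3"
begin

text \<open>The field \<open>v\<close> is \<open>|x|\<^sup>\<alpha> exp(- |x|\<^sup>2/2)\<close> times the tangential projection of a constant unit vector:
  this is where the pointwise inequality for tangential fields is sharp.\<close>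

definition "\<alpha> = ground_exponent CARD('n)"
text \<open>The vector \<open>y\<close> is \<open>|x|^2\<close> times the tangential projection of
  the unit vector, which keeps it polynomial; \<open>beta\<close> compensates with
  \<open>|x|^(\<alpha> - 2)\<close> instead of \<open>|x|^\<alpha>\<close>. The next function,
  \<open>kappa\<close>, is such that the gradient of \<open>beta\<close> is
  \<open>beta kappa x\<close>.\<close>

definition "beta (x::real^'n) = (x \<bullet> x) powr (\<alpha> / 2 - 1) * exp (- (x \<bullet> x) / 2)"
definition "kappa (x::real^'n) = (\<alpha> - 2) / (x \<bullet> x) - 1"
definition "y (x::real^'n) = (x \<bullet> x) *\<^sub>R axis e 1 - (x $ e) *\<^sub>R x"
definition "v x = beta x *\<^sub>R y x"
definition "J x = beta x *\<^sub>R (2 *\<^sub>R outer (axis e 1) x - outer x (axis e 1) - (x $ e) *\<^sub>R mat 1 + kappa x *\<^sub>R outer (y x) x)"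

lemma alpha_eq: "\<alpha>\<^sup>2 + \<alpha> * (real CARD('n) - 2) = 2"
  unfolding \<alpha>_def by (rule ground_exponent)

text \<open>The upper bound is where \<open>N \<ge> 3\<close> is felt: it amounts to
  \<open>(N - 2)^2 + 8 \<le> N^2\<close>. Positivity makes the extremal field continuous at the
  origin.\<close>

lemma alpha_pos: "0 < \<alpha>" and alpha_le_1: "\<alpha> \<le> 1"
proof -
  let ?N = "real CARD('n)"
  have N: "?N \<ge> 3" using dim by simp
  have "sqrt ((?N - 2)\<^sup>2) < sqrt ((?N - 2)\<^sup>2 + 8)" by (rule real_sqrt_less_mono) simp
  then show "0 < \<alpha>" using N by (simp add: \<alpha>_def ground_exponent_def)
  have "sqrt ((?N - 2)\<^sup>2 + 8) \<le> ?N"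
    using N by (intro real_le_lsqrt) (auto simp: power2_eq_square algebra_simps)
  then show "\<alpha> \<le> 1" by (simp add: \<alpha>_def ground_exponent_def)
qed

lemma beta_pos: "x \<noteq> 0 \<Longrightarrow> beta x > 0" and beta_nonneg: "beta x \<ge> 0"
  by (auto simp: beta_def)

lemma pd_beta: "pd k beta (\<lambda>x. beta x * kappa x * x $ k)"
proof -
  let ?g = "\<lambda>r. r powr (\<alpha> / 2 - 1) * exp (- r / 2)"
  let ?g' = "\<lambda>r. ?g r * ((\<alpha> / 2 - 1) / r - 1 / 2)"
  have "pd k (\<lambda>x. ?g (x \<bullet> x)) (\<lambda>x. ?g' (x \<bullet> x) * (2 * x $ k))"
  proof (rule pd_compose[OF pd_inner_self])
    fix x :: "real^'n" assume "x \<noteq> 0"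
    then have R: "x \<bullet> x > 0" by simp
    define a where "a = \<alpha> / 2 - 1"
    have 1: "((\<lambda>r. r powr a) has_real_derivative a * (x \<bullet> x) powr (a - 1)) (at (x \<bullet> x))"
      by (rule has_real_derivative_powr[OF R])
    have 2: "((\<lambda>r. exp (- r / 2)) has_real_derivative exp (- (x \<bullet> x) / 2) * (- 1 / 2)) (at (x \<bullet> x))"
      by (auto intro!: derivative_eq_intros)
    have p: "(x \<bullet> x) powr (a - 1) = (x \<bullet> x) powr a / (x \<bullet> x)"
      using R powr_diff[of "x \<bullet> x" a 1] by simp
    have "a * (x \<bullet> x) powr (a - 1) * exp (- (x \<bullet> x) / 2) + exp (- (x \<bullet> x) / 2) * (- 1 / 2) * (x \<bullet> x) powr a
      = (x \<bullet> x) powr a * exp (- (x \<bullet> x) / 2) * (a / (x \<bullet> x) - 1 / 2)"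
      unfolding p by (simp add: algebra_simps)
    with DERIV_mult[OF 1 2] show "(?g has_real_derivative ?g' (x \<bullet> x)) (at (x \<bullet> x))"
      unfolding a_def by simp
  next
    show "continuous_on ((\<lambda>x::real^'n. x \<bullet> x) ` (- {0})) ?g'"
      by (auto intro!: continuous_intros)
  qed
  moreover have "?g' (x \<bullet> x) * (2 * x $ k) = beta x * kappa x * x $ k" for x
    by (simp add: beta_def kappa_def algebra_simps diff_divide_distrib)
  ultimately show ?thesis unfolding beta_def[abs_def, symmetric] by (simp only:)
qed

lemma y_nth: "y x $ j = (if j = e then 1 else 0) * (x \<bullet> x) - x $ e * x $ j"
  by (simp add: y_def axis_def)

lemma pd_v: "pd k (\<lambda>x. v x $ j) (\<lambda>x. J x $ j $ k)"
proof -
  have "pd k (\<lambda>x. beta x * ((if j = e then 1 else 0) * (x \<bullet> x) - x $ e * x $ j))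
    (\<lambda>x. beta x * kappa x * x $ k * ((if j = e then 1 else 0) * (x \<bullet> x) - x $ e * x $ j)
      + beta x * ((if j = e then 1 else 0) * (2 * x $ k) - ((if e = k then 1 else 0) * x $ j + x $ e * (if j = k then 1 else 0))))"
    by (intro pd_mult pd_beta pd_diff pd_cmult pd_inner_self pd_nth)
  moreover have "beta x * kappa x * x $ k * ((if j = e then 1 else 0) * (x \<bullet> x) - x $ e * x $ j)
      + beta x * ((if j = e then 1 else 0) * (2 * x $ k) - ((if e = k then 1 else 0) * x $ j + x $ e * (if j = k then 1 else 0)))
    = J x $ j $ k" for x
    unfolding J_def y_def by (simp add: outer_def mat_def axis_def algebra_simps)
  ultimately show ?thesis by (simp add: v_def y_nth)
qed

section \<open>Size of the extremal field near the origin and at infinity\<close>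

lemma x_y: "x \<bullet> y x = 0"
  by (simp add: y_def inner_diff_right inner_axis)

lemma x_v: "x \<bullet> v x = 0"
  by (simp add: v_def x_y)

lemma y_y: "y x \<bullet> y x = (x \<bullet> x) * ((x \<bullet> x) - (x $ e)\<^sup>2)"
proof -
  have "y x \<bullet> y x = y x \<bullet> ((x \<bullet> x) *\<^sub>R axis e 1) - (x $ e) * (y x \<bullet> x)"
    by (subst (2) y_def) (simp add: inner_diff_right)
  then show ?thesis
    using x_y[of x] by (simp add: inner_commute[of "y x" x] inner_axis y_nth power2_eq_square algebra_simps)
qed

lemma component_square_le: "(x $ e)\<^sup>2 \<le> x \<bullet> x"
  using component_le_norm_cart[of x e] by (metis abs_le_square_iff abs_norm_cancel power2_norm_eq_inner)

lemma norm_y_le: "norm (y x) \<le> x \<bullet> x"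
proof -
  have "y x \<bullet> y x \<le> (x \<bullet> x) * (x \<bullet> x)"
    unfolding y_y by (intro mult_left_mono) auto
  then have "(norm (y x))\<^sup>2 \<le> (x \<bullet> x)\<^sup>2" unfolding power2_norm_eq_inner by (simp add: power2_eq_square)
  then show ?thesis by (rule power2_le_imp_le) simp
qed

text \<open>Off the origin the left-hand side is \<open>|x|^(2 \<alpha> - 2) exp (- |x|^2)\<close>,
  and by \<open>0 < \<alpha> \<le> 1\<close> the exponent lies between \<open>- 2\<close> and
  0.\<close>

lemma beta_square_le: "(x \<bullet> x) * (beta x)\<^sup>2 \<le> singular_gauss 1 x"
proof (cases "x = 0")
  case False
  then have R: "x \<bullet> x > 0" by simp
  have "(x \<bullet> x) * (beta x)\<^sup>2 = (x \<bullet> x) powr (\<alpha> - 1) * gauss 1 x"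
  proof -
    have "(beta x)\<^sup>2 = (x \<bullet> x) powr (\<alpha> - 2) * gauss 1 x"
      by (simp add: beta_def gauss_def power2_eq_square flip: exp_add powr_add) (simp add: mult_ac flip: exp_add powr_add)
    moreover have "(x \<bullet> x) * (x \<bullet> x) powr (\<alpha> - 2) = (x \<bullet> x) powr (\<alpha> - 1)"
      using R powr_add[of "x \<bullet> x" 1 "\<alpha> - 2"] by simp
    ultimately show ?thesis by (simp add: mult.assoc[symmetric])
  qed
  moreover have "(x \<bullet> x) powr (\<alpha> - 1) \<le> 1 + 1 / (x \<bullet> x)"
  proof (cases "x \<bullet> x \<ge> 1")
    case True
    then have "(x \<bullet> x) powr (\<alpha> - 1) \<le> (x \<bullet> x) powr 0" using alpha_le_1 by (intro powr_mono) auto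
    moreover have "0 \<le> 1 / (x \<bullet> x)" by simp
    moreover have "(x \<bullet> x) powr 0 = 1" using R by simp
    ultimately show ?thesis by linarith
  next
    case False
    then have "(x \<bullet> x) powr (\<alpha> - 1) \<le> (x \<bullet> x) powr (- 1)"
      using alpha_pos R by (intro powr_mono') auto
    then show ?thesis using R by (simp add: powr_minus_divide)
  qed
  ultimately show ?thesis
    using gauss_pos[of 1 x] by (simp add: singular_gauss_def mult.commute[of "gauss 1 x"] mult_right_mono)
qed (simp add: singular_gauss_nonneg)

lemma singular_gauss_square: "singular_gauss 1 x \<le> (singular_gauss (1/2) x)\<^sup>2"
proof -
  have "1 * (1 + 1 / (x \<bullet> x)) \<le> (1 + 1 / (x \<bullet> x)) * (1 + 1 / (x \<bullet> x))"
    by (intro mult_right_mono) auto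
  moreover have "gauss 1 x = (gauss (1/2) x)\<^sup>2"
    by (simp add: gauss_def power2_eq_square flip: exp_add)
  ultimately show ?thesis
    using gauss_pos[of "1/2" x] unfolding singular_gauss_def
    by (simp add: power_mult_distrib power2_eq_square[of "1 + 1 / (x \<bullet> x)"] mult_left_mono)
qed

lemma beta_norm_le: "norm x * beta x \<le> singular_gauss (1/2) x"
proof -
  have "(norm x * beta x)\<^sup>2 \<le> (singular_gauss (1/2) x)\<^sup>2"
    using order_trans[OF beta_square_le singular_gauss_square] by (simp add: power_mult_distrib power2_norm_eq_inner)
  then show ?thesis by (rule power2_le_imp_le) (rule singular_gauss_nonneg)
qed

lemma norm_v_le: "norm (v x) \<le> norm x * (norm x * beta x)"
  using mult_left_mono[OF norm_y_le beta_nonneg, of x x] beta_nonneg[of x]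
  by (simp add: v_def power2_norm_eq_inner[symmetric] power2_eq_square mult_ac)

text \<open>The pole of \<open>kappa\<close> is cancelled by \<open>|y| \<le> |x|^2\<close>, so the
  Jacobian is a polynomially bounded factor times \<open>|x| beta\<close>.\<close>

lemma norm_J_le: "norm (J x) \<le> (real CARD('n) + 5 + norm x ^ 2) * (norm x * beta x)"
proof (cases "x = 0")
  case False
  then have R: "x \<bullet> x > 0" by simp
  have m1: "norm (mat 1 :: real^'n^'n) \<le> real CARD('n)"
  proof -
    have "norm (mat 1 :: real^'n^'n) = sqrt (real CARD('n))"
      by (simp add: norm_eq_sqrt_inner inner_mat_1 trace_I)
    also have "\<dots> \<le> real CARD('n)"
      using dim by (intro real_le_lsqrt) (auto simp: power2_eq_square)
    finally show ?thesis .
  qed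
  have "\<bar>kappa x\<bar> * norm (y x) \<le> \<bar>kappa x\<bar> * (x \<bullet> x)" by (intro mult_left_mono norm_y_le) simp
  also have "\<dots> = \<bar>kappa x * (x \<bullet> x)\<bar>" using R by (simp add: abs_mult)
  also have "kappa x * (x \<bullet> x) = \<alpha> - 2 - x \<bullet> x" unfolding kappa_def by (subst left_diff_distrib) (use R in simp)
  also have "\<bar>\<alpha> - 2 - x \<bullet> x\<bar> \<le> 2 + norm x ^ 2"
    using alpha_pos alpha_le_1 inner_ge_zero[of x] unfolding power2_norm_eq_inner abs_le_iff by linarith
  finally have k: "norm (kappa x *\<^sub>R outer (y x) x) \<le> (2 + norm x ^ 2) * norm x"
    by (simp add: norm_outer mult.assoc[symmetric] mult_right_mono)
  have xe: "norm ((x $ e) *\<^sub>R (mat 1 :: real^'n^'n)) \<le> norm x * real CARD('n)"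
    unfolding norm_scaleR by (intro mult_mono m1) (auto simp: component_le_norm_cart)
  have "norm (2 *\<^sub>R outer (axis e 1) x - outer x (axis e 1) - (x $ e) *\<^sub>R mat 1 + kappa x *\<^sub>R outer (y x) x)
    \<le> norm (2 *\<^sub>R outer (axis e 1) x :: real^'n^'n) + norm (outer x (axis e 1) :: real^'n^'n) + norm ((x $ e) *\<^sub>R (mat 1 :: real^'n^'n)) + norm (kappa x *\<^sub>R outer (y x) x)"
    by (meson add_mono_thms_linordered_semiring(3) norm_triangle_ineq norm_triangle_ineq4 order_trans)
  also have "\<dots> \<le> 2 * norm x + norm x + norm x * real CARD('n) + (2 + norm x ^ 2) * norm x"
    using k xe by (simp add: norm_outer)
  also have "\<dots> = (real CARD('n) + 5 + norm x ^ 2) * norm x" by (simp add: algebra_simps)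
  finally show ?thesis
    using beta_nonneg[of x] by (simp add: J_def mult_left_mono mult.commute[of _ "beta x"] mult.left_commute[of _ "beta x"])
qed (simp add: J_def beta_def)

lemma moments_v: "moments (\<lambda>x. v x $ j)" and moments_J: "moments (\<lambda>x. J x $ j $ k)"
  and moments_v2: "moments (\<lambda>x. (norm (v x))\<^sup>2)" and moments_J2: "moments (\<lambda>x. (norm (J x))\<^sup>2)"
proof -
  have d: "DIM(real^'n) \<ge> 3" using dim by simp
  have m: "(\<lambda>x. v x $ j) \<in> borel_measurable borel" "(\<lambda>x. J x $ j $ k) \<in> borel_measurable borel" for j k
    using pd_measurable[OF pd_v] by auto
  have vm[measurable]: "v \<in> borel_measurable borel" by (rule borel_measurable_vec) (rule m)
  have Jm[measurable]: "J \<in> borel_measurable borel" by (rule borel_measurable_vec, rule borel_measurable_vec) (rule m)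
  let ?P = "\<lambda>x::real^'n. (real CARD('n) + 5 + 1 * norm x ^ 2)"
  have Jb: "norm (J x) \<le> ?P x * singular_gauss (1/2) x" for x
    by (rule order_trans[OF norm_J_le]) (auto intro!: mult_left_mono beta_norm_le)
  have vb: "norm (v x) \<le> norm x * singular_gauss (1/2) x" for x
    by (rule order_trans[OF norm_v_le]) (auto intro!: mult_left_mono beta_norm_le)
  show "moments (\<lambda>x. v x $ j)"
    by (rule moments_dominated[OF moments_singular_gauss[OF d, of "1/2"] m(1), where c = 1 and k = 1])
      (use order_trans[OF component_le_norm_cart vb] in \<open>auto simp: singular_gauss_nonneg\<close>)
  show "moments (\<lambda>x. J x $ j $ k)"
  proof (rule moments_dominated[OF moments_polynomial_singular_gauss[OF d, of "1/2" "real CARD('n) + 5" 1 2] m(2), where c = 1 and k = 0])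
    fix x
    have "\<bar>J x $ j $ k\<bar> \<le> norm (J x)"
      by (rule order_trans[OF component_le_norm_cart Finite_Cartesian_Product.norm_nth_le])
    also have "\<dots> \<le> \<bar>?P x * singular_gauss (1/2) x\<bar>" using Jb[of x] by linarith
    finally show "\<bar>J x $ j $ k\<bar> \<le> 1 * norm x ^ 0 * \<bar>?P x * singular_gauss (1/2) x\<bar>" by simp
  qed simp
  show "moments (\<lambda>x. (norm (v x))\<^sup>2)"
  proof (rule moments_dominated[OF moments_singular_gauss[OF d, of 1], where c = 1 and k = 2])
    fix x
    have "(norm (v x))\<^sup>2 \<le> (norm x * (norm x * beta x))\<^sup>2" by (intro power_mono norm_v_le) auto
    also have "\<dots> = norm x ^ 2 * ((x \<bullet> x) * (beta x)\<^sup>2)" by (simp add: power_mult_distrib power2_norm_eq_inner)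
    also have "\<dots> \<le> norm x ^ 2 * singular_gauss 1 x" by (intro mult_left_mono beta_square_le) auto
    finally show "\<bar>(norm (v x))\<^sup>2\<bar> \<le> 1 * norm x ^ 2 * \<bar>singular_gauss 1 x\<bar>" by (simp add: singular_gauss_nonneg)
  qed auto
  let ?Q = "\<lambda>x::real^'n. (2 * (real CARD('n) + 5)\<^sup>2 + 2 * norm x ^ 4)"
  show "moments (\<lambda>x. (norm (J x))\<^sup>2)"
  proof (rule moments_dominated[OF moments_polynomial_singular_gauss[OF d, of 1 "2 * (real CARD('n) + 5)\<^sup>2" 2 4], where c = 1 and k = 0])
    fix x
    have "(norm (J x))\<^sup>2 \<le> ((real CARD('n) + 5 + norm x ^ 2) * (norm x * beta x))\<^sup>2" by (intro power_mono norm_J_le) auto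
    also have "\<dots> = (real CARD('n) + 5 + norm x ^ 2)\<^sup>2 * ((x \<bullet> x) * (beta x)\<^sup>2)" by (simp add: power_mult_distrib power2_norm_eq_inner)
    also have "\<dots> \<le> ?Q x * singular_gauss 1 x"
    proof (intro mult_mono beta_square_le)
      have "(p + q)\<^sup>2 \<le> 2 * p\<^sup>2 + 2 * q\<^sup>2" for p q :: real
        using sum_squares_bound[of p q] by (simp add: power2_sum)
      from this[of "real CARD('n) + 5" "norm x ^ 2"] show "(real CARD('n) + 5 + norm x ^ 2)\<^sup>2 \<le> ?Q x"
        by (simp flip: power_mult)
    qed auto
    finally show "\<bar>(norm (J x))\<^sup>2\<bar> \<le> 1 * norm x ^ 0 * \<bar>?Q x * singular_gauss 1 x\<bar>" by simp
  qed auto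
qed

text \<open>Near the origin \<open>|v| \<le> |x|^\<alpha>\<close> with \<open>\<alpha> > 0\<close>.
  Continuity is required by the full Plancherel identity.\<close>

lemma v_continuous: "continuous_on UNIV (\<lambda>x. v x $ j)"
proof -
  have "isCont (\<lambda>x. v x $ j) x" for x
  proof (cases "x = 0")
    case False
    have "continuous_on (-{0}) (\<lambda>x. v x $ j)" using pd_continuous(1)[OF pd_v] .
    then show ?thesis using False by (simp add: continuous_on_eq_continuous_at open_Compl)
  next
    case True
    have "((\<lambda>x. v x $ j) \<longlongrightarrow> 0) (at 0)"
    proof (rule Lim_null_comparison)
      have "((\<lambda>x::real^'n. x \<bullet> x) \<longlongrightarrow> 0) (at 0)" by (auto intro!: tendsto_eq_intros)
      then show "((\<lambda>x::real^'n. (x \<bullet> x) powr (\<alpha> / 2)) \<longlongrightarrow> 0) (at 0)"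
        using alpha_pos tendsto_powr'[of "\<lambda>x::real^'n. x \<bullet> x" 0 "at 0" "\<lambda>_. \<alpha> / 2" "\<alpha> / 2"] by simp
      show "\<forall>\<^sub>F x in at 0. norm (v x $ j) \<le> (x \<bullet> x) powr (\<alpha> / 2)"
      proof (rule always_eventually, rule allI)
        fix x
        show "norm (v x $ j) \<le> (x \<bullet> x) powr (\<alpha> / 2)"
        proof (cases "x = 0")
          case False
          then have R: "x \<bullet> x > 0" by simp
          have "\<bar>v x $ j\<bar> \<le> (x \<bullet> x) * beta x"
            using order_trans[OF component_le_norm_cart norm_v_le, of x j]
            by (simp add: mult.assoc[symmetric] power2_norm_eq_inner[symmetric] power2_eq_square)
          also have "\<dots> = (x \<bullet> x) powr (\<alpha> / 2) * exp (- (x \<bullet> x) / 2)"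
            using R powr_add[of "x \<bullet> x" 1 "\<alpha> / 2 - 1"] by (simp add: beta_def mult.assoc[symmetric])
          also have "\<dots> \<le> (x \<bullet> x) powr (\<alpha> / 2) * 1" by (intro mult_left_mono) auto
          finally show ?thesis by simp
        qed (simp add: v_def y_def)
      qed
    qed
    then show ?thesis using True by (simp add: isCont_def v_def y_def)
  qed
  then show ?thesis by (simp add: continuous_at_imp_continuous_on)
qed

text \<open>With \<open>R = |x|^2\<close> the square is at most
  \<open>(1 + R) exp (- R) \<le> 1\<close>.\<close>

lemma v_bounded: "\<bar>v x $ j\<bar> \<le> 3"
proof -
  let ?R = "x \<bullet> x"
  have "(v x $ j)\<^sup>2 \<le> (norm x * (norm x * beta x))\<^sup>2"
    using power_mono[OF order_trans[OF component_le_norm_cart norm_v_le] abs_ge_zero, of x j 2] by simp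
  also have "\<dots> = ?R * (?R * (beta x)\<^sup>2)" by (simp add: power_mult_distrib power2_norm_eq_inner)
  also have "\<dots> \<le> ?R * singular_gauss 1 x" by (intro mult_left_mono beta_square_le) auto
  also have "\<dots> \<le> (?R + 1) * exp (- ?R)"
    by (cases "x = 0") (simp_all add: singular_gauss_def gauss_def field_simps)
  also have "\<dots> \<le> exp ?R * exp (- ?R)" by (intro mult_right_mono) (auto simp: add.commute)
  also have "\<dots> \<le> 3\<^sup>2" by (simp flip: exp_add)
  finally have "\<bar>v x $ j\<bar>\<^sup>2 \<le> 3\<^sup>2" by simp
  then show ?thesis by (rule power2_le_imp_le) simp
qed

text \<open>Evenness makes the sine transform vanish, so that the cosine transform alone is the
  extremal field and is real.\<close>

lemma v_even: "v (- x) = v x"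
  by (simp add: v_def beta_def y_def)

text \<open>\<open>F\<close> is half the gradient of \<open>|v|\<^sup>2\<close>.\<close>

definition "q (x::real^'n) = (\<alpha> - 1) / (x \<bullet> x) - 1"
definition "F k (x::real^'n) = ((x \<bullet> x) * (beta x * beta x)) * (q x * ((x \<bullet> x) - x $ e * x $ e) * x $ k + (x $ k - x $ e * (if e = k then 1 else 0)))"
text \<open>Off the origin \<open>|v|^2\<close> is \<open>beta^2 |x|^2 (|x|^2 - x_e^2)\<close>, and
  \<open>q\<close> is \<open>kappa\<close> plus the \<open>1/|x|^2\<close> that the middle factor
  contributes to the gradient. The derivative is left exactly as the product rule delivers it, to be
  simplified after summation over \<open>k\<close>.\<close>

definition "F' k (x::real^'n) =
   (2 * x $ k * (beta x * beta x) + (x \<bullet> x) * (beta x * kappa x * x $ k * beta x + beta x * (beta x * kappa x * x $ k)))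
     * (q x * ((x \<bullet> x) - x $ e * x $ e) * x $ k + (x $ k - x $ e * (if e = k then 1 else 0)))
   + ((x \<bullet> x) * (beta x * beta x)) *
     ((((\<alpha> - 1) * (- 2 * x $ k / (x \<bullet> x)\<^sup>2) - 0) * ((x \<bullet> x) - x $ e * x $ e)
        + q x * (2 * x $ k - ((if e = k then 1 else 0) * x $ e + x $ e * (if e = k then 1 else 0)))) * x $ k
      + q x * ((x \<bullet> x) - x $ e * x $ e) * (if k = k then 1 else 0)
      + ((if k = k then 1 else 0) - ((if e = k then 1 else 0) * (if e = k then 1 else 0) + x $ e * 0)))"

lemma pd_F: "pd k (F k) (F' k)"
proof -
  have q: "pd k q (\<lambda>x. (\<alpha> - 1) * (- 2 * x $ k / (x \<bullet> x)\<^sup>2) - 0)"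
    using pd_diff[OF pd_cmult[OF pd_inverse_inner_self[of k], of "\<alpha> - 1"] pd_const[of k 1]]
    by (simp add: q_def[abs_def])
  show ?thesis
    unfolding F_def[abs_def] F'_def[abs_def]
    by (intro pd_mult pd_add pd_diff pd_inner_self pd_beta pd_nth pd_const q)
qed

text \<open>\<open>J\<close> is a combination of four matrices \<open>A\<close>, \<open>B\<close>,
  \<open>C\<close>, \<open>D\<close>, and ten inner products between them determine its norm; two of
  these vanish because \<open>y\<close> is orthogonal to \<open>x\<close>.\<close>

lemma norm_J_square:
  "J x \<bullet> J x = (beta x)\<^sup>2 * (5 * (x \<bullet> x) + (real CARD('n) - 6) * (x $ e)\<^sup>2
     + (kappa x)\<^sup>2 * ((x \<bullet> x) * ((x \<bullet> x) * ((x \<bullet> x) - (x $ e)\<^sup>2))) + 4 * kappa x * ((x \<bullet> x) * ((x \<bullet> x) - (x $ e)\<^sup>2)))"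
proof -
  define A B C D where "A = outer (axis e 1 :: real^'n) x" and "B = outer x (axis e 1 :: real^'n)"
    and "C = (mat 1 :: real^'n^'n)" and "D = outer (y x) x"
  have yx: "y x \<bullet> x = 0" using x_y[of x] by (simp add: inner_commute)
  have f: "A \<bullet> A = x \<bullet> x" "B \<bullet> B = x \<bullet> x" "C \<bullet> C = real CARD('n)" "D \<bullet> D = (x \<bullet> x) * ((x \<bullet> x) * ((x \<bullet> x) - (x $ e)\<^sup>2))"
    "A \<bullet> B = (x $ e)\<^sup>2" "A \<bullet> C = x $ e" "A \<bullet> D = (x \<bullet> x) * ((x \<bullet> x) - (x $ e)\<^sup>2)"
    "B \<bullet> C = x $ e" "B \<bullet> D = 0" "D \<bullet> C = 0"
    by (simp_all add: A_def B_def C_def D_def inner_outer outer_mult_vec inner_mat_1 trace_outer trace_I inner_axis inner_axis'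
        x_y yx y_y y_nth power2_eq_square)
  have "J x = beta x *\<^sub>R (2 *\<^sub>R A - B - (x $ e) *\<^sub>R C + kappa x *\<^sub>R D)"
    by (simp add: J_def A_def B_def C_def D_def)
  moreover have "(2 *\<^sub>R A - B - p *\<^sub>R C + r *\<^sub>R D) \<bullet> (2 *\<^sub>R A - B - p *\<^sub>R C + r *\<^sub>R D)
    = 4 * (A \<bullet> A) + B \<bullet> B + p\<^sup>2 * (C \<bullet> C) + r\<^sup>2 * (D \<bullet> D)
    - 4 * (A \<bullet> B) - 4 * p * (A \<bullet> C) + 4 * r * (A \<bullet> D) + 2 * p * (B \<bullet> C) - 2 * r * (B \<bullet> D) - 2 * p * r * (D \<bullet> C)" for p r
    by (simp add: inner_add_left inner_add_right inner_diff_left inner_diff_right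
        inner_commute[of B A] inner_commute[of C A] inner_commute[of D A] inner_commute[of C B] inner_commute[of D B] inner_commute[of C D]
        power2_eq_square algebra_simps)
  ultimately have "J x \<bullet> J x = (beta x)\<^sup>2 * (4 * (A \<bullet> A) + B \<bullet> B + (x $ e)\<^sup>2 * (C \<bullet> C) + (kappa x)\<^sup>2 * (D \<bullet> D)
    - 4 * (A \<bullet> B) - 4 * (x $ e) * (A \<bullet> C) + 4 * kappa x * (A \<bullet> D) + 2 * (x $ e) * (B \<bullet> C) - 2 * kappa x * (B \<bullet> D)
    - 2 * (x $ e) * kappa x * (D \<bullet> C))"
    by (simp only: inner_scaleR_left inner_scaleR_right) (simp add: power2_eq_square mult.assoc)
  then show ?thesis unfolding f by (simp add: power2_eq_square algebra_simps)
qed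

text \<open>The left-hand side is half the Laplacian of \<open>|v|^2\<close>, hence
  \<open>|J|^2\<close> plus the inner product of \<open>v\<close> with its Laplacian. The claim is
  thus the oscillator equation with energy \<open>N + 2 \<alpha>\<close>, tested against
  \<open>v\<close>; the quadratic equation for \<open>\<alpha>\<close> enters as a polynomial
  relation.\<close>

lemma sum_F':
  assumes "x \<noteq> 0"
  shows "(\<Sum>k\<in>UNIV. F' k x) = (norm (J x))\<^sup>2 + (x \<bullet> x) * (norm (v x))\<^sup>2 - (real CARD('n) + 2 * \<alpha>) * (norm (v x))\<^sup>2"
proof -
  define R u b N Y k where "R = x \<bullet> x" and "u = 1 / R" and "b = (beta x)\<^sup>2" and "N = real CARD('n)"
    and "Y = R - x $ e * x $ e" and "k = kappa x"
  have uR: "u * R = 1" using assms by (simp add: u_def R_def)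
  have q: "q x = k + u" by (simp add: q_def k_def kappa_def u_def R_def add_divide_distrib diff_divide_distrib)
  have kk: "k = (\<alpha> - 2) * u - 1" by (simp add: k_def kappa_def u_def R_def)
  have s: "(\<Sum>k\<in>UNIV. x $ k * x $ k) = R" by (simp add: R_def inner_nth_sum)
  have "F' i x = (2 * b + 2 * R * b * k) * (q x * Y + 1) * (x $ i * x $ i)
      - (2 * b + 2 * R * b * k) * x $ e * ((if i = e then 1 else 0) * x $ i)
      + R * b * ((- 2 * (\<alpha> - 1) * u * u * Y + 2 * q x) * (x $ i * x $ i)
        - 2 * q x * x $ e * ((if i = e then 1 else 0) * x $ i) + (q x * Y + 1) - (if i = e then 1 else 0) * 1)" for i
  proof -
    have inv: "z / R\<^sup>2 = z * (u * u)" for z by (simp add: u_def power2_eq_square)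
    show ?thesis unfolding F'_def R_def[symmetric] Y_def[symmetric] k_def[symmetric] inv
      by (simp add: b_def power2_eq_square algebra_simps)
  qed
  then have "(\<Sum>i\<in>UNIV. F' i x) = (2 * b + 2 * R * b * k) * (q x * Y + 1) * R
      - (2 * b + 2 * R * b * k) * x $ e * x $ e
      + R * b * ((- 2 * (\<alpha> - 1) * u * u * Y + 2 * q x) * R - 2 * q x * x $ e * x $ e + N * (q x * Y + 1) - 1)"
    by (simp only: sum.distrib sum_subtractf sum_distrib_left[symmetric] s sum_delta_mult sum_constant N_def)
      (simp add: algebra_simps)
  also have "\<dots> = b * (5 * R + (N - 6) * (x $ e)\<^sup>2 + k\<^sup>2 * (R * (R * (R - (x $ e)\<^sup>2))) + 4 * k * (R * (R - (x $ e)\<^sup>2)))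
     + R * (b * (R * (R - (x $ e)\<^sup>2))) - (N + 2 * \<alpha>) * (b * (R * (R - (x $ e)\<^sup>2)))"
    using uR alpha_eq[folded N_def] unfolding q kk Y_def by algebra
  also have "\<dots> = (norm (J x))\<^sup>2 + (x \<bullet> x) * (norm (v x))\<^sup>2 - (real CARD('n) + 2 * \<alpha>) * (norm (v x))\<^sup>2"
    unfolding power2_norm_eq_inner norm_J_square
    by (simp add: v_def y_y power2_eq_square R_def b_def N_def k_def mult_ac)
  finally show ?thesis .
qed

lemma F_bound: "\<bar>F k x / norm x\<bar> \<le> (3 + 1 * norm x ^ 2) * singular_gauss 1 x"
proof (cases "x = 0")
  case False
  let ?R = "x \<bullet> x"
  have R: "?R > 0" using False by simp
  have xk: "\<bar>x $ k\<bar> \<le> norm x" "\<bar>x $ e\<bar> \<le> norm x" by (rule component_le_norm_cart)+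
  have Y: "0 \<le> ?R - x $ e * x $ e" "?R - x $ e * x $ e \<le> ?R"
    using component_square_le[of x] by (simp_all add: power2_eq_square)
  have "\<bar>q x\<bar> * (?R - x $ e * x $ e) \<le> \<bar>q x\<bar> * ?R" using Y by (intro mult_left_mono) auto
  also have "\<dots> = \<bar>q x * ?R\<bar>" using R by (simp add: abs_mult)
  also have "q x * ?R = \<alpha> - 1 - ?R" unfolding q_def by (subst left_diff_distrib) (use R in simp)
  also have "\<bar>\<alpha> - 1 - ?R\<bar> \<le> 1 + ?R" using alpha_pos alpha_le_1 R unfolding abs_le_iff by linarith
  finally have 1: "\<bar>q x\<bar> * (?R - x $ e * x $ e) \<le> 1 + ?R" .
  have "\<bar>q x * (?R - x $ e * x $ e) * x $ k\<bar> \<le> (1 + ?R) * norm x"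
    unfolding abs_mult using 1 Y xk by (intro mult_mono) auto
  moreover have "\<bar>x $ k - x $ e * (if e = k then 1 else 0)\<bar> \<le> 2 * norm x" using xk by auto
  ultimately have 2: "\<bar>q x * (?R - x $ e * x $ e) * x $ k + (x $ k - x $ e * (if e = k then 1 else 0))\<bar> \<le> (3 + ?R) * norm x"
    by (simp add: distrib_right)
  have "\<bar>F k x\<bar> \<le> singular_gauss 1 x * ((3 + ?R) * norm x)"
    unfolding F_def abs_mult[of "?R * (beta x * beta x)"]
    using beta_square_le[of x] R 2 by (intro mult_mono) (auto simp: power2_eq_square abs_mult singular_gauss_nonneg)
  then have "\<bar>F k x\<bar> / norm x \<le> singular_gauss 1 x * ((3 + ?R) * norm x) / norm x"
    by (intro divide_right_mono) auto
  then show ?thesis using False by (simp add: mult.commute power2_norm_eq_inner)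
qed (simp add: singular_gauss_nonneg)

lemma J2_integrable: "integrable lborel (\<lambda>x. (norm (J x))\<^sup>2)"
  and v2_integrable: "integrable lborel (\<lambda>x. (norm (v x))\<^sup>2)"
  and xv2_integrable: "integrable lborel (\<lambda>x. (x \<bullet> x) * (norm (v x))\<^sup>2)"
  using moments_integrable[OF moments_J2] moments_integrable[OF moments_v2] moments_integrable_power[OF moments_v2, of 2]
  by (simp_all add: power2_norm_eq_inner[of "_::real^'n"])

text \<open>The extremal counterpart of the tangential inequality at \<open>l = 1\<close>, now with
  equality and without defects.\<close>

lemma ground_state_energy:
  "(\<integral>x. (norm (J x))\<^sup>2 \<partial>lborel) + (\<integral>x. (x \<bullet> x) * (norm (v x))\<^sup>2 \<partial>lborel) = (real CARD('n) + 2 * \<alpha>) * (\<integral>x. (norm (v x))\<^sup>2 \<partial>lborel)"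
proof -
  let ?E = "\<lambda>x. (norm (J x))\<^sup>2 + (x \<bullet> x) * (norm (v x))\<^sup>2 - (real CARD('n) + 2 * \<alpha>) * (norm (v x))\<^sup>2"
  have iE: "integrable lborel ?E"
    by (intro Bochner_Integration.integrable_add Bochner_Integration.integrable_diff integrable_mult_right
        J2_integrable v2_integrable xv2_integrable)
  have Fm: "F k \<in> borel_measurable borel" "F' k \<in> borel_measurable borel" for k
    using pd_measurable[OF pd_F] by auto
  have ae: "AE x in lborel. (\<Sum>k\<in>UNIV. F' k x) = ?E x"
    using AE_lborel_singleton[where c = 0] by eventually_elim (rule sum_F')
  have sm: "(\<lambda>x. \<Sum>k\<in>UNIV. F' k x) \<in> borel_measurable borel" using Fm by measurable
  have "(\<integral>x. (\<Sum>k\<in>UNIV. F' k x) \<partial>lborel) = 0"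
  proof (rule integral_divergence_off_0[OF pd_F])
    have d: "DIM(real^'n) \<ge> 3" using dim by simp
    show "integrable lborel (\<lambda>x. F k x / norm x)" for k
      by (rule Bochner_Integration.integrable_bound[OF moments_integrable[OF moments_polynomial_singular_gauss[OF d, of 1 3 1 2]]])
        (use Fm in \<open>auto intro!: AE_I2 order_trans[OF F_bound[simplified] abs_ge_self]\<close>)
    show "integrable lborel (\<lambda>x. \<Sum>k\<in>UNIV. F' k x)"
      using integrable_cong_AE[OF _ _ ae] sm iE by auto
  qed
  moreover have "(\<integral>x. (\<Sum>k\<in>UNIV. F' k x) \<partial>lborel) = (\<integral>x. ?E x \<partial>lborel)"
    using integral_cong_AE[OF _ _ ae] sm iE by auto
  moreover have "(\<integral>x. ?E x \<partial>lborel) = (\<integral>x. (norm (J x))\<^sup>2 \<partial>lborel) + (\<integral>x. (x \<bullet> x) * (norm (v x))\<^sup>2 \<partial>lborel) - (real CARD('n) + 2 * \<alpha>) * (\<integral>x. (norm (v x))\<^sup>2 \<partial>lborel)"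
    by (simp only: Bochner_Integration.integral_add Bochner_Integration.integral_diff integral_mult_right_zero
        Bochner_Integration.integrable_add integrable_mult_right J2_integrable v2_integrable xv2_integrable)
  ultimately show ?thesis by simp
qed

end

subsection \<open>Attainment\<close>

text \<open>Differentiation exchanges cosine and sine transforms, so the generators must comprise
  both kinds.\<close>

lemma smooth_transform:
  fixes w :: "'a::euclidean_space \<Rightarrow> real"
  assumes "moments w" shows "smooth_fun (CT w)"
proof -
  define B where "B = {CT w |w::'a \<Rightarrow> real. moments w} \<union> {ST w |w::'a \<Rightarrow> real. moments w}"
  have "CT w \<in> alg B" using assms by (intro alg.base) (auto simp: B_def)
  then show ?thesis
  proof (rule smooth_fun_alg)
    fix f assume "f \<in> B"
    then consider (C) w where "moments w" "f = CT w" | (S) w where "moments w" "f = ST w" by (auto simp: B_def)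
    then show "\<exists>f'. (\<forall>x. (f has_derivative f' x) (at x)) \<and> (\<forall>i\<in>Basis. (\<lambda>x. f' x i) \<in> alg B)"
    proof cases
      case C
      have "(\<lambda>x. (- 1) * ST (\<lambda>\<xi>. (\<xi> \<bullet> i) * w \<xi>) x) \<in> alg B" for i
        using moments_inner[OF C(1), of i] by (intro alg.mult alg.const alg.base) (auto simp: B_def)
      then show ?thesis
        using CT_has_derivative[OF C(1)] unfolding C(2)
        by (intro exI[of _ "\<lambda>x h. - ST (\<lambda>\<xi>. (\<xi> \<bullet> h) * w \<xi>) x"]) simp
    next
      case S
      have "CT (\<lambda>\<xi>. (\<xi> \<bullet> i) * w \<xi>) \<in> alg B" for i
        using moments_inner[OF S(1), of i] by (intro alg.base) (auto simp: B_def)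
      then show ?thesis
        using ST_has_derivative[OF S(1)] unfolding S(2)
        by (intro exI[of _ "\<lambda>x h. CT (\<lambda>\<xi>. (\<xi> \<bullet> h) * w \<xi>) x"]) simp
    qed
  qed
qed

lemma ST_even:
  fixes w :: "'a::euclidean_space \<Rightarrow> real"
  assumes [measurable]: "w \<in> borel_measurable borel" and "\<And>x. w (- x) = w x"
  shows "ST w x = 0"
proof -
  have "ST w x = \<bar>-1\<bar> ^ DIM('a) * (\<integral>\<xi>. sin (x \<bullet> (0 + (-1) *\<^sub>R \<xi>)) * w (0 + (-1) *\<^sub>R \<xi>) \<partial>lborel)"
    unfolding ST_def by (rule integral_lborel_affine) auto
  also have "\<dots> = - ST w x" by (simp add: ST_def assms(2))
  finally show ?thesis by simp
qed

text \<open>Truncation by smooth cutoffs. In the Jacobian the additional term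
  \<open>outer (u x) (grad (?c n) x)\<close> is of order \<open>|u|/n\<close> and disappears in L2;
  all other terms are settled by dominated convergence.\<close>

lemma in_D_smooth:
  fixes u :: "real^'n \<Rightarrow> real^'n"
  assumes u: "\<And>j. smooth_fun (\<lambda>x. u x $ j)"
    and u2: "integrable lborel (\<lambda>x. (norm (u x))\<^sup>2)" and xu2: "integrable lborel (\<lambda>x. (norm (u x))\<^sup>2 * (norm x)\<^sup>2)"
    and J2: "integrable lborel (\<lambda>x. (norm (jac u x))\<^sup>2)"
  shows "in_D u (jac u)"
proof -
  have um[measurable]: "u \<in> borel_measurable borel"
    by (rule borel_measurable_vec) (rule borel_measurable_continuous_onI[OF smooth_fun_continuous[OF u]])
  have jc: "continuous_on UNIV (\<lambda>x. jac u x $ j $ k)" for j k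
    using smooth_fun_continuous[OF smooth_fun_frechet[OF u, of "axis k 1" j]] by (simp add: jac_def axis_in_Basis_iff)
  have jm[measurable]: "jac u \<in> borel_measurable borel"
    by (rule borel_measurable_vec, rule borel_measurable_vec) (rule borel_measurable_continuous_onI[OF jc])
  let ?c = "\<lambda>n. cutoff (real (Suc n)) :: real^'n \<Rightarrow> real"
  have cm[measurable]: "?c n \<in> borel_measurable borel" for n
    by (rule borel_measurable_continuous_onI[OF smooth_fun_continuous[OF smooth_cutoff]])
  define \<phi> where "\<phi> n x = ?c n x *\<^sub>R u x" for n x
  have phim[measurable]: "\<phi> n \<in> borel_measurable borel" for n
    unfolding \<phi>_def by measurable
  have test: "test_field (\<phi> n)" for n
    unfolding test_field_def
  proof (intro conjI allI)
    show "smooth_fun (\<lambda>x. \<phi> n x $ j)" for j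
      by (simp add: \<phi>_def) (intro smooth_fun_mult smooth_cutoff u)
    have "{x. \<phi> n x \<noteq> 0} \<subseteq> cball 0 (real (Suc n))"
      using cutoff_support[of "real (Suc n)"] by (force simp: \<phi>_def not_le)
    then show "compact (closure {x. \<phi> n x \<noteq> 0})"
      by (meson bounded_cball bounded_subset compact_closure)
  qed
  have cT: "(\<lambda>n. ?c n x) \<longlonglongrightarrow> 1" for x
    using cutoff_tendsto by (rule LIMSEQ_Suc)
  have cb: "\<bar>?c n x - 1\<bar> \<le> 1" for n x
    using cutoff_bounds[of "real (Suc n)" x] by (simp add: abs_le_iff)
  have jphim[measurable]: "jac (\<phi> n) \<in> borel_measurable borel" for n
    by (rule test_field_loc.jac_measurable[OF test_field_loc.intro[OF test]])
  have jac_phi: "jac (\<phi> n) x = ?c n x *\<^sub>R jac u x + outer (u x) (grad (?c n) x)" for n x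
  proof -
    have "((\<lambda>x. ?c n x * u x $ j) has_derivative (\<lambda>h. ?c n x * frechet_derivative (\<lambda>x. u x $ j) (at x) h + frechet_derivative (?c n) (at x) h * u x $ j)) (at x)" for j
      by (intro has_derivative_mult smooth_fun_has_derivative smooth_cutoff u)
    from frechet_derivative_at[OF this, symmetric]
    show ?thesis
      by (simp add: jac_def \<phi>_def outer_def grad_def vec_eq_iff mult.commute)
  qed
  have gb: "norm (grad (?c n) x) \<le> real CARD('n) * (4 * exp 1 / real (Suc n))" for n x
  proof -
    have "norm (grad (?c n) x) \<le> (\<Sum>k\<in>UNIV. \<bar>grad (?c n) x $ k\<bar>)" by (rule norm_le_l1_cart)
    also have "\<dots> \<le> (\<Sum>k\<in>(UNIV::'n set). 4 * exp 1 / real (Suc n))"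
      using cutoff_derivative[of "real (Suc n)" x "axis k 1" for k] by (intro sum_mono) (simp add: grad_def)
    finally show ?thesis by simp
  qed
  have gm: "(\<lambda>x. grad (?c n) x $ k) \<in> borel_measurable borel" for n k
  proof -
    have "smooth_fun (\<lambda>x. frechet_derivative (?c n) (at x) (axis k 1))"
      by (rule smooth_fun_frechet[OF smooth_cutoff]) (simp add: axis_in_Basis_iff)
    then show ?thesis by (simp add: grad_def borel_measurable_continuous_onI smooth_fun_continuous)
  qed
  have om[measurable]: "(\<lambda>x. outer (u x) (grad (?c n) x)) \<in> borel_measurable borel" for n
  proof (rule borel_measurable_vec, rule borel_measurable_vec)
    fix j k
    have "(\<lambda>x. u x $ j) \<in> borel_measurable borel"
      by (rule borel_measurable_continuous_onI[OF smooth_fun_continuous[OF u]])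
    then show "(\<lambda>x. outer (u x) (grad (?c n) x) $ j $ k) \<in> borel_measurable borel"
      using gm by (simp add: outer_def)
  qed
  have L: "(\<lambda>n. \<integral>\<^sup>+ x. ennreal ((norm (\<phi> n x - u x))\<^sup>2 * (1 + (norm x)\<^sup>2)) \<partial>lborel) \<longlonglongrightarrow> 0"
  proof -
    have "(\<lambda>n. \<integral>\<^sup>+ x. ennreal ((norm (\<phi> n x - u x))\<^sup>2 * (1 + (norm x)\<^sup>2)) \<partial>lborel) \<longlonglongrightarrow> (\<integral>\<^sup>+ x. 0 \<partial>(lborel :: (real^'n) measure))"
    proof (rule nn_integral_dominated_convergence[where w = "\<lambda>x. ennreal ((norm (u x))\<^sup>2 + (norm (u x))\<^sup>2 * (norm x)\<^sup>2)"])
      show "(\<integral>\<^sup>+ x. ennreal ((norm (u x))\<^sup>2 + (norm (u x))\<^sup>2 * (norm x)\<^sup>2) \<partial>lborel) < \<infinity>"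
        using Bochner_Integration.integrable_add[OF u2 xu2] by (simp add: integrable_iff_bounded)
      have eq: "(norm (\<phi> n x - u x))\<^sup>2 = (?c n x - 1)\<^sup>2 * (norm (u x))\<^sup>2" for n x
        by (simp add: \<phi>_def power_mult_distrib flip: scaleR_left_diff_distrib[of "?c n x" 1 "u x", simplified])
      show "AE x in lborel. ennreal ((norm (\<phi> n x - u x))\<^sup>2 * (1 + (norm x)\<^sup>2)) \<le> ennreal ((norm (u x))\<^sup>2 + (norm (u x))\<^sup>2 * (norm x)\<^sup>2)" for n
      proof (intro AE_I2 ennreal_leI)
        fix x
        have "(?c n x - 1)\<^sup>2 \<le> 1" using cb[of n x] by (simp add: abs_square_le_1)
        then have "(?c n x - 1)\<^sup>2 * ((norm (u x))\<^sup>2 * (1 + (norm x)\<^sup>2)) \<le> 1 * ((norm (u x))\<^sup>2 * (1 + (norm x)\<^sup>2))"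
          by (intro mult_right_mono) auto
        then show "(norm (\<phi> n x - u x))\<^sup>2 * (1 + (norm x)\<^sup>2) \<le> (norm (u x))\<^sup>2 + (norm (u x))\<^sup>2 * (norm x)\<^sup>2"
          unfolding eq by (simp add: distrib_left mult.assoc)
      qed
      show "AE x in lborel. (\<lambda>n. ennreal ((norm (\<phi> n x - u x))\<^sup>2 * (1 + (norm x)\<^sup>2))) \<longlonglongrightarrow> 0"
      proof (rule AE_I2)
        fix x
        have "(\<lambda>n. (?c n x - 1)\<^sup>2 * (norm (u x))\<^sup>2 * (1 + (norm x)\<^sup>2)) \<longlonglongrightarrow> (1 - 1)\<^sup>2 * (norm (u x))\<^sup>2 * (1 + (norm x)\<^sup>2)"
          by (intro tendsto_intros cT)
        then have "(\<lambda>n. (norm (\<phi> n x - u x))\<^sup>2 * (1 + (norm x)\<^sup>2)) \<longlonglongrightarrow> 0" by (simp add: eq)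
        then show "(\<lambda>n. ennreal ((norm (\<phi> n x - u x))\<^sup>2 * (1 + (norm x)\<^sup>2))) \<longlonglongrightarrow> 0"
          using tendsto_ennrealI by fastforce
      qed
    qed measurable
    then show ?thesis by simp
  qed
  have LG: "(\<lambda>n. \<integral>\<^sup>+ x. ennreal ((norm (jac (\<phi> n) x - jac u x))\<^sup>2) \<partial>lborel) \<longlonglongrightarrow> 0"
  proof -
    define K where "K = real CARD('n) * (4 * exp 1)"
    have le: "(norm (jac (\<phi> n) x - jac u x))\<^sup>2 \<le> 2 * ((?c n x - 1)\<^sup>2 * (norm (jac u x))\<^sup>2) + 2 * ((K / real (Suc n))\<^sup>2 * (norm (u x))\<^sup>2)" for n x
    proof -
      have "jac (\<phi> n) x - jac u x = (?c n x - 1) *\<^sub>R jac u x + outer (u x) (grad (?c n) x)"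
        by (simp add: jac_phi scaleR_left_diff_distrib)
      then have "norm (jac (\<phi> n) x - jac u x) \<le> \<bar>?c n x - 1\<bar> * norm (jac u x) + norm (u x) * norm (grad (?c n) x)"
        using norm_triangle_ineq[of "(?c n x - 1) *\<^sub>R jac u x" "outer (u x) (grad (?c n) x)"] by (simp add: norm_outer)
      also have "\<dots> \<le> \<bar>?c n x - 1\<bar> * norm (jac u x) + norm (u x) * (K / real (Suc n))"
        using gb[of n x] by (intro add_left_mono mult_left_mono) (auto simp: K_def)
      finally have "(norm (jac (\<phi> n) x - jac u x))\<^sup>2 \<le> (\<bar>?c n x - 1\<bar> * norm (jac u x) + norm (u x) * (K / real (Suc n)))\<^sup>2"
        by (intro power_mono) auto
      also have "\<dots> \<le> 2 * (\<bar>?c n x - 1\<bar> * norm (jac u x))\<^sup>2 + 2 * (norm (u x) * (K / real (Suc n)))\<^sup>2"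
        using sum_squares_bound[of "\<bar>?c n x - 1\<bar> * norm (jac u x)" "norm (u x) * (K / real (Suc n))"] unfolding power2_sum by linarith
      also have "\<dots> = 2 * ((?c n x - 1)\<^sup>2 * (norm (jac u x))\<^sup>2) + 2 * ((K / real (Suc n))\<^sup>2 * (norm (u x))\<^sup>2)"
        by (simp only: power_mult_distrib power2_abs mult.commute)
      finally show ?thesis .
    qed
    have K0: "K \<ge> 0" by (simp add: K_def)
    have "(\<lambda>n. \<integral>\<^sup>+ x. ennreal ((norm (jac (\<phi> n) x - jac u x))\<^sup>2) \<partial>lborel) \<longlonglongrightarrow> (\<integral>\<^sup>+ x. 0 \<partial>(lborel :: (real^'n) measure))"
    proof (rule nn_integral_dominated_convergence[where w = "\<lambda>x. ennreal (2 * (norm (jac u x))\<^sup>2 + 2 * K\<^sup>2 * (norm (u x))\<^sup>2)"])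
      show "(\<integral>\<^sup>+ x. ennreal (2 * (norm (jac u x))\<^sup>2 + 2 * K\<^sup>2 * (norm (u x))\<^sup>2) \<partial>lborel) < \<infinity>"
        using Bochner_Integration.integrable_add[OF integrable_mult_right[OF J2, of 2] integrable_mult_right[OF u2, of "2 * K\<^sup>2"]]
        by (simp add: integrable_iff_bounded)
      show "AE x in lborel. ennreal ((norm (jac (\<phi> n) x - jac u x))\<^sup>2) \<le> ennreal (2 * (norm (jac u x))\<^sup>2 + 2 * K\<^sup>2 * (norm (u x))\<^sup>2)" for n
      proof (intro AE_I2 ennreal_leI order_trans[OF le])
        fix x
        have "(?c n x - 1)\<^sup>2 \<le> 1" using cb[of n x] by (simp add: abs_square_le_1)
        moreover have "(K / real (Suc n))\<^sup>2 \<le> K\<^sup>2"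
          using K0 by (intro power_mono) (auto simp: divide_le_eq mult_left_le algebra_simps)
        ultimately have "(?c n x - 1)\<^sup>2 * (norm (jac u x))\<^sup>2 \<le> 1 * (norm (jac u x))\<^sup>2" "(K / real (Suc n))\<^sup>2 * (norm (u x))\<^sup>2 \<le> K\<^sup>2 * (norm (u x))\<^sup>2"
          by (intro mult_right_mono; simp)+
        then show "2 * ((?c n x - 1)\<^sup>2 * (norm (jac u x))\<^sup>2) + 2 * ((K / real (Suc n))\<^sup>2 * (norm (u x))\<^sup>2) \<le> 2 * (norm (jac u x))\<^sup>2 + 2 * K\<^sup>2 * (norm (u x))\<^sup>2"
          by linarith
      qed
      show "AE x in lborel. (\<lambda>n. ennreal ((norm (jac (\<phi> n) x - jac u x))\<^sup>2)) \<longlonglongrightarrow> 0"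
      proof (rule AE_I2)
        fix x
        have "(\<lambda>n. K * (1 / real (Suc n))) \<longlonglongrightarrow> K * 0"
          by (intro tendsto_intros LIMSEQ_Suc[OF lim_1_over_n])
        then have k: "(\<lambda>n. K / real (Suc n)) \<longlonglongrightarrow> 0" by simp
        have "(\<lambda>n. 2 * ((?c n x - 1)\<^sup>2 * (norm (jac u x))\<^sup>2) + 2 * ((K / real (Suc n))\<^sup>2 * (norm (u x))\<^sup>2))
          \<longlonglongrightarrow> 2 * ((1 - 1)\<^sup>2 * (norm (jac u x))\<^sup>2) + 2 * (0\<^sup>2 * (norm (u x))\<^sup>2)"
          by (intro tendsto_intros cT k)
        then have z: "(\<lambda>n. 2 * ((?c n x - 1)\<^sup>2 * (norm (jac u x))\<^sup>2) + 2 * ((K / real (Suc n))\<^sup>2 * (norm (u x))\<^sup>2)) \<longlonglongrightarrow> 0" by simp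
        have "(\<lambda>n. (norm (jac (\<phi> n) x - jac u x))\<^sup>2) \<longlonglongrightarrow> 0"
          by (rule tendsto_sandwich[OF _ always_eventually[OF allI, OF le] tendsto_const z]) simp
        then show "(\<lambda>n. ennreal ((norm (jac (\<phi> n) x - jac u x))\<^sup>2)) \<longlonglongrightarrow> 0"
          using tendsto_ennrealI by fastforce
      qed
    qed measurable
    then show ?thesis by simp
  qed
  show ?thesis
    unfolding in_D_def using test L LG um jm by auto
qed

section \<open>The extremal field in physical space\<close>

context extremal
begin

definition "u = cosT v"

lemma u_nth: "u x $ j = CT (\<lambda>\<xi>. v \<xi> $ j) x"
  by (simp add: u_def cosT_def)

lemma u_smooth: "smooth_fun (\<lambda>x. u x $ j)"
  unfolding u_nth using smooth_transform[OF moments_v] by simp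

lemma jac_u: "jac u x $ j $ k = - ST (\<lambda>\<xi>. (\<xi> \<bullet> axis k 1) * v \<xi> $ j) x"
proof -
  have "frechet_derivative (\<lambda>y. u y $ j) (at x) = (\<lambda>h. - ST (\<lambda>\<xi>. (\<xi> \<bullet> h) * v \<xi> $ j) x)"
    unfolding u_nth using frechet_derivative_at[OF CT_has_derivative[OF moments_v, of j x]] by simp
  then show ?thesis by (simp add: jac_def)
qed

lemma component_integrable: "integrable lborel (\<lambda>x. (v x $ j)\<^sup>2)" "integrable lborel (\<lambda>x. (J x $ j $ k)\<^sup>2)"
   "integrable lborel (\<lambda>x. ((x \<bullet> axis k 1) * v x $ j)\<^sup>2)"
proof -
  note m = moments_measurable[OF moments_v] moments_measurable[OF moments_J]
  show "integrable lborel (\<lambda>x. (v x $ j)\<^sup>2)"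
    by (rule Bochner_Integration.integrable_bound[OF v2_integrable])
      (use m in \<open>auto intro!: AE_I2 power_mono[OF component_le_norm_cart abs_ge_zero, of _ _ 2, simplified]\<close>)
  show "integrable lborel (\<lambda>x. (J x $ j $ k)\<^sup>2)"
    by (rule Bochner_Integration.integrable_bound[OF J2_integrable])
      (use m in \<open>auto intro!: AE_I2 power_mono[OF order_trans[OF component_le_norm_cart Finite_Cartesian_Product.norm_nth_le] abs_ge_zero, of _ _ _ 2, simplified]\<close>)
  show "integrable lborel (\<lambda>x. ((x \<bullet> axis k 1) * v x $ j)\<^sup>2)"
  proof (rule Bochner_Integration.integrable_bound[OF xv2_integrable])
    show "(\<lambda>x. ((x \<bullet> axis k 1) * v x $ j)\<^sup>2) \<in> borel_measurable lborel" using m by measurable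
    show "AE x in lborel. norm (((x \<bullet> axis k 1) * v x $ j)\<^sup>2) \<le> norm ((x \<bullet> x) * (norm (v x))\<^sup>2)"
    proof (rule AE_I2)
      fix x :: "real^'n"
      have "\<bar>x $ k\<bar>\<^sup>2 * \<bar>v x $ j\<bar>\<^sup>2 \<le> (norm x)\<^sup>2 * (norm (v x))\<^sup>2"
        by (intro mult_mono power_mono component_le_norm_cart) auto
      then show "norm (((x \<bullet> axis k 1) * v x $ j)\<^sup>2) \<le> norm ((x \<bullet> x) * (norm (v x))\<^sup>2)"
        by (simp add: inner_axis power_mult_distrib flip: power2_norm_eq_inner)
    qed
  qed
qed

text \<open>Equality is essential here, since the mass of \<open>u\<close> stands on the larger side
  of the final estimate; for the two energies an upper bound is enough.\<close>

lemma u_square: "integrable lborel (\<lambda>x. (u x $ j)\<^sup>2)"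
  "(\<integral>x. (u x $ j)\<^sup>2 \<partial>lborel) = (2 * pi) ^ CARD('n) * (\<integral>x. (v x $ j)\<^sup>2 \<partial>lborel)"
proof -
  have "power_spectrum (\<lambda>\<xi>. v \<xi> $ j) = (\<lambda>x. (u x $ j)\<^sup>2)"
    using ST_even[OF moments_measurable[OF moments_v, of j]] by (simp add: power_spectrum_def u_nth v_even fun_eq_iff)
  then show "integrable lborel (\<lambda>x. (u x $ j)\<^sup>2)"
  "(\<integral>x. (u x $ j)\<^sup>2 \<partial>lborel) = (2 * pi) ^ CARD('n) * (\<integral>x. (v x $ j)\<^sup>2 \<partial>lborel)"
    using Plancherel[OF moments_integrable[OF moments_v] v_continuous v_bounded, of j] by auto
qed

text \<open>An upper bound may discard one half of the power spectrum, which avoids showing that it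
  vanishes.\<close>

lemma spectrum_dominated:
  assumes w: "integrable lborel w" and w2: "integrable lborel (\<lambda>x. (w x)\<^sup>2)"
    and f: "\<And>x. (f x)\<^sup>2 \<le> power_spectrum w x" and fm[measurable]: "f \<in> borel_measurable borel"
  shows "integrable lborel (\<lambda>x::real^'n. (f x)\<^sup>2 :: real)"
    "(\<integral>x. (f x)\<^sup>2 \<partial>lborel) \<le> (2 * pi) ^ CARD('n) * (\<integral>x. (w x)\<^sup>2 \<partial>lborel)"
proof -
  note P = Plancherel_le[OF w w2]
  show i: "integrable lborel (\<lambda>x. (f x)\<^sup>2)"
    by (rule Bochner_Integration.integrable_bound[OF P(1)]) (auto intro!: AE_I2 order_trans[OF f abs_ge_self])
  have "(\<integral>x. (f x)\<^sup>2 \<partial>lborel) \<le> (\<integral>x. power_spectrum w x \<partial>lborel)" by (rule integral_mono[OF i P(1) f])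
  with P(2) show "(\<integral>x. (f x)\<^sup>2 \<partial>lborel) \<le> (2 * pi) ^ CARD('n) * (\<integral>x. (w x)\<^sup>2 \<partial>lborel)" by simp
qed

lemma jac_u_square: "integrable lborel (\<lambda>x. (jac u x $ j $ k)\<^sup>2)"
  "(\<integral>x. (jac u x $ j $ k)\<^sup>2 \<partial>lborel) \<le> (2 * pi) ^ CARD('n) * (\<integral>x. ((x \<bullet> axis k 1) * v x $ j)\<^sup>2 \<partial>lborel)"
proof -
  have m: "(\<lambda>x. jac u x $ j $ k) \<in> borel_measurable borel"
    unfolding jac_u using moments_measurable[OF moments_inner[OF moments_v]] by simp
  have le: "(jac u x $ j $ k)\<^sup>2 \<le> power_spectrum (\<lambda>x. (x \<bullet> axis k 1) * v x $ j) x" for x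
    by (simp add: jac_u power_spectrum_def)
  show "integrable lborel (\<lambda>x. (jac u x $ j $ k)\<^sup>2)"
    "(\<integral>x. (jac u x $ j $ k)\<^sup>2 \<partial>lborel) \<le> (2 * pi) ^ CARD('n) * (\<integral>x. ((x \<bullet> axis k 1) * v x $ j)\<^sup>2 \<partial>lborel)"
    by (rule spectrum_dominated[OF moments_integrable[OF moments_inner[OF moments_v]] component_integrable(3) le m])+
qed

text \<open>Integration by parts against a Jacobian that is singular at the origin: the divergence
  theorem is applied to a field whose only nonzero component is
  \<open>sin (x \<bullet> \<xi>) * v \<xi> $ j\<close>, in direction \<open>k\<close>. Its flux
  condition holds because the sine vanishes at the origin to first order.\<close>

lemma x_u: "x $ k * u x $ j = - ST (\<lambda>\<xi>. J \<xi> $ j $ k) x"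
proof -
  note i = moments_integrable[OF moments_v[of j]] moments_integrable[OF moments_J[of j k]]
  let ?F = "\<lambda>l \<xi>. if l = k then sin (x \<bullet> \<xi>) * v \<xi> $ j else 0"
  let ?F' = "\<lambda>l \<xi>. if l = k then cos (x \<bullet> \<xi>) * x $ k * v \<xi> $ j + sin (x \<bullet> \<xi>) * J \<xi> $ j $ k else 0"
  have s: "pd k (\<lambda>\<xi>. sin (x \<bullet> \<xi>)) (\<lambda>\<xi>. cos (x \<bullet> \<xi>) * x $ k)"
    unfolding pd_def
    by (auto simp: inner_add_right inner_axis intro!: continuous_intros derivative_eq_intros)
  have pd: "pd l (?F l) (?F' l)" for l
    using pd_mult[OF s pd_v] pd_const[of l 0] by (cases "l = k") auto
  have eq: "(\<Sum>l\<in>UNIV. ?F' l \<xi>) = x $ k * (cos (x \<bullet> \<xi>) * v \<xi> $ j) + sin (x \<bullet> \<xi>) * J \<xi> $ j $ k" for \<xi>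
    by simp
  have "(\<integral>\<xi>. (\<Sum>l\<in>UNIV. ?F' l \<xi>) \<partial>lborel) = 0"
  proof (rule integral_divergence_off_0[OF pd])
    show "integrable lborel (\<lambda>\<xi>. \<Sum>l\<in>UNIV. ?F' l \<xi>)"
      unfolding eq by (intro Bochner_Integration.integrable_add integrable_mult_right CT_integrable ST_integrable i)
    have "integrable lborel (\<lambda>\<xi>. sin (x \<bullet> \<xi>) * v \<xi> $ j / norm \<xi>)"
    proof (rule Bochner_Integration.integrable_bound[OF integrable_mult_right[OF integrable_abs[OF i(1)], of "norm x"]])
      show "(\<lambda>\<xi>. sin (x \<bullet> \<xi>) * v \<xi> $ j / norm \<xi>) \<in> borel_measurable lborel"
        using moments_measurable[OF moments_v] by measurable
      show "AE \<xi> in lborel. norm (sin (x \<bullet> \<xi>) * v \<xi> $ j / norm \<xi>) \<le> norm (norm x * \<bar>v \<xi> $ j\<bar>)"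
      proof (rule AE_I2)
        fix \<xi>
        show "norm (sin (x \<bullet> \<xi>) * v \<xi> $ j / norm \<xi>) \<le> norm (norm x * \<bar>v \<xi> $ j\<bar>)"
        proof (cases "\<xi> = 0")
          case False
          have "\<bar>sin (x \<bullet> \<xi>)\<bar> \<le> norm x * norm \<xi>"
            by (rule order_trans[OF abs_sin_x_le_abs_x Cauchy_Schwarz_ineq2])
          then have "\<bar>sin (x \<bullet> \<xi>)\<bar> * \<bar>v \<xi> $ j\<bar> \<le> norm x * norm \<xi> * \<bar>v \<xi> $ j\<bar>" by (rule mult_right_mono) simp
          then have "\<bar>sin (x \<bullet> \<xi>)\<bar> * \<bar>v \<xi> $ j\<bar> / norm \<xi> \<le> norm x * norm \<xi> * \<bar>v \<xi> $ j\<bar> / norm \<xi>" by (rule divide_right_mono) simp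
          then show ?thesis using False by (simp add: abs_mult)
        qed simp
      qed
    qed
    then show "integrable lborel (\<lambda>\<xi>. ?F l \<xi> / norm \<xi>)" for l by (cases "l = k") auto
  qed
  then have "x $ k * CT (\<lambda>\<xi>. v \<xi> $ j) x + ST (\<lambda>\<xi>. J \<xi> $ j $ k) x = 0"
    unfolding eq CT_def ST_def
    by (simp only: Bochner_Integration.integral_add integral_mult_right_zero integrable_mult_right CT_integrable ST_integrable i)
  then show ?thesis by (simp add: u_nth)
qed

lemma x_u_square: "integrable lborel (\<lambda>x. (x $ k * u x $ j)\<^sup>2)"
  "(\<integral>x. (x $ k * u x $ j)\<^sup>2 \<partial>lborel) \<le> (2 * pi) ^ CARD('n) * (\<integral>x. (J x $ j $ k)\<^sup>2 \<partial>lborel)"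
proof -
  have m: "(\<lambda>x. x $ k * u x $ j) \<in> borel_measurable borel"
    unfolding x_u using moments_measurable[OF moments_J] by simp
  have le: "(x $ k * u x $ j)\<^sup>2 \<le> power_spectrum (\<lambda>x. J x $ j $ k) x" for x
    unfolding x_u by (simp add: power_spectrum_def)
  show "integrable lborel (\<lambda>x. (x $ k * u x $ j)\<^sup>2)"
    "(\<integral>x. (x $ k * u x $ j)\<^sup>2 \<partial>lborel) \<le> (2 * pi) ^ CARD('n) * (\<integral>x. (J x $ j $ k)\<^sup>2 \<partial>lborel)"
    by (rule spectrum_dominated[OF moments_integrable[OF moments_J] component_integrable(2) le m])+
qed

lemma u_L2: "integrable lborel (\<lambda>x. (norm (u x))\<^sup>2)"
  "(\<integral>x. (norm (u x))\<^sup>2 \<partial>lborel) = (2 * pi) ^ CARD('n) * (\<integral>x. (norm (v x))\<^sup>2 \<partial>lborel)"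
  unfolding norm_vec_square
  by (simp_all add: Bochner_Integration.integral_sum Bochner_Integration.integrable_sum u_square component_integrable sum_distrib_left)

lemma jac_u_L2: "integrable lborel (\<lambda>x. (norm (jac u x))\<^sup>2)"
  "(\<integral>x. (norm (jac u x))\<^sup>2 \<partial>lborel) \<le> (2 * pi) ^ CARD('n) * (\<integral>x. (x \<bullet> x) * (norm (v x))\<^sup>2 \<partial>lborel)"
proof -
  have eq: "(x \<bullet> x) * (norm (v x))\<^sup>2 = (\<Sum>j\<in>UNIV. \<Sum>k\<in>UNIV. ((x \<bullet> axis k 1) * v x $ j)\<^sup>2)" for x :: "real^'n"
    by (simp add: norm_vec_square power_mult_distrib inner_axis sum_product inner_nth_sum[of x x] flip: power2_eq_square) (rule sum.swap)
  show "integrable lborel (\<lambda>x. (norm (jac u x))\<^sup>2)"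
    unfolding norm_mat_square by (intro Bochner_Integration.integrable_sum jac_u_square)
  show "(\<integral>x. (norm (jac u x))\<^sup>2 \<partial>lborel) \<le> (2 * pi) ^ CARD('n) * (\<integral>x. (x \<bullet> x) * (norm (v x))\<^sup>2 \<partial>lborel)"
    unfolding eq norm_mat_square
    by (simp only: Bochner_Integration.integral_sum Bochner_Integration.integrable_sum jac_u_square(1) component_integrable(3) sum_distrib_left)
      (intro sum_mono jac_u_square(2))
qed

lemma x_u_L2: "integrable lborel (\<lambda>x. (norm (u x))\<^sup>2 * (norm x)\<^sup>2)"
  "(\<integral>x. (norm (u x))\<^sup>2 * (norm x)\<^sup>2 \<partial>lborel) \<le> (2 * pi) ^ CARD('n) * (\<integral>x. (norm (J x))\<^sup>2 \<partial>lborel)"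
proof -
  have eq: "(norm (u x))\<^sup>2 * (norm x)\<^sup>2 = (\<Sum>j\<in>UNIV. \<Sum>k\<in>UNIV. (x $ k * u x $ j)\<^sup>2)" for x
    by (simp add: norm_vec_square sum_product power_mult_distrib mult.commute) (rule sum.swap)
  show "integrable lborel (\<lambda>x. (norm (u x))\<^sup>2 * (norm x)\<^sup>2)"
    unfolding eq by (intro Bochner_Integration.integrable_sum x_u_square)
  show "(\<integral>x. (norm (u x))\<^sup>2 * (norm x)\<^sup>2 \<partial>lborel) \<le> (2 * pi) ^ CARD('n) * (\<integral>x. (norm (J x))\<^sup>2 \<partial>lborel)"
    unfolding eq norm_mat_square
    by (simp only: Bochner_Integration.integral_sum Bochner_Integration.integrable_sum x_u_square(1) component_integrable(2) sum_distrib_left)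
      (intro sum_mono x_u_square(2))
qed

lemma u_in_D: "in_D u (jac u)"
  by (rule in_D_smooth[OF u_smooth u_L2(1) x_u_L2(1) jac_u_L2(1)])

text \<open>Moved onto the test function, the transform turns the gradient into multiplication by
  \<open>\<xi>\<close>, and \<open>\<xi> \<bullet> v \<xi> = 0\<close>.\<close>

lemma u_solenoidal: "solenoidal u"
  unfolding solenoidal_def
proof (intro allI impI)
  fix \<psi> :: "real^'n \<Rightarrow> real" assume \<psi>: "test_fun \<psi>"
  \<comment> \<open>The scalar test function is repeated in all components, so that the results on
    transforms of test fields apply to it.\<close>
  interpret P: test_field_loc "\<lambda>x. (\<chi> i. \<psi> x) :: real^'n"
  proof
    have "{x. ((\<chi> i. \<psi> x) :: real^'n) \<noteq> 0} = {x. \<psi> x \<noteq> 0}" by (auto simp: vec_eq_iff)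
    then show "test_field (\<lambda>x. (\<chi> i. \<psi> x) :: real^'n)" using \<psi> by (simp add: test_fun_def test_field_def)
  qed
  have g: "grad \<psi> x $ j = P.dphi j j x" for x j
    by (simp add: grad_def P.partial_eq)
  note iv = moments_integrable[OF moments_v] and ip = moments_integrable[OF P.mom_partial]
  have m: "integrable lborel (\<lambda>x. CT (\<lambda>\<xi>. v \<xi> $ j) x * P.dphi j j x)" for j
    by (rule integrable_mult_bounded[OF ip _ CT_bound[OF iv]]) (use moments_measurable[OF moments_v] in auto)
  have mv: "integrable lborel (\<lambda>\<xi>. v \<xi> $ j * CT (P.dphi j j) \<xi>)" for j
    using integrable_mult_bounded[OF iv _ CT_bound[OF ip]] moments_measurable[OF P.mom_partial] by (simp add: mult.commute)
  have "(\<integral>x. u x \<bullet> grad \<psi> x \<partial>lborel) = (\<Sum>j\<in>UNIV. \<integral>x. CT (\<lambda>\<xi>. v \<xi> $ j) x * P.dphi j j x \<partial>lborel)"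
    by (simp add: inner_nth_sum g u_nth Bochner_Integration.integral_sum m)
  also have "\<dots> = (\<Sum>j\<in>UNIV. \<integral>\<xi>. v \<xi> $ j * CT (P.dphi j j) \<xi> \<partial>lborel)"
    by (simp add: CT_swap[OF iv ip])
  also have "\<dots> = (\<integral>\<xi>. (\<Sum>j\<in>UNIV. v \<xi> $ j * CT (P.dphi j j) \<xi>) \<partial>lborel)"
    by (simp add: Bochner_Integration.integral_sum mv)
  also have "(\<lambda>\<xi>. \<Sum>j\<in>UNIV. v \<xi> $ j * CT (P.dphi j j) \<xi>) = (\<lambda>\<xi>. (\<xi> \<bullet> v \<xi>) * ST \<psi> \<xi>)"
    by (simp add: P.CT_ST_partial inner_nth_sum sum_distrib_left mult_ac)
  finally show "(\<integral>x. u x \<bullet> grad \<psi> x \<partial>lborel) = 0" by (simp add: x_v)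
qed

lemma v_not_zero: "(\<integral>x. (norm (v x))\<^sup>2 \<partial>lborel) > 0"
proof (rule ccontr)
  assume "\<not> (\<integral>x. (norm (v x))\<^sup>2 \<partial>lborel) > 0"
  moreover have "(\<integral>x. (norm (v x))\<^sup>2 \<partial>lborel) \<ge> 0" by simp
  ultimately have "(\<integral>x. (norm (v x))\<^sup>2 \<partial>lborel) = 0" by linarith
  then have ae: "AE x in lborel. v x = 0"
    using integral_nonneg_eq_0_iff_AE[OF v2_integrable] by simp
  \<comment> \<open>On the axis of \<open>e\<close> the field vanishes, as the unit vector is normal
    there; on any other coordinate axis it is tangential and survives the projection.\<close>
  obtain i where i: "i \<noteq> e"
  proof -
    have "UNIV \<noteq> {e}"
    proof
      assume "UNIV = {e}"
      then have "CARD('n) = 1" by (metis card_1_singleton_iff One_nat_def)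
      then show False using dim by simp
    qed
    then show ?thesis using that by auto
  qed
  have "(axis i 1 :: real^'n) \<bullet> axis i 1 = 1" by (simp add: inner_axis_axis)
  moreover have "(axis i 1 :: real^'n) $ e = 0" using i by (simp add: axis_def)
  ultimately have "v (axis i 1) $ e = beta (axis i 1)" by (simp add: v_def y_nth)
  then have "v (axis i 1) $ e \<noteq> 0" using beta_pos[of "axis i 1"] by (simp add: axis_eq_0_iff)
  define S where "S = {x. v x $ e \<noteq> 0}"
  have S: "open S" "S \<noteq> {}"
    unfolding S_def using \<open>v (axis i 1) $ e \<noteq> 0\<close> v_continuous[of e] by (auto intro!: open_Collect_neq continuous_intros)
  have "S \<in> null_sets lborel"
  proof -
    have "AE x in lborel. x \<notin> S" using ae by eventually_elim (simp add: S_def)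
    then show ?thesis using S(1) by (simp add: AE_iff_null_sets[symmetric])
  qed
  then have "negligible S" unfolding negligible_iff_null_sets by (rule null_sets_completionI)
  with S open_not_negligible show False by blast
qed

lemma u_not_zero: "\<not> (AE x in lborel. u x = 0)"
proof
  assume "AE x in lborel. u x = 0"
  then have "(\<integral>x. (norm (u x))\<^sup>2 \<partial>lborel) = 0"
    by (intro integral_eq_zero_AE) (auto elim: eventually_mono)
  then show False using u_L2(2) v_not_zero by simp
qed

text \<open>Arithmetic and geometric mean: \<open>X Y \<le> ((X + Y) / 2)^2\<close>, and
  \<open>X + Y\<close> is at most \<open>K Z\<close> by the energy identity for the ground state.
  The choice \<open>l = 1\<close> of the Gaussian width is what balances the two energies.\<close>

lemma attained:
  "(\<integral>x. (norm (jac u x))\<^sup>2 \<partial>lborel) * (\<integral>x. (norm (u x))\<^sup>2 * (norm x)\<^sup>2 \<partial>lborel) = CN CARD('n) * (\<integral>x. (norm (u x))\<^sup>2 \<partial>lborel)\<^sup>2"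
proof (rule antisym)
  let ?X = "\<integral>x. (norm (jac u x))\<^sup>2 \<partial>lborel" and ?Y = "\<integral>x. (norm (u x))\<^sup>2 * (norm x)\<^sup>2 \<partial>lborel" and ?Z = "\<integral>x. (norm (u x))\<^sup>2 \<partial>lborel"
  show "CN CARD('n) * ?Z\<^sup>2 \<le> ?X * ?Y"
    by (rule solenoidal_uncertainty[OF dim u_in_D u_solenoidal])
  define K where "K = real CARD('n) + 2 * \<alpha>"
  have "?X + ?Y \<le> (2 * pi) ^ CARD('n) * ((\<integral>x. (norm (J x))\<^sup>2 \<partial>lborel) + (\<integral>x. (x \<bullet> x) * (norm (v x))\<^sup>2 \<partial>lborel))"
    using jac_u_L2(2) x_u_L2(2) by (simp add: distrib_left)
  also have "\<dots> = K * ?Z"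
    unfolding ground_state_energy u_L2(2) K_def by simp
  finally have "(?X + ?Y)\<^sup>2 \<le> (K * ?Z)\<^sup>2"
    by (intro power_mono) auto
  moreover have "4 * (?X * ?Y) \<le> (?X + ?Y)\<^sup>2"
    using sum_squares_bound[of ?X ?Y] by (simp add: power2_sum)
  ultimately have "?X * ?Y \<le> (K * ?Z)\<^sup>2 / 4" by simp
  also have "\<dots> = CN CARD('n) * ?Z\<^sup>2"
    by (simp add: CN_eq K_def \<alpha>_def power_mult_distrib)
  finally show "?X * ?Y \<le> CN CARD('n) * ?Z\<^sup>2" .
qed

end

theorem theorem1:
  assumes "CARD('n) \<ge> 3"
  shows "(\<forall>(u :: real^'n \<Rightarrow> real^'n) G. in_D u G \<and> solenoidal u \<longrightarrow>
            (\<integral>x. (norm (G x))\<^sup>2 \<partial>lborel) * (\<integral>x. (norm (u x))\<^sup>2 * (norm x)\<^sup>2 \<partial>lborel)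
              \<ge> CN CARD('n) * (\<integral>x. (norm (u x))\<^sup>2 \<partial>lborel)\<^sup>2)
       \<and> CN CARD('n) = Inf {ratio u G | (u :: real^'n \<Rightarrow> real^'n) G.
                              in_D u G \<and> solenoidal u \<and> \<not> (AE x in lborel. u x = 0)}
       \<and> (\<exists>(u :: real^'n \<Rightarrow> real^'n) G. in_D u G \<and> solenoidal u \<and> \<not> (AE x in lborel. u x = 0) \<and>
            (\<integral>x. (norm (G x))\<^sup>2 \<partial>lborel) * (\<integral>x. (norm (u x))\<^sup>2 * (norm x)\<^sup>2 \<partial>lborel)
              = CN CARD('n) * (\<integral>x. (norm (u x))\<^sup>2 \<partial>lborel)\<^sup>2)"
proof -
  \<comment> \<open>Any coordinate direction yields an extremal field, so an arbitrary index is
    taken.\<close>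
  interpret extremal "undefined :: 'n"
    by unfold_locales (rule assms)
  have le: "CN CARD('n) \<le> ratio u G"
    if "in_D u G" "solenoidal u" "\<not> (AE x in lborel. u x = 0)" for u :: "real^'n \<Rightarrow> real^'n" and G
  proof -
    have "(\<integral>x. (norm (u x))\<^sup>2 \<partial>lborel) \<noteq> 0"
      using integral_nonneg_eq_0_iff_AE[OF in_D_facts(1)[OF assms that(1,2)]] that(3) by simp
    then have "(\<integral>x. (norm (u x))\<^sup>2 \<partial>lborel)\<^sup>2 > 0" by simp
    then show ?thesis
      unfolding ratio_def using solenoidal_uncertainty[OF assms that(1,2)] by (simp only: pos_le_divide_eq)
  qed
  have "ratio u (jac u) = CN CARD('n)"
    unfolding ratio_def attained using u_L2(2) v_not_zero by simp
  then have "CN CARD('n) = Inf {ratio u G | (u :: real^'n \<Rightarrow> real^'n) G.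
      in_D u G \<and> solenoidal u \<and> \<not> (AE x in lborel. u x = 0)}"
    using u_in_D u_solenoidal u_not_zero le
    by (intro cInf_eq_minimum[symmetric]) (force, blast)
  moreover have "\<exists>(u :: real^'n \<Rightarrow> real^'n) G. in_D u G \<and> solenoidal u \<and> \<not> (AE x in lborel. u x = 0) \<and>
      (\<integral>x. (norm (G x))\<^sup>2 \<partial>lborel) * (\<integral>x. (norm (u x))\<^sup>2 * (norm x)\<^sup>2 \<partial>lborel)
        = CN CARD('n) * (\<integral>x. (norm (u x))\<^sup>2 \<partial>lborel)\<^sup>2"
    using u_in_D u_solenoidal u_not_zero attained by blast
  ultimately show ?thesis
    using solenoidal_uncertainty[OF assms] by blast
qed

end
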